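(* Let $\mathcal{E}$ be a formally integrable system of PDEs, with $n$ independent and $m$ dependent variables, whose symbolic system $g=\{g_k\}_{k\ge0}$, $g_k\subset S^kT^*\otimes N$ ($\dim T=n$, $\dim N=m$), is a generalized complete intersection of codimension $r=\operatorname{codim}(g)$. Let $k_1,\dots,k_r$ be the orders of the system, counted with multiplicity. Then the functional dimension of the solutions space $\operatorname{Sol}(\mathcal{E})$ is $$p=m+n-r-1,$$ and the functional rank is $$\sigma=S_{r-m+1}(k_1,\dots,k_r)=\sum_{1\le i_1<\dots<i_{r-m+1}\le r}k_{i_1}\cdots k_{i_{r-m+1}},$$ the $(r-m+1)$-st elementary symmetric polynomial of the orders.
   Context: Symbolic systems. $T$ and $N$ are finite-dimensional real vector spaces, $\dim T=n$, $\dim N=m$ (for a PDE system: $T$ is the tangent space to the space of independent variables, $N$ that of the dependent variables). $\delta:S^kT^*\otimes N\otimes\Lambda^jT^*\to S^{k-1}T^*\otimes N\otimes\Lambda^{j+1}T^*$ is the de Rham differential of $N$-valued polynomial differential forms on $T$, and $\delta_v=i_v\circ\delta:S^{k+1}T^*\otimes N\to S^kT^*\otimes N$ is differentiation along $v\in T$. The $l$-th prolongation of $h\subset S^kT^*\otimes N$ is $h^{(l)}=\{q\in S^{k+l}T^*\otimes N: \delta_{v_1}\cdots\delta_{v_l}q\in h\ \ \forall v_1,\dots,v_l\in T\}$. A symbolic system is a sequence of subspaces $g_k\subset S^kT^*\otimes N$, $k\ge0$, with $g_0=N$ and $g_k\subset g_{k-1}^{(1)}$. Its set of orders is $\operatorname{ord}(g)=\{k: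 g_k\ne g_{k-1}^{(1)}\}$, and the multiplicity of an order $k$ is $m(k)=\dim g_{k-1}^{(1)}/g_k$. Its codimension is $\operatorname{codim}(g)=\sum_k m(k)$, which is finite. PDE systems. The symbolic system $g$ of a PDE system $\mathcal{E}$ (at a point of the equation) consists of the symbol spaces $g_k$, the kernels of the (differentials of the) projections $\mathcal{E}_k\to\mathcal{E}_{k-1}$ of the equation and its prolongations in jet spaces. It is assumed that the type of $g$ does not vary from point to point (the dimensions of $g_k$, of the characteristic variety and of the fibres of the characteristic sheaf are constant). Characteristic variety and sheaf. $g^*=\bigoplus_i g_i^*$ is a graded module over the symmetric algebra $ST=\bigoplus_i S^iT$ (dualizing the maps $\delta_v$), finitely generated. $\operatorname{Char}^{\mathbb{C}}(g)\subset\mathbb{P}^{\mathbb{C}}T^*$ is the support of its complexification, the projective zero locus of $\operatorname{Ann}(g^* )\subset ST$. The characteristic sheaf $\mathcal{K}$ over $\operatorname{Char}^{\mathbb{C}}(g)$ has as its fibre $\mathcal{K}_x$ at a point $x$, represented by a nonzero complex covector, the value of the module there: the quotient of the complexified $g^*$ by (the maximal ideal of polynomials vanishing at that covector)$\,\cdot\, g^*$. The empty variety has dimension $-1$, so codimension $n$ in $\mathbb{P}^{\mathbb{C}}T^*$. Generalized complete intersection. A symbolic system $g$ with $\operatorname{codim}(g)=r$ is a generalized complete intersection if: (i) $m\le r<n+m$; (ii) $\operatorname{codim}_{\mathbb{C}}\operatorname{Char}^{\mathbb{C}}(g)=r-m+1$ (in $\mathbb{P}^{\mathbb{C}}T^*$);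 (iii) $\dim\mathcal{K}_x=1$ for all $x\in\operatorname{Char}^{\mathbb{C}}(g)$. Functional dimension and rank. For large $k$ the sum $\sum_{i\le k}\dim g_i$ coincides with a polynomial $P_{\mathcal{E}}(k)$, the Hilbert polynomial of $g^*$. The functional dimension of $\operatorname{Sol}(\mathcal{E})$ is $p=\deg P_{\mathcal{E}}$ (one has $p=\dim\operatorname{Char}^{\mathbb{C}}(g)+1$), and the functional rank is $\sigma=P_{\mathcal{E}}^{(p)}$ (the $p$-th derivative, a constant), i.e. $P_{\mathcal{E}}(z)=\sigma\,z^p/p!+\text{lower order terms}$. *)

theory Defs
  imports
    "HOL-Analysis.Analysis"
    "HOL-Library.Multiset"
    "HOL-Library.Function_Algebras"
    "HOL-Library.Poly_Mapping"
    "HOL-Computational_Algebra.Polynomial"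
begin

text \<open>
  \<open>s\<close> is the scalar multiplication. The classes of the elements of \<open>B\<close> form a basis of \<open>V / W\<close>, one
  class for each element of \<open>B\<close>.
\<close>

definition quotient_basis ::
    "('k::field \<Rightarrow> 'v::ab_group_add \<Rightarrow> 'v) \<Rightarrow> 'v set \<Rightarrow> 'v set \<Rightarrow> 'v set \<Rightarrow> bool" where
  "quotient_basis s V W B \<longleftrightarrow>
     B \<subseteq> V \<and> V \<subseteq> module.span s (W \<union> B) \<and>
     (\<forall>S c. finite S \<and> S \<subseteq> B \<and> (\<Sum>b\<in>S. s (c b) b) \<in> W \<longrightarrow> (\<forall>b\<in>S. c b = 0))"

text \<open>As for \<^const>\<open>dim\<close>, the value is 0 if the quotient has infinite dimension.\<close>

definition quotient_dim ::
    "('k::field \<Rightarrow> 'v::ab_group_add \<Rightarrow> 'v) \<Rightarrow> 'v set \<Rightarrow> 'v set \<Rightarrow> nat" where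
  "quotient_dim s V W = card (SOME B. quotient_basis s V W B)"


text \<open>
  Throughout, \<open>T\<close> is \<^typ>\<open>real^'n\<close> and \<open>N\<close> is \<^typ>\<open>real^'m\<close>. Multi-indices are multisets \<open>\<alpha>\<close> over \<open>'n\<close>,
  with \<open>|\<alpha>| = size \<alpha>\<close>. An element of \<open>S\<^sup>kT\<^sup>* \<otimes> N\<close> is given by its components
  \<open>q \<alpha> = q(e\<^sub>i\<^sub>1, \<dots>, e\<^sub>i\<^sub>k)\<close> for \<open>\<alpha> = {#i\<^sub>1, \<dots>, i\<^sub>k#}\<close>; the corresponding \<open>N\<close>-valued homogeneous
  polynomial on \<open>T\<close> is \<open>tensor_poly k q\<close> below, and \<open>q \<alpha>\<close> is its \<open>\<alpha>\<close>-th partial derivative.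
\<close>

type_synonym ('n, 'm) tensor = "'n multiset \<Rightarrow> real ^ 'm"

definition tensor_scale :: "real \<Rightarrow> ('n::finite, 'm::finite) tensor \<Rightarrow> ('n, 'm) tensor" where
  "tensor_scale c q = (\<lambda>\<alpha>. c *\<^sub>R q \<alpha>)"

interpretation tensor: vector_space tensor_scale
  by unfold_locales (auto simp: tensor_scale_def fun_eq_iff algebra_simps)

definition sym_tensors :: "nat \<Rightarrow> ('n::finite, 'm::finite) tensor set" where
  "sym_tensors k = {q. \<forall>\<alpha>. size \<alpha> \<noteq> k \<longrightarrow> q \<alpha> = 0}"

definition monomial :: "'n::finite multiset \<Rightarrow> real ^ 'n \<Rightarrow> real" where
  "monomial \<alpha> x = (\<Prod>i\<in>UNIV. (x $ i) ^ count \<alpha> i / fact (count \<alpha> i))"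

definition tensor_poly :: "nat \<Rightarrow> ('n::finite, 'm::finite) tensor \<Rightarrow> real ^ 'n \<Rightarrow> real ^ 'm" where
  "tensor_poly k q x = (\<Sum>\<alpha> | size \<alpha> = k. monomial \<alpha> x *\<^sub>R q \<alpha>)"

text \<open>Differentiation along a vector; see \<open>tensor_poly_has_derivative\<close>.\<close>

definition \<delta> :: "real ^ 'n::finite \<Rightarrow> ('n, 'm::finite) tensor \<Rightarrow> ('n, 'm) tensor" where
  "\<delta> v q = (\<lambda>\<alpha>. \<Sum>i\<in>UNIV. v $ i *\<^sub>R q (add_mset i \<alpha>))"

lemma finite_size_eq: "finite {\<alpha> :: 'n::finite multiset. size \<alpha> = k}"
proof -
  have "{\<alpha> :: 'n multiset. size \<alpha> = k} \<subseteq> mset ` {xs. set xs \<subseteq> UNIV \<and> length xs = k}"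
  proof
    fix \<alpha> :: "'n multiset" assume "\<alpha> \<in> {\<alpha>. size \<alpha> = k}"
    moreover obtain xs where "mset xs = \<alpha>" using ex_mset by blast
    ultimately show "\<alpha> \<in> mset ` {xs. set xs \<subseteq> UNIV \<and> length xs = k}"
      by (auto intro!: image_eqI[of _ _ xs])
  qed
  then show ?thesis
    by (rule finite_subset) (intro finite_imageI finite_lists_length_eq, simp)
qed

lemma monomial_has_derivative:
  "(monomial \<alpha> has_derivative
     (\<lambda>v. \<Sum>i\<in>UNIV. v $ i * (if i \<in># \<alpha> then monomial (\<alpha> - {#i#}) x else 0))) (at x)"
proof -
  let ?f = "\<lambda>i (y :: real ^ 'a). (y $ i) ^ count \<alpha> i / fact (count \<alpha> i)"
  let ?f' = "\<lambda>i (v :: real ^ 'a).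
     real (count \<alpha> i) * (v $ i * (x $ i) ^ (count \<alpha> i - 1)) / fact (count \<alpha> i)"
  have coord: "((\<lambda>y :: real ^ 'a. y $ i) has_derivative (\<lambda>v. v $ i)) (at x)" for i
    by (rule bounded_linear_imp_has_derivative[OF bounded_linear_vec_nth])
  have f: "(?f i has_derivative ?f' i) (at x)" for i
    by (auto intro!: derivative_eq_intros coord simp: mult_ac divide_inverse)
  have "((\<lambda>y. \<Prod>i\<in>UNIV. ?f i y) has_derivative
          (\<lambda>v. \<Sum>i\<in>UNIV. ?f' i v * (\<Prod>j\<in>UNIV - {i}. ?f j x))) (at x)"
    by (rule has_derivative_prod) (rule f)
  moreover have "?f' i v * (\<Prod>j\<in>UNIV - {i}. ?f j x) =
      v $ i * (if i \<in># \<alpha> then monomial (\<alpha> - {#i#}) x else 0)" for i v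
  proof (cases "i \<in># \<alpha>")
    case True
    then obtain \<beta> where \<beta>: "\<alpha> = add_mset i \<beta>" by (metis multi_member_split)
    have "monomial \<beta> x = (x $ i) ^ count \<beta> i / fact (count \<beta> i) *
        (\<Prod>j\<in>UNIV - {i}. (x $ j) ^ count \<beta> j / fact (count \<beta> j))"
      by (simp add: monomial_def prod.remove[of UNIV i])
    also have "(\<Prod>j\<in>UNIV - {i}. (x $ j) ^ count \<beta> j / fact (count \<beta> j)) =
        (\<Prod>j\<in>UNIV - {i}. ?f j x)"
      by (rule prod.cong) (auto simp: \<beta>)
    finally show ?thesis
      by (simp add: \<beta> field_simps del: of_nat_Suc)
  next
    case False
    then show ?thesis by (simp add: not_in_iff[THEN iffD1])
  qed
  ultimately show ?thesis
    by (simp add: monomial_def[abs_def])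
qed

lemma tensor_poly_has_derivative:
  "(tensor_poly (Suc k) q has_derivative (\<lambda>v. tensor_poly k (\<delta> v q) x)) (at x)"
proof -
  let ?M = "\<lambda>i \<alpha>. if i \<in># \<alpha> then monomial (\<alpha> - {#i#}) x else 0"
  have "(tensor_poly (Suc k) q has_derivative
      (\<lambda>v. \<Sum>\<alpha> | size \<alpha> = Suc k. (\<Sum>i\<in>UNIV. v $ i * ?M i \<alpha>) *\<^sub>R q \<alpha>)) (at x)"
    unfolding tensor_poly_def[abs_def]
    by (intro has_derivative_sum has_derivative_scaleR_left monomial_has_derivative)
  moreover have "(\<Sum>\<alpha> | size \<alpha> = Suc k. (\<Sum>i\<in>UNIV. v $ i * ?M i \<alpha>) *\<^sub>R q \<alpha>) =
      tensor_poly k (\<delta> v q) x" for v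
  proof -
    have "(\<Sum>\<alpha> | size \<alpha> = Suc k. (v $ i * ?M i \<alpha>) *\<^sub>R q \<alpha>) =
        (\<Sum>\<beta> | size \<beta> = k. monomial \<beta> x *\<^sub>R v $ i *\<^sub>R q (add_mset i \<beta>))" for i
    proof -
      have "(\<Sum>\<alpha> | size \<alpha> = Suc k. (v $ i * ?M i \<alpha>) *\<^sub>R q \<alpha>) =
          (\<Sum>\<alpha>\<in>add_mset i ` {\<beta>. size \<beta> = k}. (v $ i * ?M i \<alpha>) *\<^sub>R q \<alpha>)"
      proof (rule sum.mono_neutral_right[OF finite_size_eq])
        show "\<forall>\<alpha>\<in>{\<alpha>. size \<alpha> = Suc k} - add_mset i ` {\<beta>. size \<beta> = k}.
            (v $ i * ?M i \<alpha>) *\<^sub>R q \<alpha> = 0"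
          by (auto dest!: multi_member_split)
      qed auto
      also have "\<dots> = (\<Sum>\<beta> | size \<beta> = k. monomial \<beta> x *\<^sub>R v $ i *\<^sub>R q (add_mset i \<beta>))"
        by (subst sum.reindex) (auto simp: inj_on_def mult_ac)
      finally show ?thesis .
    qed
    then have "(\<Sum>i\<in>UNIV. \<Sum>\<alpha> | size \<alpha> = Suc k. (v $ i * ?M i \<alpha>) *\<^sub>R q \<alpha>) =
        (\<Sum>i\<in>UNIV. \<Sum>\<beta> | size \<beta> = k. monomial \<beta> x *\<^sub>R v $ i *\<^sub>R q (add_mset i \<beta>))"
      by (rule sum.cong[OF refl])
    then show ?thesis
      unfolding tensor_poly_def \<delta>_def scaleR_sum_left scaleR_sum_right
      by (subst (asm) sum.swap, subst (asm) (2) sum.swap)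
  qed
  ultimately show ?thesis by simp
qed

text \<open>The \<open>l\<close>-th prolongation of a subspace \<open>h\<close> of \<open>S\<^sup>kT\<^sup>* \<otimes> N\<close>.\<close>

definition prolong :: "nat \<Rightarrow> nat \<Rightarrow> ('n::finite, 'm::finite) tensor set \<Rightarrow> ('n, 'm) tensor set" where
  "prolong k l h =
     {q \<in> sym_tensors (k + l). \<forall>vs. length vs = l \<longrightarrow> foldr \<delta> vs q \<in> h}"

definition symbolic_system :: "(nat \<Rightarrow> ('n::finite, 'm::finite) tensor set) \<Rightarrow> bool" where
  "symbolic_system g \<longleftrightarrow>
     (\<forall>k. g k \<subseteq> sym_tensors k \<and> tensor.subspace (g k)) \<and>
     g 0 = sym_tensors 0 \<and>
     (\<forall>k. g (Suc k) \<subseteq> prolong k 1 (g k))"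

definition orders :: "(nat \<Rightarrow> ('n::finite, 'm::finite) tensor set) \<Rightarrow> nat set" where
  "orders g = {k. k \<ge> 1 \<and> g k \<noteq> prolong (k - 1) 1 (g (k - 1))}"

definition multiplicity_of_order :: "(nat \<Rightarrow> ('n::finite, 'm::finite) tensor set) \<Rightarrow> nat \<Rightarrow> nat" where
  "multiplicity_of_order g k =
     (if k \<in> orders g then quotient_dim tensor_scale (prolong (k - 1) 1 (g (k - 1))) (g k) else 0)"

definition codim :: "(nat \<Rightarrow> ('n::finite, 'm::finite) tensor set) \<Rightarrow> nat" where
  "codim g = (\<Sum>k\<in>orders g. multiplicity_of_order g k)"


text \<open>
  An element of \<open>ST\<close> (for \<open>'k = real\<close>) or of its complexification (for \<open>'k = complex\<close>) is a polynomial
  in the basis vectors \<open>e\<^sub>i\<close> of \<open>T\<close>; the monomials are again multisets over \<open>'n\<close>.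
\<close>

type_synonym ('n, 'k) sym_alg = "'n multiset \<Rightarrow>\<^sub>0 'k"

definition eval_sym :: "('n::finite, 'k::comm_ring_1) sym_alg \<Rightarrow> 'k ^ 'n \<Rightarrow> 'k" where
  "eval_sym P \<xi> = (\<Sum>\<beta>\<in>Poly_Mapping.keys P. Poly_Mapping.lookup P \<beta> * (\<Prod>i\<in>#\<beta>. \<xi> $ i))"

definition homogeneous :: "('n::finite, 'k::zero) sym_alg \<Rightarrow> bool" where
  "homogeneous P \<longleftrightarrow> (\<exists>d. \<forall>\<beta>\<in>Poly_Mapping.keys P. size \<beta> = d)"

text \<open>
  A finite sequence of \<open>\<real>\<close>-linear maps \<open>\<phi>\<^sub>i : g\<^sub>i \<rightarrow> 'k\<close>, extended by 0 outside \<open>g\<^sub>i\<close>: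
  for \<open>'k = real\<close> this is \<open>g\<^sup>* = \<Oplus>\<^sub>i g\<^sub>i\<^sup>*\<close>, and for \<open>'k = complex\<close> its complexification.
\<close>

type_synonym ('n, 'm, 'k) dual = "nat \<Rightarrow> ('n, 'm) tensor \<Rightarrow> 'k"

definition dual_module ::
    "(nat \<Rightarrow> ('n::finite, 'm::finite) tensor set) \<Rightarrow> ('n, 'm, 'k::real_field) dual set" where
  "dual_module g =
     {\<phi>. finite {i. \<phi> i \<noteq> 0} \<and>
         (\<forall>i. \<forall>q. q \<notin> g i \<longrightarrow> \<phi> i q = 0) \<and>
         (\<forall>i. \<forall>q\<in>g i. \<forall>q'\<in>g i. \<forall>a b.
            \<phi> i (tensor_scale a q + tensor_scale b q') = a *\<^sub>R \<phi> i q + b *\<^sub>R \<phi> i q')}"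

definition dual_scale :: "'k::field \<Rightarrow> ('n::finite, 'm::finite, 'k) dual \<Rightarrow> ('n, 'm, 'k) dual" where
  "dual_scale c \<phi> = (\<lambda>i q. c * \<phi> i q)"

interpretation dual: vector_space dual_scale
  by unfold_locales (auto simp: dual_scale_def fun_eq_iff algebra_simps)

text \<open>
  The action dual to \<^const>\<open>\<delta>\<close>. The monomial \<open>\<beta> = e\<^sub>i\<^sub>1 \<cdots> e\<^sub>i\<^sub>l\<close> takes \<open>\<phi> \<in> g\<^sup>*\<^sub>j\<^sub>-\<^sub>l\<close> to
  \<open>\<phi> \<circ> \<delta> e\<^sub>i\<^sub>1 \<circ> \<cdots> \<circ> \<delta> e\<^sub>i\<^sub>l \<in> g\<^sup>*\<^sub>j\<close>, and the composite of these derivations is the shift by \<open>\<beta>\<close>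
  (\<open>foldr_\<delta>_axis\<close>).
\<close>

definition shift :: "'n::finite multiset \<Rightarrow> ('n, 'm::finite) tensor \<Rightarrow> ('n, 'm) tensor" where
  "shift \<beta> q = (\<lambda>\<alpha>. q (\<alpha> + \<beta>))"

lemma \<delta>_axis: "\<delta> (axis i 1) q = (\<lambda>\<alpha>. q (add_mset i \<alpha>))"
proof -
  have "axis i (1::real) $ j *\<^sub>R q (add_mset j \<alpha>) = (if j = i then q (add_mset i \<alpha>) else 0)"
    for j \<alpha> by (simp add: axis_def)
  then show ?thesis by (simp add: \<delta>_def)
qed

lemma foldr_\<delta>_axis: "foldr \<delta> (map (\<lambda>i. axis i 1) is) q = shift (mset is) q"
  by (induction "is") (auto simp: \<delta>_axis shift_def fun_eq_iff)

definition act ::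
    "(nat \<Rightarrow> ('n::finite, 'm::finite) tensor set) \<Rightarrow> ('n, 'k::real_field) sym_alg \<Rightarrow>
     ('n, 'm, 'k) dual \<Rightarrow> ('n, 'm, 'k) dual" where
  "act g P \<phi> =
     (\<lambda>j q. if q \<in> g j
        then \<Sum>\<beta> \<in> {\<beta> \<in> Poly_Mapping.keys P. size \<beta> \<le> j}.
               Poly_Mapping.lookup P \<beta> * \<phi> (j - size \<beta>) (shift \<beta> q)
        else 0)"


definition annihilator :: "(nat \<Rightarrow> ('n::finite, 'm::finite) tensor set) \<Rightarrow> ('n, real) sym_alg set" where
  "annihilator g = {P. \<forall>\<phi>\<in>dual_module g. act g P \<phi> = 0}"

text \<open>
  Subsets of the complex projective space of covectors are represented by the sets of the nonzero
  covectors \<open>\<xi>\<close> (with components \<open>\<xi> $ i\<close> in the dual basis) that represent their points.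
\<close>

definition char_variety :: "(nat \<Rightarrow> ('n::finite, 'm::finite) tensor set) \<Rightarrow> (complex ^ 'n) set" where
  "char_variety g =
     {\<xi>. \<xi> \<noteq> 0 \<and> (\<forall>P\<in>annihilator g. eval_sym (Poly_Mapping.map complex_of_real P) \<xi> = 0)}"

definition fibre_dim :: "(nat \<Rightarrow> ('n::finite, 'm::finite) tensor set) \<Rightarrow> complex ^ 'n \<Rightarrow> nat" where
  "fibre_dim g \<xi> =
     quotient_dim dual_scale (dual_module g)
       (dual.span {act g P \<phi> | P \<phi>. eval_sym P \<xi> = 0 \<and> \<phi> \<in> dual_module g})"

definition proj_closed :: "(complex ^ 'n::finite) set \<Rightarrow> bool" where
  "proj_closed Z \<longleftrightarrow>
     (\<exists>F. (\<forall>P\<in>F. homogeneous P) \<and> Z = {\<xi>. \<xi> \<noteq> 0 \<and> (\<forall>P\<in>F. eval_sym P \<xi> = 0)})"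

definition proj_irreducible :: "(complex ^ 'n::finite) set \<Rightarrow> bool" where
  "proj_irreducible Z \<longleftrightarrow>
     Z \<noteq> {} \<and> proj_closed Z \<and>
     (\<forall>A B. proj_closed A \<and> proj_closed B \<and> Z \<subseteq> A \<union> B \<longrightarrow> Z \<subseteq> A \<or> Z \<subseteq> B)"

text \<open>
  Krull dimension: a chain \<open>Z\<^sub>0 \<subset> \<dots> \<subset> Z\<^sub>d\<close> of irreducible closed subsets has \<open>c = d + 1\<close> members.
  The empty variety admits only the empty chain and gets dimension \<open>-1\<close>.
\<close>

definition proj_dim :: "(complex ^ 'n::finite) set \<Rightarrow> int" where
  "proj_dim V =
     int (GREATEST c. \<exists>Z :: nat \<Rightarrow> (complex ^ 'n) set.
            (\<forall>i<c. proj_irreducible (Z i) \<and> Z i \<subseteq> V) \<and> (\<forall>i. Suc i < c \<longrightarrow> Z i \<subset> Z (Suc i))) - 1"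

definition proj_codim :: "(complex ^ 'n::finite) set \<Rightarrow> int" where
  "proj_codim V = (int CARD('n) - 1) - proj_dim V"

definition generalized_complete_intersection ::
    "(nat \<Rightarrow> ('n::finite, 'm::finite) tensor set) \<Rightarrow> bool" where
  "generalized_complete_intersection g \<longleftrightarrow>
     symbolic_system g \<and>
     CARD('m) \<le> codim g \<and> codim g < CARD('n) + CARD('m) \<and>
     proj_codim (char_variety g) = int (codim g) - int CARD('m) + 1 \<and>
     (\<forall>\<xi>\<in>char_variety g. fibre_dim g \<xi> = 1)"


definition hilbert_polynomial :: "(nat \<Rightarrow> ('n::finite, 'm::finite) tensor set) \<Rightarrow> real poly" where
  "hilbert_polynomial g =
     (THE P. \<forall>\<^sub>F k in sequentially. real (\<Sum>i\<le>k. tensor.dim (g i)) = poly P (real k))"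

definition functional_dimension :: "(nat \<Rightarrow> ('n::finite, 'm::finite) tensor set) \<Rightarrow> nat" where
  "functional_dimension g = degree (hilbert_polynomial g)"

text \<open>The derivative below is a constant, so it may be evaluated at 0.\<close>

definition functional_rank :: "(nat \<Rightarrow> ('n::finite, 'm::finite) tensor set) \<Rightarrow> real" where
  "functional_rank g = poly ((pderiv ^^ functional_dimension g) (hilbert_polynomial g)) 0"

definition elementary_symmetric :: "nat \<Rightarrow> nat list \<Rightarrow> nat" where
  "elementary_symmetric j ks = (\<Sum>I | I \<subseteq> {..<length ks} \<and> card I = j. \<Prod>i\<in>I. ks ! i)"


text \<open>
  A jet is a pair \<open>(x, u)\<close> of a point \<open>x\<close> and the derivatives \<open>u \<alpha> = u\<^sub>\<alpha>\<close> of all orders \<open>|\<alpha>|\<close>, i.e. a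
  point of \<open>J\<^sup>\<infinity>\<close>. The elements of \<open>J\<^sup>k\<close> are the jets whose coordinates of order greater than \<open>k\<close>
  vanish, so that \<open>truncate k\<close> is the projection \<open>\<pi>\<^sub>\<infinity>\<^sub>,\<^sub>k\<close>, and also \<open>\<pi>\<^sub>l\<^sub>,\<^sub>k\<close> on \<open>J\<^sup>l\<close> for \<open>l \<ge> k\<close>. Since the
  jet space is a vector space, the same type is used for its tangent vectors. The topology on the
  type is the product topology, which induces the Euclidean one on each \<open>J\<^sup>k\<close>.
\<close>

type_synonym ('n, 'm) jet = "(real ^ 'n) \<times> ('n multiset \<Rightarrow> real ^ 'm)"

definition jets :: "nat \<Rightarrow> ('n::finite, 'm::finite) jet set" where
  "jets k = {\<theta>. \<forall>\<alpha>. size \<alpha> > k \<longrightarrow> snd \<theta> \<alpha> = 0}"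

definition truncate :: "nat \<Rightarrow> ('n::finite, 'm::finite) jet \<Rightarrow> ('n, 'm) jet" where
  "truncate k \<theta> = (fst \<theta>, \<lambda>\<alpha>. if size \<alpha> \<le> k then snd \<theta> \<alpha> else 0)"

definition translate :: "('n::finite, 'm::finite) jet \<Rightarrow> ('n, 'm) jet \<Rightarrow> real \<Rightarrow> ('n, 'm) jet" where
  "translate \<theta> w t = (fst \<theta> + t *\<^sub>R fst w, \<lambda>\<alpha>. snd \<theta> \<alpha> + t *\<^sub>R snd w \<alpha>)"

definition dir_deriv ::
    "('n::finite, 'm::finite) jet \<Rightarrow> (('n, 'm) jet \<Rightarrow> real) \<Rightarrow> ('n, 'm) jet \<Rightarrow> real" where
  "dir_deriv w F \<theta> = deriv (\<lambda>t. F (translate \<theta> w t)) 0"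

text \<open>
  A function on \<open>J\<^sup>k\<close>, that is a function of finitely many of the coordinates, is \<open>C\<^sup>\<infinity>\<close> on an open set
  iff its iterated directional derivatives exist and are continuous there.
\<close>

definition smooth_on_jets ::
    "nat \<Rightarrow> ('n::finite, 'm::finite) jet set \<Rightarrow> (('n, 'm) jet \<Rightarrow> real) \<Rightarrow> bool" where
  "smooth_on_jets k U F \<longleftrightarrow>
     (\<forall>\<theta>. F \<theta> = F (truncate k \<theta>)) \<and>
     (\<forall>ws. continuous_on U (foldr dir_deriv ws F) \<and>
           (\<forall>\<theta>\<in>U. \<forall>w. (\<lambda>t. foldr dir_deriv ws F (translate \<theta> w t)) differentiable at 0))"

definition submanifold :: "nat \<Rightarrow> ('n::finite, 'm::finite) jet set \<Rightarrow> bool" where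
  "submanifold k M \<longleftrightarrow> M \<subseteq> jets k \<and>
     (\<forall>\<theta>\<in>M. \<exists>U c. \<exists>F :: nat \<Rightarrow> ('n, 'm) jet \<Rightarrow> real.
        open U \<and> \<theta> \<in> U \<and> (\<forall>i<c. smooth_on_jets k U (F i)) \<and>
        M \<inter> U = {\<eta> \<in> jets k \<inter> U. \<forall>i<c. F i \<eta> = 0} \<and>
        (\<forall>\<eta>\<in>U. \<forall>a. (\<forall>w. (\<Sum>i<c. a i * dir_deriv w (F i) \<eta>) = 0) \<longrightarrow> (\<forall>i<c. a i = 0)))"

text \<open>
  If \<open>M\<close> is a submanifold, the velocities at \<open>\<theta>\<close> of all curves that are differentiable there are the
  same as those of the smooth curves.
\<close>

definition tangent_space ::
    "('n::finite, 'm::finite) jet set \<Rightarrow> ('n, 'm) jet \<Rightarrow> ('n, 'm) jet set" where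
  "tangent_space M \<theta> =
     {w. \<exists>\<gamma>. \<gamma> 0 = \<theta> \<and> (\<forall>t. \<gamma> t \<in> M) \<and>
         ((\<lambda>t. fst (\<gamma> t)) has_vector_derivative fst w) (at 0) \<and>
         (\<forall>\<alpha>. ((\<lambda>t. snd (\<gamma> t) \<alpha>) has_vector_derivative snd w \<alpha>) (at 0))}"

text \<open>
  The value at \<open>\<theta> \<in> J\<^sup>k\<^sup>+\<^sup>1\<close> of the \<open>i\<close>-th total derivative, a tangent vector of \<open>J\<^sup>k\<close>. These vectors
  span the tangent space at \<open>\<pi>\<^sub>k\<^sub>+\<^sub>1\<^sub>,\<^sub>k \<theta>\<close> of the \<open>k\<close>-jet prolongation of any section with \<open>(k+1)\<close>-jet \<open>\<theta>\<close>.
\<close>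

definition total_derivative ::
    "nat \<Rightarrow> 'n::finite \<Rightarrow> ('n, 'm::finite) jet \<Rightarrow> ('n, 'm) jet" where
  "total_derivative k i \<theta> =
     (axis i 1, \<lambda>\<alpha>. if size \<alpha> \<le> k then snd \<theta> (add_mset i \<alpha>) else 0)"

definition pde_prolong :: "nat \<Rightarrow> ('n::finite, 'm::finite) jet set \<Rightarrow> ('n, 'm) jet set" where
  "pde_prolong k M =
     {\<theta> \<in> jets (Suc k). truncate k \<theta> \<in> M \<and>
        (\<forall>i. total_derivative k i \<theta> \<in> tangent_space M (truncate k \<theta>))}"

text \<open>
  A system, possibly of several orders, is given by the sequence of its loci \<open>E k\<close> in \<open>J\<^sup>k\<close>; beyond the
  maximal order of the equations, these are the prolongations. \<open>E 0\<close> is the total space of the (local)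
  bundle of dependent variables.
\<close>

definition pde_system :: "(nat \<Rightarrow> ('n::finite, 'm::finite) jet set) \<Rightarrow> bool" where
  "pde_system E \<longleftrightarrow>
     openin (top_of_set (jets 0)) (E 0) \<and>
     (\<forall>k. E (Suc k) \<subseteq> pde_prolong k (E k)) \<and>
     (\<exists>l. \<forall>k\<ge>l. E (Suc k) = pde_prolong k (E k))"

text \<open>All \<open>E k\<close> are smooth and all projections \<open>E (k + 1) \<rightarrow> E k\<close> are surjective submersions.\<close>

definition formally_integrable :: "(nat \<Rightarrow> ('n::finite, 'm::finite) jet set) \<Rightarrow> bool" where
  "formally_integrable E \<longleftrightarrow>
     pde_system E \<and>
     (\<forall>k. submanifold k (E k) \<and>
          truncate k ` E (Suc k) = E k \<and>
          (\<forall>\<theta>\<in>E (Suc k).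
             truncate k ` tangent_space (E (Suc k)) \<theta> = tangent_space (E k) (truncate k \<theta>)))"

definition points :: "(nat \<Rightarrow> ('n::finite, 'm::finite) jet set) \<Rightarrow> ('n, 'm) jet set" where
  "points E = {\<theta>. \<forall>k. truncate k \<theta> \<in> E k}"

text \<open>
  The kernel of the differential of \<open>E k \<rightarrow> E (k - 1)\<close> consists of the tangent vectors whose only
  nonzero components are those of order \<open>k\<close>.
\<close>

definition symbol ::
    "(nat \<Rightarrow> ('n::finite, 'm::finite) jet set) \<Rightarrow> ('n, 'm) jet \<Rightarrow> nat \<Rightarrow> ('n, 'm) tensor set" where
  "symbol E \<theta> k = {q \<in> sym_tensors k. (0, q) \<in> tangent_space (E k) (truncate k \<theta>)}"

definition constant_type :: "(nat \<Rightarrow> ('n::finite, 'm::finite) jet set) \<Rightarrow> bool" where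
  "constant_type E \<longleftrightarrow>
     (\<forall>\<theta>\<in>points E. \<forall>\<theta>'\<in>points E.
        (\<forall>k. tensor.dim (symbol E \<theta> k) = tensor.dim (symbol E \<theta>' k)) \<and>
        proj_dim (char_variety (symbol E \<theta>)) = proj_dim (char_variety (symbol E \<theta>')) \<and>
        fibre_dim (symbol E \<theta>) ` char_variety (symbol E \<theta>) =
          fibre_dim (symbol E \<theta>') ` char_variety (symbol E \<theta>'))"

end

theory Submission
  imports Defs "HOL-Computational_Algebra.Computational_Algebra" "Jordan_Normal_Form.Determinant"
begin

text \<open>
  Every relation of the symbol module is a homogeneous polynomial differential operator with \<open>m\<close>
  components, so \<open>g\<close> is the inverse system of a module \<open>M\<close> with \<open>m\<close> generators and \<open>r = m + c\<close>
  relations of degrees \<open>k\<^sub>1, \<dots>, k\<^sub>r\<close>. Since \<open>dim Char\<close> is known, \<open>d = n - c - 1\<close> real linear forms have no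
  common zero on the characteristic variety, and by the Nullstellensatz the elements of \<open>g\<close> of large
  degree that they kill vanish.

  To compute the Hilbert series of \<open>M\<close>, add to the relations the terms \<open>z\<^sub>i\<^sub>-\<^sub>j\<^bsup>k\<^sub>i\<^esup>\<close> (a band matrix) and \<open>t\<^sub>i i\<^sup>j\<close>
  in new variables. The variables \<open>t\<close> make all maximal minors nonzero, and counting
  the equations that determine a solution gives a lower bound for the Hilbert series of the deformed
  system. Setting \<open>x = 0\<close> and \<open>t = 0\<close> leaves the band matrix, for which an induction gives an upper
  bound. The bounds agree, so \<open>x\<close> and \<open>t\<close> are regular sequences on the deformed system. Once \<open>t = 0\<close>, the
  linear forms together with the \<open>c + 1\<close> variables \<open>z\<close> form another system of parameters, hence, by comparing
  Koszul homology, another regular sequence. Setting \<open>z = 0\<close> recovers \<open>M\<close> and shows that its Hilbert series is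
  \<open>q / (1 - X)\<^sup>d\<close> with \<open>q(1) = S\<^sub>c\<^sub>+\<^sub>1(k\<^sub>1, \<dots>, k\<^sub>r)\<close>.
\<close>

section \<open>Polynomials as differential operators\<close>

text \<open>For m = 1 the system is a complete intersection in the classical sense. For m > 1 the
  presentation matrix of M is m by r, and r - m + 1 is the largest codimension that the locus of its
  maximal minors can have. In this extremal case the Hilbert series depends on the degrees k_i
  alone. The usual reason is the exactness of the Buchsbaum-Rim complex; here the extra variables
  replace it, since they give one system whose series can be counted and of which M is a
  specialization by a regular sequence.

  Everything happens on the dual side. Polynomials act by contraction on the components of
  solutions, which are Taylor coefficients without factorials. A nonzerodivisor on M becomes a
  surjective operator on solutions, setting a variable to zero becomes passing to the kernel of its
  shift, and a regular sequence becomes a Koszul complex that is exact in all positive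
  degrees.\<close>

definition pdiff :: "('v multiset \<Rightarrow>\<^sub>0 'k::comm_ring_1) \<Rightarrow> ('v multiset \<Rightarrow> 'k) \<Rightarrow> 'v multiset \<Rightarrow> 'k" where
  "pdiff P u \<alpha> = (\<Sum>\<beta>\<in>Poly_Mapping.keys P. Poly_Mapping.lookup P \<beta> * u (\<alpha> + \<beta>))"

lemma poly_mapping_sum_single:
  "(\<Sum>\<beta>\<in>Poly_Mapping.keys P. Poly_Mapping.single \<beta> (Poly_Mapping.lookup P \<beta>)) = P"
  by (rule poly_mapping_eqI)
    (auto simp: lookup_sum lookup_single when_def sum.delta in_keys_iff)

lemma poly_mapping_single_induct:
  assumes "\<And>\<beta> c. Q (Poly_Mapping.single \<beta> c)" "\<And>P P'. Q P \<Longrightarrow> Q P' \<Longrightarrow> Q (P + P')"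
  shows "Q (P :: 'a \<Rightarrow>\<^sub>0 'b::comm_monoid_add)"
proof -
  have "Q (\<Sum>\<beta>\<in>S. Poly_Mapping.single \<beta> (Poly_Mapping.lookup P \<beta>))" if "finite S" for S
    using that
  proof induction
    case empty then show ?case using assms(1)[of undefined 0] by simp
  qed (use assms in auto)
  then show ?thesis by (metis poly_mapping_sum_single finite_keys)
qed

lemma pdiff_superset:
  assumes "finite S" "Poly_Mapping.keys P \<subseteq> S"
  shows "pdiff P u \<alpha> = (\<Sum>\<beta>\<in>S. Poly_Mapping.lookup P \<beta> * u (\<alpha> + \<beta>))"
  unfolding pdiff_def using assms by (intro sum.mono_neutral_left) (auto simp: in_keys_iff)

lemma pdiff_add_left: "pdiff (P + Q) u = (\<lambda>\<alpha>. pdiff P u \<alpha> + pdiff Q u \<alpha>)"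
proof
  fix \<alpha>
  let ?S = "Poly_Mapping.keys P \<union> Poly_Mapping.keys Q"
  show "pdiff (P + Q) u \<alpha> = pdiff P u \<alpha> + pdiff Q u \<alpha>"
    using keys_add[of P Q]
    by (simp add: pdiff_superset[of ?S] lookup_add algebra_simps sum.distrib)
qed

lemma pdiff_add_right: "pdiff P (\<lambda>\<alpha>. u \<alpha> + v \<alpha>) = (\<lambda>\<alpha>. pdiff P u \<alpha> + pdiff P v \<alpha>)"
  by (rule ext) (simp add: pdiff_def algebra_simps sum.distrib)

lemma pdiff_single: "pdiff (Poly_Mapping.single \<beta> c) u = (\<lambda>\<alpha>. c * u (\<alpha> + \<beta>))"
  by (rule ext) (subst pdiff_superset[of "{\<beta>}"], auto)

lemma pdiff_mult: "pdiff (P * Q) u = pdiff P (pdiff Q u)"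
proof (induction P rule: poly_mapping_single_induct)
  case (1 \<beta> c)
  show ?case
  proof (induction Q rule: poly_mapping_single_induct)
    case (1 \<gamma> d)
    then show ?case by (simp add: mult_single pdiff_single algebra_simps)
  next
    case (2 Q Q')
    then show ?case by (simp add: distrib_left pdiff_add_left pdiff_add_right)
  qed
next
  case (2 P P')
  then show ?case by (simp add: distrib_right pdiff_add_left)
qed

lemma pdiff_one [simp]: "pdiff 1 u = u"
  using pdiff_single[of 0 1 u] by simp

lemma pdiff_zero_left [simp]: "pdiff 0 u = (\<lambda>_. 0)"
  by (simp add: pdiff_def fun_eq_iff)

lemma pdiff_zero_right [simp]: "pdiff P (\<lambda>_. 0) = (\<lambda>_. 0)"
  by (simp add: pdiff_def fun_eq_iff)

definition vdiff :: "('v multiset \<Rightarrow>\<^sub>0 'k::comm_ring_1) \<Rightarrow> ('j \<Rightarrow> 'v multiset \<Rightarrow> 'k) \<Rightarrow> 'j \<Rightarrow> 'v multiset \<Rightarrow> 'k" where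
  "vdiff P q = (\<lambda>j. pdiff P (q j))"

lemma vdiff_add_right: "vdiff P (q + q') = vdiff P q + vdiff P q'"
  by (intro ext) (simp add: vdiff_def plus_fun_def pdiff_add_right)

lemma vdiff_add_left: "vdiff (P + Q) q = vdiff P q + vdiff Q q"
  by (intro ext) (simp add: vdiff_def plus_fun_def pdiff_add_left)

lemma vdiff_mult: "vdiff P (vdiff Q q) = vdiff (P * Q) q"
  by (intro ext) (simp add: vdiff_def pdiff_mult)

lemma vdiff_one: "vdiff 1 q = q"
  by (intro ext) (simp add: vdiff_def)

interpretation vdiff: Modules.module vdiff
  by (rule Modules.module.intro; rule vdiff_add_right vdiff_add_left vdiff_mult vdiff_one)

lemma pdiff_sum_left: "pdiff (\<Sum>i\<in>I. P i) u \<alpha> = (\<Sum>i\<in>I. pdiff (P i) u \<alpha>)"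
  by (induction I rule: infinite_finite_induct) (auto simp: pdiff_add_left)

lemma pdiff_sum_right: "pdiff P (\<lambda>\<alpha>. \<Sum>i\<in>I. u i \<alpha>) = (\<lambda>\<alpha>. \<Sum>i\<in>I. pdiff P (u i) \<alpha>)"
  by (induction I rule: infinite_finite_induct) (auto simp: pdiff_add_right)

lemma pdiff_scale: "pdiff P (\<lambda>\<alpha>. c * u \<alpha>) = (\<lambda>\<alpha>. c * pdiff P u \<alpha>)"
  by (rule ext) (simp add: pdiff_def sum_distrib_left algebra_simps)

lemma pdiff_commute: "pdiff P (pdiff Q u) = pdiff Q (pdiff P u)"
  by (metis pdiff_mult mult.commute)

section \<open>Evaluation of polynomials at covectors\<close>

lemma eval_sym_superset:
  assumes "finite S" "Poly_Mapping.keys P \<subseteq> S"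
  shows "eval_sym P \<xi> = (\<Sum>\<beta>\<in>S. Poly_Mapping.lookup P \<beta> * (\<Prod>i\<in>#\<beta>. \<xi> $ i))"
  unfolding eval_sym_def using assms by (intro sum.mono_neutral_left) (auto simp: in_keys_iff)

lemma eval_sym_add: "eval_sym (P + Q) \<xi> = eval_sym P \<xi> + eval_sym Q \<xi>"
  using keys_add[of P Q]
  by (simp add: eval_sym_superset[of "Poly_Mapping.keys P \<union> Poly_Mapping.keys Q"] lookup_add
      algebra_simps sum.distrib)

lemma eval_sym_single: "eval_sym (Poly_Mapping.single \<beta> c) \<xi> = c * (\<Prod>i\<in>#\<beta>. \<xi> $ i)"
  by (subst eval_sym_superset[of "{\<beta>}"]) auto

lemma eval_sym_mult: "eval_sym (P * Q) \<xi> = eval_sym P \<xi> * eval_sym Q \<xi>"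
proof (induction P rule: poly_mapping_single_induct)
  case (1 \<beta> c)
  show ?case
    by (induction Q rule: poly_mapping_single_induct)
      (simp_all add: mult_single eval_sym_single distrib_left eval_sym_add)
next
  case (2 P P')
  then show ?case by (simp add: distrib_right eval_sym_add)
qed

lemma eval_sym_0 [simp]: "eval_sym 0 \<xi> = 0"
  by (simp add: eval_sym_def)

lemma eval_sym_1 [simp]: "eval_sym 1 \<xi> = 1"
  using eval_sym_single[of 0 1 \<xi>] by simp

lemma eval_sym_uminus: "eval_sym (- P) \<xi> = - eval_sym P \<xi>"
  by (metis eval_sym_add eval_sym_0 add_eq_0_iff2 add.left_inverse)

lemma eval_sym_diff: "eval_sym (P - Q) \<xi> = eval_sym P \<xi> - eval_sym Q \<xi>"
  by (metis diff_conv_add_uminus eval_sym_add eval_sym_uminus)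

lemma eval_sym_sum: "eval_sym (\<Sum>i\<in>I. P i) \<xi> = (\<Sum>i\<in>I. eval_sym (P i) \<xi>)"
  by (induction I rule: infinite_finite_induct) (auto simp: eval_sym_add)

text \<open>The function spaces in play are infinite-dimensional, so finiteness is attached to
  single subsets. Without it \<open>dim\<close> carries no information: it is a cardinality, which
  is 0 for an infinite basis.\<close>

definition fin_gen :: "('a::field \<Rightarrow> 'b::ab_group_add \<Rightarrow> 'b) \<Rightarrow> 'b set \<Rightarrow> bool" where
  "fin_gen s V \<longleftrightarrow> (\<exists>B. finite B \<and> V \<subseteq> Modules.module.span s B)"

context vector_space
begin

lemma fin_gen_mono: "fin_gen scale W \<Longrightarrow> V \<subseteq> W \<Longrightarrow> fin_gen scale V"
  unfolding fin_gen_def by blast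

lemma fin_gen_finite_independent: "fin_gen scale V \<Longrightarrow> independent B \<Longrightarrow> B \<subseteq> V \<Longrightarrow> finite B"
  unfolding fin_gen_def by (meson independent_span_bound order_trans)

lemma fin_gen_basis:
  assumes "fin_gen scale V"
  obtains B where "B \<subseteq> V" "independent B" "V \<subseteq> span B" "finite B" "card B = dim V"
proof -
  obtain B where "B \<subseteq> V" "independent B" "V \<subseteq> span B" "card B = dim V"
    using basis_exists by blast
  with fin_gen_finite_independent[OF assms] that show ?thesis by blast
qed

lemma dim_le_finite_span:
  assumes "finite B" "V \<subseteq> span B" shows "dim V \<le> card B"
proof -
  have "fin_gen scale V" using assms unfolding fin_gen_def by blast
  then obtain C where "C \<subseteq> V" "independent C" "card C = dim V" "finite C"
    by (metis fin_gen_basis)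
  then show ?thesis using independent_span_bound[of B C] assms by auto
qed

lemma dim_mono_fin_gen:
  assumes "fin_gen scale W" "V \<subseteq> W" shows "dim V \<le> dim W"
proof -
  obtain B where "W \<subseteq> span B" "finite B" "card B = dim W"
    using fin_gen_basis[OF assms(1)] by metis
  then show ?thesis using dim_le_finite_span[of B V] assms(2) by auto
qed

lemma dim_eq_0_fin_gen: "fin_gen scale V \<Longrightarrow> dim V = 0 \<Longrightarrow> V \<subseteq> {0}"
  by (erule fin_gen_basis) auto

lemma card_le_dim_fin_gen:
  assumes "fin_gen scale V" "independent B" "B \<subseteq> V" shows "card B \<le> dim V"
proof -
  have "card B = dim B" using assms(2) dim_eq_card_independent by simp
  then show ?thesis using dim_mono_fin_gen[OF assms(1,3)] by simp
qed

lemma subspace_eq_of_dim: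
  assumes V: "subspace V" "fin_gen scale W" "V \<subseteq> W" "dim W \<le> dim V" shows "V = W"
proof -
  have "fin_gen scale V" using assms fin_gen_mono by blast
  then obtain B where B: "B \<subseteq> V" "independent B" "V \<subseteq> span B" "finite B" "card B = dim V"
    by (rule fin_gen_basis)
  have "W \<subseteq> span B"
  proof (rule ccontr)
    assume "\<not> W \<subseteq> span B"
    then obtain w where w: "w \<in> W" "w \<notin> span B" by blast
    then have "independent (insert w B)" using B(2) by (simp add: independent_insert)
    then have "card (insert w B) \<le> dim W" using card_le_dim_fin_gen[OF assms(2), of "insert w B"] B(1) w assms(3) by auto
    moreover have "w \<notin> B" using w span_base by blast
    ultimately show False using B assms(4) by simp
  qed
  moreover have "span B \<subseteq> V" using B(1) V(1) span_minimal by blast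
  ultimately show ?thesis using assms(3) by blast
qed

end

context vector_space_pair
begin

text \<open>A basis \<open>B\<close> of the kernel is extended to a basis \<open>C\<close> of
  \<open>V\<close>; then \<open>f\<close> is injective on the span of \<open>C - B\<close> and maps
  it onto the image.\<close>

lemma rank_nullity:
  assumes f: "Vector_Spaces.linear s1 s2 f" and V: "vs1.subspace V" "fin_gen s1 V"
  shows "vs1.dim V = vs1.dim {x \<in> V. f x = 0} + vs2.dim (f ` V)"
proof -
  interpret f: Vector_Spaces.linear s1 s2 f by (rule f)
  let ?K = "{x \<in> V. f x = 0}"
  have sK: "vs1.subspace ?K"
    using V(1) by (simp add: vs1.subspace_def f.zero f.add f.scale)
  have fK: "fin_gen s1 ?K" by (rule vs1.fin_gen_mono[OF V(2)]) auto
  obtain B where B: "B \<subseteq> ?K" "vs1.independent B" "?K \<subseteq> vs1.span B" "finite B" "card B = vs1.dim ?K"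
    using vs1.fin_gen_basis[OF fK] .
  obtain C where C: "B \<subseteq> C" "C \<subseteq> V" "vs1.independent C" "V \<subseteq> vs1.span C"
  proof (rule vs1.maximal_independent_subset_extend[of B V])
    show "B \<subseteq> V" using B(1) by blast
  qed (use B(2) in simp_all)
  have fC: "finite C" using vs1.fin_gen_finite_independent[OF V(2) C(3,2)] .
  have cC: "card C = vs1.dim V" using vs1.dim_unique[OF C(2,4,3)] by simp
  let ?D = "C - B"
  have inD: "vs1.independent ?D" by (rule vs1.independent_mono[OF C(3)]) auto
  have sK': "vs1.span B = ?K" using B(3) vs1.span_minimal[OF B(1) sK] by (rule equalityI[rotated])
  have sV': "vs1.span C = V" using C(4) vs1.span_minimal[OF C(2) V(1)] by (rule equalityI[rotated])
  \<comment> \<open>Such an \<open>x\<close> lies in the span of \<open>B\<close> and in the span of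
    \<open>C - B\<close>, so each of its coordinates with respect to \<open>C\<close>
    vanishes.\<close>
  have triv: "x = 0" if x: "x \<in> vs1.span ?D" "f x = 0" for x
  proof -
    have "x \<in> V" using x(1) sV' vs1.span_mono[of ?D C] by blast
    then have xB: "x \<in> vs1.span B" using x(2) sK' by blast
    have "vs1.representation C x b = 0" for b
    proof (rule ccontr)
      assume b: "vs1.representation C x b \<noteq> 0"
      have "vs1.representation C x = vs1.representation B x"
        by (rule vs1.representation_extend[OF C(3) xB C(1)])
      moreover have "vs1.representation C x = vs1.representation ?D x"
        by (rule vs1.representation_extend[OF C(3) x(1) Diff_subset])
      ultimately show False using b vs1.representation_ne_zero[of B x b] vs1.representation_ne_zero[of ?D x b] by auto
    qed
    moreover have "x \<in> vs1.span C" using x(1) vs1.span_mono[of ?D C] by blast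
    ultimately show ?thesis
      using vs1.sum_nonzero_representation_eq[OF C(3), of x] by simp
  qed
  have inj: "inj_on f (vs1.span ?D)"
  proof (rule inj_onI)
    fix x y assume xy: "x \<in> vs1.span ?D" "y \<in> vs1.span ?D" "f x = f y"
    then have "f (x - y) = 0" by (simp add: f.diff)
    then show "x = y" using triv[of "x - y"] vs1.span_diff[OF xy(1,2)] by simp
  qed
  have ind: "vs2.independent (f ` ?D)"
    by (rule f.independent_injective_image[OF inD inj])
  have "f ` V \<subseteq> vs2.span (f ` C)" using f.span_image[of C] C(4) by blast
  also have "vs2.span (f ` C) \<subseteq> vs2.span (insert 0 (f ` ?D))"
    using B(1) by (intro vs2.span_mono) auto
  also have "\<dots> = vs2.span (f ` ?D)" by simp
  finally have "f ` V \<subseteq> vs2.span (f ` ?D)" .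
  moreover have "f ` ?D \<subseteq> f ` V" using C(2) by auto
  ultimately have "vs2.dim (f ` V) = card (f ` ?D)" by (rule vs2.dim_unique[OF _ _ ind refl, rotated])
  also have "\<dots> = card ?D" by (rule card_image[OF inj_on_subset[OF inj vs1.span_superset]])
  also have "\<dots> = card C - card B" by (rule card_Diff_subset[OF B(4) C(1)])
  finally have "vs2.dim (f ` V) = card C - card B" .
  then show ?thesis using card_mono[OF fC C(1)] unfolding cC B(5) by linarith
qed

lemma dim_le_kernel_image:
  assumes f: "Vector_Spaces.linear s1 s2 f" and V: "vs1.subspace V" "fin_gen s1 V"
    and W: "fin_gen s2 W" "f ` V \<subseteq> W" and K: "fin_gen s1 K" "\<And>x. x \<in> V \<Longrightarrow> f x = 0 \<Longrightarrow> x \<in> K"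
  shows "vs1.dim V \<le> vs1.dim K + vs2.dim W"
proof -
  have "vs1.dim {x \<in> V. f x = 0} \<le> vs1.dim K"
    by (rule vs1.dim_mono_fin_gen[OF K(1)]) (use K(2) in blast)
  moreover have "vs2.dim (f ` V) \<le> vs2.dim W" by (rule vs2.dim_mono_fin_gen[OF W])
  ultimately show ?thesis using rank_nullity[OF f V] by simp
qed

lemma dim_image_inj:
  assumes f: "Vector_Spaces.linear s1 s2 f" and V: "vs1.subspace V" "fin_gen s1 V"
    and inj: "\<And>x. x \<in> V \<Longrightarrow> f x = 0 \<Longrightarrow> x = 0"
  shows "vs2.dim (f ` V) = vs1.dim V"
proof -
  interpret f: Vector_Spaces.linear s1 s2 f by (rule f)
  have "{x \<in> V. f x = 0} = {0}" using inj vs1.subspace_0[OF V(1)] f.zero by blast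
  moreover have "vs1.dim {0} = 0" using vs1.dim_le_finite_span[of "{}" "{0}"] by simp
  ultimately show ?thesis using rank_nullity[OF f V] by simp
qed

end

section \<open>Koszul complexes\<close>

locale koszul =
  fixes s :: "'a::comm_ring_1 \<Rightarrow> 'b::ab_group_add \<Rightarrow> 'b" (infixr \<open>\<star>\<close> 75) and V :: "'b set"
  assumes s_add: "x \<star> (u + v) = x \<star> u + x \<star> v"
    and s_add_left: "(x + y) \<star> u = x \<star> u + y \<star> u"
    and s_mult: "x \<star> (y \<star> u) = (x * y) \<star> u"
    and s_one [simp]: "1 \<star> u = u"
    and V_0 [simp]: "0 \<in> V" and V_diff: "u \<in> V \<Longrightarrow> v \<in> V \<Longrightarrow> u - v \<in> V"
    and V_s: "u \<in> V \<Longrightarrow> x \<star> u \<in> V"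
begin

lemma s_0 [simp]: "x \<star> 0 = 0"
  using s_add[of x 0 0] by simp

lemma s_minus: "x \<star> (- u) = - (x \<star> u)"
  using s_add[of x u "- u"] by (simp add: eq_neg_iff_add_eq_0 add.commute)

lemma s_diff: "x \<star> (u - v) = x \<star> u - x \<star> v"
  using s_add[of x u "- v"] by (simp add: s_minus)

lemma s_commute: "x \<star> (y \<star> u) = y \<star> (x \<star> u)"
  by (simp add: s_mult mult.commute)

definition chain_cons :: "(bool list \<Rightarrow> 'b) \<Rightarrow> (bool list \<Rightarrow> 'b) \<Rightarrow> bool list \<Rightarrow> 'b" where
  "chain_cons a b = (\<lambda>bs. case bs of [] \<Rightarrow> 0 | h # l \<Rightarrow> if h then b l else a l)"

text \<open>A chain stores the coefficient of the exterior basis vector e_I at the indicator list of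
  I. \<open>kos\<close> is the wedge product with the sum of the \<theta>_i e_i, so it raises the
  number of entries \<open>True\<close> by one. The clause for \<open>x # \<theta>s\<close> is the
  mapping cone of \<open>x\<close> on the complex of the tail.\<close>

primrec kos :: "'a list \<Rightarrow> (bool list \<Rightarrow> 'b) \<Rightarrow> bool list \<Rightarrow> 'b" where
  "kos [] c = (\<lambda>_. 0)"
| "kos (x # \<theta>s) c = chain_cons (kos \<theta>s (\<lambda>l. c (False # l)))
     (\<lambda>l. x \<star> c (False # l) - kos \<theta>s (\<lambda>l. c (True # l)) l)"

definition chains :: "nat \<Rightarrow> int \<Rightarrow> (bool list \<Rightarrow> 'b) set" where
  "chains n i = {c. \<forall>bs. c bs \<in> V \<and> (c bs \<noteq> 0 \<longrightarrow> length bs = n \<and> int (count_list bs True) = i)}"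

text \<open>The operator \<open>y\<close> kills the homology in degree \<open>i\<close>; for
  \<open>y = 1\<close> that homology is zero.\<close>

definition bounding :: "'a \<Rightarrow> 'a list \<Rightarrow> int \<Rightarrow> bool" where
  "bounding y \<theta>s i \<longleftrightarrow> (\<forall>c\<in>chains (length \<theta>s) i. kos \<theta>s c = (\<lambda>_. 0) \<longrightarrow>
     (\<exists>b\<in>chains (length \<theta>s) (i - 1). kos \<theta>s b = (\<lambda>l. y \<star> c l)))"

abbreviation "exact \<equiv> bounding 1"

lemma exactD:
  "exact \<theta>s i \<Longrightarrow> c \<in> chains (length \<theta>s) i \<Longrightarrow> kos \<theta>s c = (\<lambda>_. 0) \<Longrightarrow>
    \<exists>b\<in>chains (length \<theta>s) (i - 1). kos \<theta>s b = c"
  by (simp add: bounding_def)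

lemma chain_cons_simps [simp]:
  "chain_cons a b [] = 0" "chain_cons a b (True # l) = b l" "chain_cons a b (False # l) = a l"
  by (simp_all add: chain_cons_def)

lemma chain_cons_eq_iff: "chain_cons a b = chain_cons a' b' \<longleftrightarrow> a = a' \<and> b = b'"
proof
  assume e: "chain_cons a b = chain_cons a' b'"
  have "a l = a' l" "b l = b' l" for l
    using fun_cong[OF e, of "False # l"] fun_cong[OF e, of "True # l"] by simp_all
  then show "a = a' \<and> b = b'" by blast
qed simp

lemma chain_cons_zero: "chain_cons (\<lambda>_. 0) (\<lambda>_. 0) = (\<lambda>_. 0)"
  by (auto simp: chain_cons_def fun_eq_iff split: list.split)

lemma chain_cons_eq_0_iff: "chain_cons a b = (\<lambda>_. 0) \<longleftrightarrow> a = (\<lambda>_. 0) \<and> b = (\<lambda>_. 0)"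
  using chain_cons_eq_iff[of a b "\<lambda>_. 0" "\<lambda>_. 0"] by (simp add: chain_cons_zero)

lemma kos_chain_cons:
  "kos (x # \<theta>s) (chain_cons a b) = chain_cons (kos \<theta>s a) (\<lambda>l. x \<star> a l - kos \<theta>s b l)"
  by simp

lemma s_chain_cons: "(\<lambda>l. y \<star> chain_cons a b l) = chain_cons (\<lambda>l. y \<star> a l) (\<lambda>l. y \<star> b l)"
  by (auto simp: chain_cons_def fun_eq_iff split: list.split)

lemma s_chain_cons_diff: "(\<lambda>l. y \<star> chain_cons a b l - chain_cons c d l) =
    chain_cons (\<lambda>l. y \<star> a l - c l) (\<lambda>l. y \<star> b l - d l)"
  by (auto simp: chain_cons_def fun_eq_iff split: list.split)

declare kos.simps(2) [simp del]

lemma chain_cons_in_chains_iff: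
  "chain_cons a b \<in> chains (Suc n) i \<longleftrightarrow> a \<in> chains n i \<and> b \<in> chains n (i - 1)"
proof
  assume "chain_cons a b \<in> chains (Suc n) i"
  then have "\<forall>bs. chain_cons a b bs \<in> V \<and> (chain_cons a b bs \<noteq> 0 \<longrightarrow>
      length bs = Suc n \<and> int (count_list bs True) = i)"
    by (simp add: chains_def)
  then have "chain_cons a b (h # l) \<in> V \<and> (chain_cons a b (h # l) \<noteq> 0 \<longrightarrow>
      length (h # l) = Suc n \<and> int (count_list (h # l) True) = i)" for h l
    by blast
  from this[of False] this[of True]
  have "\<forall>l. a l \<in> V \<and> (a l \<noteq> 0 \<longrightarrow> length l = n \<and> int (count_list l True) = i)"
    "\<forall>l. b l \<in> V \<and> (b l \<noteq> 0 \<longrightarrow> length l = n \<and> int (count_list l True) = i - 1)"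
    by (simp, simp add: eq_diff_eq add.commute)
  then show "a \<in> chains n i \<and> b \<in> chains n (i - 1)"
    by (simp add: chains_def)
next
  assume "a \<in> chains n i \<and> b \<in> chains n (i - 1)"
  then show "chain_cons a b \<in> chains (Suc n) i"
    by (auto simp: chains_def chain_cons_def split: list.split)
qed

lemma chains_Suc_E:
  assumes "c \<in> chains (Suc n) i"
  obtains a b where "c = chain_cons a b" "a \<in> chains n i" "b \<in> chains n (i - 1)"
proof -
  let ?a = "\<lambda>l. c (False # l)" and ?b = "\<lambda>l. c (True # l)"
  have "c [] = 0" using assms by (auto simp: chains_def)
  then have e: "c = chain_cons ?a ?b"
    by (auto simp: chain_cons_def fun_eq_iff split: list.split)
  then show ?thesis using that[of ?a ?b] assms chain_cons_in_chains_iff[of ?a ?b n i] by simp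
qed

lemma zero_in_chains [simp]: "(\<lambda>_. 0) \<in> chains n i"
  by (simp add: chains_def)

lemma chains_diff: "c \<in> chains n i \<Longrightarrow> d \<in> chains n i \<Longrightarrow> (\<lambda>l. c l - d l) \<in> chains n i"
  by (auto simp: chains_def V_diff) (metis diff_self diff_zero)+

lemma chains_add: "c \<in> chains n i \<Longrightarrow> d \<in> chains n i \<Longrightarrow> (\<lambda>l. c l + d l) \<in> chains n i"
  using chains_diff[of "\<lambda>_. 0" n i d] chains_diff[of c n i "\<lambda>l. 0 - d l"] by simp

lemma chains_s: "c \<in> chains n i \<Longrightarrow> (\<lambda>l. x \<star> c l) \<in> chains n i"
  by (auto simp: chains_def V_s) (metis s_0)+

lemma chains_neg: assumes "i < 0" "c \<in> chains n i" shows "c = (\<lambda>_. 0)"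
proof
  fix l show "c l = 0" using assms by (auto simp: chains_def dest!: spec[of _ l])
qed

lemma chains_large: assumes "i > int n" "c \<in> chains n i" shows "c = (\<lambda>_. 0)"
proof
  fix l show "c l = 0" using assms count_le_length[of l True]
    by (auto simp: chains_def dest!: spec[of _ l])
qed

lemma kos_diff: "kos \<theta>s (\<lambda>l. c l - d l) = (\<lambda>l. kos \<theta>s c l - kos \<theta>s d l)"
proof (induction \<theta>s arbitrary: c d)
  case (Cons x \<theta>s)
  show ?case
  proof
    fix bs
    show "kos (x # \<theta>s) (\<lambda>l. c l - d l) bs = kos (x # \<theta>s) c bs - kos (x # \<theta>s) d bs"
      by (cases bs) (auto simp: kos.simps(2) Cons chain_cons_def s_diff)
  qed
qed simp

lemma kos_zero [simp]: "kos \<theta>s (\<lambda>_. 0) = (\<lambda>_. 0)"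
  using kos_diff[of \<theta>s "\<lambda>_. 0" "\<lambda>_. 0"] by simp

lemma kos_add: "kos \<theta>s (\<lambda>l. c l + d l) = (\<lambda>l. kos \<theta>s c l + kos \<theta>s d l)"
  using kos_diff[of \<theta>s c "\<lambda>l. 0 - d l"] kos_diff[of \<theta>s "\<lambda>_. 0" d] by simp

lemma kos_s: "kos \<theta>s (\<lambda>l. y \<star> c l) = (\<lambda>l. y \<star> kos \<theta>s c l)"
proof (induction \<theta>s arbitrary: c)
  case (Cons x \<theta>s)
  show ?case
  proof
    fix bs
    show "kos (x # \<theta>s) (\<lambda>l. y \<star> c l) bs = y \<star> kos (x # \<theta>s) c bs"
      by (cases bs) (auto simp: kos.simps(2) Cons chain_cons_def s_diff s_commute[of x y])
  qed
qed simp

text \<open>Long exact sequence of the mapping cone: its homology in degree \<open>i\<close> sits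
  between the homology of the tail in degrees i - 1 and i, so the top degree rises by at most
  one.\<close>

lemma exact_Cons:
  assumes ex: "\<And>i. i > a \<Longrightarrow> exact \<theta>s i" and i: "i > a + 1"
  shows "exact (x # \<theta>s) i"
  unfolding bounding_def
proof (intro ballI impI)
  let ?n = "length \<theta>s"
  fix c assume c: "c \<in> chains (length (x # \<theta>s)) i" "kos (x # \<theta>s) c = (\<lambda>_. 0)"
  then obtain u v where uv: "c = chain_cons u v" "u \<in> chains ?n i" "v \<in> chains ?n (i - 1)"
    by (auto elim: chains_Suc_E)
  have k: "kos \<theta>s u = (\<lambda>_. 0)" "(\<lambda>l. x \<star> u l - kos \<theta>s v l) = (\<lambda>_. 0)"
    using c(2) by (simp_all add: uv(1) kos_chain_cons chain_cons_eq_0_iff)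
  obtain u' where u': "u' \<in> chains ?n (i - 1)" "kos \<theta>s u' = u"
    using exactD[OF ex uv(2) k(1)] i by auto
  have "kos \<theta>s (\<lambda>l. x \<star> u' l - v l) = (\<lambda>_. 0)"
    using k(2) u'(2) by (simp add: kos_diff kos_s)
  moreover have "(\<lambda>l. x \<star> u' l - v l) \<in> chains ?n (i - 1)" using u'(1) uv(3) chains_s chains_diff by blast
  ultimately obtain v' where v': "v' \<in> chains ?n (i - 1 - 1)" "kos \<theta>s v' = (\<lambda>l. x \<star> u' l - v l)"
    using exactD[OF ex, of "i - 1"] i by auto
  have "kos (x # \<theta>s) (chain_cons u' v') = c"
    by (simp add: kos_chain_cons u' v' uv(1))
  moreover have "chain_cons u' v' \<in> chains (length (x # \<theta>s)) (i - 1)"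
    using u' v' by (simp add: chain_cons_in_chains_iff)
  ultimately show "\<exists>b\<in>chains (length (x # \<theta>s)) (i - 1). kos (x # \<theta>s) b = (\<lambda>l. 1 \<star> c l)"
    by auto
qed

lemma exact_append:
  assumes "\<And>i. i > a \<Longrightarrow> exact \<theta>s i" "i > a + int (length us)"
  shows "exact (us @ \<theta>s) i"
  using assms(2)
proof (induction us arbitrary: i)
  case (Cons u us)
  show ?case using exact_Cons[of "a + int (length us)" "us @ \<theta>s" i u] Cons by simp
qed (use assms in simp)

lemma exact_large: "i > int (length \<theta>s) \<Longrightarrow> exact \<theta>s i"
  unfolding bounding_def using chains_large by (metis kos_zero s_0 zero_in_chains)

abbreviation ground :: "nat \<Rightarrow> 'b \<Rightarrow> bool list \<Rightarrow> 'b" where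
  "ground n u \<equiv> (\<lambda>l. if l = replicate n False then u else 0)"

lemma ground_in_chains: "u \<in> V \<Longrightarrow> ground n u \<in> chains n 0"
  by (auto simp: chains_def count_list_0_iff)

lemma chains_0_ground:
  assumes "c \<in> chains n 0" shows "c = ground n (c (replicate n False))" "c (replicate n False) \<in> V"
proof -
  have "c l = 0" if "l \<noteq> replicate n False" for l
  proof (rule ccontr)
    assume "c l \<noteq> 0"
    then have "length l = n" "count_list l True = 0" using assms by (auto simp: chains_def)
    then have "l = replicate n False"
      by (metis (full_types) count_list_0_iff replicate_eqI)
    with that show False by simp
  qed
  then show "c = ground n (c (replicate n False))" by auto
  show "c (replicate n False) \<in> V" using assms by (auto simp: chains_def)
qed

text \<open>Identifies the homology in degree 0 with the common kernel of the operators.\<close>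

lemma kos_ground_eq_0_iff:
  "kos \<theta>s (ground (length \<theta>s) u) = (\<lambda>_. 0) \<longleftrightarrow> (\<forall>\<theta>\<in>set \<theta>s. \<theta> \<star> u = 0)"
proof (induction \<theta>s)
  case (Cons x \<theta>s)
  have e: "ground (length (x # \<theta>s)) u = chain_cons (ground (length \<theta>s) u) (\<lambda>_. 0)"
    by (auto simp: chain_cons_def fun_eq_iff split: list.split)
  have g: "(\<lambda>l. x \<star> ground (length \<theta>s) u l) = (\<lambda>_. 0) \<longleftrightarrow> x \<star> u = 0"
    by (auto simp: fun_eq_iff)
  show ?case
    unfolding e kos_chain_cons chain_cons_eq_0_iff kos_zero diff_0_right g Cons by auto
qed simp

definition surj_on_kernel :: "'a \<Rightarrow> 'a list \<Rightarrow> bool" where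
  "surj_on_kernel x \<theta>s \<longleftrightarrow> (\<forall>u\<in>V. (\<forall>\<theta>\<in>set \<theta>s. \<theta> \<star> u = 0) \<longrightarrow>
     (\<exists>v\<in>V. (\<forall>\<theta>\<in>set \<theta>s. \<theta> \<star> v = 0) \<and> x \<star> v = u))"

text \<open>Above degree 1 the bound of \<open>exact_Cons\<close> suffices. In degree 1 the only
  possible homology is the cokernel of \<open>x\<close> on the common kernel of the tail.\<close>

lemma exact_Cons_of_surj:
  assumes ex: "\<And>i. i \<ge> 1 \<Longrightarrow> exact \<theta>s i" and surj: "surj_on_kernel x \<theta>s" and i: "i \<ge> 1"
  shows "exact (x # \<theta>s) i"
proof (cases "i = 1")
  case False
  then show ?thesis using exact_Cons[of 0 \<theta>s i x] ex i by auto
next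
  case True
  let ?n = "length \<theta>s"
  show ?thesis
    unfolding bounding_def
  proof (intro ballI impI)
    fix c assume c: "c \<in> chains (length (x # \<theta>s)) i" "kos (x # \<theta>s) c = (\<lambda>_. 0)"
    then obtain u v where uv: "c = chain_cons u v" "u \<in> chains ?n 1" "v \<in> chains ?n 0"
      using True by (auto elim: chains_Suc_E)
    have k: "kos \<theta>s u = (\<lambda>_. 0)" "(\<lambda>l. x \<star> u l - kos \<theta>s v l) = (\<lambda>_. 0)"
      using c(2) by (simp_all add: uv(1) kos_chain_cons chain_cons_eq_0_iff)
    obtain u' where u': "u' \<in> chains ?n 0" "kos \<theta>s u' = u"
      using exactD[OF ex uv(2) k(1)] by auto
    \<comment> \<open>\<open>u'\<close> solves the first component. The defect \<open>?w\<close> in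
      the second is a cycle of degree 0, that is, a vector of the common kernel; subtracting a
      preimage of it under \<open>x\<close> corrects \<open>u'\<close> without disturbing the first
      component.\<close>
    let ?w = "\<lambda>l. x \<star> u' l - v l"
    have w: "?w \<in> chains ?n 0" using u'(1) uv(3) chains_s chains_diff by blast
    have kw: "kos \<theta>s ?w = (\<lambda>_. 0)" using k(2) u'(2) by (simp add: kos_diff kos_s)
    define y where "y = ?w (replicate ?n False)"
    have wy: "?w = ground ?n y" "y \<in> V" unfolding y_def by (rule chains_0_ground[OF w])+
    have "\<forall>\<theta>\<in>set \<theta>s. \<theta> \<star> y = 0" using kw wy(1) kos_ground_eq_0_iff[of \<theta>s y] by simp
    then obtain z where z: "z \<in> V" "\<forall>\<theta>\<in>set \<theta>s. \<theta> \<star> z = 0" "x \<star> z = y"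
      using surj wy(2) unfolding surj_on_kernel_def by blast
    let ?b = "\<lambda>l. u' l - ground ?n z l"
    have b: "?b \<in> chains ?n 0" using u'(1) ground_in_chains[OF z(1)] chains_diff by blast
    have "kos \<theta>s ?b = u" using z(2) u'(2) kos_ground_eq_0_iff[of \<theta>s z] by (simp add: kos_diff)
    moreover have "(\<lambda>l. x \<star> ?b l) = v"
    proof
      fix l
      have "x \<star> ground ?n z l = ground ?n y l" using z(3) by simp
      also have "\<dots> = x \<star> u' l - v l" using fun_cong[OF wy(1), of l] by simp
      finally show "x \<star> ?b l = v l" by (simp only: s_diff) simp
    qed
    ultimately have "kos (x # \<theta>s) (chain_cons ?b (\<lambda>_. 0)) = c"
      by (simp only: kos_chain_cons uv(1)) simp
    moreover have "chain_cons ?b (\<lambda>_. 0) \<in> chains (length (x # \<theta>s)) (i - 1)"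
      using b True by (simp add: chain_cons_in_chains_iff)
    ultimately show "\<exists>b\<in>chains (length (x # \<theta>s)) (i - 1). kos (x # \<theta>s) b = (\<lambda>l. 1 \<star> c l)"
      by auto
  qed
qed

text \<open>Exactness of the cone makes \<open>x\<close> injective on the homology of the
  tail.\<close>

lemma cycle_of_exact_Cons:
  assumes ex: "exact (x # \<theta>s) i" and c: "c \<in> chains (length \<theta>s) i" "kos \<theta>s c = (\<lambda>_. 0)"
    and b: "b \<in> chains (length \<theta>s) (i - 1)" "kos \<theta>s b = (\<lambda>l. x \<star> c l)"
  shows "\<exists>b\<in>chains (length \<theta>s) (i - 1). kos \<theta>s b = c"
proof -
  have "chain_cons c b \<in> chains (length (x # \<theta>s)) i" using c b by (simp add: chain_cons_in_chains_iff)
  moreover have "kos (x # \<theta>s) (chain_cons c b) = (\<lambda>_. 0)"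
    by (simp add: kos_chain_cons c b chain_cons_zero)
  ultimately obtain d where d: "d \<in> chains (length (x # \<theta>s)) (i - 1)" "kos (x # \<theta>s) d = chain_cons c b"
    using exactD[OF ex] by blast
  then obtain u v where uv: "d = chain_cons u v" "u \<in> chains (length \<theta>s) (i - 1)"
    by (auto elim: chains_Suc_E)
  then show ?thesis using d(2) by (auto simp: kos_chain_cons chain_cons_eq_iff)
qed

text \<open>Converse of \<open>exact_Cons_of_surj\<close> for a locally nilpotent \<open>x\<close>:
  it is injective on the homology of the tail in positive degrees, and yet some power of it kills
  each cycle.\<close>

lemma exact_of_exact_Cons:
  assumes ex: "\<And>i. i \<ge> 1 \<Longrightarrow> exact (x # \<theta>s) i" and nil: "\<And>u. u \<in> V \<Longrightarrow> \<exists>e. x ^ e \<star> u = 0"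
  shows "i \<ge> 1 \<Longrightarrow> exact \<theta>s i" "surj_on_kernel x \<theta>s"
proof -
  let ?n = "length \<theta>s"
  show "exact \<theta>s i" if i: "i \<ge> 1"
    unfolding bounding_def
  proof (intro ballI impI)
    fix c assume c: "c \<in> chains ?n i" "kos \<theta>s c = (\<lambda>_. 0)"
    have "\<exists>e. \<forall>l. x ^ e \<star> c l = 0"
    proof -
      let ?L = "{l :: bool list. length l = ?n}"
      have fin: "finite ?L" using finite_lists_length_eq[of "UNIV :: bool set"] by simp
      have "\<forall>l. \<exists>e. x ^ e \<star> c l = 0" using c(1) nil by (auto simp: chains_def)
      then obtain e where e: "\<And>l. x ^ e l \<star> c l = 0" by metis
      \<comment> \<open>A chain has only finitely many nonzero entries, so the sum of their
        exponents serves all of them at once.\<close>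
      have "x ^ (\<Sum>l\<in>?L. e l) \<star> c l = 0" for l
      proof (cases "l \<in> ?L")
        case True
        then have "(\<Sum>l\<in>?L. e l) = (\<Sum>l\<in>?L - {l}. e l) + e l" using fin by (simp add: sum.remove add.commute)
        then have "x ^ (\<Sum>l\<in>?L. e l) \<star> c l = x ^ (\<Sum>l\<in>?L - {l}. e l) \<star> x ^ e l \<star> c l"
          by (simp add: s_mult power_add)
        then show ?thesis by (simp add: e)
      next
        case False
        then have "c l = 0" using c(1) by (auto simp: chains_def)
        then show ?thesis by simp
      qed
      then show ?thesis by blast
    qed
    then obtain e where "\<forall>l. x ^ e \<star> c l = 0" ..
    then have "\<exists>b\<in>chains ?n (i - 1). kos \<theta>s b = (\<lambda>l. x ^ e \<star> c l)"
      by (intro bexI[of _ "\<lambda>_. 0"]) auto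
    then have "\<exists>b\<in>chains ?n (i - 1). kos \<theta>s b = c"
    proof (induction e)
      case (Suc e)
      let ?d = "\<lambda>l. x ^ e \<star> c l"
      have "?d \<in> chains ?n i" "kos \<theta>s ?d = (\<lambda>_. 0)" using c chains_s by (auto simp: kos_s)
      moreover obtain b where "b \<in> chains ?n (i - 1)" "kos \<theta>s b = (\<lambda>l. x \<star> ?d l)"
        using Suc.prems by (auto simp: s_mult)
      ultimately show ?case using cycle_of_exact_Cons[OF ex[OF i], of ?d b] Suc.IH by blast
    qed simp
    then show "\<exists>b\<in>chains ?n (i - 1). kos \<theta>s b = (\<lambda>l. 1 \<star> c l)" by simp
  qed
  show "surj_on_kernel x \<theta>s"
    unfolding surj_on_kernel_def
  proof (intro ballI impI)
    fix u assume u: "u \<in> V" "\<forall>\<theta>\<in>set \<theta>s. \<theta> \<star> u = 0"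
    let ?c = "chain_cons (\<lambda>_. 0) (ground ?n u)"
    have "?c \<in> chains (length (x # \<theta>s)) 1" using ground_in_chains[OF u(1)] by (simp add: chain_cons_in_chains_iff)
    moreover have "kos (x # \<theta>s) ?c = (\<lambda>_. 0)"
      using u(2) kos_ground_eq_0_iff[of \<theta>s u] by (simp add: kos_chain_cons chain_cons_eq_0_iff)
    ultimately obtain d where d: "d \<in> chains (length (x # \<theta>s)) 0" "kos (x # \<theta>s) d = ?c"
      using exactD[OF ex, of 1] by auto
    then obtain v w where vw: "d = chain_cons v w" "v \<in> chains ?n 0" "w \<in> chains ?n (0 - 1)"
      by (auto elim: chains_Suc_E)
    have w: "w = (\<lambda>_. 0)" using chains_neg[OF _ vw(3)] by simp
    have k: "kos \<theta>s v = (\<lambda>_. 0)" "(\<lambda>l. x \<star> v l) = ground ?n u"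
      using d(2) by (simp_all add: vw(1) kos_chain_cons chain_cons_eq_iff w)
    let ?v = "v (replicate ?n False)"
    have "\<forall>\<theta>\<in>set \<theta>s. \<theta> \<star> ?v = 0" using k(1) kos_ground_eq_0_iff[of \<theta>s ?v] chains_0_ground(1)[OF vw(2)] by simp
    moreover have "x \<star> ?v = u" using fun_cong[OF k(2), of "replicate ?n False"] by simp
    ultimately show "\<exists>v\<in>V. (\<forall>\<theta>\<in>set \<theta>s. \<theta> \<star> v = 0) \<and> x \<star> v = u"
      using chains_0_ground(2)[OF vw(2)] by blast
  qed
qed

text \<open>An operator that is nilpotent on the top homology cannot be surjective there, so adding it
  raises the top degree.\<close>

lemma not_exact_Cons:
  assumes nex: "\<not> exact \<theta>s a" and nil: "bounding (x ^ e) \<theta>s a"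
  shows "\<not> exact (x # \<theta>s) (a + 1)"
proof
  let ?n = "length \<theta>s"
  assume ex: "exact (x # \<theta>s) (a + 1)"
  \<comment> \<open>Exactness of the cone in degree a + 1 makes \<open>x\<close> surjective on the
    homology of the tail in degree \<open>a\<close>. By iteration every class is
    \<open>x ^ e\<close> times a class, hence zero.\<close>
  have step: "\<exists>d\<in>chains ?n a. kos \<theta>s d = (\<lambda>_. 0) \<and> (\<exists>b\<in>chains ?n (a - 1). kos \<theta>s b = (\<lambda>l. x \<star> d l - c l))"
    if c: "c \<in> chains ?n a" "kos \<theta>s c = (\<lambda>_. 0)" for c
  proof -
    have "chain_cons (\<lambda>_. 0) c \<in> chains (length (x # \<theta>s)) (a + 1)" using c by (simp add: chain_cons_in_chains_iff)
    moreover have "kos (x # \<theta>s) (chain_cons (\<lambda>_. 0) c) = (\<lambda>_. 0)" using c by (simp add: kos_chain_cons chain_cons_zero)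
    ultimately obtain d where d: "d \<in> chains (length (x # \<theta>s)) a" "kos (x # \<theta>s) d = chain_cons (\<lambda>_. 0) c"
      using exactD[OF ex] by auto
    then obtain u v where uv: "d = chain_cons u v" "u \<in> chains ?n a" "v \<in> chains ?n (a - 1)"
      by (auto elim: chains_Suc_E)
    have k: "kos \<theta>s u = (\<lambda>_. 0)" "(\<lambda>l. x \<star> u l - kos \<theta>s v l) = c"
      using d(2) by (simp_all add: uv(1) kos_chain_cons chain_cons_eq_iff)
    have "kos \<theta>s v = (\<lambda>l. x \<star> u l - c l)" using k(2) by auto
    then show ?thesis using uv k by blast
  qed
  have "\<exists>b\<in>chains ?n (a - 1). kos \<theta>s b = c" if c: "c \<in> chains ?n a" "kos \<theta>s c = (\<lambda>_. 0)" for c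
  proof -
    have "\<exists>d\<in>chains ?n a. kos \<theta>s d = (\<lambda>_. 0) \<and> (\<exists>b\<in>chains ?n (a - 1). kos \<theta>s b = (\<lambda>l. x ^ k \<star> d l - c l))" for k
    proof (induction k)
      case 0
      then show ?case using c by (intro bexI[of _ c] conjI bexI[of _ "\<lambda>_. 0"]) auto
    next
      case (Suc k)
      then obtain d b where db: "d \<in> chains ?n a" "kos \<theta>s d = (\<lambda>_. 0)" "b \<in> chains ?n (a - 1)"
        "kos \<theta>s b = (\<lambda>l. x ^ k \<star> d l - c l)" by blast
      obtain d' b' where db': "d' \<in> chains ?n a" "kos \<theta>s d' = (\<lambda>_. 0)" "b' \<in> chains ?n (a - 1)"
        "kos \<theta>s b' = (\<lambda>l. x \<star> d' l - d l)" using step[OF db(1,2)] by blast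
      have "kos \<theta>s (\<lambda>l. x ^ k \<star> b' l + b l) = (\<lambda>l. x ^ Suc k \<star> d' l - c l)"
        by (simp add: kos_add kos_s db db' s_diff s_mult mult.commute)
      then show ?case using db db' chains_add chains_s by blast
    qed
    then obtain d b where db: "d \<in> chains ?n a" "kos \<theta>s d = (\<lambda>_. 0)" "b \<in> chains ?n (a - 1)"
      "kos \<theta>s b = (\<lambda>l. x ^ e \<star> d l - c l)" by blast
    obtain b' where b': "b' \<in> chains ?n (a - 1)" "kos \<theta>s b' = (\<lambda>l. x ^ e \<star> d l)"
      using nil db unfolding bounding_def by blast
    have "kos \<theta>s (\<lambda>l. b' l - b l) = c" by (simp add: kos_diff db b')
    then show ?thesis using db b' chains_diff by blast
  qed
  then have "exact \<theta>s a" by (simp add: bounding_def)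
  with nex show False ..
qed

text \<open>Contraction with the first basis vector is a homotopy from multiplication by
  \<open>x\<close> to zero; it sends a chain to its part with head \<open>True\<close>.\<close>

lemma bounding_head: "bounding x (x # \<theta>s) i"
  unfolding bounding_def
proof (intro ballI impI)
  fix c assume c: "c \<in> chains (length (x # \<theta>s)) i" "kos (x # \<theta>s) c = (\<lambda>_. 0)"
  then obtain u v where uv: "c = chain_cons u v" "u \<in> chains (length \<theta>s) i" "v \<in> chains (length \<theta>s) (i - 1)"
    by (auto elim: chains_Suc_E)
  have "(\<lambda>l. x \<star> u l - kos \<theta>s v l) = (\<lambda>_. 0)"
    using c(2) by (simp add: uv(1) kos_chain_cons chain_cons_eq_0_iff)
  then have k: "kos \<theta>s v = (\<lambda>l. x \<star> u l)" by (simp add: fun_eq_iff)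
  have "kos (x # \<theta>s) (chain_cons v (\<lambda>_. 0)) = (\<lambda>l. x \<star> c l)"
    by (simp add: kos_chain_cons uv(1) s_chain_cons k)
  moreover have "chain_cons v (\<lambda>_. 0) \<in> chains (length (x # \<theta>s)) (i - 1)"
    using uv by (simp add: chain_cons_in_chains_iff)
  ultimately show "\<exists>b\<in>chains (length (x # \<theta>s)) (i - 1). kos (x # \<theta>s) b = (\<lambda>l. x \<star> c l)" by blast
qed

text \<open>With \<open>bounding_mult\<close> this makes the operators that kill the homology in
  degree \<open>i\<close> an ideal. Nilpotency on homology then becomes a congruence computation in
  the polynomial ring.\<close>

lemma bounding_add:
  assumes "bounding y \<theta>s i" "bounding z \<theta>s i" shows "bounding (y + z) \<theta>s i"
  unfolding bounding_def
proof (intro ballI impI)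
  fix c assume c: "c \<in> chains (length \<theta>s) i" "kos \<theta>s c = (\<lambda>_. 0)"
  obtain b b' where "b \<in> chains (length \<theta>s) (i - 1)" "kos \<theta>s b = (\<lambda>l. y \<star> c l)"
    "b' \<in> chains (length \<theta>s) (i - 1)" "kos \<theta>s b' = (\<lambda>l. z \<star> c l)"
    using assms c unfolding bounding_def by blast
  then show "\<exists>b\<in>chains (length \<theta>s) (i - 1). kos \<theta>s b = (\<lambda>l. (y + z) \<star> c l)"
    by (intro bexI[of _ "\<lambda>l. b l + b' l"]) (auto simp: kos_add s_add_left chains_add)
qed

lemma bounding_mult:
  assumes "bounding y \<theta>s i" shows "bounding (z * y) \<theta>s i"
  unfolding bounding_def
proof (intro ballI impI)
  fix c assume c: "c \<in> chains (length \<theta>s) i" "kos \<theta>s c = (\<lambda>_. 0)"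
  obtain b where "b \<in> chains (length \<theta>s) (i - 1)" "kos \<theta>s b = (\<lambda>l. y \<star> c l)"
    using assms c unfolding bounding_def by blast
  then show "\<exists>b\<in>chains (length \<theta>s) (i - 1). kos \<theta>s b = (\<lambda>l. (z * y) \<star> c l)"
    by (intro bexI[of _ "\<lambda>l. z \<star> b l"]) (auto simp: kos_s s_mult chains_s)
qed

lemma bounding_annihilator: "(\<And>u. u \<in> V \<Longrightarrow> y \<star> u = 0) \<Longrightarrow> bounding y \<theta>s i"
  unfolding bounding_def by (intro ballI impI bexI[of _ "\<lambda>_. 0"]) (auto simp: chains_def)

text \<open>Isomorphism of Koszul complexes, reduced to what carries \<open>bounding\<close> from
  \<open>\<theta>s\<close> to \<open>\<theta>s'\<close>: maps compatible with degree, scalars,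
  differences and \<open>kos\<close>, with \<open>\<Phi>\<close> inverting \<open>\<Psi>\<close> on
  chains. It serves to show that the order of the operators does not matter.\<close>

definition kos_iso :: "'a list \<Rightarrow> 'a list \<Rightarrow> bool" where
  "kos_iso \<theta>s \<theta>s' \<longleftrightarrow> length \<theta>s = length \<theta>s' \<and> (\<exists>\<Phi> \<Psi>.
     (\<forall>c i. c \<in> chains (length \<theta>s) i \<longrightarrow> \<Phi> c \<in> chains (length \<theta>s) i \<and> \<Psi> c \<in> chains (length \<theta>s) i \<and>
        kos \<theta>s' (\<Phi> c) = \<Phi> (kos \<theta>s c) \<and> kos \<theta>s (\<Psi> c) = \<Psi> (kos \<theta>s' c) \<and> \<Phi> (\<Psi> c) = c) \<and>
     (\<forall>y c. \<Phi> (\<lambda>l. y \<star> c l) = (\<lambda>l. y \<star> \<Phi> c l) \<and> \<Psi> (\<lambda>l. y \<star> c l) = (\<lambda>l. y \<star> \<Psi> c l)) \<and>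
     (\<forall>c d. \<Phi> (\<lambda>l. c l - d l) = (\<lambda>l. \<Phi> c l - \<Phi> d l) \<and> \<Psi> (\<lambda>l. c l - d l) = (\<lambda>l. \<Psi> c l - \<Psi> d l)))"

lemma kos_isoI:
  fixes \<Phi> \<Psi> :: "(bool list \<Rightarrow> 'b) \<Rightarrow> bool list \<Rightarrow> 'b"
  assumes "length \<theta>s = length \<theta>s'"
    and "\<And>c i. c \<in> chains (length \<theta>s) i \<Longrightarrow> \<Phi> c \<in> chains (length \<theta>s) i"
    and "\<And>c i. c \<in> chains (length \<theta>s) i \<Longrightarrow> \<Psi> c \<in> chains (length \<theta>s) i"
    and "\<And>c i. c \<in> chains (length \<theta>s) i \<Longrightarrow> kos \<theta>s' (\<Phi> c) = \<Phi> (kos \<theta>s c)"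
    and "\<And>c i. c \<in> chains (length \<theta>s) i \<Longrightarrow> kos \<theta>s (\<Psi> c) = \<Psi> (kos \<theta>s' c)"
    and "\<And>c i. c \<in> chains (length \<theta>s) i \<Longrightarrow> \<Phi> (\<Psi> c) = c"
    and "\<And>y c. \<Phi> (\<lambda>l. y \<star> c l) = (\<lambda>l. y \<star> \<Phi> c l)" "\<And>y c. \<Psi> (\<lambda>l. y \<star> c l) = (\<lambda>l. y \<star> \<Psi> c l)"
    and "\<And>c d. \<Phi> (\<lambda>l. c l - d l) = (\<lambda>l. \<Phi> c l - \<Phi> d l)"
    and "\<And>c d. \<Psi> (\<lambda>l. c l - d l) = (\<lambda>l. \<Psi> c l - \<Psi> d l)"
  shows "kos_iso \<theta>s \<theta>s'"
  unfolding kos_iso_def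
  by (rule conjI[OF assms(1)], rule exI[of _ \<Phi>], rule exI[of _ \<Psi>]) (use assms in blast)

lemma kos_iso_bounding:
  assumes "kos_iso \<theta>s \<theta>s'" "bounding y \<theta>s i" shows "bounding y \<theta>s' i"
proof -
  obtain \<Phi> \<Psi> where len: "length \<theta>s = length \<theta>s'" and ch: "\<And>c i. c \<in> chains (length \<theta>s) i \<Longrightarrow>
      \<Phi> c \<in> chains (length \<theta>s) i \<and> \<Psi> c \<in> chains (length \<theta>s) i \<and>
      kos \<theta>s' (\<Phi> c) = \<Phi> (kos \<theta>s c) \<and> kos \<theta>s (\<Psi> c) = \<Psi> (kos \<theta>s' c) \<and> \<Phi> (\<Psi> c) = c"
    and sc: "\<And>y c. \<Phi> (\<lambda>l. y \<star> c l) = (\<lambda>l. y \<star> \<Phi> c l)"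
    and di: "\<And>c d. \<Psi> (\<lambda>l. c l - d l) = (\<lambda>l. \<Psi> c l - \<Psi> d l)"
    using assms(1) unfolding kos_iso_def by blast
  have z: "\<Psi> (\<lambda>_. 0) = (\<lambda>_. 0)" using di[of "\<lambda>_. 0" "\<lambda>_. 0"] by simp
  show ?thesis
    unfolding bounding_def len[symmetric]
  proof (intro ballI impI)
    fix c assume c: "c \<in> chains (length \<theta>s) i" "kos \<theta>s' c = (\<lambda>_. 0)"
    have "kos \<theta>s (\<Psi> c) = (\<lambda>_. 0)" "\<Psi> c \<in> chains (length \<theta>s) i" using ch[OF c(1)] c(2) z by simp_all
    then obtain b where b: "b \<in> chains (length \<theta>s) (i - 1)" "kos \<theta>s b = (\<lambda>l. y \<star> \<Psi> c l)"
      using assms(2) unfolding bounding_def by blast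
    have "kos \<theta>s' (\<Phi> b) = (\<lambda>l. y \<star> c l)" using ch[OF b(1)] ch[OF c(1)] b(2) sc by simp
    then show "\<exists>b\<in>chains (length \<theta>s) (i - 1). kos \<theta>s' b = (\<lambda>l. y \<star> c l)" using ch[OF b(1)] by blast
  qed
qed

lemma kos_iso_refl: "kos_iso \<theta>s \<theta>s"
  by (rule kos_isoI[of _ _ id id]) simp_all

lemma kos_iso_trans:
  assumes "kos_iso \<theta>s \<theta>s'" "kos_iso \<theta>s' \<theta>s''" shows "kos_iso \<theta>s \<theta>s''"
proof -
  obtain \<Phi> \<Psi> where 1: "length \<theta>s = length \<theta>s'" "\<And>c i. c \<in> chains (length \<theta>s) i \<Longrightarrow>
      \<Phi> c \<in> chains (length \<theta>s) i \<and> \<Psi> c \<in> chains (length \<theta>s) i \<and>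
      kos \<theta>s' (\<Phi> c) = \<Phi> (kos \<theta>s c) \<and> kos \<theta>s (\<Psi> c) = \<Psi> (kos \<theta>s' c) \<and> \<Phi> (\<Psi> c) = c"
    "\<And>y c. \<Phi> (\<lambda>l. y \<star> c l) = (\<lambda>l. y \<star> \<Phi> c l)" "\<And>y c. \<Psi> (\<lambda>l. y \<star> c l) = (\<lambda>l. y \<star> \<Psi> c l)"
    "\<And>c d. \<Phi> (\<lambda>l. c l - d l) = (\<lambda>l. \<Phi> c l - \<Phi> d l)" "\<And>c d. \<Psi> (\<lambda>l. c l - d l) = (\<lambda>l. \<Psi> c l - \<Psi> d l)"
    using assms(1) unfolding kos_iso_def by blast
  obtain \<Phi>' \<Psi>' where 2: "length \<theta>s' = length \<theta>s''" "\<And>c i. c \<in> chains (length \<theta>s') i \<Longrightarrow>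
      \<Phi>' c \<in> chains (length \<theta>s') i \<and> \<Psi>' c \<in> chains (length \<theta>s') i \<and>
      kos \<theta>s'' (\<Phi>' c) = \<Phi>' (kos \<theta>s' c) \<and> kos \<theta>s' (\<Psi>' c) = \<Psi>' (kos \<theta>s'' c) \<and> \<Phi>' (\<Psi>' c) = c"
    "\<And>y c. \<Phi>' (\<lambda>l. y \<star> c l) = (\<lambda>l. y \<star> \<Phi>' c l)" "\<And>y c. \<Psi>' (\<lambda>l. y \<star> c l) = (\<lambda>l. y \<star> \<Psi>' c l)"
    "\<And>c d. \<Phi>' (\<lambda>l. c l - d l) = (\<lambda>l. \<Phi>' c l - \<Phi>' d l)" "\<And>c d. \<Psi>' (\<lambda>l. c l - d l) = (\<lambda>l. \<Psi>' c l - \<Psi>' d l)"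
    using assms(2) unfolding kos_iso_def by blast
  show ?thesis
  proof (rule kos_isoI[of _ _ "\<lambda>c. \<Phi>' (\<Phi> c)" "\<lambda>c. \<Psi> (\<Psi>' c)"])
    fix c i assume c: "c \<in> chains (length \<theta>s) i"
    have c': "c \<in> chains (length \<theta>s') i" using c 1(1) by simp
    have a: "\<Phi> c \<in> chains (length \<theta>s') i" "\<Psi>' c \<in> chains (length \<theta>s) i"
      using 1(2)[OF c] 2(2)[OF c'] 1(1) by auto
    show "\<Phi>' (\<Phi> c) \<in> chains (length \<theta>s) i" "\<Psi> (\<Psi>' c) \<in> chains (length \<theta>s) i"
      using 2(2)[OF a(1)] 1(2)[OF a(2)] 1(1) by simp_all
    show "kos \<theta>s'' (\<Phi>' (\<Phi> c)) = \<Phi>' (\<Phi> (kos \<theta>s c))" using 2(2)[OF a(1)] 1(2)[OF c] by simp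
    show "kos \<theta>s (\<Psi> (\<Psi>' c)) = \<Psi> (\<Psi>' (kos \<theta>s'' c))" using 1(2)[OF a(2)] 2(2)[OF c'] by simp
    show "\<Phi>' (\<Phi> (\<Psi> (\<Psi>' c))) = c" using 1(2)[OF a(2)] 2(2)[OF c'] by simp
  qed (simp_all add: 1 2)
qed

lemma kos_iso_Cons:
  assumes "kos_iso \<theta>s \<theta>s'" shows "kos_iso (x # \<theta>s) (x # \<theta>s')"
proof -
  obtain \<Phi> \<Psi> where 1: "length \<theta>s = length \<theta>s'" "\<And>c i. c \<in> chains (length \<theta>s) i \<Longrightarrow>
      \<Phi> c \<in> chains (length \<theta>s) i \<and> \<Psi> c \<in> chains (length \<theta>s) i \<and>
      kos \<theta>s' (\<Phi> c) = \<Phi> (kos \<theta>s c) \<and> kos \<theta>s (\<Psi> c) = \<Psi> (kos \<theta>s' c) \<and> \<Phi> (\<Psi> c) = c"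
    "\<And>y c. \<Phi> (\<lambda>l. y \<star> c l) = (\<lambda>l. y \<star> \<Phi> c l)" "\<And>y c. \<Psi> (\<lambda>l. y \<star> c l) = (\<lambda>l. y \<star> \<Psi> c l)"
    "\<And>c d. \<Phi> (\<lambda>l. c l - d l) = (\<lambda>l. \<Phi> c l - \<Phi> d l)" "\<And>c d. \<Psi> (\<lambda>l. c l - d l) = (\<lambda>l. \<Psi> c l - \<Psi> d l)"
    using assms(1) unfolding kos_iso_def by blast
  define F where "F \<Phi> c = chain_cons (\<Phi> (\<lambda>l. c (False # l))) (\<Phi> (\<lambda>l. c (True # l)))"
    for \<Phi> :: "(bool list \<Rightarrow> 'b) \<Rightarrow> bool list \<Rightarrow> 'b" and c
  have F: "F \<Phi> (chain_cons a b) = chain_cons (\<Phi> a) (\<Phi> b)" for \<Phi> a b by (simp add: F_def)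
  show ?thesis
  proof (rule kos_isoI[of _ _ "F \<Phi>" "F \<Psi>"])
    fix c i assume "c \<in> chains (length (x # \<theta>s)) i"
    then obtain a b where ab: "c = chain_cons a b" "a \<in> chains (length \<theta>s) i" "b \<in> chains (length \<theta>s) (i - 1)"
      by (auto elim: chains_Suc_E)
    show "F \<Phi> c \<in> chains (length (x # \<theta>s)) i" "F \<Psi> c \<in> chains (length (x # \<theta>s)) i"
      using 1(2)[OF ab(2)] 1(2)[OF ab(3)] by (simp_all add: ab(1) F chain_cons_in_chains_iff)
    show "kos (x # \<theta>s') (F \<Phi> c) = F \<Phi> (kos (x # \<theta>s) c)" "kos (x # \<theta>s) (F \<Psi> c) = F \<Psi> (kos (x # \<theta>s') c)"
      "F \<Phi> (F \<Psi> c) = c"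
      using 1(2)[OF ab(2)] 1(2)[OF ab(3)] by (simp_all add: ab(1) F kos_chain_cons 1(3-6))
  qed (simp_all add: 1 F_def fun_eq_iff chain_cons_def s_diff split: list.split)
qed

text \<open>Exchanging the first two basis vectors reverses their wedge product, hence the sign on
  the component with both leading entries \<open>True\<close>.\<close>

lemma kos_iso_swap: "kos_iso (x # y # \<theta>s) (y # x # \<theta>s)"
proof -
  define \<Phi> where "\<Phi> c = chain_cons (chain_cons (\<lambda>l. c (False # False # l)) (\<lambda>l. c (True # False # l)))
      (chain_cons (\<lambda>l. c (False # True # l)) (\<lambda>l. - c (True # True # l)))" for c :: "bool list \<Rightarrow> 'b"
  have \<Phi>: "\<Phi> (chain_cons (chain_cons a b) (chain_cons c d)) =
      chain_cons (chain_cons a c) (chain_cons b (\<lambda>l. - d l))" for a b c d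
    by (simp add: \<Phi>_def)
  have neg: "kos \<theta>s (\<lambda>l. - c l) = (\<lambda>l. - kos \<theta>s c l)" for c
    using kos_diff[of \<theta>s "\<lambda>_. 0" c] by simp
  have cneg: "c \<in> chains n i \<Longrightarrow> (\<lambda>l. - c l) \<in> chains n i" for c n i
    using chains_diff[of "\<lambda>_. 0" n i c] by simp
  have kk: "kos (x # y # \<theta>s) (chain_cons (chain_cons a b) (chain_cons c d)) =
     chain_cons (chain_cons (kos \<theta>s a) (\<lambda>l. y \<star> a l - kos \<theta>s b l))
       (chain_cons (\<lambda>l. x \<star> a l - kos \<theta>s c l) (\<lambda>l. x \<star> b l - (y \<star> c l - kos \<theta>s d l)))" for x y a b c d
    by (simp add: kos_chain_cons s_chain_cons_diff)
  show ?thesis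
  proof (rule kos_isoI[of _ _ \<Phi> \<Phi>])
    fix c i assume "c \<in> chains (length (x # y # \<theta>s)) i"
    then obtain a b where ab: "c = chain_cons a b" "a \<in> chains (Suc (length \<theta>s)) i" "b \<in> chains (Suc (length \<theta>s)) (i - 1)"
      by (auto elim: chains_Suc_E)
    obtain a1 a2 where a: "a = chain_cons a1 a2" "a1 \<in> chains (length \<theta>s) i" "a2 \<in> chains (length \<theta>s) (i - 1)"
      using ab(2) by (auto elim: chains_Suc_E)
    obtain b1 b2 where b: "b = chain_cons b1 b2" "b1 \<in> chains (length \<theta>s) (i - 1)" "b2 \<in> chains (length \<theta>s) (i - 1 - 1)"
      using ab(3) by (auto elim: chains_Suc_E)
    show "\<Phi> c \<in> chains (length (x # y # \<theta>s)) i" "\<Phi> c \<in> chains (length (x # y # \<theta>s)) i"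
      using a b cneg by (simp_all add: ab(1) \<Phi> chain_cons_in_chains_iff)
    show "kos (y # x # \<theta>s) (\<Phi> c) = \<Phi> (kos (x # y # \<theta>s) c)" "kos (x # y # \<theta>s) (\<Phi> c) = \<Phi> (kos (y # x # \<theta>s) c)"
      "\<Phi> (\<Phi> c) = c"
      by (simp_all add: ab(1) a(1) b(1) kk \<Phi> neg chain_cons_eq_iff algebra_simps)
  qed (auto simp: \<Phi>_def fun_eq_iff chain_cons_def s_diff s_minus split: list.split)
qed

lemma kos_iso_move: "kos_iso (x # as @ bs) (as @ x # bs)"
proof (induction as)
  case (Cons a as)
  have "kos_iso (x # a # as @ bs) (a # x # as @ bs)" by (rule kos_iso_swap)
  moreover have "kos_iso (a # x # as @ bs) (a # as @ x # bs)" by (rule kos_iso_Cons[OF Cons])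
  ultimately show ?case using kos_iso_trans by auto
qed (simp add: kos_iso_refl)

lemma kos_iso_mset: "mset \<theta>s = mset \<theta>s' \<Longrightarrow> kos_iso \<theta>s \<theta>s'"
proof (induction \<theta>s arbitrary: \<theta>s')
  case (Cons x \<theta>s)
  then have "x \<in> set \<theta>s'" by (metis list.set_intros(1) mset_eq_setD)
  then obtain as bs where e: "\<theta>s' = as @ x # bs" by (meson split_list)
  then have "mset \<theta>s = mset (as @ bs)" using Cons.prems by simp
  then have "kos_iso (x # \<theta>s) (x # as @ bs)" by (intro kos_iso_Cons Cons.IH)
  then show ?case using kos_iso_move kos_iso_trans e by blast
qed (simp add: kos_iso_refl)

lemma bounding_mset: "mset \<theta>s = mset \<theta>s' \<Longrightarrow> bounding y \<theta>s i \<Longrightarrow> bounding y \<theta>s' i"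
  using kos_iso_bounding kos_iso_mset by blast

lemma bounding_member: assumes "y \<in> set \<theta>s" shows "bounding y \<theta>s i"
proof -
  obtain as bs where "\<theta>s = as @ y # bs" using assms by (meson split_list)
  then show ?thesis using bounding_mset[of "y # as @ bs" \<theta>s y i] bounding_head by simp
qed

text \<open>Two systems of parameters: compare the top degrees of the Koszul homology of the
  concatenation computed in both ways.\<close>

theorem exact_exchange:
  assumes reg: "\<And>i. i \<ge> 1 \<Longrightarrow> exact xs i" and len: "length \<theta>s = length xs"
    and nil: "\<And>x us i. x \<in> set xs \<Longrightarrow> set \<theta>s \<subseteq> set us \<Longrightarrow> \<exists>e. bounding (x ^ e) us i"
  shows "i \<ge> 1 \<Longrightarrow> exact \<theta>s i"
proof (rule ccontr)
  assume i: "i \<ge> 1" "\<not> exact \<theta>s i"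
  \<comment> \<open>Each operator from \<open>xs\<close> is nilpotent on the homology of any list
    that contains \<open>\<theta>s\<close>, so by \<open>not_exact_Cons\<close> it carries the
    nonvanishing homology up one degree.\<close>
  have "\<not> exact (us @ \<theta>s) (i + int (length us))" if "set us \<subseteq> set xs" for us
    using that
  proof (induction us)
    case (Cons u us)
    obtain e where "bounding (u ^ e) (us @ \<theta>s) (i + int (length us))"
      using nil[of u "us @ \<theta>s"] Cons.prems by auto
    from not_exact_Cons[OF Cons.IH this] show ?case using Cons.prems by (simp add: algebra_simps)
  qed (use i in simp)
  then have "\<not> exact (xs @ \<theta>s) (i + int (length xs))" by simp
  \<comment> \<open>Seen from the other side, the homology of \<open>xs\<close> ends in degree 0,
    and adding \<open>length xs\<close> operators cannot raise it to degree i + length xs because i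
    is positive.\<close>
  moreover have "exact (\<theta>s @ xs) (i + int (length xs))"
    by (rule exact_append[of 0]) (use reg len i in auto)
  ultimately show False using bounding_mset[of "\<theta>s @ xs" "xs @ \<theta>s"] by simp
qed

end

section \<open>Families of functions on monomials and their Hilbert series\<close>

type_synonym 'v fam = "nat \<Rightarrow> 'v multiset \<Rightarrow> real"

definition fam_scale :: "real \<Rightarrow> 'v fam \<Rightarrow> 'v fam" where
  "fam_scale c q = (\<lambda>j \<alpha>. c * q j \<alpha>)"

interpretation fam: vector_space fam_scale
  by unfold_locales (auto simp: fam_scale_def fun_eq_iff algebra_simps)

interpretation fam_fam: vector_space_pair fam_scale fam_scale ..

interpretation fam_real: vector_space_pair fam_scale "(*) :: real \<Rightarrow> real \<Rightarrow> real" ..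

lemma fam_linearI:
  assumes "\<And>q q'. f (\<lambda>j \<alpha>. q j \<alpha> + q' j \<alpha>) = (\<lambda>j \<alpha>. f q j \<alpha> + f q' j \<alpha>)"
    and "\<And>c q. f (\<lambda>j \<alpha>. c * q j \<alpha>) = (\<lambda>j \<alpha>. c * f q j \<alpha>)"
  shows "Vector_Spaces.linear fam_scale fam_scale f"
  by unfold_locales (simp_all add: plus_fun_def fam_scale_def assms)

lemma fam_real_linearI:
  assumes "\<And>q q'. f (\<lambda>j \<alpha>. q j \<alpha> + q' j \<alpha>) = f q + f q'"
    and "\<And>c q. f (\<lambda>j \<alpha>. c * q j \<alpha>) = c * f q"
  shows "Vector_Spaces.linear fam_scale (*) f"
  by unfold_locales (simp_all add: plus_fun_def fam_scale_def assms)

lemma fam_subspaceI: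
  assumes "(\<lambda>j \<alpha>. 0) \<in> S" "\<And>q q'. q \<in> S \<Longrightarrow> q' \<in> S \<Longrightarrow> (\<lambda>j \<alpha>. q j \<alpha> + q' j \<alpha>) \<in> S"
    and "\<And>c q. q \<in> S \<Longrightarrow> (\<lambda>j \<alpha>. c * q j \<alpha>) \<in> S"
  shows "fam.subspace S"
  using assms unfolding fam.subspace_def by (simp add: plus_fun_def fam_scale_def zero_fun_def)

lemma linear_vdiff: "Vector_Spaces.linear fam_scale fam_scale (vdiff P)"
  by (rule fam_linearI) (simp_all add: vdiff_def pdiff_add_right pdiff_scale)

lemma dim_real_UNIV: "vector_space_over_itself.dim (UNIV :: real set) = 1"
  by (simp add: vector_space_over_itself.dim_UNIV dimension_eq_1)

lemma dim_real_le: "vector_space_over_itself.dim (S :: real set) \<le> 1"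
  using vector_space_over_itself.dim_subset[of S UNIV] dim_real_UNIV by simp

definition supported :: "(nat \<times> 'v multiset) set \<Rightarrow> 'v fam set" where
  "supported T = {q. \<forall>j \<alpha>. q j \<alpha> \<noteq> 0 \<longrightarrow> (j, \<alpha>) \<in> T}"

lemma fam_subspace_support: "fam.subspace {q. \<forall>j \<alpha>. q j \<alpha> \<noteq> 0 \<longrightarrow> P j \<alpha>}" (is "fam.subspace ?S")
proof (rule fam_subspaceI)
  fix q q' assume q: "q \<in> ?S" "q' \<in> ?S"
  have "P j \<alpha>" if "q j \<alpha> + q' j \<alpha> \<noteq> 0" for j \<alpha>
  proof -
    have "q j \<alpha> \<noteq> 0 \<or> q' j \<alpha> \<noteq> 0" using that by auto
    then show ?thesis using q by auto
  qed
  then show "(\<lambda>j \<alpha>. q j \<alpha> + q' j \<alpha>) \<in> ?S" by simp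
qed auto

lemma subspace_supported: "fam.subspace (supported T)"
  unfolding supported_def by (rule fam_subspace_support)

lemma fin_gen_supported: assumes "finite T" shows "fin_gen fam_scale (supported T)"
proof -
  define e :: "nat \<times> 'a multiset \<Rightarrow> 'a fam" where "e t = (\<lambda>j \<alpha>. if (j, \<alpha>) = t then 1 else 0)" for t
  have "q \<in> fam.span (e ` T)" if q: "q \<in> supported T" for q
  proof -
    have fs: "(\<Sum>t\<in>S. f t) j \<alpha> = (\<Sum>t\<in>S. f t j \<alpha>)" for S j \<alpha> and f :: "nat \<times> 'a multiset \<Rightarrow> 'a fam"
      by (induction S rule: infinite_finite_induct) auto
    have "q = (\<Sum>t\<in>T. fam_scale (q (fst t) (snd t)) (e t))"
    proof (intro ext)
      fix j \<alpha>
      have "(\<Sum>t\<in>T. fam_scale (q (fst t) (snd t)) (e t)) j \<alpha> = (\<Sum>t\<in>T. if t = (j, \<alpha>) then q j \<alpha> else 0)"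
        unfolding fs by (intro sum.cong) (auto simp: fam_scale_def e_def)
      also have "\<dots> = q j \<alpha>" using assms q by (auto simp: supported_def)
      finally show "q j \<alpha> = (\<Sum>t\<in>T. fam_scale (q (fst t) (snd t)) (e t)) j \<alpha>" by simp
    qed
    also have "\<dots> \<in> fam.span (e ` T)"
      by (intro fam.span_sum fam.span_scale fam.span_base imageI)
    finally show ?thesis .
  qed
  then show ?thesis using assms unfolding fin_gen_def by (intro exI[of _ "e ` T"]) auto
qed

lemma dim_supported:
  fixes T :: "(nat \<times> 'a multiset) set"
  shows "finite T \<Longrightarrow> fam.dim (supported T) = card T"
proof (induction T rule: finite_induct)
  case empty
  have "supported {} = {0 :: 'a fam}" by (auto simp: supported_def fun_eq_iff)
  then show ?case using fam.dim_le_finite_span[of "{}" "{0}"] by simp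
next
  case (insert t T)
  let ?f = "\<lambda>q :: 'a fam. q (fst t) (snd t)"
  have lin: "Vector_Spaces.linear fam_scale (*) ?f" by (rule fam_real_linearI) auto
  have "?f ` supported (insert t T) = UNIV"
  proof -
    have "x \<in> ?f ` supported (insert t T)" for x
      by (rule image_eqI[of _ _ "\<lambda>j \<alpha>. if (j, \<alpha>) = t then x else 0"]) (auto simp: supported_def)
    then show ?thesis by blast
  qed
  moreover have "{q \<in> supported (insert t T). ?f q = 0} = supported T"
  proof (rule Set.set_eqI)
    fix q :: "'a fam"
    show "q \<in> {q \<in> supported (insert t T). ?f q = 0} \<longleftrightarrow> q \<in> supported T"
      using insert(2) unfolding supported_def mem_Collect_eq by (metis (no_types, lifting) fst_conv insert_iff prod.exhaust_sel snd_conv)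
  qed
  ultimately show ?case
    using fam_real.rank_nullity[OF lin subspace_supported fin_gen_supported, of "insert t T"] insert
    by (simp add: dim_real_UNIV)
qed

lemma dim_common_kernel:
  assumes V: "fam.subspace V" "fin_gen fam_scale V"
    and G: "finite G" "\<And>t. t \<in> G \<Longrightarrow> Vector_Spaces.linear fam_scale (*) (f t)"
  shows "fam.dim V \<le> fam.dim {q \<in> V. \<forall>t\<in>G. f t q = 0} + card G"
  using G
proof (induction G rule: finite_induct)
  case (insert t G)
  let ?K = "\<lambda>G. {q \<in> V. \<forall>t\<in>G. f t q = 0}"
  have sub: "fam.subspace (?K G)"
  proof (rule fam_subspaceI)
    have z: "f s (\<lambda>j \<alpha>. 0) = 0" "f s (\<lambda>j \<alpha>. c * q j \<alpha>) = c * f s q"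
      "f s (\<lambda>j \<alpha>. q j \<alpha> + q' j \<alpha>) = f s q + f s q'" if "s \<in> G" for s c q q'
    proof -
      interpret l: Vector_Spaces.linear fam_scale "(*)" "f s" using insert.prems[of s] that by simp
      show "f s (\<lambda>j \<alpha>. 0) = 0" "f s (\<lambda>j \<alpha>. c * q j \<alpha>) = c * f s q"
        "f s (\<lambda>j \<alpha>. q j \<alpha> + q' j \<alpha>) = f s q + f s q'"
        using l.zero l.scale[of c q] l.add[of q q'] by (simp_all add: plus_fun_def fam_scale_def zero_fun_def)
    qed
    have V': "(\<lambda>j \<alpha>. 0) \<in> V" "\<And>q q'. q \<in> V \<Longrightarrow> q' \<in> V \<Longrightarrow> (\<lambda>j \<alpha>. q j \<alpha> + q' j \<alpha>) \<in> V"
      "\<And>c q. q \<in> V \<Longrightarrow> (\<lambda>j \<alpha>. c * q j \<alpha>) \<in> V"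
      using V(1) unfolding fam.subspace_def by (auto simp: plus_fun_def fam_scale_def zero_fun_def)
    show "(\<lambda>j \<alpha>. 0) \<in> ?K G" using z V' by simp
    show "(\<lambda>j \<alpha>. q j \<alpha> + q' j \<alpha>) \<in> ?K G" if "q \<in> ?K G" "q' \<in> ?K G" for q q' using that z V' by simp
    show "(\<lambda>j \<alpha>. c * q j \<alpha>) \<in> ?K G" if "q \<in> ?K G" for c q using that z V' by simp
  qed
  have fg: "fin_gen fam_scale (?K G)" by (rule fam.fin_gen_mono[OF V(2)]) auto
  have "fam.dim (?K G) = fam.dim {q \<in> ?K G. f t q = 0} + vector_space_over_itself.dim (f t ` ?K G)"
    using insert.prems by (intro fam_real.rank_nullity sub fg) simp
  moreover have "{q \<in> ?K G. f t q = 0} = ?K (insert t G)" by auto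
  ultimately show ?case using insert dim_real_le[of "f t ` ?K G"] by simp
qed simp

definition wsize :: "('v \<Rightarrow> nat) \<Rightarrow> 'v multiset \<Rightarrow> nat" where
  "wsize w \<alpha> = (\<Sum>v\<in>#\<alpha>. w v)"

lemma wsize_simps [simp]:
  "wsize w {#} = 0" "wsize w (add_mset v \<alpha>) = w v + wsize w \<alpha>" "wsize w (\<alpha> + \<beta>) = wsize w \<alpha> + wsize w \<beta>"
  by (simp_all add: wsize_def)

lemma size_le_wsize: "(\<And>v. v \<in># \<alpha> \<Longrightarrow> w v \<ge> 1) \<Longrightarrow> size \<alpha> \<le> wsize w \<alpha>"
  by (induction \<alpha>) fastforce+

lemma finite_monomials:
  assumes "finite A" "\<And>v. v \<in> A \<Longrightarrow> w v \<ge> 1"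
  shows "finite {\<alpha>. set_mset \<alpha> \<subseteq> A \<and> wsize w \<alpha> = k}"
proof -
  have "{\<alpha>. set_mset \<alpha> \<subseteq> A \<and> wsize w \<alpha> = k} \<subseteq> mset ` {xs. set xs \<subseteq> A \<and> length xs \<le> k}"
  proof
    fix \<alpha> assume "\<alpha> \<in> {\<alpha>. set_mset \<alpha> \<subseteq> A \<and> wsize w \<alpha> = k}"
    then have a: "set_mset \<alpha> \<subseteq> A" "wsize w \<alpha> = k" by auto
    obtain xs where "mset xs = \<alpha>" using ex_mset by blast
    then show "\<alpha> \<in> mset ` {xs. set xs \<subseteq> A \<and> length xs \<le> k}"
      using a size_le_wsize[of \<alpha> w] assms(2) by (intro image_eqI[of _ _ xs]) (auto simp: subset_iff)
  qed
  then show ?thesis using finite_lists_length_le[OF assms(1)] by (meson finite_imageI finite_subset)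
qed

definition of_weight :: "('v \<Rightarrow> nat) \<Rightarrow> nat \<Rightarrow> 'v fam set" where
  "of_weight w k = {q. \<forall>j \<alpha>. q j \<alpha> \<noteq> 0 \<longrightarrow> wsize w \<alpha> = k}"

definition ambient :: "nat \<Rightarrow> 'v set \<Rightarrow> 'v fam set" where
  "ambient m A = {q. \<forall>j \<alpha>. q j \<alpha> \<noteq> 0 \<longrightarrow> j < m \<and> set_mset \<alpha> \<subseteq> A}"

lemma ambient_of_weight:
  "ambient m A \<inter> of_weight w k = supported ({..<m} \<times> {\<alpha>. set_mset \<alpha> \<subseteq> A \<and> wsize w \<alpha> = k})"
  unfolding ambient_def of_weight_def supported_def by blast

lemma subspace_of_weight: "fam.subspace (of_weight w k)"
  unfolding of_weight_def by (rule fam_subspace_support)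

lemma subspace_ambient: "fam.subspace (ambient m A)"
  unfolding ambient_def by (rule fam_subspace_support)

locale weighted =
  fixes w :: "'v \<Rightarrow> nat" and m :: nat and A :: "'v set"
  assumes finite_A: "finite A" and w_pos: "v \<in> A \<Longrightarrow> w v \<ge> 1"
begin

lemma fin_gen_weight: "V \<subseteq> ambient m A \<Longrightarrow> fin_gen fam_scale (V \<inter> of_weight w k)"
proof -
  assume "V \<subseteq> ambient m A"
  moreover have "fin_gen fam_scale (ambient m A \<inter> of_weight w k)"
    unfolding ambient_of_weight
    by (intro fin_gen_supported finite_cartesian_product finite_monomials finite_A w_pos) auto
  ultimately show ?thesis by (meson Int_mono fam.fin_gen_mono order_refl)
qed

end

section \<open>Hilbert series and their coefficientwise comparison\<close>

definition hilb :: "('v \<Rightarrow> nat) \<Rightarrow> 'v fam set \<Rightarrow> real fps" where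
  "hilb w V = Abs_fps (\<lambda>k. real (fam.dim (V \<inter> of_weight w k)))"

definition fps_le :: "real fps \<Rightarrow> real fps \<Rightarrow> bool" (infix \<open>\<sqsubseteq>\<close> 50) where
  "f \<sqsubseteq> g \<longleftrightarrow> (\<forall>k. fps_nth f k \<le> fps_nth g k)"

lemma fps_le_refl [simp]: "f \<sqsubseteq> f" by (simp add: fps_le_def)

lemma fps_le_trans [trans]: "f \<sqsubseteq> g \<Longrightarrow> g \<sqsubseteq> h \<Longrightarrow> f \<sqsubseteq> h"
  unfolding fps_le_def using order_trans by blast

lemma fps_le_antisym: "f \<sqsubseteq> g \<Longrightarrow> g \<sqsubseteq> f \<Longrightarrow> f = g"
  by (rule fps_ext) (auto simp: fps_le_def intro: antisym)

lemma fps_le_mult: "0 \<sqsubseteq> h \<Longrightarrow> f \<sqsubseteq> g \<Longrightarrow> h * f \<sqsubseteq> h * g"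
  unfolding fps_le_def by (auto simp: fps_mult_nth intro!: sum_mono mult_left_mono)

lemma fps_le_add: "f \<sqsubseteq> g \<Longrightarrow> f' \<sqsubseteq> g' \<Longrightarrow> f + f' \<sqsubseteq> g + g'"
  by (auto simp: fps_le_def intro: add_mono)

lemma fps_le_0_mult: "0 \<sqsubseteq> f \<Longrightarrow> 0 \<sqsubseteq> g \<Longrightarrow> 0 \<sqsubseteq> f * g"
  using fps_le_mult[of f 0 g] by simp

text \<open>For positive \<open>w\<close>, the expansion of 1 / (1 - X^w).\<close>

definition geo :: "nat \<Rightarrow> real fps" where
  "geo w = Abs_fps (\<lambda>k. if w dvd k then 1 else 0)"

lemma geo_nonneg: "0 \<sqsubseteq> geo w" by (simp add: fps_le_def geo_def)

lemma geo_mult: assumes "w \<ge> 1" shows "(1 - fps_X ^ w) * geo w = 1"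
proof (rule fps_ext)
  fix k
  have "w dvd k \<longleftrightarrow> w dvd k - w" if "k \<ge> w" using that by (metis dvd_minus_self not_less)
  then show "fps_nth ((1 - fps_X ^ w) * geo w) k = fps_nth 1 k"
    using assms by (auto simp: left_diff_distrib fps_X_power_mult_nth geo_def not_le dest: dvd_imp_le)
qed

text \<open>Multiplication by \<open>geo w\<close> preserves the order because its coefficients are
  nonnegative, and it cancels the factor 1 - X^w.\<close>

lemma fps_le_geo:
  assumes "w \<ge> 1" "f \<sqsubseteq> g + fps_X ^ w * f" shows "f \<sqsubseteq> geo w * g"
proof -
  have "(1 - fps_X ^ w) * f \<sqsubseteq> g"
    using assms(2) by (auto simp: fps_le_def left_diff_distrib algebra_simps)
  then have "geo w * ((1 - fps_X ^ w) * f) \<sqsubseteq> geo w * g" by (rule fps_le_mult[OF geo_nonneg])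
  then show ?thesis using geo_mult[OF assms(1)] by (simp add: mult.assoc[symmetric] mult.commute[of "geo w"])
qed

definition poly_of_weight :: "('v \<Rightarrow> nat) \<Rightarrow> nat \<Rightarrow> ('v multiset \<Rightarrow>\<^sub>0 'k::zero) \<Rightarrow> bool" where
  "poly_of_weight w d P \<longleftrightarrow> (\<forall>\<beta>\<in>Poly_Mapping.keys P. wsize w \<beta> = d)"

lemma pdiff_neq_0E:
  assumes "pdiff P u \<alpha> \<noteq> 0" obtains \<beta> where "\<beta> \<in> Poly_Mapping.keys P" "u (\<alpha> + \<beta>) \<noteq> 0"
  using assms unfolding pdiff_def by (metis (mono_tags, lifting) mult_zero_right sum.neutral)

lemma vdiff_of_weight:
  assumes "q \<in> of_weight w k" "poly_of_weight w d P"
  shows "k \<ge> d \<Longrightarrow> vdiff P q \<in> of_weight w (k - d)" "k < d \<Longrightarrow> vdiff P q = 0"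
proof -
  have *: "wsize w \<alpha> + d = k" if "vdiff P q j \<alpha> \<noteq> 0" for j \<alpha>
  proof -
    have "pdiff P (q j) \<alpha> \<noteq> 0" using that by (simp add: vdiff_def)
    then obtain \<beta> where "\<beta> \<in> Poly_Mapping.keys P" "q j (\<alpha> + \<beta>) \<noteq> 0"
      by (auto elim: pdiff_neq_0E)
    then have "wsize w (\<alpha> + \<beta>) = k" "wsize w \<beta> = d"
      using assms unfolding of_weight_def poly_of_weight_def by blast+
    then show ?thesis by simp
  qed
  then show "k \<ge> d \<Longrightarrow> vdiff P q \<in> of_weight w (k - d)" unfolding of_weight_def by fastforce
  show "vdiff P q = 0" if "k < d"
  proof (intro ext)
    fix j \<alpha> show "vdiff P q j \<alpha> = 0 j \<alpha>" using *[of j \<alpha>] that by auto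
  qed
qed

lemma vdiff_ambient: "q \<in> ambient m A \<Longrightarrow> vdiff P q \<in> ambient m A"
  unfolding ambient_def vdiff_def mem_Collect_eq
proof (intro allI impI)
  fix j \<alpha> assume q: "\<forall>j \<alpha>. q j \<alpha> \<noteq> 0 \<longrightarrow> j < m \<and> set_mset \<alpha> \<subseteq> A" and "pdiff P (q j) \<alpha> \<noteq> 0"
  then obtain \<beta> where "q j (\<alpha> + \<beta>) \<noteq> 0" by (auto elim: pdiff_neq_0E)
  then have "j < m \<and> set_mset (\<alpha> + \<beta>) \<subseteq> A" using q by blast
  then show "j < m \<and> set_mset \<alpha> \<subseteq> A" by simp
qed

context weighted
begin

lemma hilb_mono: "V \<subseteq> W \<Longrightarrow> W \<subseteq> ambient m A \<Longrightarrow> hilb w V \<sqsubseteq> hilb w W"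
  unfolding fps_le_def hilb_def fps_nth_Abs_fps of_nat_le_iff
  by (intro allI fam.dim_mono_fin_gen[OF fin_gen_weight] Int_mono) auto

lemma dim_weight_step:
  assumes V: "fam.subspace V" "V \<subseteq> ambient m A" and P: "poly_of_weight w d P"
  shows "fam.dim (V \<inter> of_weight w k) = fam.dim ({q \<in> V. vdiff P q = 0} \<inter> of_weight w k) +
    fam.dim (vdiff P ` (V \<inter> of_weight w k))"
proof -
  have "fam.dim (V \<inter> of_weight w k) = fam.dim {q \<in> V \<inter> of_weight w k. vdiff P q = 0} +
      fam.dim (vdiff P ` (V \<inter> of_weight w k))"
    by (intro fam_fam.rank_nullity linear_vdiff fam.subspace_inter V subspace_of_weight fin_gen_weight)
  moreover have "{q \<in> V \<inter> of_weight w k. vdiff P q = 0} = {q \<in> V. vdiff P q = 0} \<inter> of_weight w k" by auto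
  ultimately show ?thesis by simp
qed

lemma hilb_step:
  assumes V: "fam.subspace V" "V \<subseteq> ambient m A" and P: "poly_of_weight w d P"
    and W: "vdiff P ` V \<subseteq> W" "W \<subseteq> ambient m A"
  shows "hilb w V \<sqsubseteq> hilb w {q \<in> V. vdiff P q = 0} + fps_X ^ d * hilb w W"
  unfolding fps_le_def
proof
  fix k
  have "fam.dim (vdiff P ` (V \<inter> of_weight w k)) \<le> (if k < d then 0 else fam.dim (W \<inter> of_weight w (k - d)))"
  proof (cases "k < d")
    case True
    then have "vdiff P ` (V \<inter> of_weight w k) \<subseteq> {0}" using vdiff_of_weight(2)[OF _ P] by auto
    then show ?thesis using True fam.dim_le_finite_span[of "{}" "vdiff P ` (V \<inter> of_weight w k)"] by simp
  next
    case False
    have "vdiff P ` (V \<inter> of_weight w k) \<subseteq> W \<inter> of_weight w (k - d)"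
      using vdiff_of_weight(1)[OF _ P] W(1) False by auto
    then show ?thesis using False fam.dim_mono_fin_gen[OF fin_gen_weight[OF W(2)]] by simp
  qed
  then show "fps_nth (hilb w V) k \<le> fps_nth (hilb w {q \<in> V. vdiff P q = 0} + fps_X ^ d * hilb w W) k"
    using dim_weight_step[OF V P, of k] by (auto simp: hilb_def fps_X_power_mult_nth)
qed

text \<open>Equality in the estimate of \<open>hilb_step\<close> leaves no room for a cokernel in
  any weight.\<close>

lemma surj_of_hilb_eq:
  assumes V: "fam.subspace V" "V \<subseteq> ambient m A" and P: "poly_of_weight w d P"
    and W: "vdiff P ` V \<subseteq> W" "W \<subseteq> ambient m A" "fam.subspace W"
    and eq: "hilb w V = hilb w {q \<in> V. vdiff P q = 0} + fps_X ^ d * hilb w W"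
  shows "vdiff P ` (V \<inter> of_weight w (k + d)) = W \<inter> of_weight w k"
proof (rule fam.subspace_eq_of_dim)
  interpret l: Vector_Spaces.linear fam_scale fam_scale "vdiff P" by (rule linear_vdiff)
  show "fam.subspace (vdiff P ` (V \<inter> of_weight w (k + d)))"
    by (intro l.subspace_image fam.subspace_inter V subspace_of_weight)
  show "fin_gen fam_scale (W \<inter> of_weight w k)" by (rule fin_gen_weight[OF W(2)])
  show "vdiff P ` (V \<inter> of_weight w (k + d)) \<subseteq> W \<inter> of_weight w k"
    using vdiff_of_weight(1)[OF _ P, of _ "k + d"] W(1) by auto
  have "fps_nth (hilb w V) (k + d) = fps_nth (hilb w {q \<in> V. vdiff P q = 0}) (k + d) + fps_nth (hilb w W) k"
    by (subst eq) (simp add: fps_X_power_mult_nth)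
  then show "fam.dim (W \<inter> of_weight w k) \<le> fam.dim (vdiff P ` (V \<inter> of_weight w (k + d)))"
    using dim_weight_step[OF V P, of "k + d"] by (simp add: hilb_def)
qed

lemma hilb_of_surj:
  assumes V: "fam.subspace V" "V \<subseteq> ambient m A" and P: "poly_of_weight w d P"
    and surj: "\<And>k. vdiff P ` (V \<inter> of_weight w (k + d)) = V \<inter> of_weight w k"
  shows "hilb w V = hilb w {q \<in> V. vdiff P q = 0} + fps_X ^ d * hilb w V"
proof (rule fps_ext)
  fix k
  have "fam.dim (vdiff P ` (V \<inter> of_weight w k)) = (if k < d then 0 else fam.dim (V \<inter> of_weight w (k - d)))"
  proof (cases "k < d")
    case True
    then have "vdiff P ` (V \<inter> of_weight w k) \<subseteq> {0}" using vdiff_of_weight(2)[OF _ P] by auto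
    then show ?thesis using True fam.dim_le_finite_span[of "{}" "vdiff P ` (V \<inter> of_weight w k)"] by simp
  next
    case False
    then show ?thesis using surj[of "k - d"] by simp
  qed
  then show "fps_nth (hilb w V) k = fps_nth (hilb w {q \<in> V. vdiff P q = 0} + fps_X ^ d * hilb w V) k"
    using dim_weight_step[OF V P, of k] by (auto simp: hilb_def fps_X_power_mult_nth)
qed

end

section \<open>Inverse systems\<close>

lemma poly_of_weight_mult:
  "poly_of_weight w d P \<Longrightarrow> poly_of_weight w e Q \<Longrightarrow> poly_of_weight w (d + e) (P * Q)"
  using keys_mult[of P Q] by (fastforce simp: poly_of_weight_def)

lemma poly_of_weight_1: "poly_of_weight w 0 (1 :: 'v multiset \<Rightarrow>\<^sub>0 'k::comm_ring_1)"
  by (simp add: poly_of_weight_def)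

lemma poly_of_weight_power: "poly_of_weight w d (P :: 'v multiset \<Rightarrow>\<^sub>0 'k::comm_ring_1) \<Longrightarrow> poly_of_weight w (e * d) (P ^ e)"
  by (induction e) (auto simp: poly_of_weight_1 intro: poly_of_weight_mult)

lemma poly_of_weight_single: "wsize w \<beta> = d \<Longrightarrow> poly_of_weight w d (Poly_Mapping.single \<beta> c)"
  by (simp add: poly_of_weight_def)

definition pvar :: "'v \<Rightarrow> 'v multiset \<Rightarrow>\<^sub>0 'k::comm_ring_1" where
  "pvar v = Poly_Mapping.single {#v#} 1"

lemma vdiff_pvar: "vdiff (pvar v) q = (\<lambda>j \<alpha>. q j (add_mset v \<alpha>))"
  by (simp add: vdiff_def pvar_def pdiff_single fun_eq_iff)

lemma poly_of_weight_pvar: "poly_of_weight w (w v) (pvar v)"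
  by (simp add: pvar_def poly_of_weight_single)

text \<open>The inverse system of the module with \<open>m\<close> generators and relations \<open>F i\<close> for \<open>i < r\<close> over
  the polynomial ring in the variables \<open>A\<close>: shifting a family is dual to multiplying by a monomial.\<close>

definition sol :: "nat \<Rightarrow> nat \<Rightarrow> (nat \<Rightarrow> nat \<Rightarrow> 'v multiset \<Rightarrow>\<^sub>0 real) \<Rightarrow> 'v set \<Rightarrow> 'v fam set" where
  "sol m r F A = {q \<in> ambient m A. (\<forall>i<r. \<forall>\<alpha>. (\<Sum>j<m. pdiff (F i j) (q j) \<alpha>) = 0) \<and>
     (\<exists>B. \<forall>j \<alpha>. q j \<alpha> \<noteq> 0 \<longrightarrow> size \<alpha> \<le> B)}"

lemma sol_ambient: "sol m r F A \<subseteq> ambient m A"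
  by (auto simp: sol_def)

lemma subspace_sol: "fam.subspace (sol m r F A)"
proof (rule fam_subspaceI)
  have a: "fam.subspace (ambient m A)" by (rule subspace_ambient)
  show "(\<lambda>j \<alpha>. 0) \<in> sol m r F A" by (simp add: sol_def ambient_def)
  fix q assume q: "q \<in> sol m r F A"
  then obtain B where B: "\<And>j \<alpha>. q j \<alpha> \<noteq> 0 \<Longrightarrow> size \<alpha> \<le> B" by (auto simp: sol_def)
  show "(\<lambda>j \<alpha>. c * q j \<alpha>) \<in> sol m r F A" for c
    using q B fam.subspace_scale[OF a, of q c]
    by (auto simp: sol_def pdiff_scale sum_distrib_left[symmetric] fam_scale_def)
  fix q' assume q': "q' \<in> sol m r F A"
  then obtain B' where B': "\<And>j \<alpha>. q' j \<alpha> \<noteq> 0 \<Longrightarrow> size \<alpha> \<le> B'" by (auto simp: sol_def)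
  have "(\<lambda>j \<alpha>. q j \<alpha> + q' j \<alpha>) \<in> ambient m A"
    using fam.subspace_add[OF a, of q q'] q q' by (simp add: sol_def plus_fun_def)
  moreover have "\<forall>j \<alpha>. q j \<alpha> + q' j \<alpha> \<noteq> 0 \<longrightarrow> size \<alpha> \<le> max B B'"
  proof (intro allI impI)
    fix j \<alpha> assume "q j \<alpha> + q' j \<alpha> \<noteq> 0"
    then have "q j \<alpha> \<noteq> 0 \<or> q' j \<alpha> \<noteq> 0" by auto
    then show "size \<alpha> \<le> max B B'" using B[of j \<alpha>] B'[of j \<alpha>] by auto
  qed
  ultimately show "(\<lambda>j \<alpha>. q j \<alpha> + q' j \<alpha>) \<in> sol m r F A"
    using q q' by (auto simp: sol_def pdiff_add_right sum.distrib)
qed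

lemma vdiff_sol: assumes "q \<in> sol m r F A" shows "vdiff P q \<in> sol m r F A"
proof -
  from assms obtain B where B: "\<And>j \<alpha>. q j \<alpha> \<noteq> 0 \<Longrightarrow> size \<alpha> \<le> B" by (auto simp: sol_def)
  have "size \<alpha> \<le> B" if "vdiff P q j \<alpha> \<noteq> 0" for j \<alpha>
  proof -
    have "pdiff P (q j) \<alpha> \<noteq> 0" using that by (simp add: vdiff_def)
    then obtain \<beta> where "q j (\<alpha> + \<beta>) \<noteq> 0" by (auto elim: pdiff_neq_0E)
    then show ?thesis using B[of j "\<alpha> + \<beta>"] by simp
  qed
  moreover have "(\<Sum>j<m. pdiff (F i j) (vdiff P q j) \<alpha>) = 0" if "i < r" for i \<alpha>
  proof -
    have "(\<Sum>j<m. pdiff (F i j) (vdiff P q j) \<alpha>) = pdiff P (\<lambda>\<alpha>. \<Sum>j<m. pdiff (F i j) (q j) \<alpha>) \<alpha>"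
      unfolding pdiff_sum_right vdiff_def by (intro sum.cong refl fun_cong[OF pdiff_commute])
    also have "(\<lambda>\<alpha>. \<Sum>j<m. pdiff (F i j) (q j) \<alpha>) = (\<lambda>_. 0)" using assms that by (simp add: sol_def)
    finally show ?thesis by simp
  qed
  ultimately show ?thesis using assms vdiff_ambient[of q m A P] by (auto simp: sol_def)
qed

text \<open>Dual to setting the variable \<open>v\<close> to zero: a family is killed by the shift
  along \<open>v\<close> exactly if no monomial containing \<open>v\<close> occurs in its
  support.\<close>

lemma sol_kernel_pvar:
  assumes "v \<notin> A" shows "{q \<in> sol m r F (insert v A). vdiff (pvar v) q = 0} = sol m r F A"
proof (rule Set.set_eqI)
  fix q :: "'a fam"
  have 0: "v \<notin># \<alpha>" if z: "vdiff (pvar v) q = 0" "q j \<alpha> \<noteq> 0" for j \<alpha>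
  proof
    assume "v \<in># \<alpha>"
    then obtain \<beta> where "\<alpha> = add_mset v \<beta>" by (meson mset_add)
    then show False using fun_cong[OF fun_cong[OF z(1)], of j \<beta>] z(2) by (simp add: vdiff_pvar)
  qed
  have 1: "q \<in> ambient m A" if z: "vdiff (pvar v) q = 0" and q: "q \<in> ambient m (insert v A)"
    unfolding ambient_def mem_Collect_eq
  proof (intro allI impI)
    fix j \<alpha> assume n: "q j \<alpha> \<noteq> 0"
    then have "j < m \<and> set_mset \<alpha> \<subseteq> insert v A" using q unfolding ambient_def by blast
    moreover have "v \<notin># \<alpha>" by (rule 0[OF z n])
    ultimately show "j < m \<and> set_mset \<alpha> \<subseteq> A" by (simp add: subset_insert)
  qed
  have 2: "vdiff (pvar v) q = 0 \<and> q \<in> ambient m (insert v A)" if q: "q \<in> ambient m A"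
  proof
    show "vdiff (pvar v) q = 0"
    proof (intro ext)
      fix j \<alpha> show "vdiff (pvar v) q j \<alpha> = 0 j \<alpha>"
        using q assms by (force simp: vdiff_pvar ambient_def)
    qed
    show "q \<in> ambient m (insert v A)" using q unfolding ambient_def by blast
  qed
  show "q \<in> {q \<in> sol m r F (insert v A). vdiff (pvar v) q = 0} \<longleftrightarrow> q \<in> sol m r F A"
    using 1 2 unfolding sol_def by blast
qed

lemma sol_kernel_pvars:
  "set vs \<inter> A = {} \<Longrightarrow> {q \<in> sol m r F (A \<union> set vs). \<forall>\<theta>\<in>set (map pvar vs). vdiff \<theta> q = 0} = sol m r F A"
proof (induction vs arbitrary: A)
  case (Cons v vs)
  show ?case
  proof (cases "v \<in> set vs")
    case True
    then have e: "set (map (pvar :: 'a \<Rightarrow> 'a multiset \<Rightarrow>\<^sub>0 real) (v # vs)) = set (map pvar vs)"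
      "set (v # vs) = set vs" by auto
    show ?thesis unfolding e by (rule Cons.IH) (use Cons.prems in auto)
  next
    case False
    have "{q \<in> sol m r F (A \<union> set (v # vs)). \<forall>\<theta>\<in>set (map pvar (v # vs)). vdiff \<theta> q = 0} =
      {q \<in> {q \<in> sol m r F (insert v A \<union> set vs). \<forall>\<theta>\<in>set (map pvar vs). vdiff \<theta> q = 0}. vdiff (pvar v) q = 0}"
      by auto
    also have "\<dots> = {q \<in> sol m r F (insert v A). vdiff (pvar v) q = 0}"
      by (subst Cons.IH) (use Cons.prems False in auto)
    also have "\<dots> = sol m r F A" by (rule sol_kernel_pvar) (use Cons.prems in auto)
    finally show ?thesis .
  qed
qed simp

lemma hilb_sol_insert:
  assumes "finite A" "\<And>u. u \<in> insert v A \<Longrightarrow> w u \<ge> 1" "v \<notin> A"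
  shows "hilb w (sol m r F (insert v A)) \<sqsubseteq> hilb w (sol m r F A) + fps_X ^ w v * hilb w (sol m r F (insert v A))"
proof -
  interpret weighted w m "insert v A" by unfold_locales (use assms in auto)
  have "vdiff (pvar v) ` sol m r F (insert v A) \<subseteq> sol m r F (insert v A)" using vdiff_sol by blast
  from hilb_step[OF subspace_sol sol_ambient poly_of_weight_pvar this sol_ambient]
  show ?thesis unfolding sol_kernel_pvar[OF assms(3)] .
qed

abbreviation geos :: "('v \<Rightarrow> nat) \<Rightarrow> 'v list \<Rightarrow> real fps" where
  "geos w vs \<equiv> prod_list (map (\<lambda>v. geo (w v)) vs)"

lemma geos_nonneg: "0 \<sqsubseteq> geos w vs"
  by (induction vs) (auto simp: geo_nonneg fps_le_0_mult, simp add: fps_le_def)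

lemma geos_nonzero: "(\<And>v. v \<in> set vs \<Longrightarrow> w v \<ge> 1) \<Longrightarrow> geos w vs \<noteq> 0"
proof (induction vs)
  case (Cons v vs)
  have "geo (w v) \<noteq> 0" using geo_mult[of "w v"] Cons.prems[of v] by auto
  then show ?case using Cons by simp
qed simp

lemma hilb_sol_chain:
  assumes "finite A" "\<And>u. u \<in> A \<union> set vs \<Longrightarrow> w u \<ge> 1" "distinct vs" "set vs \<inter> A = {}"
  shows "hilb w (sol m r F (A \<union> set vs)) \<sqsubseteq> geos w vs * hilb w (sol m r F A)"
  using assms(2-)
proof (induction vs)
  case (Cons v vs)
  have "hilb w (sol m r F (insert v (A \<union> set vs))) \<sqsubseteq> geo (w v) * hilb w (sol m r F (A \<union> set vs))"
    by (intro fps_le_geo hilb_sol_insert) (use Cons.prems assms(1) in auto)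
  also have "\<dots> \<sqsubseteq> geo (w v) * (geos w vs * hilb w (sol m r F A))"
    by (intro fps_le_mult geo_nonneg Cons.IH) (use Cons.prems in auto)
  finally show ?case by (simp add: mult.assoc)
qed simp

text \<open>Each variable can multiply the series by at most its \<open>geo\<close>. If the product
  of all these bounds is attained, there is no slack at any single stage, and equality at a stage is
  surjectivity of its variable.\<close>

lemma hilb_sol_chain_eq:
  assumes fin: "finite A" "\<And>u. u \<in> A \<union> set (v # vs) \<Longrightarrow> w u \<ge> 1" "distinct (v # vs)" "set (v # vs) \<inter> A = {}"
    and eq: "hilb w (sol m r F (A \<union> set (v # vs))) = geos w (v # vs) * hilb w (sol m r F A)"
  shows "hilb w (sol m r F (A \<union> set vs)) = geos w vs * hilb w (sol m r F A)"
    and "vdiff (pvar v) ` (sol m r F (A \<union> set (v # vs)) \<inter> of_weight w (k + w v)) =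
      sol m r F (A \<union> set (v # vs)) \<inter> of_weight w k"
proof -
  let ?V = "sol m r F (insert v (A \<union> set vs))"
  interpret weighted w m "insert v (A \<union> set vs)" by unfold_locales (use fin in auto)
  have e: "hilb w ?V = geo (w v) * (geos w vs * hilb w (sol m r F A))" using eq by (simp add: mult.assoc)
  then have "(1 - fps_X ^ w v) * hilb w ?V = ((1 - fps_X ^ w v) * geo (w v)) * (geos w vs * hilb w (sol m r F A))"
    by (simp add: mult.assoc)
  moreover have "(1 - fps_X ^ w v) * geo (w v) = 1" by (rule geo_mult) (use fin(2)[of v] in simp)
  ultimately have "(1 - fps_X ^ w v) * hilb w ?V = geos w vs * hilb w (sol m r F A)" by simp
  then have e': "hilb w ?V = geos w vs * hilb w (sol m r F A) + fps_X ^ w v * hilb w ?V"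
    unfolding left_diff_distrib mult_1_left diff_eq_eq .
  have "hilb w ?V \<sqsubseteq> hilb w (sol m r F (A \<union> set vs)) + fps_X ^ w v * hilb w ?V"
    by (rule hilb_sol_insert) (use fin in auto)
  then have "geos w vs * hilb w (sol m r F A) \<sqsubseteq> hilb w (sol m r F (A \<union> set vs))"
    by (subst (asm) (1) e') (simp add: fps_le_def)
  moreover have "hilb w (sol m r F (A \<union> set vs)) \<sqsubseteq> geos w vs * hilb w (sol m r F A)"
    by (rule hilb_sol_chain) (use fin in auto)
  ultimately show 1: "hilb w (sol m r F (A \<union> set vs)) = geos w vs * hilb w (sol m r F A)"
    by (intro fps_le_antisym)
  have v: "v \<notin> A \<union> set vs" using fin by auto
  have "vdiff (pvar v) ` ?V \<subseteq> ?V" using vdiff_sol by blast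
  moreover have "hilb w ?V = hilb w {q \<in> ?V. vdiff (pvar v) q = 0} + fps_X ^ w v * hilb w ?V"
    unfolding sol_kernel_pvar[OF v] 1 by (rule e')
  ultimately have "vdiff (pvar v) ` (?V \<inter> of_weight w (k + w v)) = ?V \<inter> of_weight w k"
    by (intro surj_of_hilb_eq subspace_sol sol_ambient poly_of_weight_pvar)
  then show "vdiff (pvar v) ` (sol m r F (A \<union> set (v # vs)) \<inter> of_weight w (k + w v)) =
      sol m r F (A \<union> set (v # vs)) \<inter> of_weight w k" by simp
qed

lemma koszul_sol: "koszul vdiff (sol m r F A)"
proof
  show "0 \<in> sol m r F A" using subspace_sol fam.subspace_0 by blast
  show "u - v \<in> sol m r F A" if "u \<in> sol m r F A" "v \<in> sol m r F A" for u v
    using that fam.subspace_diff[OF subspace_sol] by blast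
qed (rule vdiff_add_right vdiff_add_left vdiff_mult vdiff_one vdiff_sol, assumption?)+

section \<open>Homogeneous components\<close>

definition component :: "nat \<Rightarrow> 'v fam \<Rightarrow> 'v fam" where
  "component k q = (\<lambda>j \<alpha>. if size \<alpha> = k then q j \<alpha> else 0)"

lemma wsize_size: "(\<And>v. v \<in># \<alpha> \<Longrightarrow> w v = 1) \<Longrightarrow> wsize w \<alpha> = size \<alpha>"
  by (induction \<alpha>) auto

lemma sum_components:
  assumes "\<And>j \<alpha>. q j \<alpha> \<noteq> 0 \<Longrightarrow> size \<alpha> \<le> B" shows "(\<Sum>k\<le>B. component k q) = q"
proof (intro ext)
  fix j \<alpha>
  have fs: "(\<Sum>k\<in>S. f k) j \<alpha> = (\<Sum>k\<in>S. f k j \<alpha>)" for S and f :: "nat \<Rightarrow> 'a fam"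
    by (induction S rule: infinite_finite_induct) auto
  show "(\<Sum>k\<le>B. component k q) j \<alpha> = q j \<alpha>"
    using assms[of j \<alpha>] by (auto simp: fs component_def)
qed

lemma vdiff_component:
  assumes "q \<in> ambient m A" "\<forall>v\<in>A. w v = 1" "poly_of_weight w d P"
  shows "vdiff P (component (k + d) q) = component k (vdiff P q)"
proof (intro ext)
  fix j \<alpha>
  have "Poly_Mapping.lookup P \<beta> * component (k + d) q j (\<alpha> + \<beta>) =
      (if size \<alpha> = k then Poly_Mapping.lookup P \<beta> * q j (\<alpha> + \<beta>) else 0)"
    if "\<beta> \<in> Poly_Mapping.keys P" for \<beta>
  proof (cases "q j (\<alpha> + \<beta>) = 0")
    case False
    then have "set_mset (\<alpha> + \<beta>) \<subseteq> A" using assms(1) unfolding ambient_def by blast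
    then have "wsize w \<beta> = size \<beta>" by (intro wsize_size bspec[OF assms(2)]) auto
    then have "size \<beta> = d" using that assms(3) by (auto simp: poly_of_weight_def)
    then show ?thesis by (simp add: component_def)
  qed (simp add: component_def)
  then show "vdiff P (component (k + d) q) j \<alpha> = component k (vdiff P q) j \<alpha>"
    by (simp add: vdiff_def pdiff_def component_def cong: sum.cong)
qed

lemma component_sol:
  assumes q: "q \<in> sol m r F A" and w: "\<forall>v\<in>A. w v = 1"
    and F: "\<And>i j. i < r \<Longrightarrow> j < m \<Longrightarrow> poly_of_weight w (d i) (F i j)"
  shows "component k q \<in> sol m r F A"
proof -
  have amb: "q \<in> ambient m A" using q by (simp add: sol_def)
  have "(\<Sum>j<m. pdiff (F i j) (component k q j) \<alpha>) = 0" if i: "i < r" for i \<alpha>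
  proof (cases "k \<ge> d i")
    case True
    have "pdiff (F i j) (component k q j) \<alpha> = (if size \<alpha> = k - d i then pdiff (F i j) (q j) \<alpha> else 0)"
      if "j < m" for j
      using fun_cong[OF fun_cong[OF vdiff_component[OF amb w F[OF i that], of "k - d i"]], of j \<alpha>] True
      by (simp add: vdiff_def component_def)
    then have "(\<Sum>j<m. pdiff (F i j) (component k q j) \<alpha>) =
        (if size \<alpha> = k - d i then \<Sum>j<m. pdiff (F i j) (q j) \<alpha> else 0)" by simp
    then show ?thesis using q i by (simp add: sol_def)
  next
    case False
    have "pdiff (F i j) (component k q j) \<alpha> = 0" if "j < m" for j
    proof (rule ccontr)
      assume "pdiff (F i j) (component k q j) \<alpha> \<noteq> 0"
      then obtain \<beta> where b: "\<beta> \<in> Poly_Mapping.keys (F i j)" "component k q j (\<alpha> + \<beta>) \<noteq> 0"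
        by (auto elim: pdiff_neq_0E)
      then have "q j (\<alpha> + \<beta>) \<noteq> 0" "size (\<alpha> + \<beta>) = k" by (auto simp: component_def split: if_splits)
      then have "set_mset (\<alpha> + \<beta>) \<subseteq> A" using amb unfolding ambient_def by blast
      then have "wsize w \<beta> = size \<beta>" by (intro wsize_size bspec[OF w]) auto
      then have "size \<beta> = d i" using F[OF i that] b(1) by (auto simp: poly_of_weight_def)
      then show False using False \<open>size (\<alpha> + \<beta>) = k\<close> by simp
    qed
    then show ?thesis by simp
  qed
  moreover have "\<exists>B. \<forall>j \<alpha>. component k q j \<alpha> \<noteq> 0 \<longrightarrow> size \<alpha> \<le> B"
    by (intro exI[of _ k]) (simp add: component_def)
  moreover have "component k q \<in> ambient m A" using amb by (auto simp: ambient_def component_def)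
  ultimately show ?thesis by (auto simp: sol_def)
qed

section \<open>Graded inverse systems and regular sequences\<close>

lemma ambient_wsize:
  assumes "q \<in> ambient m A" "\<forall>v\<in>A. w v = 1" "q j \<alpha> \<noteq> 0" shows "wsize w \<alpha> = size \<alpha>"
proof (rule wsize_size)
  fix v assume "v \<in># \<alpha>"
  then have "v \<in> A" using assms(1,3) unfolding ambient_def by blast
  then show "w v = 1" using assms(2) by blast
qed

lemma component_of_weight:
  assumes "q \<in> ambient m A" "\<forall>v\<in>A. w v = 1" shows "component k q \<in> of_weight w k"
  unfolding of_weight_def mem_Collect_eq
proof (intro allI impI)
  fix j \<alpha> assume "component k q j \<alpha> \<noteq> 0"
  then have "q j \<alpha> \<noteq> 0" "size \<alpha> = k" by (auto simp: component_def split: if_splits)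
  then show "wsize w \<alpha> = k" using ambient_wsize[OF assms] by simp
qed

lemma component_id:
  assumes "q \<in> ambient m A" "\<forall>v\<in>A. w v = 1" "q \<in> of_weight w k" shows "component k q = q"
proof (intro ext)
  fix j \<alpha> show "component k q j \<alpha> = q j \<alpha>"
    using ambient_wsize[OF assms(1,2), of j \<alpha>] assms(3) by (auto simp: component_def of_weight_def)
qed

text \<open>Bounded support makes \<open>u\<close> a finite sum of its components, and each of these
  has a preimage.\<close>

lemma surj_of_graded:
  assumes U: "fam.subspace U" "\<And>q k. q \<in> U \<Longrightarrow> component k q \<in> U" "U \<subseteq> ambient m A"
    and bd: "\<And>q. q \<in> U \<Longrightarrow> \<exists>B. \<forall>j \<alpha>. q j \<alpha> \<noteq> 0 \<longrightarrow> size \<alpha> \<le> B" and w: "\<forall>v\<in>A. w v = 1"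
    and surj: "\<And>k. vdiff P ` (U \<inter> of_weight w (k + d)) = U \<inter> of_weight w k"
    and u: "u \<in> U"
  shows "\<exists>v\<in>U. vdiff P v = u"
proof -
  interpret l: Vector_Spaces.linear fam_scale fam_scale "vdiff P" by (rule linear_vdiff)
  obtain B where B: "\<And>j \<alpha>. u j \<alpha> \<noteq> 0 \<Longrightarrow> size \<alpha> \<le> B" using bd[OF u] by blast
  have "\<exists>v\<in>U. vdiff P v = component k u" for k
  proof -
    have "component k u \<in> U \<inter> of_weight w k" using component_of_weight[OF _ w] U u by blast
    then show ?thesis using surj[of k] by force
  qed
  then obtain v where v: "\<And>k. v k \<in> U" "\<And>k. vdiff P (v k) = component k u" by metis
  have "vdiff P (\<Sum>k\<le>B. v k) = (\<Sum>k\<le>B. component k u)" unfolding l.sum v(2) ..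
  also have "\<dots> = u" by (rule sum_components[OF B])
  finally show ?thesis using fam.subspace_sum[OF U(1), of "{..B}" v] v(1) by blast
qed

lemma graded_of_surj:
  assumes U: "\<And>q k. q \<in> U \<Longrightarrow> component k q \<in> U" "U \<subseteq> ambient m A" "\<And>q. q \<in> U \<Longrightarrow> vdiff P q \<in> U"
    and w: "\<forall>v\<in>A. w v = 1" and P: "poly_of_weight w d P"
    and surj: "\<And>u. u \<in> U \<Longrightarrow> \<exists>v\<in>U. vdiff P v = u"
  shows "vdiff P ` (U \<inter> of_weight w (k + d)) = U \<inter> of_weight w k"
proof
  show "vdiff P ` (U \<inter> of_weight w (k + d)) \<subseteq> U \<inter> of_weight w k"
  proof
    fix x assume "x \<in> vdiff P ` (U \<inter> of_weight w (k + d))"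
    then obtain q where q: "q \<in> U" "q \<in> of_weight w (k + d)" "x = vdiff P q" by blast
    then show "x \<in> U \<inter> of_weight w k" using U(3)[OF q(1)] vdiff_of_weight(1)[OF q(2) P] by simp
  qed
  show "U \<inter> of_weight w k \<subseteq> vdiff P ` (U \<inter> of_weight w (k + d))"
  proof
    fix u assume u: "u \<in> U \<inter> of_weight w k"
    obtain v where v: "v \<in> U" "vdiff P v = u" using surj u by blast
    have amb: "v \<in> ambient m A" "u \<in> ambient m A" using v u U(2) by auto
    have "vdiff P (component (k + d) v) = component k u" using vdiff_component[OF amb(1) w P] v(2) by simp
    also have "\<dots> = u" using component_id[OF amb(2) w] u by blast
    finally have "u = vdiff P (component (k + d) v)" by simp
    moreover have "component (k + d) v \<in> U \<inter> of_weight w (k + d)"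
      using component_of_weight[OF amb(1) w] U(1)[OF v(1)] by blast
    ultimately show "u \<in> vdiff P ` (U \<inter> of_weight w (k + d))" by blast
  qed
qed

locale graded_sol = weighted w m A for w :: "'v \<Rightarrow> nat" and m A +
  fixes r :: nat and F :: "nat \<Rightarrow> nat \<Rightarrow> 'v multiset \<Rightarrow>\<^sub>0 real" and d :: "nat \<Rightarrow> nat"
  assumes w1: "v \<in> A \<Longrightarrow> w v = 1"
    and F: "i < r \<Longrightarrow> j < m \<Longrightarrow> poly_of_weight w (d i) (F i j)"
begin

lemma w1_all: "\<forall>v\<in>A. w v = 1" using w1 by blast

sublocale koszul vdiff "sol m r F A" by (rule koszul_sol)

lemma sol_bounded: "q \<in> sol m r F A' \<Longrightarrow> \<exists>B. \<forall>j \<alpha>. q j \<alpha> \<noteq> 0 \<longrightarrow> size \<alpha> \<le> B"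
  by (simp add: sol_def)

lemma surj_on_kernel_pvar:
  assumes A: "A = A' \<union> set rs" "set rs \<inter> A' = {}"
    and surj: "\<And>k. vdiff (pvar v) ` (sol m r F A' \<inter> of_weight w (k + w v)) = sol m r F A' \<inter> of_weight w k"
    and \<theta>s: "set \<theta>s = set (map pvar rs)"
  shows "surj_on_kernel (pvar v) \<theta>s"
  unfolding surj_on_kernel_def
proof (intro ballI impI)
  have ker: "{q \<in> sol m r F A. \<forall>\<theta>\<in>set \<theta>s. vdiff \<theta> q = 0} = sol m r F A'"
    unfolding A(1) \<theta>s by (rule sol_kernel_pvars[OF A(2)])
  fix u assume "u \<in> sol m r F A" "\<forall>\<theta>\<in>set \<theta>s. vdiff \<theta> u = 0"
  then have u: "u \<in> sol m r F A'" using ker by blast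
  have w1': "\<forall>v\<in>A'. w v = 1" using w1 A(1) by simp
  have "\<exists>v'\<in>sol m r F A'. vdiff (pvar v) v' = u"
    by (rule surj_of_graded[OF subspace_sol component_sol[OF _ w1' F] sol_ambient sol_bounded w1' surj u])
  then show "\<exists>v'\<in>sol m r F A. (\<forall>\<theta>\<in>set \<theta>s. vdiff \<theta> v' = 0) \<and> vdiff (pvar v) v' = u" using ker by blast
qed

text \<open>The dual of the Hilbert series criterion for regular sequences: the variables are
  regular as soon as adjoining them multiplies the series by the full product of the 1 / (1 -
  X^w).\<close>

lemma exact_pvars:
  assumes A: "A = A0 \<union> set vs" "distinct vs" "set vs \<inter> A0 = {}"
    and eq: "hilb w (sol m r F A) = geos w vs * hilb w (sol m r F A0)" and i: "i \<ge> 1"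
  shows "exact (rev (map pvar vs)) i"
proof -
  \<comment> \<open>Variables leave from the front of \<open>vs\<close>, while the Koszul complex
    grows at the head of its list; hence the reversal. The common kernel of the shifts along
    \<open>rs\<close> is the system in the variables that remain.\<close>
  have "hilb w (sol m r F (A0 \<union> set us)) = geos w us * hilb w (sol m r F A0) \<and>
      (\<forall>i\<ge>1. exact (rev (map pvar rs)) i)" if "vs = rs @ us" for rs us
    using that
  proof (induction rs arbitrary: us rule: rev_induct)
    case Nil
    then show ?case using eq A exact_large[of "[]"] by auto
  next
    case (snoc v rs)
    have vs: "vs = rs @ v # us" using snoc.prems by simp
    note IH = snoc.IH[OF vs]
    have fin: "finite A0" "\<And>u. u \<in> A0 \<union> set (v # us) \<Longrightarrow> w u \<ge> 1" "distinct (v # us)" "set (v # us) \<inter> A0 = {}"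
      using finite_A w_pos A vs by auto
    note chain = hilb_sol_chain_eq[OF fin conjunct1[OF IH]]
    have "surj_on_kernel (pvar v) (rev (map pvar rs))"
      by (rule surj_on_kernel_pvar[of "A0 \<union> set (v # us)" rs]) (use A vs chain(2) in auto)
    then have "\<forall>i\<ge>1. exact (pvar v # rev (map pvar rs)) i"
      using exact_Cons_of_surj IH by blast
    then show ?case using chain(1) by simp
  qed
  from this[of vs "[]"] show ?thesis using i by simp
qed

text \<open>This rests on the size bound in \<open>sol\<close>, which makes the solutions a direct
  sum of their graded pieces rather than a product.\<close>

lemma locally_nilpotent:
  assumes P: "poly_of_weight w 1 P" and u: "u \<in> sol m r F A" shows "\<exists>e. vdiff (P ^ e) u = 0"
proof -
  obtain B where B: "\<And>j \<alpha>. u j \<alpha> \<noteq> 0 \<Longrightarrow> size \<alpha> \<le> B" using sol_bounded[OF u] by blast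
  have "vdiff (P ^ Suc B) u = 0"
  proof (intro ext, rule ccontr)
    fix j \<alpha> assume "vdiff (P ^ Suc B) u j \<alpha> \<noteq> 0 j \<alpha>"
    then have "pdiff (P ^ Suc B) (u j) \<alpha> \<noteq> 0" by (simp add: vdiff_def)
    then obtain \<beta> where b: "\<beta> \<in> Poly_Mapping.keys (P ^ Suc B)" "u j (\<alpha> + \<beta>) \<noteq> 0"
      by (rule pdiff_neq_0E)
    have "wsize w \<beta> = Suc B" using poly_of_weight_power[OF P, of "Suc B"] b(1) by (simp add: poly_of_weight_def)
    moreover have "wsize w (\<alpha> + \<beta>) = size (\<alpha> + \<beta>)"
      using ambient_wsize[of u m A w j "\<alpha> + \<beta>"] w1_all b(2) u by (simp add: sol_def)
    ultimately show False using B[OF b(2)] by simp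
  qed
  then show ?thesis by blast
qed

text \<open>Each operator of \<open>as\<close> acts surjectively on the common kernel of those to
  its right, so passing to its own kernel multiplies the series by 1 - X.\<close>

lemma hilb_of_exact:
  assumes "\<And>i. i \<ge> 1 \<Longrightarrow> exact (as @ bs) i" "\<And>\<theta>. \<theta> \<in> set (as @ bs) \<Longrightarrow> poly_of_weight w 1 \<theta>"
  shows "(1 - fps_X) ^ length as * hilb w {q \<in> sol m r F A. \<forall>\<theta>\<in>set bs. vdiff \<theta> q = 0} =
    hilb w {q \<in> sol m r F A. \<forall>\<theta>\<in>set (as @ bs). vdiff \<theta> q = 0}"
  using assms
proof (induction as)
  case (Cons x as)
  let ?U = "{q \<in> sol m r F A. \<forall>\<theta>\<in>set (as @ bs). vdiff \<theta> q = 0}"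
  have x: "poly_of_weight w 1 x" and ab: "\<And>\<theta>. \<theta> \<in> set (as @ bs) \<Longrightarrow> poly_of_weight w 1 \<theta>"
    using Cons.prems(2) by auto
  have "\<And>i. i \<ge> 1 \<Longrightarrow> exact (x # (as @ bs)) i" using Cons.prems(1) by simp
  then have conv: "\<And>i. i \<ge> 1 \<Longrightarrow> exact (as @ bs) i" "surj_on_kernel x (as @ bs)"
    using exact_of_exact_Cons[of x "as @ bs"] locally_nilpotent[OF x] by blast+
  have sub: "fam.subspace ?U"
  proof -
    have "fam.subspace {q. vdiff \<theta> q = 0}" for \<theta> :: "'v multiset \<Rightarrow>\<^sub>0 real"
    proof -
      interpret l: Vector_Spaces.linear fam_scale fam_scale "vdiff \<theta>" by (rule linear_vdiff)
      show ?thesis by (rule l.subspace_kernel)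
    qed
    then have "fam.subspace (sol m r F A \<inter> (\<Inter>\<theta>\<in>set (as @ bs). {q. vdiff \<theta> q = 0}))"
      by (intro fam.subspace_inter subspace_sol fam.subspace_Inter) auto
    moreover have "?U = sol m r F A \<inter> (\<Inter>\<theta>\<in>set (as @ bs). {q. vdiff \<theta> q = 0})" by auto
    ultimately show ?thesis by simp
  qed
  have amb: "?U \<subseteq> ambient m A" using sol_ambient by blast
  have comp: "component k q \<in> ?U" if q: "q \<in> ?U" for q k
  proof -
    have qa: "q \<in> ambient m A" using q amb by blast
    have "vdiff \<theta> (component k q) = 0" if "\<theta> \<in> set (as @ bs)" for \<theta>
    proof (cases k)
      case 0
      show ?thesis
        by (rule vdiff_of_weight(2)[OF component_of_weight[OF qa w1_all] ab[OF that]]) (simp_all add: 0)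
    next
      case (Suc l)
      have "vdiff \<theta> (component (l + 1) q) = component l (vdiff \<theta> q)" by (rule vdiff_component[OF qa w1_all ab[OF that]])
      also have "vdiff \<theta> q = 0" using q that by blast
      also have "component l (0 :: 'v fam) = 0" by (simp add: component_def fun_eq_iff)
      finally show ?thesis using Suc by simp
    qed
    moreover have "component k q \<in> sol m r F A" by (rule component_sol[OF _ w1_all F]) (use q in auto)
    ultimately show ?thesis by blast
  qed
  have closed: "vdiff x q \<in> ?U" if q: "q \<in> ?U" for q
  proof -
    have "vdiff \<theta> (vdiff x q) = 0" if "\<theta> \<in> set (as @ bs)" for \<theta>
    proof -
      have "vdiff \<theta> q = 0" using q that by blast
      then show ?thesis by (simp only: s_commute[of \<theta>] s_0)
    qed
    then show ?thesis using q vdiff_sol by blast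
  qed
  have "\<exists>v\<in>?U. vdiff x v = u" if u: "u \<in> ?U" for u
  proof -
    obtain v where "v \<in> sol m r F A" "\<forall>\<theta>\<in>set (as @ bs). vdiff \<theta> v = 0" "vdiff x v = u"
      using bspec[OF conv(2)[unfolded surj_on_kernel_def], of u] u by blast
    then show ?thesis by blast
  qed
  from graded_of_surj[OF comp amb closed w1_all x this]
  have "vdiff x ` (?U \<inter> of_weight w (k + 1)) = ?U \<inter> of_weight w k" for k .
  from hilb_of_surj[OF sub amb x this]
  have "hilb w ?U = hilb w {q \<in> ?U. vdiff x q = 0} + fps_X * hilb w ?U" by simp
  moreover have "{q \<in> ?U. vdiff x q = 0} = {q \<in> sol m r F A. \<forall>\<theta>\<in>set ((x # as) @ bs). vdiff \<theta> q = 0}" by auto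
  ultimately have "(1 - fps_X) * hilb w ?U = hilb w {q \<in> sol m r F A. \<forall>\<theta>\<in>set ((x # as) @ bs). vdiff \<theta> q = 0}"
    unfolding left_diff_distrib mult_1_left diff_eq_eq by simp
  note step = this
  have pow: "(1 - fps_X) ^ length (x # as) * H = (1 - fps_X) * ((1 - fps_X) ^ length as * H)"
    for H :: "real fps" by (simp add: mult.assoc)
  show ?case
    by (rule trans[OF pow trans[OF arg_cong[where f = "(*) (1 - fps_X)", OF Cons.IH[OF conv(1) ab]] step]])
qed simp

end

section \<open>The band matrix and the Hilbert numerator\<close>

lemma ambient_mono:
  assumes "m \<le> m'" "A \<subseteq> A'" shows "ambient m A \<subseteq> ambient m' A'"
proof
  fix q :: "'a fam" assume q: "q \<in> ambient m A"
  show "q \<in> ambient m' A'"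
    unfolding ambient_def mem_Collect_eq
  proof (intro allI impI)
    fix j \<alpha> assume "q j \<alpha> \<noteq> 0"
    then have "j < m \<and> set_mset \<alpha> \<subseteq> A" using q unfolding ambient_def by blast
    then show "j < m' \<and> set_mset \<alpha> \<subseteq> A'" using assms by auto
  qed
qed

definition tpoly :: "nat \<Rightarrow> real poly" where
  "tpoly a = (\<Sum>i<a. monom 1 i)"

text \<open>The Hilbert series of the band system with m generators, m + c relations and variables
  z_0, ..., z_c. For c = 0 the matrix is diagonal in one variable. Otherwise apply the K-th power of
  the last variable, K being the degree of the last relation: its kernel is filtered by K layers,
  each bounded by the system without that variable, and its image has one generator fewer.\<close>

fun qpoly :: "(nat \<Rightarrow> nat) \<Rightarrow> nat \<Rightarrow> nat \<Rightarrow> real poly" where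
  "qpoly k 0 c = 0"
| "qpoly k (Suc m) 0 = qpoly k m 0 + tpoly (k m)"
| "qpoly k (Suc m) (Suc c) =
     tpoly (k (m + Suc c)) * qpoly k (Suc m) c + monom 1 (k (m + Suc c)) * qpoly k m (Suc c)"

text \<open>The numerator when all variables are free: m generators minus, for each relation, a
  shifted count of the monomials at which it imposes a new equation (see
  \<open>S_telescope\<close>).\<close>

fun spoly :: "(nat \<Rightarrow> nat) \<Rightarrow> nat \<Rightarrow> nat \<Rightarrow> real poly" where
  "spoly k 0 r = 0"
| "spoly k (Suc m) 0 = of_nat (Suc m)"
| "spoly k (Suc m) (Suc r) = (1 - monom 1 (k r)) * spoly k (Suc m) r + monom 1 (k r) * spoly k m r"

lemma tpoly_mult: "tpoly a * (1 - monom 1 (Suc 0)) = 1 - monom 1 a"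
proof (induction a)
  case (Suc a)
  have "tpoly (Suc a) = tpoly a + monom 1 a" by (simp add: tpoly_def)
  then show ?case using Suc by (simp add: distrib_right right_diff_distrib mult_monom)
qed (simp add: tpoly_def monom_0 one_pCons)

lemma spoly_small: "r \<le> m \<Longrightarrow> spoly k m r = of_nat m - (\<Sum>i<r. monom 1 (k i))"
proof (induction r arbitrary: m)
  case 0 then show ?case by (cases m) simp_all
next
  case (Suc r)
  then obtain m' where m: "m = Suc m'" "r \<le> m'" by (cases m) auto
  have "spoly k m (Suc r) = (1 - monom 1 (k r)) * (of_nat m - (\<Sum>i<r. monom 1 (k i))) +
      monom 1 (k r) * (of_nat m' - (\<Sum>i<r. monom 1 (k i)))"
    using Suc.IH[of m] Suc.IH[of m'] m by simp
  also have "\<dots> = of_nat m - (\<Sum>i<Suc r. monom 1 (k i))"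
    by (simp add: m algebra_simps)
  finally show ?case .
qed

text \<open>As 1 - X turns \<open>tpoly a\<close> into 1 - X^a, the recursion for the band matrix
  becomes the recursion for the count of equations. This is why the upper and the lower bound
  meet.\<close>

lemma qpoly_spoly: "qpoly k m c * (1 - monom 1 (Suc 0)) ^ Suc c = spoly k m (m + c)"
proof (induction k m c rule: qpoly.induct)
  case (2 k m)
  then show ?case
    by (simp add: spoly_small distrib_right tpoly_mult del: spoly.simps qpoly.simps(1,3))
next
  case (3 k m c)
  let ?x = "1 - monom 1 (Suc 0) :: real poly"
  have "qpoly k (Suc m) (Suc c) * ?x ^ Suc (Suc c) =
     (tpoly (k (m + Suc c)) * ?x) * (qpoly k (Suc m) c * ?x ^ Suc c) +
     monom 1 (k (m + Suc c)) * (qpoly k m (Suc c) * ?x ^ Suc (Suc c))"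
    by (simp add: algebra_simps)
  also have "\<dots> = (1 - monom 1 (k (m + Suc c))) * spoly k (Suc m) (m + Suc c) +
     monom 1 (k (m + Suc c)) * spoly k m (m + Suc c)"
    unfolding 3 tpoly_mult by simp
  also have "\<dots> = spoly k (Suc m) (Suc m + Suc c)"
    by (simp only: add_Suc spoly.simps(3))
  finally show ?case .
qed simp

definition esym :: "(nat \<Rightarrow> nat) \<Rightarrow> nat \<Rightarrow> nat \<Rightarrow> nat" where
  "esym k j r = (\<Sum>I | I \<subseteq> {..<r} \<and> card I = j. \<Prod>i\<in>I. k i)"

lemma esym_Suc: "esym k (Suc j) (Suc r) = esym k (Suc j) r + k r * esym k j r"
proof -
  let ?S = "\<lambda>j (r::nat). {I. I \<subseteq> {..<r} \<and> card I = j}"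
  have fin: "finite (?S j r)" for j r by (rule finite_subset[of _ "Pow {..<r}"]) auto
  have e: "?S (Suc j) (Suc r) = ?S (Suc j) r \<union> insert r ` ?S j r"
  proof (intro equalityI subsetI)
    fix I assume "I \<in> ?S (Suc j) (Suc r)"
    then have I: "I \<subseteq> {..<Suc r}" "card I = Suc j" "finite I" by (auto intro: finite_subset)
    show "I \<in> ?S (Suc j) r \<union> insert r ` ?S j r"
    proof (cases "r \<in> I")
      case True
      then have "I = insert r (I - {r})" "I - {r} \<in> ?S j r" using I by (auto simp: less_Suc_eq)
      then show ?thesis by blast
    next
      case False
      then have "I \<subseteq> {..<r}" using I(1) by (auto simp: less_Suc_eq)
      then show ?thesis using I by simp
    qed
  next
    fix I assume "I \<in> ?S (Suc j) r \<union> insert r ` ?S j r"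
    then show "I \<in> ?S (Suc j) (Suc r)"
    proof
      assume "I \<in> insert r ` ?S j r"
      then obtain I' where I': "I = insert r I'" "I' \<subseteq> {..<r}" "card I' = j" by blast
      moreover have "finite I'" "r \<notin> I'" using I'(2) finite_subset by auto
      ultimately show ?thesis by auto
    qed auto
  qed
  have inj: "inj_on (insert r) (?S j r)"
  proof (rule inj_onI)
    fix I I' assume "I \<in> ?S j r" "I' \<in> ?S j r" "insert r I = insert r I'"
    moreover then have "r \<notin> I" "r \<notin> I'" by auto
    ultimately show "I = I'" by (metis Diff_insert_absorb)
  qed
  have "esym k (Suc j) (Suc r) = esym k (Suc j) r + (\<Sum>I\<in>insert r ` ?S j r. \<Prod>i\<in>I. k i)"
    unfolding esym_def e by (rule sum.union_disjoint) (use fin in auto)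
  also have "(\<Sum>I\<in>insert r ` ?S j r. \<Prod>i\<in>I. k i) = (\<Sum>I\<in>?S j r. \<Prod>i\<in>insert r I. k i)"
    by (simp add: sum.reindex[OF inj])
  also have "\<dots> = (\<Sum>I\<in>?S j r. k r * (\<Prod>i\<in>I. k i))"
  proof (rule sum.cong[OF refl])
    fix I assume "I \<in> ?S j r"
    then have "finite I" "r \<notin> I" using finite_subset by auto
    then show "(\<Prod>i\<in>insert r I. k i) = k r * (\<Prod>i\<in>I. k i)" by simp
  qed
  finally show ?thesis by (simp add: esym_def sum_distrib_left)
qed

lemma esym_0: "esym k 0 r = 1"
proof -
  have "{I. I \<subseteq> {..<r} \<and> card I = 0} = {{}}" by (auto dest: finite_subset)
  then show ?thesis by (simp add: esym_def)
qed

lemma esym_small: "r < j \<Longrightarrow> esym k j r = 0"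
proof -
  assume "r < j"
  then have "card I \<noteq> j" if "I \<subseteq> {..<r}" for I using card_mono[of "{..<r}" I] that by auto
  then show ?thesis by (auto simp: esym_def intro!: sum.neutral)
qed

text \<open>At 1 the polynomial \<open>tpoly a\<close> has the value a and powers of X become 1, so
  the recursion of \<open>qpoly\<close> turns into \<open>esym_Suc\<close>. This is the origin of
  the elementary symmetric polynomial in the rank.\<close>

lemma poly_qpoly_1: "poly (qpoly k m c) 1 = real (esym k (Suc c) (m + c))"
proof (induction k m c rule: qpoly.induct)
  case (1 k c) then show ?case by (simp add: esym_small)
next
  case (2 k m)
  then show ?case by (simp add: esym_Suc esym_0 tpoly_def poly_sum poly_monom)
next
  case (3 k m c)
  have "esym k (Suc (Suc c)) (Suc m + Suc c) = esym k (Suc (Suc c)) (m + Suc c) + k (m + Suc c) * esym k (Suc c) (Suc m + c)"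
    using esym_Suc[of k "Suc c" "m + Suc c"] by simp
  then show ?case using 3 by (simp add: tpoly_def poly_sum poly_monom)
qed

text \<open>Used to see that the numerator does not vanish at 1, so that the degree of the Hilbert
  polynomial does not drop.\<close>

lemma esym_pos: "(\<And>i. i < r \<Longrightarrow> k i \<ge> 1) \<Longrightarrow> j \<le> r \<Longrightarrow> esym k j r > 0"
proof -
  assume k: "\<And>i. i < r \<Longrightarrow> k i \<ge> 1" and j: "j \<le> r"
  have "(\<Prod>i\<in>{..<j}. k i) > 0" using k j by (intro prod_pos) (auto intro: Suc_le_lessD)
  moreover have "{..<j} \<in> {I. I \<subseteq> {..<r} \<and> card I = j}" using j by auto
  ultimately show ?thesis unfolding esym_def by (intro sum_pos2[of _ "{..<j}"]) auto
qed

text \<open>Filter the kernel of \<open>P ^ e\<close> by the kernels of lower powers. The operator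
  \<open>P ^ i\<close> embeds the i-th quotient into the kernel of \<open>P\<close>, with weights
  shifted by i * d.\<close>

lemma (in weighted) hilb_kernel_power:
  assumes U: "fam.subspace U" "U \<subseteq> ambient m A" "\<And>q. q \<in> U \<Longrightarrow> vdiff P q \<in> U" and P: "poly_of_weight w d P"
  shows "hilb w {q \<in> U. vdiff (P ^ e) q = 0} \<sqsubseteq> (\<Sum>i<e. fps_X ^ (i * d)) * hilb w {q \<in> U. vdiff P q = 0}"
proof (induction e)
  case 0
  have z: "{q \<in> U. vdiff (P ^ 0) q = 0} \<subseteq> {0}" by (auto simp: vdiff_one)
  have "fam.dim ({q \<in> U. vdiff (P ^ 0) q = 0} \<inter> of_weight w k) = 0" for k
    using fam.dim_le_finite_span[of "{}" "{q \<in> U. vdiff (P ^ 0) q = 0} \<inter> of_weight w k"] z by auto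
  then show ?case unfolding fps_le_def hilb_def fps_nth_Abs_fps by (simp only: ) simp
next
  case (Suc e)
  have sub: "fam.subspace {q \<in> U. vdiff Q q = 0}" for Q
  proof -
    interpret l: Vector_Spaces.linear fam_scale fam_scale "vdiff Q" by (rule linear_vdiff)
    have "{q \<in> U. vdiff Q q = 0} = U \<inter> {q. vdiff Q q = 0}" by auto
    then show ?thesis using fam.subspace_inter[OF U(1) l.subspace_kernel] by simp
  qed
  have pow: "vdiff (P ^ e) q \<in> U" if "q \<in> U" for q
    using that
  proof (induction e arbitrary: q)
    case 0 then show ?case by (simp add: vdiff_one)
  next
    case (Suc e)
    have "vdiff P (vdiff (P ^ e) q) \<in> U" by (rule U(3)[OF Suc.IH[OF Suc.prems]])
    then show ?case unfolding vdiff_mult power_Suc .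
  qed
  let ?U = "{q \<in> U. vdiff (P ^ Suc e) q = 0}"
  have "vdiff (P ^ e) ` ?U \<subseteq> {q \<in> U. vdiff P q = 0}"
    using pow by (auto simp: vdiff_mult)
  then have "hilb w ?U \<sqsubseteq> hilb w {q \<in> ?U. vdiff (P ^ e) q = 0} + fps_X ^ (e * d) * hilb w {q \<in> U. vdiff P q = 0}"
    by (intro hilb_step sub poly_of_weight_power P) (use U(2) in auto)
  also have "{q \<in> ?U. vdiff (P ^ e) q = 0} = {q \<in> U. vdiff (P ^ e) q = 0}"
  proof -
    have "vdiff (P ^ Suc e) q = 0" if "vdiff (P ^ e) q = 0" for q
    proof -
      have "vdiff (P ^ Suc e) q = vdiff P (vdiff (P ^ e) q)" by (simp add: vdiff_mult)
      then show ?thesis using that vdiff.scale_zero_right by metis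
    qed
    then show ?thesis by blast
  qed
  also have "hilb w {q \<in> U. vdiff (P ^ e) q = 0} + fps_X ^ (e * d) * hilb w {q \<in> U. vdiff P q = 0} \<sqsubseteq>
      (\<Sum>i<e. fps_X ^ (i * d)) * hilb w {q \<in> U. vdiff P q = 0} + fps_X ^ (e * d) * hilb w {q \<in> U. vdiff P q = 0}"
    by (intro fps_le_add Suc fps_le_refl)
  finally show ?case unfolding sum.lessThan_Suc distrib_right .
qed

text \<open>With m columns and m + c rows this matrix in z_0, ..., z_c has rank m away from the
  origin: if z_s is the first nonzero variable, the rows s, ..., s + m - 1 form a triangular matrix
  with powers of z_s on the diagonal. The guard keeps the natural subtraction i - j honest.\<close>

definition band :: "(nat \<Rightarrow> 'v) \<Rightarrow> (nat \<Rightarrow> nat) \<Rightarrow> nat \<Rightarrow> nat \<Rightarrow> 'v multiset \<Rightarrow>\<^sub>0 real" where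
  "band z k i j = (if j \<le> i then Poly_Mapping.single (replicate_mset (k i) (z (i - j))) 1 else 0)"

lemma pvar_power: "pvar v ^ e = Poly_Mapping.single (replicate_mset e v) 1"
  by (induction e) (simp_all add: pvar_def mult_single)

lemma band_power: "j \<le> i \<Longrightarrow> band z k i j = pvar (z (i - j)) ^ k i"
  by (simp add: band_def pvar_power)

lemma pdiff_band_outside:
  assumes "q \<in> ambient m A" "k i \<ge> 1" "z (i - j) \<notin> A" shows "pdiff (band z k i j) (q j') \<alpha> = 0"
proof (cases "j \<le> i")
  case True
  have "q j' (\<alpha> + replicate_mset (k i) (z (i - j))) = 0"
  proof (rule ccontr)
    assume "q j' (\<alpha> + replicate_mset (k i) (z (i - j))) \<noteq> 0"
    then have "set_mset (\<alpha> + replicate_mset (k i) (z (i - j))) \<subseteq> A" using assms(1) unfolding ambient_def by blast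
    then show False using assms(2,3) by auto
  qed
  then show ?thesis using True by (simp add: band_def pdiff_single)
qed (simp add: band_def)

lemma replicate_mset_add: "replicate_mset (a + b) x = replicate_mset a x + replicate_mset b x"
  by (induction a) auto

lemma sol_drop:
  assumes q: "q \<in> sol (Suc m) r F A" "\<And>\<alpha>. q m \<alpha> = 0" and r: "r' \<le> r" shows "q \<in> sol m r' F A"
proof -
  have qm: "q m = (\<lambda>_. 0)" using q(2) by auto
  have "q \<in> ambient m A"
    unfolding ambient_def mem_Collect_eq
  proof (intro allI impI)
    fix j \<alpha> assume n: "q j \<alpha> \<noteq> 0"
    then have "j < Suc m \<and> set_mset \<alpha> \<subseteq> A" using q(1) unfolding sol_def ambient_def by blast
    moreover have "j \<noteq> m" using n q(2) by auto
    ultimately show "j < m \<and> set_mset \<alpha> \<subseteq> A" by simp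
  qed
  moreover have "(\<Sum>j<m. pdiff (F i j) (q j) \<alpha>) = 0" if "i < r'" for i \<alpha>
  proof -
    have "(\<Sum>j<Suc m. pdiff (F i j) (q j) \<alpha>) = 0" using q(1) that r by (simp add: sol_def)
    then show ?thesis by (simp add: qm)
  qed
  moreover have "\<exists>B. \<forall>j \<alpha>. q j \<alpha> \<noteq> 0 \<longrightarrow> size \<alpha> \<le> B" using q(1) by (simp add: sol_def)
  ultimately show ?thesis by (simp add: sol_def)
qed

lemma sol_mono_relations: "r' \<le> r \<Longrightarrow> sol m r F A \<subseteq> sol m r' F A"
  by (auto simp: sol_def)

lemma fps_of_tpoly: "fps_of_poly (tpoly a) = (\<Sum>i<a. fps_X ^ i)"
  by (simp add: tpoly_def fps_of_poly_sum fps_of_poly_monom)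

text \<open>Follows the recursion of \<open>qpoly\<close>: for c = 0 project to the last component,
  otherwise apply the highest power of the last variable that the last relation provides.\<close>

theorem hilb_band_le:
  assumes k: "\<And>i. k i \<ge> 1" and inj: "inj z" and w: "\<And>i. w (z i) = 1"
  shows "hilb w (sol m (m + c) (band z k) (z ` {..c})) \<sqsubseteq> fps_of_poly (qpoly k m c)"
  using k
proof (induction k m c rule: qpoly.induct)
  case (1 k c)
  have "fam.dim (sol 0 (0 + c) (band z k) (z ` {..c}) \<inter> of_weight w a) = 0" for a
  proof -
    have "sol 0 (0 + c) (band z k) (z ` {..c}) \<subseteq> {0}"
      by (auto simp: sol_def ambient_def fun_eq_iff)
    then show ?thesis
      using fam.dim_le_finite_span[of "{}" "sol 0 (0 + c) (band z k) (z ` {..c}) \<inter> of_weight w a"] by auto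
  qed
  then show ?case by (simp add: fps_le_def hilb_def)
next
  case (2 k m)
  let ?A = "z ` {..(0::nat)}"
  let ?V = "sol (Suc m) (Suc m + 0) (band z k) ?A" and ?U = "sol m (m + 0) (band z k) ?A"
  interpret weighted w "Suc m" ?A by unfold_locales (use w in auto)
  define \<pi> :: "'a fam \<Rightarrow> 'a fam" where "\<pi> q = (\<lambda>j \<alpha>. if j = m then q m \<alpha> else 0)" for q
  have lin: "Vector_Spaces.linear fam_scale fam_scale \<pi>"
    by (rule fam_linearI) (auto simp: \<pi>_def fun_eq_iff)
  have U_ambient: "?U \<subseteq> ambient (Suc m) ?A"
    by (rule order_trans[OF sol_ambient ambient_mono]) auto
  have "fam.dim (?V \<inter> of_weight w a) \<le> fam.dim (?U \<inter> of_weight w a) + (if a < k m then 1 else 0)" for a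
  proof -
    \<comment> \<open>On the single variable \<open>z 0\<close> the last relation cuts the last
      component off at the power \<open>k m\<close>, so weight \<open>a\<close> leaves one monomial
      or none.\<close>
    define T where "T = (if a < k m then {(m, replicate_mset a (z 0))} else {})"
    have fT: "finite T" by (simp add: T_def)
    have "fam.dim (?V \<inter> of_weight w a) \<le> fam.dim (?U \<inter> of_weight w a) + fam.dim (supported T)"
    proof (rule fam_fam.dim_le_kernel_image[OF lin])
      show "fam.subspace (?V \<inter> of_weight w a)" by (intro fam.subspace_inter subspace_sol subspace_of_weight)
      show "fin_gen fam_scale (?V \<inter> of_weight w a)" by (rule fin_gen_weight[OF sol_ambient])
      show "fin_gen fam_scale (supported T)" by (rule fin_gen_supported[OF fT])
      show "fin_gen fam_scale (?U \<inter> of_weight w a)" by (rule fin_gen_weight[OF U_ambient])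
      show "q \<in> ?U \<inter> of_weight w a" if q: "q \<in> ?V \<inter> of_weight w a" and 0: "\<pi> q = 0" for q
      proof -
        have "q m \<alpha> = 0" for \<alpha> using fun_cong[OF fun_cong[OF 0], of m \<alpha>] by (simp add: \<pi>_def)
        then show ?thesis using sol_drop[of q m "Suc m + 0" "band z k" ?A m] q by auto
      qed
      show "\<pi> ` (?V \<inter> of_weight w a) \<subseteq> supported T"
      proof (rule image_subsetI)
        fix q assume q: "q \<in> ?V \<inter> of_weight w a"
        have amb: "q \<in> ambient (Suc m) ?A" using q sol_ambient by blast
        have "\<alpha> = replicate_mset a (z 0) \<and> a < k m" if n: "q m \<alpha> \<noteq> 0" for \<alpha>
        proof -
          have "set_mset \<alpha> \<subseteq> {z 0}" using amb n unfolding ambient_def by fastforce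
          then have r: "\<alpha> = replicate_mset (size \<alpha>) (z 0)" by (rule set_mset_subset_singletonD)
          have "wsize w \<alpha> = a" using q n unfolding of_weight_def by blast
          moreover have "wsize w (replicate_mset l (z 0)) = l" for l by (induction l) (simp_all add: w)
          ultimately have a: "\<alpha> = replicate_mset a (z 0)" using r by metis
          have "a < k m"
          proof (rule ccontr)
            assume "\<not> a < k m"
            then have e: "replicate_mset a (z 0) = replicate_mset (a - k m) (z 0) + replicate_mset (k m) (z 0)"
              by (simp add: replicate_mset_add[symmetric])
            let ?b = "replicate_mset (a - k m) (z 0)"
            have "(\<Sum>j<Suc m. pdiff (band z k m j) (q j) ?b) = 0" using q by (simp add: sol_def)
            moreover have "pdiff (band z k m j) (q j) ?b = 0" if "j < m" for j
              using amb 2(2)[of m] by (rule pdiff_band_outside) (use inj that in \<open>auto dest: injD\<close>)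
            moreover have "pdiff (band z k m m) (q m) ?b = q m \<alpha>" unfolding a e by (simp add: band_def pdiff_single)
            ultimately show False using n by simp
          qed
          with a show ?thesis by blast
        qed
        then show "\<pi> q \<in> supported T" by (auto simp: supported_def \<pi>_def T_def)
      qed
    qed
    then show ?thesis unfolding dim_supported[OF fT] by (simp add: T_def split: if_splits)
  qed
  then have d: "real (fam.dim (?V \<inter> of_weight w a)) \<le> real (fam.dim (?U \<inter> of_weight w a) + (if a < k m then 1 else 0))" for a
    by (rule of_nat_mono)
  have ct: "coeff (tpoly b) a = (if a < b then 1 else 0)" for a b
    by (simp add: tpoly_def coeff_sum)
  show ?case
    unfolding fps_le_def
  proof
    fix a
    have "real (fam.dim (?U \<inter> of_weight w a)) \<le> coeff (qpoly k m 0) a"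
      using 2 by (simp add: fps_le_def hilb_def)
    then have "real (fam.dim (?V \<inter> of_weight w a)) \<le> coeff (qpoly k m 0) a + (if a < k m then 1 else 0)"
      using d[of a] by (simp split: if_splits)
    then show "fps_nth (hilb w ?V) a \<le> fps_nth (fps_of_poly (qpoly k (Suc m) 0)) a"
      by (simp add: hilb_def ct)
  qed
next
  case (3 k m c)
  let ?A = "z ` {..Suc c}" and ?K = "k (m + Suc c)" and ?v = "z (Suc c)" and ?B = "band z k"
  let ?V = "sol (Suc m) (Suc m + Suc c) ?B ?A" and ?W = "sol m (m + Suc c) ?B ?A"
    and ?V' = "sol (Suc m) (Suc m + c) ?B (z ` {..c})"
  interpret weighted w "Suc m" ?A by unfold_locales (use w in auto)
  have P: "poly_of_weight w 1 (pvar ?v)" using poly_of_weight_pvar[of w ?v] w by simp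
  have PK: "poly_of_weight w ?K (pvar ?v ^ ?K)" using poly_of_weight_power[OF P, of ?K] by simp
  have amb: "ambient m ?A \<subseteq> ambient (Suc m) ?A" "ambient (Suc m) (z ` {..c}) \<subseteq> ambient (Suc m) ?A"
    by (rule ambient_mono; auto)+
  \<comment> \<open>In the last relation, with index m + Suc c, the entry in column j involves z_(m
    + Suc c - j). For j < m this variable is not among those present, so the relation says that the
    power of \<open>?v\<close> kills the last component.\<close>
  have W: "vdiff (pvar ?v ^ ?K) ` ?V \<subseteq> ?W"
  proof (rule image_subsetI)
    fix q assume q: "q \<in> ?V"
    have qa: "q \<in> ambient (Suc m) ?A" using q sol_ambient by blast
    let ?i = "m + Suc c"
    have "vdiff (pvar ?v ^ ?K) q m \<alpha> = 0" for \<alpha>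
    proof -
      have "(\<Sum>j<Suc m. pdiff (?B ?i j) (q j) \<alpha>) = 0" using q by (simp add: sol_def)
      moreover have "pdiff (?B ?i j) (q j) \<alpha> = 0" if "j < m" for j
        using qa 3(3)[of ?i] by (rule pdiff_band_outside) (use inj that in \<open>auto dest!: injD\<close>)
      moreover have "pdiff (?B ?i m) (q m) \<alpha> = vdiff (pvar ?v ^ ?K) q m \<alpha>" by (simp add: band_power vdiff_def)
      ultimately show ?thesis by simp
    qed
    then show "vdiff (pvar ?v ^ ?K) q \<in> ?W" by (rule sol_drop[OF vdiff_sol[OF q]]) simp
  qed
  have "hilb w ?V \<sqsubseteq> hilb w {q \<in> ?V. vdiff (pvar ?v ^ ?K) q = 0} + fps_X ^ ?K * hilb w ?W"
    by (rule hilb_step[OF subspace_sol sol_ambient PK W order_trans[OF sol_ambient amb(1)]])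
  also have "\<dots> \<sqsubseteq> (\<Sum>i<?K. fps_X ^ (i * 1)) * hilb w {q \<in> ?V. vdiff (pvar ?v) q = 0} + fps_X ^ ?K * hilb w ?W"
    by (intro fps_le_add fps_le_refl hilb_kernel_power subspace_sol sol_ambient vdiff_sol P)
  also have "{q \<in> ?V. vdiff (pvar ?v) q = 0} = sol (Suc m) (Suc m + Suc c) ?B (z ` {..c})"
  proof -
    have "?A = insert ?v (z ` {..c})" by (simp add: atMost_Suc)
    moreover have "?v \<notin> z ` {..c}" using inj by (auto dest: injD)
    ultimately show ?thesis using sol_kernel_pvar[of ?v "z ` {..c}"] by simp
  qed
  also have "(\<Sum>i<?K. fps_X ^ (i * 1)) * hilb w (sol (Suc m) (Suc m + Suc c) ?B (z ` {..c})) + fps_X ^ ?K * hilb w ?W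
     \<sqsubseteq> (\<Sum>i<?K. fps_X ^ (i * 1)) * fps_of_poly (qpoly k (Suc m) c) + fps_X ^ ?K * fps_of_poly (qpoly k m (Suc c))"
  proof (intro fps_le_add fps_le_mult)
    show "0 \<sqsubseteq> (\<Sum>i<?K. fps_X ^ (i * 1))"
      by (auto simp: fps_le_def fps_sum_nth fps_X_power_nth intro!: sum_nonneg)
    show "0 \<sqsubseteq> fps_X ^ ?K" by (simp add: fps_le_def fps_X_power_nth)
    \<comment> \<open>Without \<open>?v\<close> the last relation is simply dropped, which can only
      enlarge the space; what remains has the shape required by the induction hypothesis.\<close>
    have "hilb w (sol (Suc m) (Suc m + Suc c) ?B (z ` {..c})) \<sqsubseteq> hilb w ?V'"
      by (rule hilb_mono[OF sol_mono_relations order_trans[OF sol_ambient amb(2)]]) simp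
    also have "\<dots> \<sqsubseteq> fps_of_poly (qpoly k (Suc m) c)" using 3 by simp
    finally show "hilb w (sol (Suc m) (Suc m + Suc c) ?B (z ` {..c})) \<sqsubseteq> fps_of_poly (qpoly k (Suc m) c)" .
    show "hilb w ?W \<sqsubseteq> fps_of_poly (qpoly k m (Suc c))" using 3 by simp
  qed
  finally show ?case
    by (simp add: fps_of_poly_add fps_of_poly_mult fps_of_tpoly fps_of_poly_monom)
qed

section \<open>Maximal minors\<close>

definition degree_in :: "'v set \<Rightarrow> 'v multiset \<Rightarrow> nat" where
  "degree_in T \<mu> = size (filter_mset (\<lambda>v. v \<in> T) \<mu>)"

lemma degree_in_simps [simp]:
  "degree_in T {#} = 0" "degree_in T (add_mset v \<mu>) = (if v \<in> T then 1 else 0) + degree_in T \<mu>"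
  "degree_in T (\<mu> + \<nu>) = degree_in T \<mu> + degree_in T \<nu>"
  by (simp_all add: degree_in_def)

text \<open>For n = 1 this says that no variable of \<open>T\<close> occurs.\<close>

definition low :: "'v set \<Rightarrow> nat \<Rightarrow> ('v multiset \<Rightarrow>\<^sub>0 real) \<Rightarrow> bool" where
  "low T n P \<longleftrightarrow> (\<forall>\<beta>\<in>Poly_Mapping.keys P. degree_in T \<beta> < n)"

lemma low_0 [simp]: "low T n 0" by (simp add: low_def)

lemma low_add: "low T n P \<Longrightarrow> low T n Q \<Longrightarrow> low T n (P + Q)"
  using keys_add[of P Q] by (auto simp: low_def)

lemma low_sum: "(\<And>i. i \<in> I \<Longrightarrow> low T n (f i)) \<Longrightarrow> low T n (\<Sum>i\<in>I. f i)"
  by (induction I rule: infinite_finite_induct) (auto intro: low_add)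

lemma low_mult:
  assumes "\<And>\<beta>. \<beta> \<in> Poly_Mapping.keys P \<Longrightarrow> degree_in T \<beta> \<le> a" "low T n Q" shows "low T (a + n) (P * Q)"
  unfolding low_def
proof
  fix \<beta> assume "\<beta> \<in> Poly_Mapping.keys (P * Q)"
  then obtain b c where "\<beta> = b + c" "b \<in> Poly_Mapping.keys P" "c \<in> Poly_Mapping.keys Q"
    using keys_mult[of P Q] by auto
  then show "degree_in T \<beta> < a + n" using assms(1)[of b] assms(2) by (fastforce simp: low_def)
qed

lemma low_of_int:
  fixes P :: "'v multiset \<Rightarrow>\<^sub>0 real"
  assumes "low T n P" shows "low T n (of_int s * P)"
proof -
  have e: "Poly_Mapping.single 0 (of_int s) = (of_int s :: 'v multiset \<Rightarrow>\<^sub>0 real)" by (rule single_of_int)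
  have "degree_in T \<beta> \<le> 0" if "\<beta> \<in> Poly_Mapping.keys (of_int s :: 'v multiset \<Rightarrow>\<^sub>0 real)" for \<beta>
    using that unfolding e[symmetric] keys_single by (simp split: if_splits)
  from low_mult[OF this assms] show ?thesis by simp
qed

lemma single_sum: "Poly_Mapping.single X (\<Sum>i\<in>I. f i) = (\<Sum>i\<in>I. Poly_Mapping.single X (f i))"
  by (induction I rule: infinite_finite_induct) (auto simp: single_add)

text \<open>Only the choice of the single variable in every factor reaches degree
  \<open>card I\<close> in \<open>T\<close>; all other terms of the expanded product stay
  below.\<close>

lemma prod_leading_term:
  assumes "finite I" "\<And>i. i \<in> I \<Longrightarrow> x i \<in> T" "\<And>i. i \<in> I \<Longrightarrow> low T 1 (G i)"
  shows "\<exists>R. low T (card I) R \<and> (\<Prod>i\<in>I. G i + Poly_Mapping.single {#x i#} (c i)) =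
    Poly_Mapping.single (\<Sum>i\<in>I. {#x i#}) (\<Prod>i\<in>I. c i) + R"
  using assms
proof (induction I rule: finite_induct)
  case empty
  then show ?case by (intro exI[of _ 0]) simp
next
  case (insert i I)
  then obtain R where R: "low T (card I) R" "(\<Prod>i\<in>I. G i + Poly_Mapping.single {#x i#} (c i)) =
    Poly_Mapping.single (\<Sum>i\<in>I. {#x i#}) (\<Prod>i\<in>I. c i) + R" by auto
  let ?s = "Poly_Mapping.single {#x i#} (c i)" and ?M = "Poly_Mapping.single (\<Sum>i\<in>I. {#x i#}) (\<Prod>i\<in>I. c i)"
  have deg: "degree_in T (\<Sum>i\<in>I. {#x i#}) = card I"
    using insert(1,4) by (induction I rule: finite_induct) auto
  have G: "low T 1 (G i)" and xi: "x i \<in> T" using insert.prems by auto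
  have "low T (card I + 1) (?M * G i)"
    by (rule low_mult[OF _ G]) (simp add: deg split: if_splits)
  moreover have "low T (0 + card I) (G i * R)"
    by (rule low_mult[OF _ R(1)]) (use G in \<open>auto simp: low_def\<close>)
  then have "low T (card I + 1) (G i * R)" by (auto simp: low_def)
  moreover have "low T (1 + card I) (?s * R)"
    by (rule low_mult[OF _ R(1)]) (simp add: xi split: if_splits)
  ultimately have "low T (card (insert i I)) (?M * G i + (G i * R + ?s * R))"
    using insert(1,2) by (simp add: low_add)
  moreover have "(\<Prod>i\<in>insert i I. G i + Poly_Mapping.single {#x i#} (c i)) =
      Poly_Mapping.single (\<Sum>i\<in>insert i I. {#x i#}) (\<Prod>i\<in>insert i I. c i) + (?M * G i + (G i * R + ?s * R))"
    using insert(1,2) R(2) by (simp add: algebra_simps mult_single)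
  ultimately show ?case by blast
qed

text \<open>A vector in the kernel lists the coefficients of a polynomial of degree less than m with
  m distinct roots.\<close>

lemma vandermonde_nonzero:
  assumes "inj_on x {..<m}"
  shows "det (mat m m (\<lambda>(a, j). x a ^ j) :: real mat) \<noteq> 0"
proof
  let ?A = "mat m m (\<lambda>(a, j). x a ^ j) :: real mat"
  assume "det ?A = 0"
  then obtain v where v: "v \<in> carrier_vec m" "v \<noteq> 0\<^sub>v m" "?A *\<^sub>v v = 0\<^sub>v m"
    using det_0_iff_vec_prod_zero_field[of ?A m] by auto
  define p where "p = (\<Sum>j<m. monom (vec_index v j) j)"
  have root: "poly p (x a) = 0" if "a < m" for a
  proof -
    have "vec_index (?A *\<^sub>v v) a = (\<Sum>j<m. x a ^ j * vec_index v j)"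
      using that v(1) by (auto simp: scalar_prod_def atLeast0LessThan)
    then show ?thesis using v(3) that by (simp add: p_def poly_sum poly_monom mult.commute)
  qed
  have coeff: "coeff p j = (if j < m then vec_index v j else 0)" for j
    by (auto simp: p_def coeff_sum)
  have "p = 0"
  proof (rule ccontr)
    assume p: "p \<noteq> 0"
    have "x ` {..<m} \<subseteq> {y. poly p y = 0}" using root by auto
    then have "m \<le> card {y. poly p y = 0}"
      using card_mono[OF poly_roots_finite[OF p], of "x ` {..<m}"] card_image[OF assms] by simp
    also have "\<dots> \<le> degree p" by (rule card_poly_roots_bound[OF p])
    finally have "m \<le> degree p" .
    then have "coeff p (degree p) = 0" by (simp add: coeff)
    then show False using p by simp
  qed
  then have "vec_index v j = 0" if "j < m" for j using coeff[of j] that by simp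
  then have "v = 0\<^sub>v m" using v(1) by (intro eq_vecI) auto
  with v(2) show False ..
qed

text \<open>In the expansion of the minor of the rows \<open>J\<close>, every permutation has the
  same leading monomial in \<open>T\<close>, the product of the t (J a), and the coefficients add up
  to a Vandermonde determinant. The powers x_i^j in the deformation are chosen for this.\<close>

lemma annihilating_minor:
  fixes t :: "nat \<Rightarrow> 'v" and J :: "nat \<Rightarrow> nat" and x :: "nat \<Rightarrow> real"
  assumes "inj_on J {..<m}" "inj x" "\<And>a. a < m \<Longrightarrow> t (J a) \<in> T"
    and G: "\<And>i j. low T 1 (G i j)"
    and F: "\<And>i j. F i j = G i j + Poly_Mapping.single {#t i#} (x i ^ j)"
  shows "\<exists>D c R. D = Poly_Mapping.single (\<Sum>a<m. {#t (J a)#}) c + R \<and> c \<noteq> 0 \<and> low T m R \<and>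
    (\<forall>q. (\<forall>a<m. \<forall>\<alpha>. (\<Sum>j<m. pdiff (F (J a) j) (q j) \<alpha>) = 0) \<longrightarrow> (\<forall>l<m. pdiff D (q l) = (\<lambda>_. 0)))"
proof -
  let ?M = "mat m m (\<lambda>(a, j). F (J a) j)"
  let ?V = "mat m m (\<lambda>(a, j). x (J a) ^ j) :: real mat"
  let ?X = "\<Sum>a<m. {#t (J a)#}"
  have M: "?M \<in> carrier_mat m m" and V: "?V \<in> carrier_mat m m" by auto
  define D where "D = det ?M"
  have "\<exists>R. low T m R \<and> (\<Prod>a<m. F (J a) (p a)) = Poly_Mapping.single ?X (\<Prod>a<m. x (J a) ^ p a) + R" for p
    using prod_leading_term[of "{..<m}" "\<lambda>a. t (J a)" T "\<lambda>a. G (J a) (p a)" "\<lambda>a. x (J a) ^ p a"] assms(3) G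
    by (simp add: F)
  from choice[OF allI[OF this]] obtain R where
    "\<forall>p. low T m (R p) \<and> (\<Prod>a<m. F (J a) (p a)) = Poly_Mapping.single ?X (\<Prod>a<m. x (J a) ^ p a) + R p" ..
  then have R: "\<And>p. low T m (R p)"
    "\<And>p. (\<Prod>a<m. F (J a) (p a)) = Poly_Mapping.single ?X (\<Prod>a<m. x (J a) ^ p a) + R p" by auto
  let ?P = "{p. p permutes {0..<m}}"
  have "D = (\<Sum>p\<in>?P. of_int (sign p) * (\<Prod>a<m. F (J a) (p a)))"
    unfolding D_def det_def'[OF M]
  proof (rule sum.cong[OF refl])
    fix p :: "nat \<Rightarrow> nat" assume "p \<in> ?P"
    then have "p a < m" if "a < m" for a using permutes_in_image[of p "{0..<m}" a] that by simp
    then have "(\<Prod>a = 0..<m. ?M $$ (a, p a)) = (\<Prod>a<m. F (J a) (p a))"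
      unfolding atLeast0LessThan by (intro prod.cong) auto
    then show "of_int (sign p) * (\<Prod>a = 0..<m. ?M $$ (a, p a)) = of_int (sign p) * (\<Prod>a<m. F (J a) (p a))" by simp
  qed
  also have "\<dots> = (\<Sum>p\<in>?P. Poly_Mapping.single ?X (of_int (sign p) * (\<Prod>a<m. x (J a) ^ p a)) + of_int (sign p) * R p)"
  proof (rule sum.cong[OF refl])
    fix p :: "nat \<Rightarrow> nat"
    have "of_int (sign p) * Poly_Mapping.single ?X y = Poly_Mapping.single ?X (of_int (sign p) * y)" for y :: real
      by (simp add: single_of_int[symmetric] mult_single del: single_of_int)
    then show "of_int (sign p) * (\<Prod>a<m. F (J a) (p a)) =
        Poly_Mapping.single ?X (of_int (sign p) * (\<Prod>a<m. x (J a) ^ p a)) + of_int (sign p) * R p"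
      by (simp add: R(2) distrib_left)
  qed
  also have "\<dots> = (\<Sum>p\<in>?P. Poly_Mapping.single ?X (of_int (sign p) * (\<Prod>a<m. x (J a) ^ p a))) +
      (\<Sum>p\<in>?P. of_int (sign p) * R p)" by (rule sum.distrib)
  also have "(\<Sum>p\<in>?P. Poly_Mapping.single ?X (of_int (sign p) * (\<Prod>a<m. x (J a) ^ p a))) =
      Poly_Mapping.single ?X (\<Sum>p\<in>?P. of_int (sign p) * (\<Prod>a<m. x (J a) ^ p a))"
    by (rule single_sum[symmetric])
  also have "(\<Sum>p\<in>?P. of_int (sign p) * (\<Prod>a<m. x (J a) ^ p a)) = det ?V"
    unfolding det_def'[OF V]
  proof (rule sum.cong[OF refl])
    fix p :: "nat \<Rightarrow> nat" assume "p \<in> ?P"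
    then have "p a < m" if "a < m" for a using permutes_in_image[of p "{0..<m}" a] that by simp
    then have "(\<Prod>a = 0..<m. ?V $$ (a, p a)) = (\<Prod>a<m. x (J a) ^ p a)"
      unfolding atLeast0LessThan by (intro prod.cong) auto
    then show "of_int (sign p) * (\<Prod>a<m. x (J a) ^ p a) = of_int (sign p) * (\<Prod>a = 0..<m. ?V $$ (a, p a))" by simp
  qed
  finally have D: "D = Poly_Mapping.single ?X (det ?V) + (\<Sum>p\<in>?P. of_int (sign p) * R p)" .
  have "inj_on (\<lambda>a. x (J a)) {..<m}"
    using assms(1,2) by (auto simp: inj_on_def dest: injD)
  then have V0: "det ?V \<noteq> 0" by (rule vandermonde_nonzero)
  have lowR: "low T m (\<Sum>p\<in>?P. of_int (sign p) * R p)" by (intro low_sum low_of_int R(1))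
  have kill: "pdiff D (q l) = (\<lambda>_. 0)"
    if q: "\<And>a \<alpha>. a < m \<Longrightarrow> (\<Sum>j<m. pdiff (F (J a) j) (q j) \<alpha>) = 0" and l: "l < m" for q l
  proof
    fix \<alpha>
    \<comment> \<open>Cramer's rule: the adjugate combines the relations of the rows
      \<open>J\<close> into \<open>D\<close> acting on one component.\<close>
    define N where "N = adj_mat ?M"
    have N: "N \<in> carrier_mat m m" "N * ?M = D \<cdot>\<^sub>m 1\<^sub>m m" using adj_mat[OF M] by (simp_all add: N_def D_def)
    have e: "(\<Sum>a<m. N $$ (l, a) * F (J a) j) = (if j = l then D else 0)" if j: "j < m" for j
    proof -
      have "(N * ?M) $$ (l, j) = (\<Sum>a<m. N $$ (l, a) * F (J a) j)"
        using N(1) l j by (auto simp: times_mat_def scalar_prod_def atLeast0LessThan intro!: sum.cong)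
      then show ?thesis using N(2) l j by auto
    qed
    have "pdiff D (q l) \<alpha> = (\<Sum>j<m. pdiff (if j = l then D else 0) (q j) \<alpha>)"
      using l by (subst sum.remove[of _ l]) (auto intro!: sum.neutral)
    also have "\<dots> = (\<Sum>j<m. \<Sum>a<m. pdiff (N $$ (l, a)) (pdiff (F (J a) j) (q j)) \<alpha>)"
      by (rule sum.cong[OF refl]) (simp add: e[symmetric] pdiff_sum_left pdiff_mult)
    also have "\<dots> = (\<Sum>a<m. \<Sum>j<m. pdiff (N $$ (l, a)) (pdiff (F (J a) j) (q j)) \<alpha>)" by (rule sum.swap)
    also have "\<dots> = (\<Sum>a<m. pdiff (N $$ (l, a)) (\<lambda>\<alpha>. \<Sum>j<m. pdiff (F (J a) j) (q j) \<alpha>) \<alpha>)"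
      by (simp add: pdiff_sum_right)
    also have "\<dots> = 0"
    proof (rule sum.neutral, rule ballI)
      fix a assume "a \<in> {..<m}"
      then have "(\<lambda>\<alpha>. \<Sum>j<m. pdiff (F (J a) j) (q j) \<alpha>) = (\<lambda>_. 0)" using q[of a] by auto
      then show "pdiff (N $$ (l, a)) (\<lambda>\<alpha>. \<Sum>j<m. pdiff (F (J a) j) (q j) \<alpha>) \<alpha> = 0" by simp
    qed
    finally show "pdiff D (q l) \<alpha> = 0" .
  qed
  show ?thesis
    by (intro exI conjI allI impI, rule D, rule V0, rule lowR, rule kill) auto
qed

text \<open>By the annihilating minors, the equations that a family has to satisfy are implied by the equations at the monomials
  in which fewer than \<open>m\<close> of the variables \<open>t 0, \<dots>, t (i - 1)\<close> occur.\<close>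

lemma relations_from_good:
  fixes t :: "nat \<Rightarrow> 'v" and x :: "nat \<Rightarrow> real"
  assumes t: "inj_on t {..<r}" and x: "inj x" and G: "\<And>i j. low (t ` {..<r}) 1 (G i j)"
    and F: "\<And>i j. F i j = G i j + Poly_Mapping.single {#t i#} (x i ^ j)"
    and good: "\<And>i \<mu>. i < r \<Longrightarrow> card (set_mset \<mu> \<inter> t ` {..<i}) < m \<Longrightarrow> (\<Sum>j<m. pdiff (F i j) (q j) \<mu>) = 0"
    and i: "i < r"
  shows "(\<Sum>j<m. pdiff (F i j) (q j) \<mu>) = 0"
  using i
proof (induction i arbitrary: \<mu> rule: less_induct)
  case (less i)
  note IHi = less.IH and i = less.prems
  let ?T = "t ` {..<r}" and ?R = "\<lambda>\<mu>. \<Sum>j<m. pdiff (F i j) (q j) \<mu>"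
  show ?case
  proof (induction "degree_in ?T \<mu>" arbitrary: \<mu> rule: less_induct)
    case less
    show ?case
    proof (cases "card (set_mset \<mu> \<inter> t ` {..<i}) < m")
      case True
      then show ?thesis by (rule good[OF i])
    next
      case False
      \<comment> \<open>The monomial contains m of the variables belonging to earlier relations.
        Those relations hold everywhere by the induction on i, so their minor \<open>D\<close> kills
        each component of \<open>q\<close>.\<close>
      then obtain S where S: "S \<subseteq> set_mset \<mu> \<inter> t ` {..<i}" "card S = m" "finite S"
        using obtain_subset_with_card_n[of m "set_mset \<mu> \<inter> t ` {..<i}"] by (auto simp: not_less)
      obtain h where h: "bij_betw h {..<m} S"
        using S(2,3) ex_bij_betw_nat_finite[of S] by (auto simp: atLeast0LessThan)
      have "\<exists>k<i. t k = h a" if "a < m" for a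
        using h S(1) that by (force simp: bij_betw_def)
      then obtain J where J: "\<And>a. a < m \<Longrightarrow> J a < i" "\<And>a. a < m \<Longrightarrow> t (J a) = h a" by metis
      have injJ: "inj_on J {..<m}"
      proof (rule inj_onI)
        fix a b assume ab: "a \<in> {..<m}" "b \<in> {..<m}" "J a = J b"
        then have "h a = h b" using J(2)[of a] J(2)[of b] by simp
        then show "a = b" using ab h by (simp add: bij_betw_def inj_on_def)
      qed
      have Jr: "t (J a) \<in> ?T" if "a < m" for a using J(1)[OF that] i by auto
      obtain D c R where D: "D = Poly_Mapping.single (\<Sum>a<m. {#t (J a)#}) c + R" "c \<noteq> 0" "low ?T m R"
        "\<forall>q. (\<forall>a<m. \<forall>\<alpha>. (\<Sum>j<m. pdiff (F (J a) j) (q j) \<alpha>) = 0) \<longrightarrow> (\<forall>l<m. pdiff D (q l) = (\<lambda>_. 0))"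
        using annihilating_minor[OF injJ x Jr G F] by blast
      have "\<forall>a<m. \<forall>\<alpha>. (\<Sum>j<m. pdiff (F (J a) j) (q j) \<alpha>) = 0"
        using IHi[OF J(1)] J(1) i less_trans by blast
      then have kill: "pdiff D (q l) = (\<lambda>_. 0)" if "l < m" for l
        using D(4) that by blast
      let ?X = "\<Sum>a<m. {#t (J a)#}"
      have "?X = mset_set S"
      proof -
        have "?X = (\<Sum>a<m. {#h a#})" using J(2) by simp
        also have "\<dots> = (\<Sum>s\<in>S. {#s#})" by (rule sum.reindex_bij_betw[OF h])
        finally show ?thesis by simp
      qed
      moreover have "mset_set S \<subseteq># \<mu>"
        by (rule mset_subset_eqI) (use S in \<open>auto simp: count_mset_set'\<close>)
      ultimately have mu: "\<mu> = (\<mu> - ?X) + ?X" by simp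
      let ?\<nu> = "\<mu> - ?X"
      have dX: "degree_in ?T ?X = m"
      proof -
        have "degree_in ?T (\<Sum>a<k. {#t (J a)#}) = k" if "k \<le> m" for k
          using that by (induction k) (use Jr in auto)
        then show ?thesis by simp
      qed
      have R0: "?R (?\<nu> + \<beta>) = 0" if "\<beta> \<in> Poly_Mapping.keys R" for \<beta>
      proof (rule less.hyps)
        have "degree_in ?T \<beta> < m" using D(3) that by (simp add: low_def)
        moreover have "degree_in ?T \<mu> = degree_in ?T ?\<nu> + m" using arg_cong[OF mu, of "degree_in ?T"] dX by simp
        ultimately show "degree_in ?T (?\<nu> + \<beta>) < degree_in ?T \<mu>" by simp
      qed
      \<comment> \<open>Applying \<open>D\<close> to the i-th relation gives zero. Its leading term
        contributes the value at \<mu>, the others contribute values at monomials of smaller degree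
        in \<open>t\<close>, which vanish by the inner induction.\<close>
      have "pdiff D ?R ?\<nu> = (\<Sum>j<m. pdiff (F i j) (pdiff D (q j)) ?\<nu>)"
        unfolding pdiff_sum_right by (intro sum.cong refl fun_cong[OF pdiff_commute])
      also have "\<dots> = 0" using kill by simp
      finally have "pdiff D ?R ?\<nu> = 0" .
      moreover have "pdiff D ?R ?\<nu> = c * ?R (?\<nu> + ?X) + pdiff R ?R ?\<nu>"
        unfolding D(1) pdiff_add_left pdiff_single ..
      moreover have "pdiff R ?R ?\<nu> = 0" unfolding pdiff_def[of R] using R0 by simp
      ultimately have "?R (?\<nu> + ?X) = 0" using D(2) by simp
      then show ?thesis using mu by simp
    qed
  qed
qed

section \<open>A lower bound for the Hilbert series\<close>

definition mcount :: "('v \<Rightarrow> nat) \<Rightarrow> 'v set \<Rightarrow> ('v multiset \<Rightarrow> bool) \<Rightarrow> real fps" where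
  "mcount w B Q = Abs_fps (\<lambda>k. real (card {\<mu>. set_mset \<mu> \<subseteq> B \<and> Q \<mu> \<and> wsize w \<mu> = k}))"

lemma finite_mcount:
  assumes "finite B" "\<forall>v\<in>B. w v \<ge> 1"
  shows "finite {\<mu>. set_mset \<mu> \<subseteq> B \<and> Q \<mu> \<and> wsize w \<mu> = k}"
proof (rule finite_subset)
  show "finite {\<mu>. set_mset \<mu> \<subseteq> B \<and> wsize w \<mu> = k}" by (rule finite_monomials) (use assms in auto)
qed auto

lemma mcount_insert:
  assumes "finite B" "\<forall>u\<in>insert v B. w u \<ge> 1" "v \<notin> B"
  shows "mcount w (insert v B) Q = mcount w B Q + fps_X ^ w v * mcount w (insert v B) (\<lambda>\<mu>. Q (add_mset v \<mu>))"
proof (rule fps_ext)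
  fix k
  let ?S = "\<lambda>B Q k. {\<mu>. set_mset \<mu> \<subseteq> B \<and> Q \<mu> \<and> wsize w \<mu> = k}"
  let ?Q = "\<lambda>\<mu>. Q (add_mset v \<mu>)"
  have fin: "finite (?S (insert v B) Q k)" for Q k by (rule finite_mcount) (use assms in auto)
  have "?S (insert v B) Q k = ?S B Q k \<union> add_mset v ` (if w v \<le> k then ?S (insert v B) ?Q (k - w v) else {})"
    (is "_ = _ \<union> ?R")
  proof (intro equalityI subsetI)
    fix \<mu> assume m: "\<mu> \<in> ?S (insert v B) Q k"
    show "\<mu> \<in> ?S B Q k \<union> ?R"
    proof (cases "v \<in># \<mu>")
      case True
      then obtain \<nu> where n: "\<mu> = add_mset v \<nu>" by (meson mset_add)
      then have "w v \<le> k" "\<nu> \<in> ?S (insert v B) ?Q (k - w v)" using m by auto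
      then show ?thesis using n by auto
    next
      case False
      then have "set_mset \<mu> \<subseteq> B" using m by auto
      then show ?thesis using m by auto
    qed
  next
    fix \<mu> assume "\<mu> \<in> ?S B Q k \<union> ?R"
    then show "\<mu> \<in> ?S (insert v B) Q k" by (auto split: if_splits)
  qed
  moreover have "card ?R = (if w v \<le> k then card (?S (insert v B) ?Q (k - w v)) else 0)"
    by (simp add: card_image inj_on_def)
  moreover have "?S B Q k \<inter> ?R = {}"
  proof (rule equals0I)
    fix \<mu> assume m: "\<mu> \<in> ?S B Q k \<inter> ?R"
    obtain \<nu> where "\<mu> = add_mset v \<nu>" using IntD2[OF m] by (rule imageE)
    then have "v \<in># \<mu>" by simp
    moreover have "set_mset \<mu> \<subseteq> B" using IntD1[OF m] by (rule CollectE) (rule conjunct1)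
    ultimately show False using assms(3) by (rule_tac notE[OF assms(3) subsetD])
  qed
  moreover have "finite ?R" using fin by auto
  moreover have "finite (?S B Q k)" by (rule finite_mcount) (use assms in auto)
  ultimately have "card (?S (insert v B) Q k) = card (?S B Q k) +
      (if w v \<le> k then card (?S (insert v B) ?Q (k - w v)) else 0)"
    by (simp add: card_Un_disjoint)
  then show "fps_nth (mcount w (insert v B) Q) k =
      fps_nth (mcount w B Q + fps_X ^ w v * mcount w (insert v B) ?Q) k"
    by (auto simp: mcount_def fps_X_power_mult_nth)
qed

lemma geo_solve:
  assumes "w \<ge> 1" "f = g + fps_X ^ w * f" shows "f = geo w * g"
proof -
  have "(1 - fps_X ^ w) * f = g" using assms(2) unfolding left_diff_distrib mult_1_left diff_eq_eq .
  then have "geo w * g = geo w * ((1 - fps_X ^ w) * f)" by simp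
  also have "\<dots> = ((1 - fps_X ^ w) * geo w) * f" by (simp only: ac_simps)
  finally have "geo w * g = ((1 - fps_X ^ w) * geo w) * f" .
  then show ?thesis using geo_mult[OF assms(1)] by simp
qed

lemma mcount_insert_free:
  assumes "finite B" "\<forall>u\<in>insert v B. w u \<ge> 1" "v \<notin> B" "\<forall>\<mu>. Q (add_mset v \<mu>) = Q \<mu>"
  shows "mcount w (insert v B) Q = geo (w v) * mcount w B Q"
proof (rule geo_solve)
  have Q: "(\<lambda>\<mu>. Q (add_mset v \<mu>)) = Q" using assms(4) by (simp add: fun_eq_iff)
  show "mcount w (insert v B) Q = mcount w B Q + fps_X ^ w v * mcount w (insert v B) Q"
    using mcount_insert[OF assms(1-3), of Q] unfolding Q .
qed (use assms(2) in simp)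

lemma mcount_all:
  assumes "finite B" "\<forall>u\<in>set vs \<union> B. w u \<ge> 1" "distinct vs" "set vs \<inter> B = {}"
  shows "mcount w (set vs \<union> B) (\<lambda>_. True) = geos w vs * mcount w B (\<lambda>_. True)"
  using assms(2-)
proof (induction vs)
  case (Cons v vs)
  have "mcount w (insert v (set vs \<union> B)) (\<lambda>_. True) = geo (w v) * mcount w (set vs \<union> B) (\<lambda>_. True)"
  proof (rule mcount_insert_free)
    show "finite (set vs \<union> B)" using assms(1) by simp
    show "\<forall>u\<in>insert v (set vs \<union> B). 1 \<le> w u" using Cons.prems(1) by simp
    show "v \<notin> set vs \<union> B" using Cons.prems(2,3) by simp
  qed simp
  moreover have "mcount w (set vs \<union> B) (\<lambda>_. True) = geos w vs * mcount w B (\<lambda>_. True)"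
    by (rule Cons.IH) (use Cons.prems in auto)
  ultimately show ?case by (simp add: mult.assoc)
qed simp

lemma mcount_empty: "mcount w {} (\<lambda>_. True) = 1"
proof (rule fps_ext)
  fix k
  have "{\<mu>. set_mset \<mu> \<subseteq> {} \<and> True \<and> wsize w \<mu> = k} = (if k = 0 then {{#}} else {})" by auto
  then show "fps_nth (mcount w {} (\<lambda>_. True)) k = fps_nth 1 k" by (simp add: mcount_def)
qed

locale minor_count =
  fixes w :: "'v \<Rightarrow> nat" and A :: "'v set" and t :: "nat \<Rightarrow> 'v" and r :: nat and k :: "nat \<Rightarrow> nat"
  assumes fin: "finite A" and t: "inj_on t {..<r}" "t ` {..<r} \<inter> A = {}"
    and w: "\<And>v. v \<in> A \<Longrightarrow> w v \<ge> 1" and k: "\<And>i. i < r \<Longrightarrow> w (t i) = k i" "\<And>i. i < r \<Longrightarrow> k i \<ge> 1"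
begin

abbreviation "B i \<equiv> A \<union> t ` {..<i}"
abbreviation "few i n \<equiv> (\<lambda>\<mu>. card (set_mset \<mu> \<inter> t ` {..<i}) < n)"
abbreviation "S n i \<equiv> fps_of_poly (spoly k n i)"
abbreviation "M \<equiv> mcount w A (\<lambda>_. True)"

lemma B_Suc: "B (Suc i) = insert (t i) (B i)" by (auto simp: lessThan_Suc)

lemma t_fresh: "i < r \<Longrightarrow> t i \<notin> B i" "i < r \<Longrightarrow> t i \<notin> t ` {..<i}"
  using t by (auto dest!: inj_onD)

lemma B_pos: "i \<le> r \<Longrightarrow> u \<in> B i \<Longrightarrow> w u \<ge> 1"
  using w k by auto

lemma finite_B: "finite (B i)" using fin by simp

lemma mcount_few_0: "mcount w C (few i 0) = 0"
  by (rule fps_ext) (simp add: mcount_def)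

text \<open>A monomial either omits \<open>t i\<close>, or contains it and may then contain one
  fewer of the earlier variables. In the second case the exponent of \<open>t i\<close> is any
  positive number.\<close>

lemma mcount_few_Suc:
  assumes i: "i < r"
  shows "mcount w (B (Suc i)) (few (Suc i) (Suc n)) =
    mcount w (B i) (few i (Suc n)) + fps_X ^ k i * geo (k i) * mcount w (B i) (few i n)"
proof -
  have pos: "\<forall>u\<in>insert (t i) (B i). w u \<ge> 1" using B_pos[of "Suc i"] i unfolding B_Suc by auto
  have q: "(\<lambda>\<mu>. few (Suc i) (Suc n) (add_mset (t i) \<mu>)) = few i n"
  proof
    fix \<mu>
    have "set_mset (add_mset (t i) \<mu>) \<inter> t ` {..<Suc i} = insert (t i) (set_mset \<mu> \<inter> t ` {..<i})"
      by (auto simp: lessThan_Suc)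
    then show "few (Suc i) (Suc n) (add_mset (t i) \<mu>) = few i n \<mu>" using t_fresh(2)[OF i] by simp
  qed
  have q': "\<forall>\<mu>. few i n (add_mset (t i) \<mu>) = few i n \<mu>" using t_fresh(2)[OF i] by simp
  have e: "mcount w (B i) (few (Suc i) (Suc n)) = mcount w (B i) (few i (Suc n))"
  proof -
    have "{\<mu>. set_mset \<mu> \<subseteq> B i \<and> few (Suc i) (Suc n) \<mu> \<and> wsize w \<mu> = l} =
      {\<mu>. set_mset \<mu> \<subseteq> B i \<and> few i (Suc n) \<mu> \<and> wsize w \<mu> = l}" for l
    proof (rule Collect_cong, rule conj_cong[OF refl])
      fix \<mu> assume "set_mset \<mu> \<subseteq> B i"
      then have "t i \<notin> set_mset \<mu>" using t_fresh(1)[OF i] by blast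
      then have "set_mset \<mu> \<inter> t ` {..<Suc i} = set_mset \<mu> \<inter> t ` {..<i}" by (auto simp: lessThan_Suc)
      then show "(few (Suc i) (Suc n) \<mu> \<and> wsize w \<mu> = l) = (few i (Suc n) \<mu> \<and> wsize w \<mu> = l)" by simp
    qed
    then show ?thesis by (simp add: mcount_def)
  qed
  have "mcount w (insert (t i) (B i)) (few (Suc i) (Suc n)) = mcount w (B i) (few i (Suc n)) +
      fps_X ^ w (t i) * mcount w (insert (t i) (B i)) (few i n)"
    using mcount_insert[OF finite_B pos t_fresh(1)[OF i], of "few (Suc i) (Suc n)"] unfolding q e .
  also have "mcount w (insert (t i) (B i)) (few i n) = geo (w (t i)) * mcount w (B i) (few i n)"
    by (rule mcount_insert_free[OF finite_B pos t_fresh(1)[OF i] q'])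
  finally show ?thesis using k(1)[OF i] unfolding B_Suc by (simp add: mult.assoc)
qed

lemma geo_k: "i < r \<Longrightarrow> (1 - fps_X ^ k i) * geo (k i) = 1"
  using geo_mult k(2) by blast

lemma S_0: "S 0 i = 0" by simp

lemma S_Suc: "S (Suc n) (Suc i) = (1 - fps_X ^ k i) * S (Suc n) i + fps_X ^ k i * S n i"
  by (simp add: fps_of_poly_add fps_of_poly_mult fps_of_poly_diff fps_of_poly_monom)

text \<open>Over the common denominator, the recursion \<open>mcount_few_Suc\<close> is the one
  satisfied by the differences of \<open>spoly\<close> in its number of generators.\<close>

lemma mcount_few: "i \<le> r \<Longrightarrow> mcount w (B i) (few i (Suc n)) = (S (Suc n) i - S n i) * (\<Prod>l<i. geo (k l)) * M"
proof (induction i arbitrary: n)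
  case 0
  have "S (Suc n) 0 - S n 0 = 1"
    by (cases n) (simp_all add: fps_of_poly_diff[symmetric] fps_of_poly_add[symmetric])
  then show ?case by (simp add: mcount_def)
next
  case (Suc i)
  let ?x = "fps_X ^ k i" and ?g = "geo (k i)" and ?P = "\<Prod>l<i. geo (k l)"
  have i: "i < r" "i \<le> r" using Suc.prems by auto
  have g: "(1 - ?x) * ?g = 1" by (rule geo_k[OF i(1)])
  \<comment> \<open>For n = 0 no monomial qualifies, so the lower neighbour of the difference is 0
    by convention.\<close>
  define D where "D = (case n of 0 \<Rightarrow> 0 | Suc n' \<Rightarrow> S n i - S n' i)"
  have D: "mcount w (B i) (few i n) = D * ?P * M"
    using Suc.IH[OF i(2), of "n - 1"] by (cases n) (simp_all only: D_def mcount_few_0 nat.case mult_zero_left diff_Suc_1)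
  have SD: "S (Suc n) (Suc i) - S n (Suc i) = (1 - ?x) * (S (Suc n) i - S n i) + ?x * D"
  proof (cases n)
    case 0
    then show ?thesis using S_Suc[of 0 i] S_0 by (simp add: D_def)
  next
    case (Suc n')
    then show ?thesis unfolding S_Suc[of n i] by (simp only: S_Suc[of n' i] D_def nat.case) (simp add: algebra_simps)
  qed
  have "mcount w (B (Suc i)) (few (Suc i) (Suc n)) = (S (Suc n) i - S n i) * ?P * M + ?x * ?g * (D * ?P * M)"
    unfolding mcount_few_Suc[OF i(1)] Suc.IH[OF i(2)] D ..
  also have "\<dots> = ((1 - ?x) * ?g) * ((S (Suc n) i - S n i) * ?P * M) + ?x * ?g * (D * ?P * M)"
    unfolding g by simp
  also have "\<dots> = ((1 - ?x) * (S (Suc n) i - S n i) + ?x * D) * (?P * ?g) * M" by (simp add: algebra_simps)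
  finally show ?case unfolding SD[symmetric] prod.lessThan_Suc .
qed

lemma mcount_few_r:
  assumes "i \<le> l" "l \<le> r"
  shows "mcount w (B l) (few i (Suc n)) = (S (Suc n) i - S n i) * (\<Prod>j<l. geo (k j)) * M"
  using assms
proof (induction l rule: dec_induct)
  case base then show ?case by (rule mcount_few)
next
  case (step l)
  have l: "l < r" using step by simp
  have pos: "\<forall>u\<in>insert (t l) (B l). w u \<ge> 1" using B_pos[of "Suc l"] l unfolding B_Suc by auto
  have "t l \<notin> t ` {..<i}" using t(1) l step(1) by (auto dest!: inj_onD)
  then have "mcount w (insert (t l) (B l)) (few i (Suc n)) = geo (w (t l)) * mcount w (B l) (few i (Suc n))"
    by (intro mcount_insert_free finite_B pos t_fresh l) auto
  then show ?case unfolding B_Suc using step l k(1)[OF l] by (simp add: algebra_simps)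
qed

lemma S_telescope: "S (Suc n) l = of_nat (Suc n) - (\<Sum>i<l. fps_X ^ k i * (S (Suc n) i - S n i))"
proof (induction l)
  case 0
  have "fps_of_poly (of_nat j) = of_nat j" for j by (induction j) (simp_all add: fps_of_poly_add)
  then have "S (Suc n) 0 = of_nat (Suc n)" unfolding spoly.simps .
  then show ?case by simp
next
  case (Suc l)
  have "S (Suc n) (Suc l) = S (Suc n) l - fps_X ^ k l * (S (Suc n) l - S n l)"
    unfolding S_Suc by (simp add: algebra_simps)
  also have "\<dots> = of_nat (Suc n) - (\<Sum>i<Suc l. fps_X ^ k i * (S (Suc n) i - S n i))"
    unfolding sum.lessThan_Suc Suc diff_diff_eq ..
  finally show ?case .
qed

lemma mcount_total: "l \<le> r \<Longrightarrow> mcount w (B l) (\<lambda>_. True) = (\<Prod>j<l. geo (k j)) * M"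
proof (induction l)
  case (Suc l)
  have l: "l < r" using Suc by simp
  have pos: "\<forall>u\<in>insert (t l) (B l). w u \<ge> 1" using B_pos[of "Suc l"] l unfolding B_Suc by auto
  have "mcount w (insert (t l) (B l)) (\<lambda>_. True) = geo (w (t l)) * mcount w (B l) (\<lambda>_. True)"
    by (intro mcount_insert_free finite_B pos t_fresh l) auto
  then show ?case unfolding B_Suc using Suc l k(1)[OF l] by (simp add: algebra_simps)
qed simp

text \<open>The left side counts unknown coefficients minus equations at the monomials containing
  fewer than Suc n of the earlier \<open>t\<close>.\<close>

lemma count_identity:
  "of_nat (Suc n) * mcount w (B r) (\<lambda>_. True) - (\<Sum>i<r. fps_X ^ k i * mcount w (B r) (few i (Suc n))) =
     S (Suc n) r * (\<Prod>j<r. geo (k j)) * M"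
proof -
  have "(\<Sum>i<r. fps_X ^ k i * mcount w (B r) (few i (Suc n))) =
      (\<Sum>i<r. fps_X ^ k i * (S (Suc n) i - S n i)) * ((\<Prod>j<r. geo (k j)) * M)"
    unfolding sum_distrib_right
  proof (rule sum.cong[OF refl])
    fix i assume "i \<in> {..<r}"
    then show "fps_X ^ k i * mcount w (B r) (few i (Suc n)) =
      fps_X ^ k i * (S (Suc n) i - S n i) * ((\<Prod>j<r. geo (k j)) * M)"
      using mcount_few_r[of i r n] by (simp only: mult.assoc) simp
  qed
  then show ?thesis unfolding S_telescope[of n r] mcount_total[OF order_refl] by (simp only: left_diff_distrib mult.assoc)
qed

text \<open>By \<open>relations_from_good\<close> the counted equations imply all the others, so
  unknowns minus counted equations bounds the dimension of the solutions from below.\<close>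

theorem hilb_lower_bound:
  fixes x :: "nat \<Rightarrow> real"
  assumes x: "inj x" and G: "\<And>i j. low (t ` {..<r}) 1 (G i j)"
    and F: "\<And>i j. F i j = G i j + Poly_Mapping.single {#t i#} (x i ^ j)"
    and Fw: "\<And>i j. i < r \<Longrightarrow> poly_of_weight w (k i) (F i j)"
  shows "S (Suc n) r * (\<Prod>j<r. geo (k j)) * M \<sqsubseteq> hilb w (sol (Suc n) r F (B r))"
  unfolding count_identity[symmetric] fps_le_def
proof
  fix \<kappa>
  let ?m = "Suc n"
  define T where "T = {..<?m} \<times> {\<mu>. set_mset \<mu> \<subseteq> B r \<and> wsize w \<mu> = \<kappa>}"
  \<comment> \<open>A relation of weight \<open>k i\<close> read off at \<mu> involves the
    coefficients of weight wsize w \<mu> + k i. The sum in place of a difference makes the set empty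
    when \<kappa> is smaller than \<open>k i\<close>.\<close>
  define N where "N i = {\<mu>. set_mset \<mu> \<subseteq> B r \<and> few i ?m \<mu> \<and> wsize w \<mu> + k i = \<kappa>}" for i
  define \<Gamma> where "\<Gamma> = Sigma {..<r} N"
  have finM: "finite {\<mu>. set_mset \<mu> \<subseteq> B r \<and> wsize w \<mu> = \<kappa>}"
    by (rule finite_monomials[OF finite_B]) (use B_pos[of r] in blast)
  have fT: "finite T" unfolding T_def using finM by simp
  have fN: "finite (N i)" for i
  proof -
    have "N i \<subseteq> {\<mu>. set_mset \<mu> \<subseteq> B r \<and> few i ?m \<mu> \<and> wsize w \<mu> = \<kappa> - k i}" by (auto simp: N_def)
    moreover have "finite {\<mu>. set_mset \<mu> \<subseteq> B r \<and> few i ?m \<mu> \<and> wsize w \<mu> = \<kappa> - k i}"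
      by (rule finite_mcount[OF finite_B]) (use B_pos[of r] in blast)
    ultimately show ?thesis by (rule finite_subset)
  qed
  define \<phi> where "\<phi> p q = (\<Sum>j<?m. pdiff (F (fst p) j) (q j) (snd p))" for p q
  have lin: "Vector_Spaces.linear fam_scale (*) (\<phi> p)" for p
    by (rule fam_real_linearI) (simp_all add: \<phi>_def pdiff_add_right pdiff_scale sum.distrib sum_distrib_left del: sum.lessThan_Suc)
  let ?V = "supported T"
  have VT: "?V = ambient ?m (B r) \<inter> of_weight w \<kappa>" unfolding T_def ambient_of_weight ..
  have "fam.dim ?V \<le> fam.dim {q \<in> ?V. \<forall>p\<in>\<Gamma>. \<phi> p q = 0} + card \<Gamma>"
    by (rule dim_common_kernel[OF subspace_supported fin_gen_supported[OF fT]]) (use fN lin in \<open>auto simp: \<Gamma>_def\<close>)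
  also have "fam.dim {q \<in> ?V. \<forall>p\<in>\<Gamma>. \<phi> p q = 0} \<le> fam.dim (sol ?m r F (B r) \<inter> of_weight w \<kappa>)"
  proof (rule fam.dim_mono_fin_gen)
    interpret weighted w ?m "B r" by (unfold_locales; (rule finite_B | rule B_pos[OF order_refl]))
    show "fin_gen fam_scale (sol ?m r F (B r) \<inter> of_weight w \<kappa>)" by (rule fin_gen_weight[OF sol_ambient])
    show "{q \<in> ?V. \<forall>p\<in>\<Gamma>. \<phi> p q = 0} \<subseteq> sol ?m r F (B r) \<inter> of_weight w \<kappa>"
    proof
      fix q assume q: "q \<in> {q \<in> ?V. \<forall>p\<in>\<Gamma>. \<phi> p q = 0}"
      then have qa: "q \<in> ambient ?m (B r)" "q \<in> of_weight w \<kappa>" using VT by auto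
      have "(\<Sum>j<?m. pdiff (F i j) (q j) \<mu>) = 0" if i: "i < r" and few: "few i ?m \<mu>" for i \<mu>
      proof (cases "\<mu> \<in> N i")
        case True
        then have "\<phi> (i, \<mu>) q = 0" using q i unfolding \<Gamma>_def by blast
        then show ?thesis by (simp add: \<phi>_def)
      next
        case False
        have "pdiff (F i j) (q j) \<mu> = 0" for j
        proof (rule ccontr)
          assume "pdiff (F i j) (q j) \<mu> \<noteq> 0"
          then obtain \<beta> where b: "\<beta> \<in> Poly_Mapping.keys (F i j)" "q j (\<mu> + \<beta>) \<noteq> 0" by (rule pdiff_neq_0E)
          have "wsize w \<beta> = k i" using Fw[OF i] b(1) by (simp add: poly_of_weight_def)
          moreover have "wsize w (\<mu> + \<beta>) = \<kappa>" using qa(2) b(2) unfolding of_weight_def by blast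
          moreover have "set_mset (\<mu> + \<beta>) \<subseteq> B r" using qa(1) b(2) unfolding ambient_def by blast
          ultimately show False using False few by (simp add: N_def)
        qed
        then show ?thesis by simp
      qed
      then have "(\<Sum>j<?m. pdiff (F i j) (q j) \<mu>) = 0" if "i < r" for i \<mu>
        by (rule relations_from_good[OF t(1) x G F _ that])
      moreover have "size \<mu> \<le> \<kappa>" if "q j \<mu> \<noteq> 0" for j \<mu>
      proof -
        have "set_mset \<mu> \<subseteq> B r" "wsize w \<mu> = \<kappa>" using qa that unfolding ambient_def of_weight_def by blast+
        then show ?thesis using size_le_wsize[of \<mu> w] B_pos[of r] by auto
      qed
      ultimately show "q \<in> sol ?m r F (B r) \<inter> of_weight w \<kappa>" using qa by (auto simp: sol_def)
    qed
  qed
  finally have "fam.dim ?V \<le> fam.dim (sol ?m r F (B r) \<inter> of_weight w \<kappa>) + card \<Gamma>" by simp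
  moreover have "fam.dim ?V = ?m * card {\<mu>. set_mset \<mu> \<subseteq> B r \<and> wsize w \<mu> = \<kappa>}"
    unfolding dim_supported[OF fT] by (simp add: T_def card_cartesian_product)
  moreover have "card \<Gamma> = (\<Sum>i<r. card (N i))" unfolding \<Gamma>_def by (rule card_SigmaI) (use fN in auto)
  ultimately have main: "real ?m * real (card {\<mu>. set_mset \<mu> \<subseteq> B r \<and> wsize w \<mu> = \<kappa>}) - (\<Sum>i<r. real (card (N i))) \<le>
      real (fam.dim (sol ?m r F (B r) \<inter> of_weight w \<kappa>))"
    by (simp only: of_nat_mult[symmetric] of_nat_sum[symmetric])
  have N: "fps_nth (fps_X ^ k i * mcount w (B r) (few i ?m)) \<kappa> = real (card (N i))" for i
  proof (cases "\<kappa> < k i")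
    case False
    then have "N i = {\<mu>. set_mset \<mu> \<subseteq> B r \<and> few i ?m \<mu> \<and> wsize w \<mu> = \<kappa> - k i}" by (auto simp: N_def)
    then show ?thesis using False by (simp add: fps_X_power_mult_nth mcount_def)
  next
    case True
    then have "N i = {}" by (auto simp: N_def)
    then show ?thesis using True by (simp add: fps_X_power_mult_nth)
  qed
  have "fps_nth (of_nat ?m * mcount w (B r) (\<lambda>_. True)) \<kappa> = real ?m * real (card {\<mu>. set_mset \<mu> \<subseteq> B r \<and> wsize w \<mu> = \<kappa>})"
    by (simp only: fps_of_nat[symmetric] fps_mult_left_const_nth) (simp add: mcount_def)
  then show "fps_nth (of_nat ?m * mcount w (B r) (\<lambda>_. True) - (\<Sum>i<r. fps_X ^ k i * mcount w (B r) (few i ?m))) \<kappa> \<le>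
      fps_nth (hilb w (sol ?m r F (B r))) \<kappa>"
    using main by (simp only: fps_sub_nth fps_sum_nth N hilb_def fps_nth_Abs_fps)
qed

end

section \<open>Elimination\<close>

text \<open>A matrix congruent to P^e times the identity modulo an ideal has an annihilator, of the
  kind a determinant would give, that is congruent to a power of P. It is built by Gaussian
  elimination without division.\<close>

lemma (in Modules.module) elimination:
  fixes m :: nat
  assumes I: "0 \<in> I" "\<And>x y. x \<in> I \<Longrightarrow> y \<in> I \<Longrightarrow> x + y \<in> I" "\<And>x y. y \<in> I \<Longrightarrow> x * y \<in> I"
  shows "(\<forall>j<m. \<forall>l<m. a j l - (if j = l then P ^ e else 0) \<in> I) \<Longrightarrow>
    \<exists>D e. D - P ^ e \<in> I \<and>
      (\<forall>u. (\<forall>j<m. (\<Sum>l<m. scale (a j l) (u l)) = 0) \<longrightarrow> (\<forall>l<m. scale D (u l) = 0))"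
proof (induction m arbitrary: a e)
  case 0
  then show ?case using I(1) by (intro exI[of _ 1] exI[of _ 0]) simp
next
  case (Suc m)
  have uminus: "- x \<in> I" if "x \<in> I" for x using I(3)[OF that, of "-1"] by simp
  have diff: "x - y \<in> I" if "x \<in> I" "y \<in> I" for x y using I(2)[OF that(1) uminus[OF that(2)]] by simp
  have cong: "x * y - x' * y' \<in> I" if "x - x' \<in> I" "y - y' \<in> I" for x x' y y'
  proof -
    have "x * (y - y') + y' * (x - x') \<in> I" using that I by blast
    then show ?thesis by (simp add: algebra_simps)
  qed
  \<comment> \<open>The pivot is \<open>a m m\<close>. Products of two entries close to P^e are
    close to P^(e + e), hence the doubled exponent.\<close>
  define a' where "a' j l = a m m * a j l - a j m * a m l" for j l
  have near: "a j l - (if j = l then P ^ e else 0) \<in> I" if "j < Suc m" "l < Suc m" for j l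
    using Suc.prems that by blast
  have mm: "a m m - P ^ e \<in> I" using near[of m m] by simp
  have "\<forall>j<m. \<forall>l<m. a' j l - (if j = l then P ^ (e + e) else 0) \<in> I"
  proof (intro allI impI)
    fix j l assume jl: "j < m" "l < m"
    have "a j l - (if j = l then P ^ e else 0) \<in> I" using near jl by simp
    from cong[OF mm this]
    have "a m m * a j l - (if j = l then P ^ (e + e) else 0) \<in> I" by (simp add: power_add split: if_splits)
    moreover have "a m l \<in> I" using near[of m l] jl by simp
    then have "a j m * a m l \<in> I" by (rule I(3))
    ultimately have "(a m m * a j l - (if j = l then P ^ (e + e) else 0)) - a j m * a m l \<in> I" by (rule diff)
    then show "a' j l - (if j = l then P ^ (e + e) else 0) \<in> I" by (simp add: a'_def algebra_simps)
  qed
  from Suc.IH[OF this] obtain D e' where D: "D - P ^ e' \<in> I"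
    "\<And>u l. \<forall>j<m. (\<Sum>l<m. scale (a' j l) (u l)) = 0 \<Longrightarrow> l < m \<Longrightarrow> scale D (u l) = 0" by blast
  have "scale (D * a m m) (u l) = 0"
    if u: "\<forall>j<Suc m. (\<Sum>l<Suc m. scale (a j l) (u l)) = 0" and l: "l < Suc m" for u l
  proof -
    have row: "(\<Sum>l<m. scale (a j l) (u l)) = - scale (a j m) (u m)" if "j < Suc m" for j
      using u that by (simp add: add_eq_0_iff2)
    have "(\<Sum>l<m. scale (a' j l) (u l)) = 0" if j: "j < m" for j
    proof -
      have "(\<Sum>l<m. scale (a' j l) (u l)) =
          scale (a m m) (\<Sum>l<m. scale (a j l) (u l)) - scale (a j m) (\<Sum>l<m. scale (a m l) (u l))"
        by (simp add: a'_def scale_left_diff_distrib sum_subtractf scale_sum_right)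
      also have "\<dots> = 0" using row[of j] row[of m] j by (simp add: mult.commute)
      finally show ?thesis .
    qed
    then have z: "scale D (u l) = 0" if "l < m" for l using D(2) that by blast
    show ?thesis
    proof (cases "l = m")
      case False
      then have "scale (a m m) (scale D (u l)) = 0" using z[of l] l by simp
      then show ?thesis by (simp add: mult.commute)
    next
      case True
      have "scale (D * a m m) (u m) = - scale D (\<Sum>l<m. scale (a m l) (u l))" using row[of m] by simp
      also have "(\<Sum>l<m. scale D (scale (a m l) (u l))) = (\<Sum>l<m. scale (a m l) (scale D (u l)))"
        by (simp add: mult.commute)
      then have "scale D (\<Sum>l<m. scale (a m l) (u l)) = (\<Sum>l<m. scale (a m l) (scale D (u l)))"
        by (simp only: scale_sum_right)
      also have "\<dots> = 0" using z by (intro sum.neutral) simp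
      finally show ?thesis using True by simp
    qed
  qed
  moreover have "D * a m m - P ^ (e' + e) \<in> I" using cong[OF D(1) mm] by (simp add: power_add)
  ultimately show ?case by blast
qed

text \<open>If the submodule generated by the relations and the \<open>\<theta> e\<^sub>l\<close> missed the monomial \<open>\<beta> e\<^sub>j\<close>, a linear
  functional separating the two would be a nonzero solution of weight \<open>E\<close> killed by all \<open>\<theta>\<close>.\<close>

lemma monomial_in_submodule:
  fixes f :: "nat \<Rightarrow> nat \<Rightarrow> 'v multiset \<Rightarrow>\<^sub>0 real"
  assumes f: "\<And>i j \<beta>. \<beta> \<in> Poly_Mapping.keys (f i j) \<Longrightarrow> set_mset \<beta> \<subseteq> A \<and> wsize w \<beta> = k i"
    and ls: "\<And>\<theta> \<beta>. \<theta> \<in> L \<Longrightarrow> \<beta> \<in> Poly_Mapping.keys \<theta> \<Longrightarrow> set_mset \<beta> \<subseteq> A \<and> wsize w \<beta> = 1" and L: "finite L"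
    and pos: "\<And>v. v \<in> A \<Longrightarrow> w v \<ge> 1"
    and triv: "\<And>q. q \<in> sol m r f A \<Longrightarrow> q \<in> of_weight w E \<Longrightarrow> \<forall>\<theta>\<in>L. vdiff \<theta> q = 0 \<Longrightarrow> q = 0"
    and \<beta>: "set_mset \<beta> \<subseteq> A" "wsize w \<beta> = E" and j: "j < m"
  shows "\<exists>G h. \<forall>l<m. (if l = j then Poly_Mapping.single \<beta> 1 else 0) = (\<Sum>a<r. G a * f a l) + (\<Sum>\<theta>\<in>L. h \<theta> l * \<theta>)"
proof (rule ccontr)
  assume neg: "\<not> ?thesis"
  define sc :: "real \<Rightarrow> (nat \<Rightarrow> 'v multiset \<Rightarrow>\<^sub>0 real) \<Rightarrow> _" where "sc c Q = (\<lambda>l. Poly_Mapping.single 0 c * Q l)" for c Q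
  interpret vs: vector_space sc
    by unfold_locales
      (simp_all add: sc_def fun_eq_iff distrib_left distrib_right single_add mult_single mult.assoc[symmetric])
  interpret vp: vector_space_pair sc "(*) :: real \<Rightarrow> real \<Rightarrow> real" ..
  define e :: "nat \<Rightarrow> 'v multiset \<Rightarrow> nat \<Rightarrow> 'v multiset \<Rightarrow>\<^sub>0 real" where
    "e l \<alpha> = (\<lambda>l'. if l' = l then Poly_Mapping.single \<alpha> 1 else 0)" for l \<alpha>
  define tup where "tup G h = (\<lambda>l. if l < m then (\<Sum>a<r. G a * f a l) + (\<Sum>\<theta>\<in>L. h \<theta> l * \<theta>) else 0)"
    for G :: "nat \<Rightarrow> 'v multiset \<Rightarrow>\<^sub>0 real" and h
  define W where "W = {tup G h | G h. True}"
  have sub: "vs.subspace W"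
  proof (rule vs.subspaceI)
    have "tup (\<lambda>_. 0) (\<lambda>_ _. 0) = 0" by (simp add: tup_def fun_eq_iff)
    then show "0 \<in> W" unfolding W_def by (metis (mono_tags, lifting) mem_Collect_eq)
    have "tup G h + tup G' h' = tup (\<lambda>a. G a + G' a) (\<lambda>\<theta> l. h \<theta> l + h' \<theta> l)" for G h G' h'
      by (simp add: tup_def fun_eq_iff distrib_right sum.distrib)
    then show "x + y \<in> W" if "x \<in> W" "y \<in> W" for x y
      using that unfolding W_def by (smt (verit, best) mem_Collect_eq)
    have "sc c (tup G h) = tup (\<lambda>a. Poly_Mapping.single 0 c * G a) (\<lambda>\<theta> l. Poly_Mapping.single 0 c * h \<theta> l)" for c G h
      by (simp add: tup_def sc_def fun_eq_iff distrib_left sum_distrib_left mult.assoc)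
    then show "sc c x \<in> W" if "x \<in> W" for c x
      using that unfolding W_def by (smt (verit, best) mem_Collect_eq)
  qed
  have notin: "e j \<beta> \<notin> W"
  proof
    assume "e j \<beta> \<in> W"
    then obtain G h where "e j \<beta> = tup G h" unfolding W_def by blast
    then have "e j \<beta> l = tup G h l" for l by simp
    then have "\<forall>l<m. (if l = j then Poly_Mapping.single \<beta> 1 else 0) = (\<Sum>a<r. G a * f a l) + (\<Sum>\<theta>\<in>L. h \<theta> l * \<theta>)"
      by (simp add: e_def tup_def)
    then show False using neg by blast
  qed
  obtain B where B: "B \<subseteq> W" "vs.independent B" "W \<subseteq> vs.span B" using vs.basis_exists by metis
  have "e j \<beta> \<notin> vs.span B" using notin vs.span_minimal[OF B(1) sub] by blast
  then have "vs.independent (insert (e j \<beta>) B)" using B(2) by (simp add: vs.independent_insert)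
  from vp.linear_independent_extend[OF this, of "\<lambda>b. if b = e j \<beta> then 1 else 0"]
  obtain g where g: "Vector_Spaces.linear sc (*) g" "\<forall>x\<in>insert (e j \<beta>) B. g x = (if x = e j \<beta> then 1 else 0)" by blast
  interpret g: Vector_Spaces.linear sc "(*)" g by (rule g)
  have gW: "g x = 0" if "x \<in> W" for x
  proof (rule g.eq_0_on_span[of B])
    show "x \<in> vs.span B" using that B(3) by blast
    show "g y = 0" if "y \<in> B" for y using g(2) that B(1) notin by auto
  qed
  \<comment> \<open>Only the values of \<open>g\<close> on monomials of weight \<open>E\<close> are
    kept. The generators are homogeneous, so each equation involves a single weight and this
    truncation is still a solution.\<close>
  define p where "p l \<alpha> = (if l < m \<and> set_mset \<alpha> \<subseteq> A \<and> wsize w \<alpha> = E then g (e l \<alpha>) else 0)" for l \<alpha>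
  \<comment> \<open>Contracting the homogeneous tuple \<open>Q\<close> with \<open>p\<close> at
    \<mu> amounts to evaluating \<open>g\<close> on the multiple of \<open>Q\<close> by the monomial
    \<mu>.\<close>
  have key: "(\<Sum>l<m. pdiff (Q l) (p l) \<mu>) =
      (if set_mset \<mu> \<subseteq> A \<and> wsize w \<mu> + d = E then g (\<lambda>l. if l < m then Poly_Mapping.single \<mu> 1 * Q l else 0) else 0)"
    if Q: "\<And>l \<gamma>. \<gamma> \<in> Poly_Mapping.keys (Q l) \<Longrightarrow> set_mset \<gamma> \<subseteq> A \<and> wsize w \<gamma> = d" for Q \<mu> d
  proof (cases "set_mset \<mu> \<subseteq> A \<and> wsize w \<mu> + d = E")
    case False
    have "pdiff (Q l) (p l) \<mu> = 0" for l
    proof (rule ccontr)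
      assume "pdiff (Q l) (p l) \<mu> \<noteq> 0"
      then obtain \<gamma> where c: "\<gamma> \<in> Poly_Mapping.keys (Q l)" "p l (\<mu> + \<gamma>) \<noteq> 0" by (rule pdiff_neq_0E)
      then have "set_mset (\<mu> + \<gamma>) \<subseteq> A \<and> wsize w (\<mu> + \<gamma>) = E" unfolding p_def by presburger
      then show False using False Q[OF c(1)] by simp
    qed
    then show ?thesis unfolding if_not_P[OF False] by simp
  next
    case True
    have fs: "(\<Sum>i\<in>S. F i) l = (\<Sum>i\<in>S. F i l)" for S l and F :: "'i \<Rightarrow> nat \<Rightarrow> 'v multiset \<Rightarrow>\<^sub>0 real"
      by (induction S rule: infinite_finite_induct) auto
    have "(\<lambda>l. if l < m then Poly_Mapping.single \<mu> 1 * Q l else 0) =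
        (\<Sum>l<m. \<Sum>\<gamma>\<in>Poly_Mapping.keys (Q l). sc (Poly_Mapping.lookup (Q l) \<gamma>) (e l (\<mu> + \<gamma>)))"
    proof
      fix l
      have "Poly_Mapping.single \<mu> 1 * Q l = Poly_Mapping.single \<mu> 1 *
          (\<Sum>\<gamma>\<in>Poly_Mapping.keys (Q l). Poly_Mapping.single \<gamma> (Poly_Mapping.lookup (Q l) \<gamma>))"
        by (simp only: poly_mapping_sum_single)
      also have "\<dots> = (\<Sum>\<gamma>\<in>Poly_Mapping.keys (Q l). Poly_Mapping.single (\<mu> + \<gamma>) (Poly_Mapping.lookup (Q l) \<gamma>))"
        by (simp add: sum_distrib_left mult_single)
      also have "(if l < m then \<dots> else 0) = (\<Sum>l'<m. if l' = l then
          (\<Sum>\<gamma>\<in>Poly_Mapping.keys (Q l'). Poly_Mapping.single (\<mu> + \<gamma>) (Poly_Mapping.lookup (Q l') \<gamma>)) else 0)"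
        by (simp add: sum.delta)
      also have "\<dots> = (\<Sum>l'<m. \<Sum>\<gamma>\<in>Poly_Mapping.keys (Q l'). sc (Poly_Mapping.lookup (Q l') \<gamma>) (e l' (\<mu> + \<gamma>)) l)"
        by (intro sum.cong) (auto simp: sc_def e_def mult_single)
      finally show "(if l < m then Poly_Mapping.single \<mu> 1 * Q l else 0) =
        (\<Sum>l<m. \<Sum>\<gamma>\<in>Poly_Mapping.keys (Q l). sc (Poly_Mapping.lookup (Q l) \<gamma>) (e l (\<mu> + \<gamma>))) l"
        by (simp only: fs)
    qed
    then have "g (\<lambda>l. if l < m then Poly_Mapping.single \<mu> 1 * Q l else 0) =
        (\<Sum>l<m. \<Sum>\<gamma>\<in>Poly_Mapping.keys (Q l). Poly_Mapping.lookup (Q l) \<gamma> * g (e l (\<mu> + \<gamma>)))"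
      by (simp only: g.sum g.scale)
    also have "\<dots> = (\<Sum>l<m. pdiff (Q l) (p l) \<mu>)"
      unfolding pdiff_def by (intro sum.cong refl) (use True Q in \<open>auto simp: p_def\<close>)
    finally show ?thesis using True by simp
  qed
  have rel: "(\<Sum>l<m. pdiff (f a l) (p l) \<mu>) = 0" if a: "a < r" for a \<mu>
  proof -
    have "(\<lambda>l. if l < m then Poly_Mapping.single \<mu> 1 * f a l else 0) =
        tup (\<lambda>a'. if a' = a then Poly_Mapping.single \<mu> 1 else 0) (\<lambda>_ _. 0)"
      using a by (simp add: tup_def fun_eq_iff if_distrib[of "\<lambda>x. x * _"] cong: if_cong)
    then have "g (\<lambda>l. if l < m then Poly_Mapping.single \<mu> 1 * f a l else 0) = 0" by (intro gW) (auto simp: W_def)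
    then show ?thesis using key[of "f a" "k a" \<mu>] f by simp
  qed
  have "pdiff \<theta> (p l) \<mu> = 0" if \<theta>: "\<theta> \<in> L" for \<theta> l \<mu>
  proof (cases "l < m")
    case False
    then have "p l = (\<lambda>_. 0)" by (simp add: p_def fun_eq_iff)
    then show ?thesis by simp
  next
    case True
    let ?Q = "\<lambda>l'. if l' = l then \<theta> else 0"
    have "(\<lambda>l. if l < m then Poly_Mapping.single \<mu> 1 * ?Q l else 0) =
        tup (\<lambda>_. 0) (\<lambda>\<theta>' l'. if \<theta>' = \<theta> then if l' = l then Poly_Mapping.single \<mu> 1 else 0 else 0)"
      using \<theta> L by (auto simp: tup_def fun_eq_iff if_distrib[of "\<lambda>x. x * _"] cong: if_cong)
    then have g0: "g (\<lambda>l. if l < m then Poly_Mapping.single \<mu> 1 * ?Q l else 0) = 0" by (intro gW) (auto simp: W_def)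
    have "set_mset \<gamma> \<subseteq> A \<and> wsize w \<gamma> = 1" if "\<gamma> \<in> Poly_Mapping.keys (?Q l')" for l' \<gamma>
      using ls[OF \<theta>, of \<gamma>] that by (cases "l' = l") auto
    from key[of ?Q 1 \<mu>, OF this] have "(\<Sum>l<m. pdiff (?Q l) (p l) \<mu>) = 0" unfolding g0 by (simp only: if_cancel)
    moreover have "(\<Sum>l'<m. pdiff (?Q l') (p l') \<mu>) = (\<Sum>l'<m. if l' = l then pdiff \<theta> (p l) \<mu> else 0)"
      by (intro sum.cong) auto
    ultimately show ?thesis using True by simp
  qed
  then have "\<forall>\<theta>\<in>L. vdiff \<theta> p = 0" by (simp add: vdiff_def fun_eq_iff)
  moreover have "p \<in> of_weight w E" unfolding of_weight_def p_def by auto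
  moreover have "p \<in> sol m r f A"
  proof -
    have "p \<in> ambient m A" unfolding ambient_def p_def by (simp split: if_splits)
    moreover have "size \<alpha> \<le> E" if "p l \<alpha> \<noteq> 0" for l \<alpha>
    proof -
      have "set_mset \<alpha> \<subseteq> A" "wsize w \<alpha> = E" using that unfolding p_def by presburger+
      then show ?thesis using size_le_wsize[of \<alpha> w] pos by blast
    qed
    ultimately show ?thesis using rel by (auto simp: sol_def)
  qed
  ultimately have "p = 0" by (intro triv)
  then have "p j \<beta> = 0" by simp
  then show False using g(2) j \<beta> by (simp add: p_def)
qed

section \<open>Deformation to generic relations\<close>

text \<open>\<open>XV\<close> names the given variables. Of the new ones, \<open>ZV\<close> fills
  the band and \<open>TV\<close> supplies one variable for each relation.\<close>

datatype 'n evar = XV 'n | ZV nat | TV nat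

lemma pdiff_outside:
  assumes "q \<in> ambient m A" "\<And>\<beta>. \<beta> \<in> Poly_Mapping.keys P \<Longrightarrow> \<not> set_mset \<beta> \<subseteq> A" shows "pdiff P (q j) = (\<lambda>_. 0)"
proof (rule ext, rule ccontr)
  fix \<alpha> assume "pdiff P (q j) \<alpha> \<noteq> 0"
  then obtain \<beta> where b: "\<beta> \<in> Poly_Mapping.keys P" "q j (\<alpha> + \<beta>) \<noteq> 0" by (rule pdiff_neq_0E)
  then have "set_mset (\<alpha> + \<beta>) \<subseteq> A" using assms(1) unfolding ambient_def by blast
  then show False using assms(2)[OF b(1)] by simp
qed

lemma sol_cong:
  assumes "\<And>i j q. i < r \<Longrightarrow> j < m \<Longrightarrow> q \<in> ambient m A \<Longrightarrow> pdiff (F i j) (q j) = pdiff (F' i j) (q j)"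
  shows "sol m r F A = sol m r F' A"
proof -
  have "(\<forall>i<r. \<forall>\<alpha>. (\<Sum>j<m. pdiff (F i j) (q j) \<alpha>) = 0) = (\<forall>i<r. \<forall>\<alpha>. (\<Sum>j<m. pdiff (F' i j) (q j) \<alpha>) = 0)"
    if "q \<in> ambient m A" for q
    using assms[OF _ _ that] by simp
  then show ?thesis unfolding sol_def by blast
qed

lemma hilb_sol_strip:
  assumes "finite A" "\<And>u. u \<in> A \<union> set (us @ vs) \<Longrightarrow> w u \<ge> 1" "distinct (us @ vs)" "set (us @ vs) \<inter> A = {}"
    and "hilb w (sol m r F (A \<union> set (us @ vs))) = geos w (us @ vs) * hilb w (sol m r F A)"
  shows "hilb w (sol m r F (A \<union> set vs)) = geos w vs * hilb w (sol m r F A)"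
  using assms(2-)
proof (induction us)
  case (Cons u us)
  have "hilb w (sol m r F (A \<union> set (us @ vs))) = geos w (us @ vs) * hilb w (sol m r F A)"
    by (rule hilb_sol_chain_eq(1)[OF assms(1), of "u"]) (use Cons.prems in \<open>simp_all only: append_Cons\<close>)
  moreover have "w v \<ge> 1" if "v \<in> A \<union> set (us @ vs)" for v using Cons.prems(1) that by simp
  ultimately show ?case using Cons.IH Cons.prems(2,3) by simp
qed simp

interpretation pdiff: Modules.module pdiff
  by (rule Modules.module.intro) (simp_all add: plus_fun_def pdiff_add_left pdiff_add_right pdiff_mult)

locale perturbation =
  fixes f :: "nat \<Rightarrow> nat \<Rightarrow> 'n::finite evar multiset \<Rightarrow>\<^sub>0 real" and k :: "nat \<Rightarrow> nat" and m c :: nat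
  assumes m: "m \<ge> 1" and k: "\<And>i. k i \<ge> 1"
    and f: "\<And>i j \<beta>. \<beta> \<in> Poly_Mapping.keys (f i j) \<Longrightarrow> set_mset \<beta> \<subseteq> range XV \<and> size \<beta> = k i"
begin

abbreviation "r \<equiv> m + c"
abbreviation "X \<equiv> range XV :: 'n evar set"
abbreviation "Z \<equiv> ZV ` {..c} :: 'n evar set"

text \<open>The term with \<open>TV i\<close> is linear in that variable, so weight
  \<open>k i\<close> makes it homogeneous along with the rest of the i-th relation.\<close>

definition w :: "'n evar \<Rightarrow> nat" where "w v = (case v of TV i \<Rightarrow> k i | _ \<Rightarrow> 1)"

text \<open>The deformation by the variables \<open>TV i\<close> makes the maximal minors nonzero; that by the bands forces
  the locus over \<open>X = 0\<close> to have the expected codimension.\<close>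

definition F :: "nat \<Rightarrow> nat \<Rightarrow> 'n evar multiset \<Rightarrow>\<^sub>0 real" where
  "F i j = f i j + band ZV k i j + Poly_Mapping.single {#TV i#} (real i ^ j)"

definition xs :: "'n evar list" where "xs = (SOME xs. set xs = X \<and> distinct xs)"
definition zs :: "'n evar list" where "zs = map ZV [0..<Suc c]"
definition ts :: "'n evar list" where "ts = map TV [0..<r]"

lemma w_simps [simp]: "w (XV a) = 1" "w (ZV i) = 1" "w (TV i) = k i"
  by (simp_all add: w_def)

lemma w_pos: "w v \<ge> 1" using k by (cases v) auto

lemma xs: "set xs = X" "distinct xs"
  using someI_ex[OF finite_distinct_list[of X]] by (auto simp: xs_def)

lemma zs: "set zs = Z" "distinct zs" by (auto simp: zs_def distinct_map inj_on_def simp del: upt_Suc)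

lemma ts: "set ts = TV ` {..<r}" "distinct ts" by (auto simp: ts_def distinct_map inj_on_def)

lemma length_xs: "length xs = CARD('n)"
proof -
  have "length xs = card X" using xs distinct_card by metis
  also have "\<dots> = CARD('n)" by (intro card_image) (simp add: inj_on_def)
  finally show ?thesis .
qed

lemma length_zs: "length zs = Suc c" by (simp add: zs_def del: upt_Suc)

lemma geos_xs: "geos w xs = geo 1 ^ CARD('n)"
proof -
  have "geos w us = geo 1 ^ length us" if "set us \<subseteq> X" for us using that by (induction us) auto
  then show ?thesis using xs(1) length_xs by simp
qed

lemma geos_zs: "geos w zs = geo 1 ^ Suc c"
proof -
  have "geos w us = geo 1 ^ length us" if "set us \<subseteq> Z" for us using that by (induction us) auto
  from this[of zs] show ?thesis unfolding length_zs zs(1) by blast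
qed

lemma geos_ts: "geos w ts = (\<Prod>j<r. geo (k j))"
  by (simp add: ts_def o_def prod.distinct_set_conv_list[symmetric] atLeast0LessThan del: upt_Suc)

lemma wsize_X: "set_mset \<beta> \<subseteq> X \<Longrightarrow> wsize w \<beta> = size \<beta>"
  by (rule wsize_size) auto

lemma f_weight: "poly_of_weight w (k i) (f i j)"
  unfolding poly_of_weight_def using f wsize_X by metis

lemma poly_of_weight_add: "poly_of_weight w' d P \<Longrightarrow> poly_of_weight w' d Q \<Longrightarrow> poly_of_weight w' d (P + Q)"
  unfolding poly_of_weight_def using keys_add[of P Q] by blast

lemma F_weight: "poly_of_weight w (k i) (F i j)"
proof -
  have "wsize w (replicate_mset e (ZV a)) = e" for e a by (induction e) auto
  then have "poly_of_weight w (k i) (band ZV k i j)"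
    by (auto simp: band_def poly_of_weight_single) (simp add: poly_of_weight_def)
  then show ?thesis unfolding F_def
    by (intro poly_of_weight_add f_weight) (auto intro!: poly_of_weight_single)
qed

lemma f_outside: "\<beta> \<in> Poly_Mapping.keys (f i j) \<Longrightarrow> \<not> set_mset \<beta> \<subseteq> Z"
proof
  assume b: "\<beta> \<in> Poly_Mapping.keys (f i j)" "set_mset \<beta> \<subseteq> Z"
  then have "set_mset \<beta> = {}" using f[OF b(1)] by auto
  then show False using f[OF b(1)] k[of i] by simp
qed

lemma t_outside: "A \<subseteq> X \<union> Z \<Longrightarrow> \<beta> \<in> Poly_Mapping.keys (Poly_Mapping.single {#TV i#} x) \<Longrightarrow> \<not> set_mset \<beta> \<subseteq> A"
  by (auto split: if_splits)

lemma band_outside: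
  assumes "A \<subseteq> X \<union> Z" "A \<subseteq> X \<or> i - j > c" "\<beta> \<in> Poly_Mapping.keys (band ZV k i j)" shows "\<not> set_mset \<beta> \<subseteq> A"
proof -
  have "\<beta> = replicate_mset (k i) (ZV (i - j))" using assms(3) by (simp add: band_def split: if_splits)
  then have "ZV (i - j) \<in># \<beta>" using k[of i] by simp
  then show ?thesis using assms(1,2) by auto
qed

text \<open>The degrees \<open>k i\<close> are positive, so each monomial of \<open>f i j\<close>
  contains a variable outside \<open>Z\<close> and acts by zero; only the band survives.\<close>

lemma sol_Z: "sol m r F Z = sol m r (band ZV k) Z"
proof (rule sol_cong)
  fix i j q assume q: "q \<in> ambient m Z"
  show "pdiff (F i j) (q j) = pdiff (band ZV k i j) (q j)"
  proof -
    have "pdiff (f i j) (q j) = (\<lambda>_. 0)" by (rule pdiff_outside[OF q]) (rule f_outside)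
    moreover have "pdiff (Poly_Mapping.single {#TV i#} (real i ^ j)) (q j) = (\<lambda>_. 0)"
      by (rule pdiff_outside[OF q]) (rule t_outside[OF Un_upper2])
    ultimately show ?thesis unfolding F_def pdiff_add_left by simp
  qed
qed

lemma sol_X: "sol m r F X = sol m r f X"
proof (rule sol_cong)
  fix i j q assume q: "q \<in> ambient m X"
  show "pdiff (F i j) (q j) = pdiff (f i j) (q j)"
  proof -
    have "pdiff (band ZV k i j) (q j) = (\<lambda>_. 0)"
      by (rule pdiff_outside[OF q]) (rule band_outside[OF Un_upper1 disjI1[OF order_refl]])
    moreover have "pdiff (Poly_Mapping.single {#TV i#} (real i ^ j)) (q j) = (\<lambda>_. 0)"
      by (rule pdiff_outside[OF q]) (rule t_outside[OF Un_upper1])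
    ultimately show ?thesis unfolding F_def pdiff_add_left by simp
  qed
qed

text \<open>For the fully deformed system both bounds equal q times the product of the 1 / (1 - X^w)
  over \<open>ts @ xs\<close>. The sandwich forces equality at every stage, in particular once
  \<open>ts\<close> is removed; cancelling the product gives the series over
  \<open>Z\<close>.\<close>

lemma hilb_sol_XZ:
  shows "hilb w (sol m r F (Z \<union> X)) = geos w xs * hilb w (sol m r F Z)"
    and "hilb w (sol m r F Z) = fps_of_poly (qpoly k m c)"
proof -
  let ?q = "fps_of_poly (qpoly k m c)" and ?g = "geos w (ts @ xs)"
  have disj: "set (ts @ xs) \<inter> Z = {}" "distinct (ts @ xs)" using xs ts by auto
  have up1: "hilb w (sol m r F (Z \<union> set (ts @ xs))) \<sqsubseteq> ?g * hilb w (sol m r F Z)"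
    by (rule hilb_sol_chain) (use disj w_pos in auto)
  have "hilb w (sol m r F Z) \<sqsubseteq> ?q"
    unfolding sol_Z by (rule hilb_band_le) (use k in \<open>auto simp: inj_on_def\<close>)
  then have up2: "?g * hilb w (sol m r F Z) \<sqsubseteq> ?g * ?q" by (rule fps_le_mult[OF geos_nonneg])
  interpret minor_count w "X \<union> Z" TV r k by unfold_locales (use w_pos k in \<open>auto simp: inj_on_def\<close>)
  obtain n where n: "m = Suc n" using m by (cases m) auto
  have "S (Suc n) r * (\<Prod>j<r. geo (k j)) * M \<sqsubseteq> hilb w (sol (Suc n) r F (B r))"
  proof (rule hilb_lower_bound)
    show "inj real" by (simp add: inj_on_def)
    show "F i j = (f i j + band ZV k i j) + Poly_Mapping.single {#TV i#} (real i ^ j)" for i j by (simp add: F_def)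
    show "poly_of_weight w (k i) (F i j)" for i j by (rule F_weight)
    show "low (TV ` {..<r}) 1 (f i j + band ZV k i j)" for i j
    proof (rule low_add)
      have z: "degree_in (TV ` {..<r}) \<beta> = 0" if "set_mset \<beta> \<subseteq> X \<union> range ZV" for \<beta>
        using that by (induction \<beta>) auto
      show "low (TV ` {..<r}) 1 (f i j)" unfolding low_def using f z by (simp add: subset_iff)
      have "degree_in (TV ` {..<r}) (replicate_mset e (ZV a :: 'n evar)) = 0" for e a
        by (rule z) (simp add: subset_iff)
      then show "low (TV ` {..<r}) 1 (band ZV k i j :: 'n evar multiset \<Rightarrow>\<^sub>0 real)" by (auto simp: low_def band_def)
    qed
  qed
  moreover have "B r = Z \<union> set (ts @ xs)" using xs ts by auto
  \<comment> \<open>\<open>M\<close> contributes 1 / (1 - X) for each variable in \<open>xs\<close>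
    and \<open>zs\<close>. The factor (1 - X)^(c + 1) by which \<open>spoly\<close> differs from
    \<open>qpoly\<close> cancels the part that comes from \<open>zs\<close>.\<close>
  moreover have "S (Suc n) r * (\<Prod>j<r. geo (k j)) * M = ?g * ?q"
  proof -
    have "M = geos w (xs @ zs) * mcount w {} (\<lambda>_. True)"
      using mcount_all[of "{}" "xs @ zs" w] xs zs w_pos by auto
    then have M: "M = geos w xs * geo 1 ^ Suc c" using mcount_empty[of w] geos_zs by simp
    have S: "fps_of_poly (spoly k m r) = ?q * (1 - fps_X) ^ Suc c"
      unfolding qpoly_spoly[symmetric] fps_of_poly_mult fps_of_poly_power fps_of_poly_diff fps_of_poly_monom fps_of_poly_1
      by simp
    have g: "(1 - fps_X) ^ Suc c * geo 1 ^ Suc c = 1"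
      using geo_mult[of 1] by (simp only: power_mult_distrib[symmetric]) simp
    have "S m r * (\<Prod>j<r. geo (k j)) * M = ((1 - fps_X) ^ Suc c * geo 1 ^ Suc c) * (?q * geos w ts * geos w xs)"
      unfolding M S geos_ts by (simp only: ac_simps)
    also have "\<dots> = ?g * ?q" unfolding g by simp
    finally show ?thesis unfolding n .
  qed
  ultimately have low: "?g * ?q \<sqsubseteq> hilb w (sol m r F (Z \<union> set (ts @ xs)))" using n by simp
  have eq: "hilb w (sol m r F (Z \<union> set (ts @ xs))) = ?g * hilb w (sol m r F Z)"
    using up1 fps_le_trans[OF up2 low] by (rule fps_le_antisym)
  have "?g * hilb w (sol m r F Z) = ?g * ?q"
    using up2 fps_le_trans[OF low up1] by (rule fps_le_antisym)
  moreover have "?g \<noteq> 0" by (rule geos_nonzero) (rule w_pos)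
  ultimately show "hilb w (sol m r F Z) = ?q" by simp
  show "hilb w (sol m r F (Z \<union> X)) = geos w xs * hilb w (sol m r F Z)"
    using hilb_sol_strip[OF _ _ disj(2,1) eq] w_pos xs by simp
qed

end

sublocale perturbation \<subseteq> graded_sol w m "Z \<union> X" r F k
  by unfold_locales (use F_weight in auto)

context perturbation
begin

text \<open>The deformed system without \<open>ts\<close> has the series q / (1 - X)^n. Setting
  \<open>zs\<close> to zero multiplies it by (1 - X)^(c + 1), provided that \<open>zs\<close> is a
  regular sequence, and the trivial kernel is what guarantees this.\<close>

theorem hilb_sol_of_trivial_kernel:
  assumes ls: "\<And>\<theta> \<beta>. \<theta> \<in> set ls \<Longrightarrow> \<beta> \<in> Poly_Mapping.keys \<theta> \<Longrightarrow> set_mset \<beta> \<subseteq> X \<and> size \<beta> = 1"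
    and len: "length ls + Suc c = CARD('n)"
    and triv: "\<And>q. q \<in> sol m r f X \<Longrightarrow> q \<in> of_weight w E \<Longrightarrow> \<forall>\<theta>\<in>set ls. vdiff \<theta> q = 0 \<Longrightarrow> q = 0"
  shows "hilb w (sol m r f X) * (1 - fps_X) ^ length ls = fps_of_poly (qpoly k m c)"
proof -
  let ?\<Theta> = "ls @ map pvar zs"
  have ls1: "poly_of_weight w 1 \<theta>" if "\<theta> \<in> set ls" for \<theta>
    unfolding poly_of_weight_def using ls[OF that] wsize_X by metis
  have th1: "poly_of_weight w 1 \<theta>" if th: "\<theta> \<in> set ?\<Theta>" for \<theta>
  proof (cases "\<theta> \<in> set ls")
    case False
    then obtain v where "v \<in> set zs" "\<theta> = pvar v" using th by auto
    then show ?thesis using poly_of_weight_pvar[of w v] zs(1) by auto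
  qed (rule ls1)
  \<comment> \<open>Operators in \<open>I\<close> kill the homology. Modulo \<open>I\<close> the
    forms \<open>ls\<close> and the variables \<open>zs\<close> vanish, hence the band does, and the
    relations alone reach the E-th power of \<open>x\<close> in every component.
    \<open>elimination\<close> turns this into an operator that kills all solutions and is a power
    of \<open>x\<close> modulo \<open>I\<close>. It lies in \<open>I\<close>, and so does that
    power.\<close>
  have nil: "\<exists>e. bounding (x ^ e) us i" if x: "x \<in> set (rev (map pvar xs))" and us: "set ?\<Theta> \<subseteq> set us" for x us i
  proof -
    obtain v where v: "x = pvar v" "v \<in> X" using x xs(1) by auto
    define I where "I = {y. bounding y us i}"
    have I0: "0 \<in> I" unfolding I_def mem_Collect_eq by (rule bounding_annihilator) (simp add: vdiff_def zero_fun_def)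
    have Iadd: "y + y' \<in> I" if "y \<in> I" "y' \<in> I" for y y' using that bounding_add unfolding I_def by blast
    have Imul: "y * y' \<in> I" if "y' \<in> I" for y y' using that bounding_mult unfolding I_def by blast
    have Isum: "(\<Sum>s\<in>S. g s) \<in> I" if "\<And>s. s \<in> S \<Longrightarrow> g s \<in> I" for S and g :: "'i \<Rightarrow> _"
      using that by (induction S rule: infinite_finite_induct) (auto intro: I0 Iadd)
    have Imem: "y \<in> I" if "y \<in> set ?\<Theta>" for y using that us bounding_member unfolding I_def by blast
    \<comment> \<open>The band cut down to the variables of \<open>Z\<close>; the entries left out
      act by zero on families supported in \<open>Z \<union> X\<close>.\<close>
    define b :: "nat \<Rightarrow> nat \<Rightarrow> 'n evar multiset \<Rightarrow>\<^sub>0 real" where "b a l = (if l \<le> a \<and> a - l \<le> c then band ZV k a l else 0)" for a l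
    have bI: "b a l \<in> I" for a l
    proof (cases "l \<le> a \<and> a - l \<le> c")
      case True
      have "pvar (ZV (a - l)) \<in> I" by (rule Imem) (use True zs(1) in auto)
      moreover have "b a l = pvar (ZV (a - l)) ^ (k a - 1) * pvar (ZV (a - l))"
        using True k[of a] by (simp add: b_def band_power power_Suc2[symmetric] del: power_Suc)
      ultimately show ?thesis using Imul by simp
    next
      case False
      then show ?thesis using I0 by (auto simp: b_def)
    qed
    have Fb: "pdiff (F a l) (q l) = pdiff (f a l + b a l) (q l)" if q: "q \<in> ambient m (Z \<union> X)" for a l q
    proof -
      have AX: "Z \<union> X \<subseteq> X \<union> Z" by blast
      have "pdiff (band ZV k a l) (q l) = pdiff (b a l) (q l)"
      proof (cases "l \<le> a \<and> a - l \<le> c")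
        case False
        show ?thesis
        proof (cases "l \<le> a")
          case True
          then have "a - l > c" using False by simp
          have "pdiff (band ZV k a l) (q l) = (\<lambda>_. 0)"
            by (rule pdiff_outside[OF q]) (rule band_outside[OF AX disjI2[OF \<open>a - l > c\<close>]])
          then show ?thesis using False by (auto simp: b_def)
        qed (simp add: b_def band_def)
      qed (simp add: b_def)
      moreover have "pdiff (Poly_Mapping.single {#TV a#} (real a ^ l)) (q l) = (\<lambda>_. 0)"
        by (rule pdiff_outside[OF q]) (rule t_outside[OF AX])
      ultimately show ?thesis unfolding F_def pdiff_add_left by simp
    qed
    have "\<exists>G h. \<forall>l<m. (if l = j then Poly_Mapping.single (replicate_mset E v) 1 else 0) =
        (\<Sum>a<r. G a * f a l) + (\<Sum>\<theta>\<in>set ls. h \<theta> l * \<theta>)" if "j < m" for j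
    proof (rule monomial_in_submodule[where A = X and w = w and k = k and E = E])
      show "set_mset \<beta> \<subseteq> X \<and> wsize w \<beta> = k i" if "\<beta> \<in> Poly_Mapping.keys (f i j)" for i j \<beta>
        using f[OF that] wsize_X by metis
      show "set_mset \<beta> \<subseteq> X \<and> wsize w \<beta> = 1" if "\<theta> \<in> set ls" "\<beta> \<in> Poly_Mapping.keys \<theta>" for \<theta> \<beta>
        using ls[OF that] wsize_X by metis
      show 1: "set_mset (replicate_mset E v) \<subseteq> X" using v by (simp split: if_splits)
      show "wsize w (replicate_mset E v) = E" using wsize_X[OF 1] by simp
    qed (use w_pos triv that in auto)
    then have "\<forall>j. \<exists>Gh. j < m \<longrightarrow> (\<forall>l<m. (if l = j then Poly_Mapping.single (replicate_mset E v) 1 else 0) =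
        (\<Sum>a<r. fst Gh a * f a l) + (\<Sum>\<theta>\<in>set ls. snd Gh \<theta> l * \<theta>))" by simp
    from choice[OF this] obtain Gh where Gh: "\<forall>j. j < m \<longrightarrow> (\<forall>l<m. (if l = j then Poly_Mapping.single (replicate_mset E v) 1 else 0) =
        (\<Sum>a<r. fst (Gh j) a * f a l) + (\<Sum>\<theta>\<in>set ls. snd (Gh j) \<theta> l * \<theta>))" ..
    define G where "G j = fst (Gh j)" for j
    define h where "h j = snd (Gh j)" for j
    have Gh: "(if l = j then Poly_Mapping.single (replicate_mset E v) 1 else 0) =
        (\<Sum>a<r. G j a * f a l) + (\<Sum>\<theta>\<in>set ls. h j \<theta> l * \<theta>)" if "j < m" "l < m" for j l
      using Gh that unfolding G_def h_def by blast
    \<comment> \<open>The coefficients found for the relations \<open>f\<close> are applied to the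
      deformed relations; the difference consists of band terms and multiples of \<open>ls\<close>,
      all in \<open>I\<close>.\<close>
    define a where "a j l = (\<Sum>i<r. G j i * (f i l + b i l))" for j l
    have "a j l - (if j = l then pvar v ^ E else 0) \<in> I" if "j < m" "l < m" for j l
    proof -
      have "(if j = l then pvar v ^ E else 0) = (\<Sum>a<r. G j a * f a l) + (\<Sum>\<theta>\<in>set ls. h j \<theta> l * \<theta>)"
        using Gh[OF that] by (simp add: pvar_power split: if_splits)
      then have "a j l - (if j = l then pvar v ^ E else 0) =
          (\<Sum>i<r. G j i * b i l) + (\<Sum>\<theta>\<in>set ls. (- h j \<theta> l) * \<theta>)"
        by (simp add: a_def distrib_left sum.distrib sum_negf)
      also have "\<dots> \<in> I" by (intro Iadd Isum Imul bI Imem) auto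
      finally show ?thesis .
    qed
    then have "\<forall>j<m. \<forall>l<m. a j l - (if j = l then pvar v ^ E else 0) \<in> I" by blast
    from pdiff.elimination[OF I0 Iadd Imul this] obtain D e where D: "D - pvar v ^ e \<in> I"
      "\<And>u l. \<forall>j<m. (\<Sum>l<m. pdiff (a j l) (u l)) = 0 \<Longrightarrow> l < m \<Longrightarrow> pdiff D (u l) = 0" by blast
    have "vdiff D q = 0" if q: "q \<in> sol m r F (Z \<union> X)" for q
    proof -
      have qa: "q \<in> ambient m (Z \<union> X)" by (rule subsetD[OF sol_ambient q])
      have z: "(\<Sum>l<m. pdiff (f i l + b i l) (q l)) = 0" if "i < r" for i
      proof
        fix \<alpha>
        have fs: "(\<Sum>l\<in>L. u l) \<alpha> = (\<Sum>l\<in>L. u l \<alpha>)" for L and u :: "nat \<Rightarrow> 'n evar multiset \<Rightarrow> real"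
          by (induction L rule: infinite_finite_induct) auto
        have "(\<Sum>l<m. pdiff (F i l) (q l) \<alpha>) = 0" using q that unfolding sol_def by blast
        then show "(\<Sum>l<m. pdiff (f i l + b i l) (q l)) \<alpha> = 0 \<alpha>"
          unfolding fs Fb[OF qa] zero_fun_def .
      qed
      have "(\<Sum>l<m. pdiff (a j l) (q l)) = 0" for j
      proof -
        have "(\<Sum>l<m. pdiff (a j l) (q l)) = (\<Sum>l<m. \<Sum>i<r. pdiff (G j i) (pdiff (f i l + b i l) (q l)))"
          by (simp only: a_def pdiff.scale_sum_left pdiff_mult)
        also have "\<dots> = (\<Sum>i<r. pdiff (G j i) (\<Sum>l<m. pdiff (f i l + b i l) (q l)))"
          by (subst sum.swap) (simp only: pdiff.scale_sum_right)
        also have "\<dots> = 0" using z by (intro sum.neutral) (simp add: pdiff.scale_zero_right)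
        finally show ?thesis .
      qed
      then have "pdiff D (q l) = 0" if "l < m" for l using D(2) that by blast
      moreover have "q l = 0" if "\<not> l < m" for l
      proof
        fix \<alpha> show "q l \<alpha> = 0 \<alpha>" using qa that unfolding ambient_def by auto
      qed
      ultimately have "pdiff D (q l) = 0" for l by (cases "l < m") (simp_all add: pdiff.scale_zero_right)
      then show ?thesis unfolding vdiff_def by (intro ext) simp
    qed
    then have "D \<in> I" unfolding I_def mem_Collect_eq by (rule bounding_annihilator)
    then have "D + (- 1) * (D - pvar v ^ e) \<in> I" using D(1) by (intro Iadd Imul)
    then have "pvar v ^ e \<in> I" by simp
    then show ?thesis using v(1) unfolding I_def by blast
  qed
  have "exact (rev (map pvar xs)) i" if "i \<ge> 1" for i
    by (rule exact_pvars[of Z xs i, OF _ xs(2) _ hilb_sol_XZ(1) that]) (use xs in auto)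
  \<comment> \<open>The exchange needs lists of equal length: by \<open>len\<close> the d forms and
    the c + 1 variables are as many as the members of \<open>xs\<close>.\<close>
  then have ex: "exact ?\<Theta> i" if "i \<ge> 1" for i
    by (rule exact_exchange[OF _ _ nil that]) (use len length_xs in \<open>simp_all add: zs_def del: upt_Suc\<close>)
  have "exact (map pvar zs) i" if "i \<ge> 1" for i
  proof -
    \<comment> \<open>The forms stand in front so that they can be stripped off one by one, leaving
      the regularity of \<open>zs\<close>.\<close>
    have "(\<And>i. i \<ge> 1 \<Longrightarrow> exact (us @ map pvar zs) i) \<Longrightarrow> set us \<subseteq> set ls \<Longrightarrow> exact (map pvar zs) i" for us
    proof (induction us)
      case (Cons u us)
      have "exact (us @ map pvar zs) i" if "i \<ge> 1" for i
        by (rule exact_of_exact_Cons(1)[of u]) (use Cons.prems locally_nilpotent[OF ls1] that in auto)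
      then show ?case using Cons by simp
    qed (use that in simp)
    then show ?thesis using ex by blast
  qed
  then have exz: "\<And>i. i \<ge> 1 \<Longrightarrow> exact (map pvar zs @ []) i" by simp
  have thz: "\<And>\<theta> :: 'n evar multiset \<Rightarrow>\<^sub>0 real. \<theta> \<in> set (map pvar zs @ []) \<Longrightarrow> poly_of_weight w 1 \<theta>"
    by (rule th1) simp
  have "(1 - fps_X) ^ length (map pvar zs :: ('n evar multiset \<Rightarrow>\<^sub>0 real) list) *
      hilb w {q \<in> sol m r F (Z \<union> X). \<forall>\<theta>\<in>set ([] :: ('n evar multiset \<Rightarrow>\<^sub>0 real) list). vdiff \<theta> q = 0} =
      hilb w {q \<in> sol m r F (Z \<union> X). \<forall>\<theta>\<in>set (map pvar zs @ []). vdiff \<theta> q = 0}"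
    by (rule hilb_of_exact) (rule exz, assumption, rule thz, assumption)
  moreover have "{q \<in> sol m r F (Z \<union> X). \<forall>\<theta>\<in>set (map pvar zs @ []). vdiff \<theta> q = 0} = sol m r F X"
    using sol_kernel_pvars[of zs X m r F] zs(1) by (auto simp: Un_commute)
  ultimately have H: "hilb w (sol m r f X) = (1 - fps_X) ^ Suc c * (geo 1 ^ CARD('n) * fps_of_poly (qpoly k m c))"
    using hilb_sol_XZ geos_xs sol_X by (simp add: zs_def del: upt_Suc)
  have "(1 - fps_X) ^ CARD('n) * geo 1 ^ CARD('n) = 1"
    using geo_mult[of 1] by (simp only: power_mult_distrib[symmetric]) simp
  then show ?thesis unfolding H len[symmetric] power_add by (simp only: ac_simps) (simp add: mult.left_commute)
qed

end

section \<open>Projective closed sets\<close>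

lemma nat_seq_mono_subseq:
  fixes s :: "nat \<Rightarrow> nat" shows "\<exists>f. strict_mono f \<and> incseq (s \<circ> f)"
proof -
  have "\<exists>N. N \<ge> k \<and> (\<forall>j\<ge>k. s N \<le> s j)" for k
    using ex_has_least_nat[of "\<lambda>N. N \<ge> k" k s] by auto
  from choice[OF allI[OF this]] obtain g where g: "\<forall>k. g k \<ge> k \<and> (\<forall>j\<ge>k. s (g k) \<le> s j)" ..
  define f where "f = rec_nat (g 0) (\<lambda>_ x. g (Suc x))"
  have f: "f 0 = g 0" "\<And>k. f (Suc k) = g (Suc (f k))" by (simp_all add: f_def)
  have inc: "f k < f (Suc k)" for k using g f(2)[of k] by (metis Suc_le_eq)
  have "s (f k) \<le> s (f (Suc k))" for k
  proof (cases k)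
    case 0
    then show ?thesis using g f(1) by (metis le0)
  next
    case (Suc l)
    have "Suc (f l) \<le> f (Suc k)" using inc[of l] inc[of k] Suc by simp
    then show ?thesis using g f(2)[of l] Suc by metis
  qed
  then have "incseq (s \<circ> f)" by (simp add: incseq_SucI)
  moreover have "strict_mono f" using inc by (simp add: strict_mono_Suc_iff)
  ultimately show ?thesis by blast
qed

text \<open>Dickson's lemma: passing to subsequences one variable at a time makes every exponent
  nondecreasing.\<close>

lemma dickson:
  fixes a :: "nat \<Rightarrow> 'n::finite multiset" shows "\<exists>i j. i < j \<and> a i \<subseteq># a j"
proof -
  have "\<exists>f. strict_mono f \<and> (\<forall>x\<in>S. incseq (\<lambda>k. count (a (f k)) x))" if "finite S" for S
    using that
  proof induction
    case empty
    show ?case by (rule exI[of _ id]) (simp add: strict_mono_def)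
  next
    case (insert x S)
    then obtain f where f: "strict_mono f" "\<forall>x\<in>S. incseq (\<lambda>k. count (a (f k)) x)" by blast
    obtain g where g: "strict_mono g" "incseq ((\<lambda>k. count (a (f k)) x) \<circ> g)" using nat_seq_mono_subseq by blast
    have "incseq (\<lambda>k. count (a (f (g k))) y)" if "y \<in> S" for y
      unfolding incseq_def
    proof (intro allI impI)
      fix k l :: nat assume "k \<le> l"
      then have "g k \<le> g l" using g(1) strict_mono_less_eq by blast
      then show "count (a (f (g k))) y \<le> count (a (f (g l))) y" using f(2) that by (auto dest: incseqD)
    qed
    then have "\<forall>y\<in>insert x S. incseq (\<lambda>k. count (a ((f \<circ> g) k)) y)" using g(2) by (simp add: o_def)
    then show ?case using strict_mono_o[OF f(1) g(1)] by blast
  qed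
  from this[OF finite[of UNIV]] obtain f where f: "strict_mono f" "\<And>x. incseq (\<lambda>k. count (a (f k)) x)" by auto
  have "a (f 0) \<subseteq># a (f 1)" by (rule mset_subset_eqI) (use f(2) in \<open>auto dest: incseqD\<close>)
  moreover have "f 0 < f 1" using f(1) by (simp add: strict_mono_def)
  ultimately show ?thesis by blast
qed

lemma lookup_single_mult:
  fixes P :: "'v multiset \<Rightarrow>\<^sub>0 'k::comm_ring_1"
  shows "Poly_Mapping.lookup (Poly_Mapping.single \<gamma> c * P) (\<gamma> + \<beta>) = c * Poly_Mapping.lookup P \<beta>"
proof (induction P rule: poly_mapping_single_induct)
  case (2 P P')
  then show ?case by (simp add: distrib_left lookup_add)
qed (simp add: mult_single lookup_single when_def)

text \<open>Hilbert's basis theorem; a monomial order is obtained by coding monomials as products of primes.\<close>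

theorem ideal_acc:
  fixes I :: "nat \<Rightarrow> ('n::finite multiset \<Rightarrow>\<^sub>0 'k::field) set"
  assumes zero: "\<And>k. 0 \<in> I k" and add: "\<And>k x y. x \<in> I k \<Longrightarrow> y \<in> I k \<Longrightarrow> x + y \<in> I k"
    and mul: "\<And>k x y. y \<in> I k \<Longrightarrow> x * y \<in> I k" and inc: "\<And>k. I k \<subset> I (Suc k)"
  shows False
proof -
  obtain pr :: "nat \<Rightarrow> nat" where pr: "inj pr" "range pr \<subseteq> {p. prime p}"
    using primes_infinite infinite_iff_countable_subset[of "{p :: nat. prime p}"] by blast
  obtain ix :: "'n \<Rightarrow> nat" where ix: "inj ix" using finite_imp_inj_to_nat_seg[OF finite[of UNIV]] by blast
  define p where "p = pr \<circ> ix"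
  have p: "inj p" "\<And>i. prime (p i)" using pr ix by (auto simp: p_def inj_compose)
  \<comment> \<open>By unique factorization \<open>N\<close> is injective, and it is multiplicative.
    Comparing its values is therefore a total order on monomials, compatible with products and
    well-founded.\<close>
  define N where "N \<alpha> = prod_mset (image_mset p \<alpha>)" for \<alpha>
  have N_add: "N (\<alpha> + \<beta>) = N \<alpha> * N \<beta>" for \<alpha> \<beta> by (simp add: N_def)
  have N_inj: "\<alpha> = \<beta>" if "N \<alpha> = N \<beta>" for \<alpha> \<beta>
  proof -
    have "prime_factorization (N \<alpha>) = image_mset p \<alpha>" for \<alpha>
      unfolding N_def by (rule prime_factorization_prod_mset_primes) (use p(2) in auto)
    then have "image_mset p \<alpha> = image_mset p \<beta>" using that by metis
    then show ?thesis using multiset.inj_map[OF p(1)] by (simp add: inj_eq)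
  qed
  have N_pos: "N \<alpha> > 0" for \<alpha>
    unfolding N_def using p(2) by (induction \<alpha>) (auto simp: prime_gt_0_nat)
  define lead :: "('n multiset \<Rightarrow>\<^sub>0 'k) \<Rightarrow> 'n multiset \<Rightarrow> bool" where
    "lead P \<alpha> \<longleftrightarrow> \<alpha> \<in> Poly_Mapping.keys P \<and> (\<forall>\<beta>\<in>Poly_Mapping.keys P. N \<beta> \<le> N \<alpha>)" for P \<alpha>
  have lead_ex: "\<exists>\<alpha>. lead P \<alpha>" if "P \<noteq> 0" for P
  proof -
    have ne: "Poly_Mapping.keys P \<noteq> {}" using that by simp
    then have "Max (N ` Poly_Mapping.keys P) \<in> N ` Poly_Mapping.keys P" by (intro Max_in) auto
    then obtain \<alpha> where "\<alpha> \<in> Poly_Mapping.keys P" "N \<alpha> = Max (N ` Poly_Mapping.keys P)" by auto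
    then show ?thesis unfolding lead_def by (intro exI[of _ \<alpha>]) auto
  qed
  \<comment> \<open>\<open>P k\<close> will be an element of \<open>I (Suc k) - I k\<close> whose
    leading monomial is least possible.\<close>
  define Q where "Q k Pa \<longleftrightarrow> fst Pa \<in> I (Suc k) - I k \<and> lead (fst Pa) (snd Pa)" for k Pa
  have "\<exists>Pa. Q k Pa \<and> (\<forall>Pa'. Q k Pa' \<longrightarrow> N (snd Pa) \<le> N (snd Pa'))" for k
  proof -
    obtain P where P: "P \<in> I (Suc k)" "P \<notin> I k" using inc[of k] by blast
    then have "P \<noteq> 0" using zero by blast
    then obtain \<alpha> where "lead P \<alpha>" using lead_ex by blast
    then have "Q k (P, \<alpha>)" using P by (simp add: Q_def)
    then show ?thesis using ex_has_least_nat[of "Q k" "(P, \<alpha>)" "\<lambda>Pa. N (snd Pa)"] by simp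
  qed
  from choice[OF allI[OF this]] obtain f where f: "\<forall>k. Q k (f k) \<and> (\<forall>Pa'. Q k Pa' \<longrightarrow> N (snd (f k)) \<le> N (snd Pa'))" ..
  define P where "P k = fst (f k)" for k
  define a where "a k = snd (f k)" for k
  have P: "P k \<in> I (Suc k)" "P k \<notin> I k" "lead (P k) (a k)" for k using f by (auto simp: Q_def P_def a_def)
  have least: "N (a k) \<le> N \<alpha>" if "R \<in> I (Suc k)" "R \<notin> I k" "lead R \<alpha>" for k R \<alpha>
  proof -
    have "Q k (R, \<alpha>)" using that by (simp add: Q_def)
    then have "N (snd (f k)) \<le> N (snd (R, \<alpha>))" using f by blast
    then show ?thesis by (simp add: a_def)
  qed
  have mono: "I k \<subseteq> I l" if "k \<le> l" for k l
    by (rule lift_Suc_mono_le[OF _ that]) (rule psubset_imp_subset[OF inc])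
  obtain i j where ij: "i < j" "a i \<subseteq># a j" using dickson by blast
  define \<gamma> where "\<gamma> = a j - a i"
  have \<gamma>: "a j = \<gamma> + a i" using ij(2) by (simp add: \<gamma>_def)
  let ?lc = "\<lambda>k. Poly_Mapping.lookup (P k) (a k)"
  have lc: "?lc k \<noteq> 0" for k using P(3)[of k] by (simp add: lead_def in_keys_iff)
  \<comment> \<open>A multiple of \<open>P i\<close> that cancels the leading term of
    \<open>P j\<close>. It lies in \<open>I j\<close>, so \<open>P j + T\<close> is still new at
    stage j but has a smaller leading monomial.\<close>
  define T where "T = Poly_Mapping.single \<gamma> (- (?lc j / ?lc i)) * P i"
  have "P i \<in> I j" using P(1)[of i] mono[of "Suc i" j] ij(1) by auto
  then have T: "T \<in> I j" unfolding T_def by (rule mul)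
  have R1: "P j + T \<in> I (Suc j)" using add P(1) T mono[of j "Suc j"] by auto
  have R2: "P j + T \<notin> I j"
  proof
    assume "P j + T \<in> I j"
    then have "(P j + T) + (- 1) * T \<in> I j" using add mul T by blast
    then show False using P(2)[of j] by simp
  qed
  then have "P j + T \<noteq> 0" using zero by metis
  then obtain \<alpha> where \<alpha>: "lead (P j + T) \<alpha>" using lead_ex by blast
  have "Poly_Mapping.lookup T (a j) = - ?lc j"
    unfolding \<gamma> T_def lookup_single_mult using lc[of i] by (simp add: \<gamma>)
  then have "a j \<notin> Poly_Mapping.keys (P j + T)" by (simp add: in_keys_iff lookup_add)
  then have ne: "\<alpha> \<noteq> a j" using \<alpha> by (auto simp: lead_def)
  have "N \<alpha> \<le> N (a j)"
  proof -
    have "\<alpha> \<in> Poly_Mapping.keys (P j) \<or> \<alpha> \<in> Poly_Mapping.keys T"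
      using \<alpha> keys_add[of "P j" T] by (auto simp: lead_def)
    then show ?thesis
    proof
      assume "\<alpha> \<in> Poly_Mapping.keys (P j)"
      then show ?thesis using P(3)[of j] by (simp add: lead_def)
    next
      assume "\<alpha> \<in> Poly_Mapping.keys T"
      then obtain b where "\<alpha> = \<gamma> + b" "b \<in> Poly_Mapping.keys (P i)"
        using keys_mult[of "Poly_Mapping.single \<gamma> (- (?lc j / ?lc i))" "P i"]
        unfolding T_def by (auto split: if_splits)
      then show ?thesis using P(3)[of i] by (simp add: N_add \<gamma> lead_def)
    qed
  qed
  then have "N \<alpha> < N (a j)" using ne N_inj by (metis le_neq_implies_less)
  then show False using least[OF R1 R2 \<alpha>] by simp
qed

lemma homogeneous_mult:
  fixes P Q :: "('n::finite, 'k::comm_ring_1) sym_alg"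
  assumes "homogeneous P" "homogeneous Q" shows "homogeneous (P * Q)"
proof -
  obtain d e where "\<forall>\<beta>\<in>Poly_Mapping.keys P. size \<beta> = d" "\<forall>\<beta>\<in>Poly_Mapping.keys Q. size \<beta> = e"
    using assms unfolding homogeneous_def by blast
  then have "\<forall>\<beta>\<in>Poly_Mapping.keys (P * Q). size \<beta> = d + e" using keys_mult[of P Q] by fastforce
  then show ?thesis unfolding homogeneous_def by blast
qed

lemma proj_closed_Int: assumes "proj_closed A" "proj_closed B" shows "proj_closed (A \<inter> B)"
proof -
  obtain F G where "\<forall>P\<in>F. homogeneous P" "A = {\<xi>. \<xi> \<noteq> 0 \<and> (\<forall>P\<in>F. eval_sym P \<xi> = 0)}"
    "\<forall>P\<in>G. homogeneous P" "B = {\<xi>. \<xi> \<noteq> 0 \<and> (\<forall>P\<in>G. eval_sym P \<xi> = 0)}"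
    using assms unfolding proj_closed_def by blast
  then show ?thesis unfolding proj_closed_def by (intro exI[of _ "F \<union> G"]) auto
qed

lemma proj_closed_Un: assumes "proj_closed A" "proj_closed B" shows "proj_closed (A \<union> B)"
proof -
  obtain F G where FG: "\<forall>P\<in>F. homogeneous P" "A = {\<xi>. \<xi> \<noteq> 0 \<and> (\<forall>P\<in>F. eval_sym P \<xi> = 0)}"
    "\<forall>P\<in>G. homogeneous P" "B = {\<xi>. \<xi> \<noteq> 0 \<and> (\<forall>P\<in>G. eval_sym P \<xi> = 0)}"
    using assms unfolding proj_closed_def by blast
  let ?H = "{P * Q | P Q. P \<in> F \<and> Q \<in> G}"
  have "\<xi> \<in> A \<union> B \<longleftrightarrow> \<xi> \<noteq> 0 \<and> (\<forall>R\<in>?H. eval_sym R \<xi> = 0)" for \<xi>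
  proof
    assume "\<xi> \<in> A \<union> B"
    then show "\<xi> \<noteq> 0 \<and> (\<forall>R\<in>?H. eval_sym R \<xi> = 0)" using FG(2,4) by (auto simp: eval_sym_mult)
  next
    assume r: "\<xi> \<noteq> 0 \<and> (\<forall>R\<in>?H. eval_sym R \<xi> = 0)"
    have "eval_sym P \<xi> = 0 \<or> eval_sym Q \<xi> = 0" if "P \<in> F" "Q \<in> G" for P Q
    proof -
      have "eval_sym (P * Q) \<xi> = 0" using r that by blast
      then show ?thesis by (simp add: eval_sym_mult)
    qed
    then show "\<xi> \<in> A \<union> B" using r FG(2,4) by blast
  qed
  then have "A \<union> B = {\<xi>. \<xi> \<noteq> 0 \<and> (\<forall>R\<in>?H. eval_sym R \<xi> = 0)}" by blast
  moreover have "\<forall>R\<in>?H. homogeneous R" using FG(1,3) homogeneous_mult by blast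
  ultimately show ?thesis unfolding proj_closed_def by blast
qed

lemma proj_closed_empty: "proj_closed {}"
  unfolding proj_closed_def by (intro exI[of _ "{1}"]) (auto simp: homogeneous_def)

lemma proj_closed_Union: "finite S \<Longrightarrow> (\<And>Y. Y \<in> S \<Longrightarrow> proj_closed Y) \<Longrightarrow> proj_closed (\<Union>S)"
  by (induction S rule: finite_induct) (auto intro: proj_closed_empty proj_closed_Un)

text \<open>A strictly descending chain of closed sets would give a strictly ascending chain of
  vanishing ideals.\<close>

lemma wf_proj_closed: "wf {(A :: (complex ^ 'n::finite) set, B). proj_closed A \<and> proj_closed B \<and> A \<subset> B}"
proof -
  have False if Z: "\<And>k. proj_closed (Z k)" "\<And>k. Z (Suc k) \<subset> Z k" for Z :: "nat \<Rightarrow> (complex ^ 'n) set"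
  proof (rule ideal_acc)
    let ?I = "\<lambda>k. {P. \<forall>\<xi>\<in>Z k. eval_sym P \<xi> = 0}"
    show "0 \<in> ?I k" for k by simp
    show "x + y \<in> ?I k" if "x \<in> ?I k" "y \<in> ?I k" for k x y using that by (simp add: eval_sym_add)
    show "x * y \<in> ?I k" if "y \<in> ?I k" for k x y using that by (simp add: eval_sym_mult)
    show "?I k \<subset> ?I (Suc k)" for k
    proof
      show "?I k \<subseteq> ?I (Suc k)" using Z(2)[of k] by blast
      obtain \<xi> where \<xi>: "\<xi> \<in> Z k" "\<xi> \<notin> Z (Suc k)" using Z(2)[of k] by blast
      obtain F where F: "Z (Suc k) = {\<xi>. \<xi> \<noteq> 0 \<and> (\<forall>P\<in>F. eval_sym P \<xi> = 0)}"
        using Z(1) unfolding proj_closed_def by blast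
      have "\<xi> \<noteq> 0" using \<xi>(1) Z(1)[of k] unfolding proj_closed_def by blast
      then obtain P where P: "P \<in> F" "eval_sym P \<xi> \<noteq> 0" using \<xi>(2) F by blast
      then have "P \<in> ?I (Suc k)" using F by blast
      moreover have "P \<notin> ?I k" using P \<xi>(1) by blast
      ultimately show "?I k \<noteq> ?I (Suc k)" by blast
    qed
  qed
  then show ?thesis unfolding wf_iff_no_infinite_down_chain by blast
qed

lemma irreducible_decomposition:
  "proj_closed Z \<Longrightarrow> \<exists>S. finite S \<and> (\<forall>Y\<in>S. proj_irreducible Y) \<and> Z = \<Union>S"
proof (induction Z rule: wf_induct_rule[OF wf_proj_closed])
  case (1 Z)
  note IH = 1(1) and Z = 1(2)
  show ?case
  proof (cases "Z = {} \<or> proj_irreducible Z")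
    case True
    then show ?thesis
    proof
      assume "Z = {}" then show ?thesis by (intro exI[of _ "{}"]) simp
    next
      assume "proj_irreducible Z" then show ?thesis by (intro exI[of _ "{Z}"]) simp
    qed
  next
    case False
    then obtain A B where AB: "proj_closed A" "proj_closed B" "Z \<subseteq> A \<union> B" "\<not> Z \<subseteq> A" "\<not> Z \<subseteq> B"
      using Z unfolding proj_irreducible_def by blast
    have ex: "\<exists>S. finite S \<and> (\<forall>Y\<in>S. proj_irreducible Y) \<and> Z \<inter> C = \<Union>S" if "proj_closed C" "\<not> Z \<subseteq> C" for C
    proof (rule IH)
      show "proj_closed (Z \<inter> C)" by (rule proj_closed_Int[OF Z that(1)])
      then show "(Z \<inter> C, Z) \<in> {(A, B). proj_closed A \<and> proj_closed B \<and> A \<subset> B}" using Z that(2) by blast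
    qed
    obtain S where S: "finite S" "\<forall>Y\<in>S. proj_irreducible Y" "Z \<inter> A = \<Union>S" using ex[OF AB(1,4)] by blast
    obtain T where T: "finite T" "\<forall>Y\<in>T. proj_irreducible Y" "Z \<inter> B = \<Union>T" using ex[OF AB(2,5)] by blast
    have "Z = \<Union>(S \<union> T)" using S(3) T(3) AB(3) by blast
    then show ?thesis using S T by (intro exI[of _ "S \<union> T"]) blast
  qed
qed

lemma irreducible_subset_Union:
  "finite S \<Longrightarrow> proj_irreducible Z \<Longrightarrow> (\<And>Y. Y \<in> S \<Longrightarrow> proj_closed Y) \<Longrightarrow> Z \<subseteq> \<Union>S \<Longrightarrow> \<exists>Y\<in>S. Z \<subseteq> Y"
proof (induction S rule: finite_induct)
  case empty
  then show ?case by (auto simp: proj_irreducible_def)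
next
  case (insert Y S)
  have "proj_closed (\<Union>S)" by (rule proj_closed_Union[OF insert.hyps(1)]) (use insert.prems in auto)
  moreover have "Z \<subseteq> Y \<union> \<Union>S" using insert.prems by auto
  ultimately have "Z \<subseteq> Y \<or> Z \<subseteq> \<Union>S" using insert.prems(1,2) unfolding proj_irreducible_def by blast
  then show ?case using insert.IH insert.prems by blast
qed

section \<open>Chains of irreducible closed sets and sections by linear forms\<close>

definition irreducible_chain :: "(complex ^ 'n::finite) set \<Rightarrow> nat \<Rightarrow> bool" where
  "irreducible_chain V c \<longleftrightarrow> (\<exists>Z :: nat \<Rightarrow> (complex ^ 'n) set.
     (\<forall>i<c. proj_irreducible (Z i) \<and> Z i \<subseteq> V) \<and> (\<forall>i. Suc i < c \<longrightarrow> Z i \<subset> Z (Suc i)))"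

lemma proj_dim_irreducible_chain: "proj_dim V = int (GREATEST c. irreducible_chain V c) - 1"
  unfolding proj_dim_def irreducible_chain_def ..

definition real_form :: "real ^ 'n::finite \<Rightarrow> complex ^ 'n \<Rightarrow> complex" where
  "real_form l \<xi> = (\<Sum>i\<in>UNIV. complex_of_real (l $ i) * \<xi> $ i)"

text \<open>Forms with coefficients s^(e i) run along a moment curve. At a fixed nonzero covector
  they give a nonzero polynomial in s, so all but finitely many real s work.\<close>

lemma ex_real_form_nonzero:
  fixes T :: "(complex ^ 'n::finite) set"
  assumes "finite T" "0 \<notin> T" shows "\<exists>l. \<forall>\<xi>\<in>T. real_form l \<xi> \<noteq> 0"
proof -
  obtain e :: "'n \<Rightarrow> nat" where e: "inj e" using finite_imp_inj_to_nat_seg[OF finite[of UNIV]] by blast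
  define p where "p \<xi> = (\<Sum>i\<in>UNIV. monom (\<xi> $ i) (e i))" for \<xi> :: "complex ^ 'n"
  have "p \<xi> \<noteq> 0" if "\<xi> \<in> T" for \<xi>
  proof
    assume p: "p \<xi> = 0"
    have "\<xi> $ i = 0" for i
    proof -
      have "poly.coeff (p \<xi>) (e i) = (\<Sum>j\<in>UNIV. if j = i then \<xi> $ j else 0)"
        unfolding p_def coeff_sum coeff_monom by (intro sum.cong) (use e in \<open>auto simp: inj_eq\<close>)
      then show ?thesis using p by simp
    qed
    then have "\<xi> = 0" by (simp add: Finite_Cartesian_Product.vec_eq_iff)
    then show False using that assms(2) by blast
  qed
  then have "finite (\<Union>\<xi>\<in>T. {x. poly (p \<xi>) x = 0})" using assms(1) poly_roots_finite by blast
  then have "finite (complex_of_real -` (\<Union>\<xi>\<in>T. {x. poly (p \<xi>) x = 0}))"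
    by (rule finite_vimageI) (simp add: inj_on_def)
  then obtain s :: real where s: "s \<notin> complex_of_real -` (\<Union>\<xi>\<in>T. {x. poly (p \<xi>) x = 0})"
    using ex_new_if_finite infinite_UNIV_char_0 by blast
  have "real_form (\<chi> i. s ^ e i) \<xi> = poly (p \<xi>) (complex_of_real s)" for \<xi>
    by (simp add: real_form_def p_def poly_sum poly_monom mult.commute)
  then show ?thesis using s by (intro exI[of _ "\<chi> i. s ^ e i"]) auto
qed

lemma proj_closed_real_form: "proj_closed {\<xi>. \<xi> \<noteq> 0 \<and> real_form l \<xi> = 0}"
proof -
  define P where "P = (\<Sum>i\<in>UNIV. Poly_Mapping.single {#i#} (complex_of_real (l $ i)))"
  have "Poly_Mapping.keys P \<subseteq> (\<Union>i\<in>UNIV. Poly_Mapping.keys (Poly_Mapping.single {#i#} (complex_of_real (l $ i))))"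
    unfolding P_def by (rule keys_sum)
  then have "\<forall>\<beta>\<in>Poly_Mapping.keys P. size \<beta> = 1" by (auto split: if_splits)
  then have "homogeneous P" unfolding homogeneous_def by blast
  moreover have "eval_sym P \<xi> = real_form l \<xi>" for \<xi> by (simp add: P_def eval_sym_sum eval_sym_single real_form_def)
  ultimately show ?thesis unfolding proj_closed_def by (intro exI[of _ "{P}"]) simp
qed

text \<open>A linear form that vanishes on no component of \<open>V\<close> cuts down the length of the chains.\<close>

theorem ex_linear_forms:
  "proj_closed V \<Longrightarrow> \<not> irreducible_chain V (Suc d) \<Longrightarrow>
    \<exists>ls. length ls = d \<and> (\<forall>\<xi>\<in>V. \<exists>l\<in>set ls. real_form l \<xi> \<noteq> 0)"
proof (induction d arbitrary: V)
  case 0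
  obtain S where S: "\<forall>Y\<in>S. proj_irreducible Y" "V = \<Union>S" using irreducible_decomposition[OF 0(1)] by blast
  have "S = {}"
  proof (rule ccontr)
    assume "S \<noteq> {}"
    then obtain Y where "proj_irreducible Y" "Y \<subseteq> V" using S by blast
    then have "irreducible_chain V (Suc 0)" unfolding irreducible_chain_def by (intro exI[of _ "\<lambda>_. Y"]) simp
    then show False using 0(2) by simp
  qed
  then show ?case using S(2) by simp
next
  case (Suc d)
  obtain S where S: "finite S" "\<forall>Y\<in>S. proj_irreducible Y" "V = \<Union>S" using irreducible_decomposition[OF Suc.prems(1)] by blast
  \<comment> \<open>A form that is nonzero at one chosen point of each component vanishes on none of
    them. The top of a chain in the section then lies properly inside some component, which extends
    the chain.\<close>
  have "\<forall>Y. \<exists>\<xi>. Y \<in> S \<longrightarrow> \<xi> \<in> Y" using S(2) unfolding proj_irreducible_def by blast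
  from choice[OF this] obtain pt where pt: "\<forall>Y. Y \<in> S \<longrightarrow> pt Y \<in> Y" ..
  have nz: "pt Y \<noteq> 0" if "Y \<in> S" for Y
    using pt S(2) that unfolding proj_irreducible_def proj_closed_def by blast
  then obtain l where l: "\<forall>\<xi>\<in>pt ` S. real_form l \<xi> \<noteq> 0" using ex_real_form_nonzero[of "pt ` S"] S(1) by (metis finite_imageI imageE)
  let ?V = "V \<inter> {\<xi>. \<xi> \<noteq> 0 \<and> real_form l \<xi> = 0}"
  have "proj_closed ?V" by (rule proj_closed_Int[OF Suc.prems(1) proj_closed_real_form])
  moreover have "\<not> irreducible_chain ?V (Suc d)"
  proof
    assume "irreducible_chain ?V (Suc d)"
    then obtain Z where Z: "\<And>i. i < Suc d \<Longrightarrow> proj_irreducible (Z i)" "\<And>i. i < Suc d \<Longrightarrow> Z i \<subseteq> ?V"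
      "\<And>i. Suc i < Suc d \<Longrightarrow> Z i \<subset> Z (Suc i)" unfolding irreducible_chain_def by blast
    have "Z d \<subseteq> \<Union>S" using Z(2)[of d] S(3) by blast
    moreover have "proj_closed Y" if "Y \<in> S" for Y using S(2) that unfolding proj_irreducible_def by blast
    ultimately obtain Y where Y: "Y \<in> S" "Z d \<subseteq> Y" using irreducible_subset_Union[OF S(1) Z(1)[of d]] by blast
    have "pt Y \<in> Y" "pt Y \<notin> Z d" using pt Y(1) l Z(2)[of d] by auto
    then have "Z d \<subset> Y" using Y(2) by blast
    have "irreducible_chain V (Suc (Suc d))"
      unfolding irreducible_chain_def
    proof (intro exI[of _ "\<lambda>i. if i = Suc d then Y else Z i"] conjI allI impI)
      fix i assume "i < Suc (Suc d)"
      then have i: "i = Suc d \<or> i < Suc d" by auto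
      show "proj_irreducible (if i = Suc d then Y else Z i)" using i Z(1) S(2) Y(1) by auto
      show "(if i = Suc d then Y else Z i) \<subseteq> V" using i Z(2) S(3) Y(1) by auto
    next
      fix i assume "Suc i < Suc (Suc d)"
      then have "i = d \<or> Suc i < Suc d" by auto
      then show "(if i = Suc d then Y else Z i) \<subset> (if Suc i = Suc d then Y else Z (Suc i))"
        using Z(3)[of i] \<open>Z d \<subset> Y\<close> by auto
    qed
    then show False using Suc.prems(2) by blast
  qed
  ultimately obtain ls where ls: "length ls = d" "\<forall>\<xi>\<in>?V. \<exists>l\<in>set ls. real_form l \<xi> \<noteq> 0" using Suc.IH by blast
  have "\<exists>l'\<in>set (l # ls). real_form l' \<xi> \<noteq> 0" if x: "\<xi> \<in> V" for \<xi>
  proof (cases "real_form l \<xi> = 0")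
    case True
    have "\<xi> \<noteq> 0" using x Suc.prems(1) unfolding proj_closed_def by blast
    then show ?thesis using True x ls(2) by auto
  qed simp
  then show ?case using ls(1) by (intro exI[of _ "l # ls"]) auto
qed

section \<open>Lengths of chains of irreducible closed sets\<close>

definition fun_scale :: "complex \<Rightarrow> ('a \<Rightarrow> complex) \<Rightarrow> 'a \<Rightarrow> complex" where
  "fun_scale c f = (\<lambda>x. c * f x)"

interpretation cfun: vector_space fun_scale
  by unfold_locales (auto simp: fun_scale_def fun_eq_iff algebra_simps)

interpretation cfun_cfun: vector_space_pair fun_scale fun_scale ..

lemma cfun_linearI:
  assumes "\<And>f g. L (\<lambda>x. f x + g x) = (\<lambda>x. L f x + L g x)" "\<And>c f. L (\<lambda>x. c * f x) = (\<lambda>x. c * L f x)"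
  shows "Vector_Spaces.linear fun_scale fun_scale L"
  by unfold_locales (simp_all add: plus_fun_def fun_scale_def assms)

text \<open>The degree k part of the homogeneous coordinate ring of \<open>Z\<close>. Representing
  classes by functions extended by 0 builds in the quotient by the vanishing ideal and makes
  restriction to a smaller set a linear map.\<close>

definition graded_part :: "(complex ^ 'n::finite) set \<Rightarrow> nat \<Rightarrow> (complex ^ 'n \<Rightarrow> complex) set" where
  "graded_part Z k = {\<lambda>\<xi>. if \<xi> \<in> Z then eval_sym P \<xi> else 0 | P. \<forall>\<beta>\<in>Poly_Mapping.keys P. size \<beta> = k}"

abbreviation "hfun Z k \<equiv> cfun.dim (graded_part Z k)"

lemma graded_partE:
  assumes "f \<in> graded_part Z k"
  obtains P where "\<forall>\<beta>\<in>Poly_Mapping.keys P. size \<beta> = k" "f = (\<lambda>\<xi>. if \<xi> \<in> Z then eval_sym P \<xi> else 0)"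
  using assms unfolding graded_part_def by blast

lemma graded_partI: "\<forall>\<beta>\<in>Poly_Mapping.keys P. size \<beta> = k \<Longrightarrow> (\<lambda>\<xi>. if \<xi> \<in> Z then eval_sym P \<xi> else 0) \<in> graded_part Z k"
  unfolding graded_part_def by blast

lemma subspace_graded_part: "cfun.subspace (graded_part Z k)"
proof (rule cfun.subspaceI)
  have "(\<lambda>\<xi>. if \<xi> \<in> Z then eval_sym 0 \<xi> else 0) \<in> graded_part Z k" by (rule graded_partI) simp
  moreover have "(\<lambda>\<xi>. if \<xi> \<in> Z then eval_sym 0 \<xi> else 0) = 0" by (simp add: fun_eq_iff)
  ultimately show "0 \<in> graded_part Z k" by simp
next
  fix f g assume fg: "f \<in> graded_part Z k" "g \<in> graded_part Z k"
  obtain P where P: "\<forall>\<beta>\<in>Poly_Mapping.keys P. size \<beta> = k" "f = (\<lambda>\<xi>. if \<xi> \<in> Z then eval_sym P \<xi> else 0)"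
    using fg(1) by (rule graded_partE)
  obtain Q where Q: "\<forall>\<beta>\<in>Poly_Mapping.keys Q. size \<beta> = k" "g = (\<lambda>\<xi>. if \<xi> \<in> Z then eval_sym Q \<xi> else 0)"
    using fg(2) by (rule graded_partE)
  have "(\<lambda>\<xi>. if \<xi> \<in> Z then eval_sym (P + Q) \<xi> else 0) \<in> graded_part Z k"
    by (rule graded_partI) (use P(1) Q(1) keys_add[of P Q] in blast)
  then show "f + g \<in> graded_part Z k" unfolding P(2) Q(2) by (simp add: plus_fun_def eval_sym_add if_distrib cong: if_cong)
next
  fix c f assume "f \<in> graded_part Z k"
  then obtain P where P: "\<forall>\<beta>\<in>Poly_Mapping.keys P. size \<beta> = k" "f = (\<lambda>\<xi>. if \<xi> \<in> Z then eval_sym P \<xi> else 0)"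
    by (rule graded_partE)
  have "\<forall>\<beta>\<in>Poly_Mapping.keys (Poly_Mapping.single {#} c * P). size \<beta> = k"
    using P(1) keys_mult[of "Poly_Mapping.single {#} c" P] by (auto split: if_splits)
  from graded_partI[OF this] have "(\<lambda>\<xi>. if \<xi> \<in> Z then eval_sym (Poly_Mapping.single {#} c * P) \<xi> else 0) \<in> graded_part Z k" .
  moreover have "(\<lambda>\<xi>. if \<xi> \<in> Z then eval_sym (Poly_Mapping.single {#} c * P) \<xi> else 0) = fun_scale c f"
    unfolding P(2) by (simp add: fun_scale_def eval_sym_mult eval_sym_single fun_eq_iff)
  ultimately show "fun_scale c f \<in> graded_part Z k" by simp
qed

lemma card_size_multisets: "card {\<alpha> :: 'n::finite multiset. size \<alpha> = k} \<le> Suc k ^ CARD('n)"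
proof -
  let ?S = "{\<alpha> :: 'n::finite multiset. size \<alpha> = k}"
  have inj: "inj_on count ?S" by (rule inj_onI) (simp add: count_inject)
  have sub: "count ` ?S \<subseteq> PiE UNIV (\<lambda>_. {..k})" using count_le_size by fastforce
  have fin: "finite (PiE (UNIV :: 'n set) (\<lambda>_. {..k}))" by (rule finite_PiE) auto
  have "card ?S \<le> card (PiE (UNIV :: 'n set) (\<lambda>_. {..k}))" using card_inj_on_le[OF inj sub fin] .
  then show "card ?S \<le> Suc k ^ CARD('n)" by (simp add: card_PiE)
qed

lemma graded_part_bounded:
  fixes Z :: "(complex ^ 'n::finite) set"
  shows "fin_gen fun_scale (graded_part Z k)" and "hfun Z k \<le> Suc k ^ CARD('n)"
proof -
  let ?S = "{\<alpha> :: 'n multiset. size \<alpha> = k}"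
  define e where "e \<alpha> = (\<lambda>\<xi>. if \<xi> \<in> Z then \<Prod>i\<in>#\<alpha>. \<xi> $ i else 0)" for \<alpha>
  have sub: "graded_part Z k \<subseteq> cfun.span (e ` ?S)"
  proof
    fix f assume "f \<in> graded_part Z k"
    then obtain P where P: "\<forall>\<beta>\<in>Poly_Mapping.keys P. size \<beta> = k" "f = (\<lambda>\<xi>. if \<xi> \<in> Z then eval_sym P \<xi> else 0)"
      by (rule graded_partE)
    have fs: "(\<Sum>i\<in>S. F i) \<xi> = (\<Sum>i\<in>S. F i \<xi>)" for S \<xi> and F :: "'n multiset \<Rightarrow> complex ^ 'n \<Rightarrow> complex"
      by (induction S rule: infinite_finite_induct) auto
    have "f = (\<Sum>\<beta>\<in>Poly_Mapping.keys P. fun_scale (Poly_Mapping.lookup P \<beta>) (e \<beta>))"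
      unfolding P(2) by (rule ext) (simp add: fs fun_scale_def e_def eval_sym_def)
    also have "\<dots> \<in> cfun.span (e ` ?S)"
      by (intro cfun.span_sum cfun.span_scale cfun.span_base imageI) (use P(1) in auto)
    finally show "f \<in> cfun.span (e ` ?S)" .
  qed
  have fin: "finite (e ` ?S)" using finite_size_eq by blast
  show "fin_gen fun_scale (graded_part Z k)" using sub fin unfolding fin_gen_def by blast
  have "hfun Z k \<le> card (e ` ?S)" by (rule cfun.dim_le_finite_span[OF fin sub])
  also have "\<dots> \<le> card ?S" by (rule card_image_le[OF finite_size_eq])
  finally show "hfun Z k \<le> Suc k ^ CARD('n)" using card_size_multisets[of k, where 'n = 'n] by simp
qed

lemma hfun_pos:
  assumes "\<xi> \<in> Z" "\<xi> \<noteq> 0" shows "hfun Z k \<ge> 1"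
proof (rule ccontr)
  assume "\<not> hfun Z k \<ge> 1"
  then have "graded_part Z k \<subseteq> {0}"
    by (intro cfun.dim_eq_0_fin_gen graded_part_bounded) simp
  moreover obtain i where i: "\<xi> $ i \<noteq> 0" using assms(2) by (auto simp: Finite_Cartesian_Product.vec_eq_iff)
  let ?P = "Poly_Mapping.single (replicate_mset k i) 1 :: ('a, complex) sym_alg"
  have "(\<lambda>\<xi>. if \<xi> \<in> Z then eval_sym ?P \<xi> else 0) \<in> graded_part Z k" by (rule graded_partI) simp
  ultimately have "(\<lambda>\<xi>. if \<xi> \<in> Z then eval_sym ?P \<xi> else 0) = 0" by blast
  from fun_cong[OF this, of \<xi>] have "eval_sym ?P \<xi> = 0" using assms(1) by simp
  then show False using i by (simp add: eval_sym_single)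
qed

text \<open>A form that vanishes on \<open>Z\<close> but not on the irreducible \<open>Z'\<close> is
  no zero divisor in the coordinate ring of \<open>Z'\<close>, and its multiples lie in the kernel
  of the restriction to \<open>Z\<close>.\<close>

lemma hfun_step:
  fixes Z Z' :: "(complex ^ 'n::finite) set"
  assumes Z: "Z \<subseteq> Z'" and irr: "proj_irreducible Z'"
    and h: "\<forall>\<beta>\<in>Poly_Mapping.keys h. size \<beta> = a" "\<forall>\<xi>\<in>Z. eval_sym h \<xi> = 0" "\<xi>0 \<in> Z'" "eval_sym h \<xi>0 \<noteq> 0"
  shows "hfun Z' (k + a) \<ge> hfun Z' k + hfun Z (k + a)"
proof -
  define \<rho> where "\<rho> f = (\<lambda>\<xi>. if \<xi> \<in> Z then f \<xi> else 0)" for f :: "complex ^ 'n \<Rightarrow> complex"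
  define \<mu> where "\<mu> f = (\<lambda>\<xi>. eval_sym h \<xi> * f \<xi>)" for f
  have \<rho>: "Vector_Spaces.linear fun_scale fun_scale \<rho>" by (rule cfun_linearI) (auto simp: \<rho>_def)
  have \<mu>: "Vector_Spaces.linear fun_scale fun_scale \<mu>" by (rule cfun_linearI) (auto simp: \<mu>_def algebra_simps)
  have "\<rho> ` graded_part Z' (k + a) = graded_part Z (k + a)"
  proof -
    have e: "\<rho> (\<lambda>\<xi>. if \<xi> \<in> Z' then eval_sym P \<xi> else 0) = (\<lambda>\<xi>. if \<xi> \<in> Z then eval_sym P \<xi> else 0)" for P
      using Z by (auto simp: \<rho>_def fun_eq_iff)
    show ?thesis
    proof (intro equalityI subsetI)
      fix f assume "f \<in> \<rho> ` graded_part Z' (k + a)"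
      then obtain g where g: "g \<in> graded_part Z' (k + a)" "f = \<rho> g" by blast
      obtain P where "\<forall>\<beta>\<in>Poly_Mapping.keys P. size \<beta> = k + a" "g = (\<lambda>\<xi>. if \<xi> \<in> Z' then eval_sym P \<xi> else 0)"
        using g(1) by (rule graded_partE)
      then show "f \<in> graded_part Z (k + a)" unfolding g(2) by (simp only: e graded_partI)
    next
      fix f assume "f \<in> graded_part Z (k + a)"
      then obtain P where P: "\<forall>\<beta>\<in>Poly_Mapping.keys P. size \<beta> = k + a" "f = (\<lambda>\<xi>. if \<xi> \<in> Z then eval_sym P \<xi> else 0)"
        by (rule graded_partE)
      show "f \<in> \<rho> ` graded_part Z' (k + a)" unfolding P(2) e[symmetric] by (intro imageI graded_partI P(1))
    qed
  qed
  then have 1: "hfun Z' (k + a) = cfun.dim {f \<in> graded_part Z' (k + a). \<rho> f = 0} + hfun Z (k + a)"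
    using cfun_cfun.rank_nullity[OF \<rho> subspace_graded_part graded_part_bounded(1), of Z' "k + a"] by simp
  have 2: "cfun.dim (\<mu> ` graded_part Z' k) = hfun Z' k"
  proof (rule cfun_cfun.dim_image_inj[OF \<mu> subspace_graded_part graded_part_bounded(1)])
    fix f assume f: "f \<in> graded_part Z' k" "\<mu> f = 0"
    obtain P where P: "\<forall>\<beta>\<in>Poly_Mapping.keys P. size \<beta> = k" "f = (\<lambda>\<xi>. if \<xi> \<in> Z' then eval_sym P \<xi> else 0)"
      using f(1) by (rule graded_partE)
    let ?A = "\<lambda>P. {\<xi>. \<xi> \<noteq> 0 \<and> (\<forall>R\<in>{P}. eval_sym R \<xi> = 0)}"
    have "homogeneous P" "homogeneous h" unfolding homogeneous_def using P(1) h(1) by blast+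
    moreover have "proj_closed (?A R)" if "homogeneous R" for R
      unfolding proj_closed_def using that by (intro exI[of _ "{R}"]) simp
    ultimately have cl: "proj_closed (?A P)" "proj_closed (?A h)" by blast+
    have "Z' \<subseteq> ?A h \<union> ?A P"
    proof
      fix \<xi> assume x: "\<xi> \<in> Z'"
      have "\<xi> \<noteq> 0" using x irr unfolding proj_irreducible_def proj_closed_def by blast
      moreover have "eval_sym h \<xi> * eval_sym P \<xi> = 0" using fun_cong[OF f(2), of \<xi>] x by (simp add: \<mu>_def P(2))
      ultimately show "\<xi> \<in> ?A h \<union> ?A P" by simp
    qed
    then have "Z' \<subseteq> ?A h \<or> Z' \<subseteq> ?A P" using irr cl unfolding proj_irreducible_def by blast
    moreover have "\<not> Z' \<subseteq> ?A h" using h(3,4) by blast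
    ultimately have "\<forall>\<xi>\<in>Z'. eval_sym P \<xi> = 0" by blast
    then show "f = 0" unfolding P(2) by (simp add: fun_eq_iff)
  qed
  have 3: "\<mu> ` graded_part Z' k \<subseteq> {f \<in> graded_part Z' (k + a). \<rho> f = 0}"
  proof
    fix g assume "g \<in> \<mu> ` graded_part Z' k"
    then obtain f where f: "f \<in> graded_part Z' k" "g = \<mu> f" by blast
    obtain P where P: "\<forall>\<beta>\<in>Poly_Mapping.keys P. size \<beta> = k" "f = (\<lambda>\<xi>. if \<xi> \<in> Z' then eval_sym P \<xi> else 0)"
      using f(1) by (rule graded_partE)
    have "\<forall>\<beta>\<in>Poly_Mapping.keys (h * P). size \<beta> = k + a" using P(1) h(1) keys_mult[of h P] by fastforce
    from graded_partI[OF this] have "(\<lambda>\<xi>. if \<xi> \<in> Z' then eval_sym (h * P) \<xi> else 0) \<in> graded_part Z' (k + a)" .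
    moreover have "g = (\<lambda>\<xi>. if \<xi> \<in> Z' then eval_sym (h * P) \<xi> else 0)"
      unfolding f(2) P(2) \<mu>_def by (auto simp: eval_sym_mult)
    moreover have "\<rho> g = 0" unfolding f(2) \<rho>_def \<mu>_def using h(2) by (simp add: fun_eq_iff)
    ultimately show "g \<in> {f \<in> graded_part Z' (k + a). \<rho> f = 0}" by simp
  qed
  have "fin_gen fun_scale {f \<in> graded_part Z' (k + a). \<rho> f = 0}"
    by (rule cfun.fin_gen_mono[OF graded_part_bounded(1)]) (rule Collect_restrict)
  from cfun.dim_mono_fin_gen[OF this 3]
  have "hfun Z' k \<le> cfun.dim {f \<in> graded_part Z' (k + a). \<rho> f = 0}" unfolding 2 .
  then show ?thesis using 1 by simp
qed

lemma eval_sym_power: "eval_sym (P ^ e) \<xi> = eval_sym P \<xi> ^ e"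
  by (induction e) (simp_all add: eval_sym_mult)

lemma keys_power_size:
  "\<forall>\<beta>\<in>Poly_Mapping.keys P. size \<beta> = a \<Longrightarrow> \<forall>\<beta>\<in>Poly_Mapping.keys ((P :: ('n::finite, complex) sym_alg) ^ e). size \<beta> = e * a"
proof (induction e)
  case (Suc e)
  then show ?case using keys_mult[of P "P ^ e"] by fastforce
qed simp

text \<open>Summing \<open>hfun_step\<close> over multiples of the degree raises the order of growth
  by one for each member of the chain.\<close>

lemma hfun_chain:
  fixes Z :: "nat \<Rightarrow> (complex ^ 'n::finite) set"
  assumes irr: "\<And>i. i \<le> j \<Longrightarrow> proj_irreducible (Z i)" and inc: "\<And>i. i < j \<Longrightarrow> Z i \<subset> Z (Suc i)"
  shows "\<exists>N\<ge>1. \<forall>s. s choose j \<le> hfun (Z j) (N * s)"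
  using assms
proof (induction j)
  case 0
  obtain \<xi> where "\<xi> \<in> Z 0" using 0(1)[of 0] unfolding proj_irreducible_def by blast
  moreover have "\<xi> \<noteq> 0" using calculation 0(1)[of 0] unfolding proj_irreducible_def proj_closed_def by blast
  ultimately have "hfun (Z 0) k \<ge> 1" for k by (rule hfun_pos)
  then show ?case by (intro exI[of _ 1]) simp
next
  case (Suc j)
  then obtain N where N: "N \<ge> 1" "\<And>s. s choose j \<le> hfun (Z j) (N * s)" by (auto simp: less_Suc_eq)
  have irr: "proj_irreducible (Z j)" "proj_irreducible (Z (Suc j))" and sub: "Z j \<subset> Z (Suc j)"
    using Suc.prems by auto
  obtain F where F: "\<forall>P\<in>F. homogeneous P" "Z j = {\<xi>. \<xi> \<noteq> 0 \<and> (\<forall>P\<in>F. eval_sym P \<xi> = 0)}"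
    using irr(1) unfolding proj_irreducible_def proj_closed_def by blast
  obtain \<xi>0 where x0: "\<xi>0 \<in> Z (Suc j)" "\<xi>0 \<notin> Z j" using sub by blast
  have "\<xi>0 \<noteq> 0" using x0(1) irr(2) unfolding proj_irreducible_def proj_closed_def by blast
  then obtain h where h: "h \<in> F" "eval_sym h \<xi>0 \<noteq> 0" using x0(2) F(2) by blast
  obtain a where a: "\<forall>\<beta>\<in>Poly_Mapping.keys h. size \<beta> = a" using F(1) h(1) unfolding homogeneous_def by blast
  have hZ: "eval_sym h \<xi> = 0" if "\<xi> \<in> Z j" for \<xi> using F(2) h(1) that by blast
  obtain \<xi>1 where x1: "\<xi>1 \<in> Z j" using irr(1) unfolding proj_irreducible_def by blast
  have a1: "a \<ge> 1"
  proof (rule ccontr)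
    assume "\<not> a \<ge> 1"
    then have "\<forall>\<beta>\<in>Poly_Mapping.keys h. \<beta> = {#}" using a by (metis less_one not_le size_eq_0_iff_empty)
    then have "eval_sym h \<xi>0 = eval_sym h \<xi>1" unfolding eval_sym_def by (intro sum.cong) auto
    then show False using h(2) hZ[OF x1] by simp
  qed
  \<comment> \<open>The N-th power of \<open>h\<close> has degree N * a, which fits the progression
    on which the bound for \<open>Z j\<close> is available. The induction step is then Pascal's
    rule.\<close>
  have "s choose Suc j \<le> hfun (Z (Suc j)) (N * a * s)" for s
  proof (induction s)
    case (Suc s)
    have "hfun (Z (Suc j)) (N * a * s + N * a) \<ge> hfun (Z (Suc j)) (N * a * s) + hfun (Z j) (N * a * s + N * a)"
    proof (rule hfun_step)
      show "\<forall>\<beta>\<in>Poly_Mapping.keys (h ^ N). size \<beta> = N * a" by (rule keys_power_size[OF a])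
      show "\<forall>\<xi>\<in>Z j. eval_sym (h ^ N) \<xi> = 0" using hZ N(1) by (simp add: eval_sym_power)
      show "eval_sym (h ^ N) \<xi>0 \<noteq> 0" using h(2) by (simp add: eval_sym_power)
    qed (use sub irr(2) x0(1) in auto)
    moreover have "s choose j \<le> hfun (Z j) (N * a * s + N * a)"
    proof -
      have "s choose j \<le> (a * Suc s) choose j"
        by (rule binomial_right_mono) (use mult_le_mono1[OF a1, of "Suc s"] in simp)
      also have "\<dots> \<le> hfun (Z j) (N * (a * Suc s))" by (rule N(2))
      finally show ?thesis by (simp add: algebra_simps)
    qed
    ultimately show ?case using Suc by (simp add: algebra_simps)
  qed simp
  then show ?case using N(1) a1 by (intro exI[of _ "N * a"]) (simp add: Suc_le_eq)
qed

text \<open>\<open>GREATEST\<close> in \<open>proj_dim\<close> is meaningful only for a bounded set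
  of lengths, and any bound will do. A longer chain would make a coordinate ring grow faster than
  the polynomial ring in n variables.\<close>

lemma chain_length_bound:
  fixes V :: "(complex ^ 'n::finite) set"
  assumes "irreducible_chain V c" shows "c \<le> Suc CARD('n)"
proof (rule ccontr)
  let ?n = "CARD('n)"
  assume c: "\<not> c \<le> Suc ?n"
  obtain Z :: "nat \<Rightarrow> (complex ^ 'n) set" where "(\<forall>i<c. proj_irreducible (Z i) \<and> Z i \<subseteq> V) \<and> (\<forall>i. Suc i < c \<longrightarrow> Z i \<subset> Z (Suc i))"
    using assms unfolding irreducible_chain_def ..
  then have Z: "\<And>i. i < c \<Longrightarrow> proj_irreducible (Z i)" "\<And>i. Suc i < c \<Longrightarrow> Z i \<subset> Z (Suc i)" by blast+
  obtain N where N: "N \<ge> 1" "\<And>s. s choose Suc ?n \<le> hfun (Z (Suc ?n)) (N * s)"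
  proof -
    have "\<exists>N\<ge>1. \<forall>s. s choose Suc ?n \<le> hfun (Z (Suc ?n)) (N * s)"
      by (rule hfun_chain) (rule Z, use c in simp)+
    then show ?thesis using that by blast
  qed
  \<comment> \<open>Chosen to exceed (N + 1)^n (n + 1)^(n + 1), the constant that is left after
    cancelling s^n.\<close>
  define s where "s = (Suc N * Suc ?n) ^ Suc ?n"
  have s: "s \<ge> Suc ?n" "s \<ge> 1"
  proof -
    have "Suc ?n \<le> Suc N * Suc ?n" by simp
    also have "\<dots> \<le> (Suc N * Suc ?n) ^ Suc ?n" by (rule self_le_power) auto
    finally show "s \<ge> Suc ?n" by (simp add: s_def)
    then show "s \<ge> 1" by simp
  qed
  have "(real s / real (Suc ?n)) ^ Suc ?n \<le> real (s choose Suc ?n)" by (rule binomial_ge_n_over_k_pow_k) (rule s(1))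
  also have "\<dots> \<le> real (Suc (N * s) ^ ?n)"
    using le_trans[OF N(2) graded_part_bounded(2)] by (simp only: of_nat_le_iff)
  also have "\<dots> \<le> real ((Suc N * s) ^ ?n)" using s(2) by (simp only: of_nat_le_iff) (intro power_mono, auto)
  finally have "real s ^ Suc ?n \<le> real ((Suc N * s) ^ ?n) * real (Suc ?n) ^ Suc ?n"
    by (simp only: power_divide) (simp add: field_simps del: power_Suc of_nat_Suc)
  then have "real (s ^ Suc ?n) \<le> real ((Suc N * s) ^ ?n * Suc ?n ^ Suc ?n)"
    by (simp only: of_nat_mult of_nat_power)
  then have "s ^ Suc ?n \<le> (Suc N * s) ^ ?n * Suc ?n ^ Suc ?n" by (simp only: of_nat_le_iff)
  then have "s * s ^ ?n \<le> (Suc N ^ ?n * Suc ?n ^ Suc ?n) * s ^ ?n"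
    unfolding power_mult_distrib power_Suc[of s] by (simp only: ac_simps)
  then have "s \<le> Suc N ^ ?n * Suc ?n ^ Suc ?n" by (rule mult_right_le_imp_le) (use s(2) in simp)
  also have "\<dots> < Suc N ^ Suc ?n * Suc ?n ^ Suc ?n"
    using N(1) by (intro mult_strict_right_mono) auto
  also have "\<dots> = s" unfolding s_def power_mult_distrib ..
  finally show False by simp
qed

theorem ex_linear_forms_of_dim:
  assumes V: "proj_closed V" and d: "proj_dim V = int d - 1"
  shows "\<exists>ls. length ls = d \<and> (\<forall>\<xi>\<in>V. \<exists>l\<in>set ls. real_form l \<xi> \<noteq> 0)"
proof (rule ex_linear_forms[OF V])
  show "\<not> irreducible_chain V (Suc d)"
  proof
    assume "irreducible_chain V (Suc d)"
    then have "Suc d \<le> (GREATEST c. irreducible_chain V c)"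
      by (rule Greatest_le_nat) (rule chain_length_bound)
    then show False using d unfolding proj_dim_irreducible_chain by simp
  qed
qed

section \<open>The weak Nullstellensatz\<close>

abbreviation const :: "'k \<Rightarrow> 'v multiset \<Rightarrow>\<^sub>0 'k::comm_ring_1" where
  "const c \<equiv> Poly_Mapping.single {#} c"

lemma const_add: "const (a + b) = const a + const b" by (rule single_add)

lemma const_mult: "const (a * b) = const a * const b" by (simp add: mult_single)

lemma const_one: "const 1 = (1 :: 'v multiset \<Rightarrow>\<^sub>0 'k::comm_ring_1)"
  using single_one[where 'a = "'v multiset" and 'b = 'k] by (simp add: zero_multiset_def)

definition subst_var :: "'v \<Rightarrow> 'k poly \<Rightarrow> 'v multiset \<Rightarrow>\<^sub>0 'k::comm_ring_1" where
  "subst_var i \<phi> = poly (map_poly const \<phi>) (pvar i)"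

lemma subst_var_pCons: "subst_var i (pCons a \<phi>) = const a + pvar i * subst_var i \<phi>"
proof (cases "a = 0 \<and> \<phi> = 0")
  case False
  then have "map_poly const (pCons a \<phi>) = pCons (const a :: 'a multiset \<Rightarrow>\<^sub>0 'b) (map_poly const \<phi>)"
    by (intro map_poly_pCons) auto
  then show ?thesis by (simp add: subst_var_def)
qed (simp add: subst_var_def)

lemma subst_var_0 [simp]: "subst_var i 0 = 0" by (simp add: subst_var_def)

lemma subst_var_add: "subst_var i (\<phi> + \<psi>) = subst_var i \<phi> + subst_var i \<psi>"
  by (induction \<phi> \<psi> rule: poly_induct2) (simp_all add: subst_var_pCons const_add algebra_simps)

lemma subst_var_smult: "subst_var i (Polynomial.smult c \<phi>) = const c * subst_var i \<phi>"
  by (induction \<phi>) (simp_all add: subst_var_pCons const_mult algebra_simps)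

lemma subst_var_factor: "subst_var i ([:- c, 1:] * \<phi>) = (pvar i - const c) * subst_var i \<phi>"
proof -
  have "[:- c, 1:] * \<phi> = Polynomial.smult (- c) \<phi> + pCons 0 \<phi>" by simp
  then have "subst_var i ([:- c, 1:] * \<phi>) = - const c * subst_var i \<phi> + pvar i * subst_var i \<phi>"
    by (simp only: subst_var_add subst_var_smult subst_var_pCons single_uminus) simp
  also have "\<dots> = (pvar i - const c) * subst_var i \<phi>" by (simp add: left_diff_distrib)
  finally show ?thesis .
qed

lemma subst_var_prod: "subst_var i (\<Prod>t\<in>T. [:- t, 1:]) = (\<Prod>t\<in>T. pvar i - const t)"
proof (induction T rule: infinite_finite_induct)
  case (insert t T)
  have "subst_var i (\<Prod>t\<in>insert t T. [:- t, 1:]) = (pvar i - const t) * subst_var i (\<Prod>t\<in>T. [:- t, 1:])"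
    unfolding prod.insert[OF insert(1,2)] by (rule subst_var_factor)
  then show ?case unfolding insert(3) prod.insert[OF insert(1,2)] .
qed (simp_all add: subst_var_def const_one)

lemma subst_var_sum: "subst_var i (\<Sum>t\<in>T. \<phi> t) = (\<Sum>t\<in>T. subst_var i (\<phi> t))"
  by (induction T rule: infinite_finite_induct) (simp_all add: subst_var_add)

definition poly_ideal :: "('a :: comm_ring_1) set \<Rightarrow> bool" where
  "poly_ideal J \<longleftrightarrow> 0 \<in> J \<and> (\<forall>x\<in>J. \<forall>y\<in>J. x + y \<in> J) \<and> (\<forall>x. \<forall>y\<in>J. x * y \<in> J)"

lemma poly_idealD:
  assumes "poly_ideal J" shows "0 \<in> J" "x \<in> J \<Longrightarrow> y \<in> J \<Longrightarrow> x + y \<in> J" "y \<in> J \<Longrightarrow> x * y \<in> J"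
  using assms unfolding poly_ideal_def by blast+

lemma poly_ideal_uminus: "poly_ideal J \<Longrightarrow> x \<in> J \<Longrightarrow> - x \<in> J"
  using poly_idealD(3)[of J x "-1"] by simp

lemma poly_ideal_diff: "poly_ideal J \<Longrightarrow> x \<in> J \<Longrightarrow> y \<in> J \<Longrightarrow> x - y \<in> J"
  using poly_idealD(2)[OF _ _ poly_ideal_uminus, of J x y] by simp

lemma poly_ideal_sum: "poly_ideal J \<Longrightarrow> (\<And>i. i \<in> S \<Longrightarrow> f i \<in> J) \<Longrightarrow> (\<Sum>i\<in>S. f i) \<in> J"
  by (induction S rule: infinite_finite_induct) (auto intro: poly_idealD)

definition adjoin :: "('a :: comm_ring_1) set \<Rightarrow> 'a \<Rightarrow> 'a set" where
  "adjoin J p = {u + v * p | u v. u \<in> J}"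

lemma poly_ideal_adjoin: assumes J: "poly_ideal J" shows "poly_ideal (adjoin J p)" "J \<subseteq> adjoin J p" "p \<in> adjoin J p"
proof -
  have i: "u + v * p \<in> adjoin J p" if "u \<in> J" for u v using that unfolding adjoin_def by blast
  show "J \<subseteq> adjoin J p" using i[of _ 0] by auto
  show "p \<in> adjoin J p" using i[OF poly_idealD(1)[OF J], of 1] by simp
  show "poly_ideal (adjoin J p)"
    unfolding poly_ideal_def
  proof (intro conjI ballI allI)
    show "0 \<in> adjoin J p" using i[OF poly_idealD(1)[OF J], of 0] by simp
    fix x y assume "x \<in> adjoin J p" "y \<in> adjoin J p"
    then obtain u v u' v' where x: "x = u + v * p" "u \<in> J" "y = u' + v' * p" "u' \<in> J" unfolding adjoin_def by blast
    have "x + y = (u + u') + (v + v') * p" using x by (simp add: algebra_simps)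
    then show "x + y \<in> adjoin J p" using i poly_idealD(2)[OF J] x by metis
  next
    fix x y assume "y \<in> adjoin J p"
    then obtain u v where y: "y = u + v * p" "u \<in> J" unfolding adjoin_def by blast
    have "x * y = x * u + (x * v) * p" using y by (simp add: algebra_simps)
    then show "x * y \<in> adjoin J p" using i poly_idealD(3)[OF J] y by metis
  qed
qed

definition pm_scale :: "complex \<Rightarrow> ('v multiset \<Rightarrow>\<^sub>0 complex) \<Rightarrow> 'v multiset \<Rightarrow>\<^sub>0 complex" where
  "pm_scale c P = const c * P"

interpretation pm: vector_space pm_scale
  by unfold_locales (simp_all add: pm_scale_def distrib_left distrib_right const_add const_mult const_one mult.assoc)

lemma fin_gen_bounded_degree: "fin_gen pm_scale {P :: 'n::finite multiset \<Rightarrow>\<^sub>0 complex. \<forall>\<beta>\<in>Poly_Mapping.keys P. size \<beta> \<le> D}"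
proof -
  let ?S = "\<Union>k\<le>D. {\<beta> :: 'n multiset. size \<beta> = k}"
  have "P \<in> pm.span ((\<lambda>\<beta>. Poly_Mapping.single \<beta> 1) ` ?S)" if P: "\<forall>\<beta>\<in>Poly_Mapping.keys P. size \<beta> \<le> D" for P
  proof -
    have "P = (\<Sum>\<beta>\<in>Poly_Mapping.keys P. pm_scale (Poly_Mapping.lookup P \<beta>) (Poly_Mapping.single \<beta> 1))"
      by (simp add: pm_scale_def mult_single poly_mapping_sum_single)
    also have "\<dots> \<in> pm.span ((\<lambda>\<beta>. Poly_Mapping.single \<beta> 1) ` ?S)"
      by (intro pm.span_sum pm.span_scale pm.span_base imageI) (use P in auto)
    finally show ?thesis .
  qed
  moreover have "finite ((\<lambda>\<beta>. Poly_Mapping.single \<beta> (1 :: complex)) ` ?S)" using finite_size_eq by blast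
  ultimately show ?thesis unfolding fin_gen_def by blast
qed

text \<open>Otherwise \<open>x\<^sub>i - \<lambda>\<close> would have an inverse \<open>R \<lambda>\<close> modulo \<open>J\<close> for each of the uncountably many
  \<open>\<lambda>\<close>, so infinitely many inverses would have bounded degree and hence be linearly dependent. Clearing
  denominators gives a univariate polynomial in \<open>J\<close>.\<close>

lemma proper_adjoin_var:
  fixes J :: "('n::finite multiset \<Rightarrow>\<^sub>0 complex) set"
  assumes J: "poly_ideal J" "1 \<notin> J" shows "\<exists>c. 1 \<notin> adjoin J (pvar i - const c)"
proof (rule ccontr)
  assume neg: "\<not> ?thesis"
  let ?x = "\<lambda>c. pvar i - const c :: 'n multiset \<Rightarrow>\<^sub>0 complex"
  have "\<exists>R. 1 - R * ?x c \<in> J" for c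
  proof -
    obtain u v where "1 = u + v * ?x c" "u \<in> J" using neg unfolding adjoin_def by blast
    then show ?thesis by (intro exI[of _ v]) (simp add: algebra_simps)
  qed
  from choice[OF allI[OF this]] obtain R where R: "\<forall>c. 1 - R c * ?x c \<in> J" ..
  have cancel: "P \<in> J" if "?x c * P \<in> J" for c P
  proof -
    have "R c * (?x c * P) + P * (1 - R c * ?x c) \<in> J" using that R J(1) poly_idealD by metis
    then show ?thesis by (simp add: algebra_simps)
  qed
  \<comment> \<open>Each linear factor can be cancelled because it is invertible modulo
    \<open>J\<close>, so a nonzero univariate member would reduce to a nonzero constant.\<close>
  have no_univariate: "\<phi> = 0" if "subst_var i \<phi> \<in> J" for \<phi>
    using that
  proof (induction "degree \<phi>" arbitrary: \<phi>)
    case 0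
    then obtain a where a: "\<phi> = [:a:]" by (metis degree_eq_zeroE)
    show ?case
    proof (rule ccontr)
      assume "\<phi> \<noteq> 0"
      then have "const (inverse a) * subst_var i \<phi> = 1"
        using a by (simp add: subst_var_pCons const_mult[symmetric] const_one)
      then show False using poly_idealD(3)[OF J(1) 0(2)] J(2) by metis
    qed
  next
    case (Suc d)
    have "\<not> constant (poly \<phi>)" using Suc(2) by (simp add: constant_degree)
    then obtain c where "poly \<phi> c = 0" using fundamental_theorem_of_algebra by blast
    then obtain \<psi> where \<psi>: "\<phi> = [:- c, 1:] * \<psi>" by (metis poly_eq_0_iff_dvd dvdE)
    have "\<psi> \<noteq> 0" using \<psi> Suc(2) by auto
    then have "d = degree \<psi>" using Suc(2) unfolding \<psi> by (subst (asm) degree_mult_eq) auto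
    moreover have "subst_var i \<psi> \<in> J" using Suc(3) cancel unfolding \<psi> subst_var_factor by blast
    ultimately show ?case using Suc(1) \<open>\<psi> \<noteq> 0\<close> by blast
  qed
  have deg: "\<exists>D. \<forall>\<beta>\<in>Poly_Mapping.keys P. size \<beta> \<le> D" for P :: "'n multiset \<Rightarrow>\<^sub>0 complex"
    by (rule exI[of _ "Max (size ` Poly_Mapping.keys P)"]) simp
  define S where "S D = {t :: real. \<forall>\<beta>\<in>Poly_Mapping.keys (R (complex_of_real t)). size \<beta> \<le> D}" for D :: nat
  \<comment> \<open>The uncountable real line is a countable union of the sets \<open>S D\<close>,
    so these cannot all be finite.\<close>
  have "\<exists>D. infinite (S D)"
  proof (rule ccontr)
    assume "\<not> ?thesis"
    then have "countable (S D)" for D by (simp add: countable_finite)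
    then have "countable (\<Union>D. S D)" by (rule countable_UN[OF countableI_type])
    moreover have "(\<Union>D. S D) = UNIV" using deg unfolding S_def by blast
    ultimately show False using uncountable_UNIV_real by simp
  qed
  then obtain D where D: "infinite (S D)" by blast
  define C where "C = complex_of_real ` S D"
  have C: "infinite C" using D unfolding C_def by (simp add: finite_image_iff inj_on_def)
  have "inj R"
  proof (rule injI, rule ccontr)
    fix c c' assume e: "R c = R c'" and ne: "c \<noteq> c'"
    have "(1 - R c' * ?x c') - (1 - R c * ?x c) \<in> J" using poly_ideal_diff[OF J(1)] R by blast
    moreover have "(1 - R c' * ?x c') - (1 - R c * ?x c) = const (c' - c) * R c"
      using e by (simp add: single_diff algebra_simps)
    ultimately have "const (inverse (c' - c)) * (const (c' - c) * R c) \<in> J" using poly_idealD(3)[OF J(1)] by metis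
    moreover have "const (inverse (c' - c)) * (const (c' - c) * R c) = R c"
      using ne by (simp add: mult.assoc[symmetric] const_mult[symmetric] const_one)
    ultimately have "R c \<in> J" by metis
    then have "?x c * R c + (1 - R c * ?x c) \<in> J" using R poly_idealD[OF J(1)] by metis
    then show False using J(2) by (simp add: algebra_simps)
  qed
  then have inj: "inj_on R C" by (rule inj_on_subset) simp
  have "pm.dependent (R ` C)"
  proof (rule ccontr)
    assume ind: "pm.independent (R ` C)"
    have "finite (R ` C)"
      by (rule pm.fin_gen_finite_independent[OF fin_gen_bounded_degree[of D] ind]) (auto simp: C_def S_def)
    then show False using C finite_image_iff[OF inj] by simp
  qed
  then obtain T u where T: "finite T" "T \<subseteq> R ` C" "(\<Sum>v\<in>T. pm_scale (u v) v) = 0" "\<exists>v\<in>T. u v \<noteq> 0"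
    unfolding pm.dependent_explicit by blast
  obtain T' where T': "T' \<subseteq> C" "T = R ` T'" using T(2) by (metis subset_image_iff)
  have injT: "inj_on R T'" using inj T'(1) by (rule inj_on_subset)
  have fT: "finite T'" using T(1) T'(2) finite_image_iff[OF injT] by simp
  define a where "a t = u (R t)" for t
  have sum0: "(\<Sum>t\<in>T'. const (a t) * R t) = 0"
    using T(3) unfolding T'(2) sum.reindex[OF injT] by (simp add: pm_scale_def a_def o_def)
  obtain t0 where t0: "t0 \<in> T'" "a t0 \<noteq> 0" using T(4) T'(2) by (auto simp: a_def)
  \<comment> \<open>A linear dependence of the inverses R t, multiplied by the product of all the
    factors x_i - t.\<close>
  define \<phi> where "\<phi> = (\<Sum>t\<in>T'. Polynomial.smult (a t) (\<Prod>s\<in>T' - {t}. [:- s, 1:]))"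
  have "subst_var i \<phi> = (\<Sum>t\<in>T'. const (a t) * (\<Prod>s\<in>T' - {t}. ?x s))"
    by (simp only: \<phi>_def subst_var_sum subst_var_smult subst_var_prod)
  also have "\<dots> = (\<Sum>t\<in>T'. const (a t) * (\<Prod>s\<in>T' - {t}. ?x s)) - (\<Prod>s\<in>T'. ?x s) * (\<Sum>t\<in>T'. const (a t) * R t)"
    unfolding sum0 by simp
  also have "\<dots> = (\<Sum>t\<in>T'. (const (a t) * (\<Prod>s\<in>T' - {t}. ?x s)) * (1 - R t * ?x t))"
    unfolding sum_distrib_left sum_subtractf[symmetric]
  proof (rule sum.cong[OF refl])
    fix t assume "t \<in> T'"
    then have "(\<Prod>s\<in>T'. ?x s) = ?x t * (\<Prod>s\<in>T' - {t}. ?x s)" by (rule prod.remove[OF fT])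
    then have e: "(\<Prod>s\<in>T'. ?x s) = ?x t * (\<Prod>s\<in>T' - {t}. ?x s)" .
    have alg: "p * P - (x * P) * (p * R) = p * P * (1 - R * x)" for p P x R :: "'n multiset \<Rightarrow>\<^sub>0 complex"
      by (simp add: algebra_simps)
    show "const (a t) * (\<Prod>s\<in>T' - {t}. ?x s) - (\<Prod>s\<in>T'. ?x s) * (const (a t) * R t) =
        const (a t) * (\<Prod>s\<in>T' - {t}. ?x s) * (1 - R t * ?x t)"
      unfolding e by (rule alg)
  qed
  also have "\<dots> \<in> J" using R by (intro poly_ideal_sum poly_idealD(3) J(1)) blast
  finally have "\<phi> = 0" by (rule no_univariate)
  \<comment> \<open>At \<open>t0\<close> only the summand in which the factor for \<open>t0\<close>
    is missing survives, so \<phi> is not zero.\<close>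
  moreover have "poly \<phi> t0 = a t0 * (\<Prod>s\<in>T' - {t0}. t0 - s)"
  proof -
    have "poly \<phi> t0 = (\<Sum>t\<in>T'. a t * (\<Prod>s\<in>T' - {t}. t0 - s))" by (simp add: \<phi>_def poly_sum poly_prod)
    also have "\<dots> = a t0 * (\<Prod>s\<in>T' - {t0}. t0 - s) + (\<Sum>t\<in>T' - {t0}. a t * (\<Prod>s\<in>T' - {t}. t0 - s))"
      by (rule sum.remove[OF fT t0(1)])
    also have "(\<Sum>t\<in>T' - {t0}. a t * (\<Prod>s\<in>T' - {t}. t0 - s)) = 0"
    proof (rule sum.neutral, rule ballI)
      fix t assume "t \<in> T' - {t0}"
      then have "(\<Prod>s\<in>T' - {t}. t0 - s) = 0" using fT t0(1) by (intro prod_zero) auto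
      then show "a t * (\<Prod>s\<in>T' - {t}. t0 - s) = 0" by simp
    qed
    finally show ?thesis by simp
  qed
  moreover have "(\<Prod>s\<in>T' - {t0}. t0 - s) \<noteq> 0" using fT by (simp add: prod_zero_iff)
  ultimately show False using t0(2) by simp
qed

text \<open>Adjoining one x_i - c_i after another keeps the ideal proper; once all variables are
  treated, every polynomial is congruent to its value at the point so found.\<close>

theorem weak_nullstellensatz:
  fixes J :: "('n::finite multiset \<Rightarrow>\<^sub>0 complex) set"
  assumes J: "poly_ideal J" "1 \<notin> J" shows "\<exists>\<xi>. \<forall>P\<in>J. eval_sym P \<xi> = 0"
proof -
  have "\<exists>J' \<xi>. poly_ideal J' \<and> 1 \<notin> J' \<and> J \<subseteq> J' \<and> (\<forall>i\<in>S. pvar i - const (\<xi> i) \<in> J')" if "finite S" for S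
    using that
  proof induction
    case empty
    then show ?case using J by blast
  next
    case (insert i S)
    then obtain J' \<xi> where J': "poly_ideal J'" "1 \<notin> J'" "J \<subseteq> J'" "\<forall>i\<in>S. pvar i - const (\<xi> i) \<in> J'" by blast
    obtain c where c: "1 \<notin> adjoin J' (pvar i - const c)" using proper_adjoin_var[OF J'(1,2)] by blast
    note ad = poly_ideal_adjoin[OF J'(1), of "pvar i - const c"]
    have "pvar l - const ((\<xi>(i := c)) l) \<in> adjoin J' (pvar i - const c)" if "l \<in> insert i S" for l
    proof (cases "l = i")
      case False
      then show ?thesis using that J'(4) ad(2) by auto
    qed (simp add: ad(3))
    then show ?case using ad c J'(3) by (intro exI[of _ "adjoin J' (pvar i - const c)"] exI[of _ "\<xi>(i := c)"]) blast
  qed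
  from this[OF finite[of UNIV]] obtain J' \<xi> where J': "poly_ideal J'" "1 \<notin> J'" "J \<subseteq> J'" "\<And>i. pvar i - const (\<xi> i) \<in> J'" by blast
  let ?\<xi> = "\<chi> i. \<xi> i"
  have red: "P - const (eval_sym P ?\<xi>) \<in> J'" for P
  proof (induction P rule: poly_mapping_single_induct)
    case (1 \<beta> c)
    show ?case
    proof (induction \<beta>)
      case empty
      then show ?case using poly_idealD(1)[OF J'(1)] by (simp add: eval_sym_single)
    next
      case (add i \<beta>)
      have "Poly_Mapping.single (add_mset i \<beta>) c = pvar i * Poly_Mapping.single \<beta> c" by (simp add: pvar_def mult_single)
      moreover have "eval_sym (Poly_Mapping.single (add_mset i \<beta>) c) ?\<xi> = \<xi> i * eval_sym (Poly_Mapping.single \<beta> c) ?\<xi>"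
        by (simp add: eval_sym_single)
      ultimately have "Poly_Mapping.single (add_mset i \<beta>) c - const (eval_sym (Poly_Mapping.single (add_mset i \<beta>) c) ?\<xi>) =
        pvar i * (Poly_Mapping.single \<beta> c - const (eval_sym (Poly_Mapping.single \<beta> c) ?\<xi>)) +
        const (eval_sym (Poly_Mapping.single \<beta> c) ?\<xi>) * (pvar i - const (\<xi> i))"
        by (simp add: const_mult algebra_simps)
      also have "\<dots> \<in> J'" by (intro poly_idealD(2,3)[OF J'(1)] add J'(4))
      finally show ?case .
    qed
  next
    case (2 P P')
    have e: "(P + P') - const (eval_sym (P + P') ?\<xi>) = (P - const (eval_sym P ?\<xi>)) + (P' - const (eval_sym P' ?\<xi>))"
      by (simp add: eval_sym_add const_add)
    show ?case unfolding e by (rule poly_idealD(2)[OF J'(1) 2])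
  qed
  have "eval_sym P ?\<xi> = 0" if "P \<in> J" for P
  proof (rule ccontr)
    assume nz: "eval_sym P ?\<xi> \<noteq> 0"
    have "P - (P - const (eval_sym P ?\<xi>)) \<in> J'" using that J'(3) red poly_ideal_diff[OF J'(1)] by blast
    then have "const (inverse (eval_sym P ?\<xi>)) * const (eval_sym P ?\<xi>) \<in> J'" using poly_idealD(3)[OF J'(1)] by simp
    then show False using nz J'(2) by (simp add: const_mult[symmetric] const_one)
  qed
  then show ?thesis by blast
qed

section \<open>The characteristic variety\<close>

definition comps :: "('n::finite, 'm::finite) tensor \<Rightarrow> 'm \<Rightarrow> 'n multiset \<Rightarrow> real" where
  "comps q = (\<lambda>j \<alpha>. q \<alpha> $ j)"

lemma shift_add: "shift (\<beta> + \<gamma>) q = shift \<beta> (shift \<gamma> q)"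
  by (simp add: shift_def fun_eq_iff add.assoc)

lemma symbolic_system_shift1:
  assumes "symbolic_system g" "q \<in> g (Suc k)" shows "shift {#i#} q \<in> g k"
proof -
  have "q \<in> prolong k 1 (g k)" using assms unfolding symbolic_system_def by blast
  then have "\<forall>vs. length vs = 1 \<longrightarrow> foldr \<delta> vs q \<in> g k" by (simp add: prolong_def)
  then have "foldr \<delta> [axis i 1] q \<in> g k" by (metis length_Cons list.size(3) One_nat_def)
  then show ?thesis by (simp add: \<delta>_axis shift_def)
qed

lemma symbolic_system_shift:
  assumes g: "symbolic_system g" shows "q \<in> g k \<Longrightarrow> size \<beta> \<le> k \<Longrightarrow> shift \<beta> q \<in> g (k - size \<beta>)"
proof (induction \<beta> arbitrary: k q)
  case empty
  then show ?case by (simp add: shift_def)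
next
  case (add i \<beta>)
  then obtain k' where k': "k = Suc k'" by (cases k) auto
  have "shift \<beta> (shift {#i#} q) \<in> g (k' - size \<beta>)"
    by (rule add.IH) (use add.prems k' symbolic_system_shift1[OF g] in auto)
  then show ?case using shift_add[of \<beta> "{#i#}" q] k' by simp
qed

lemma symbolic_system_sym: "symbolic_system g \<Longrightarrow> q \<in> g k \<Longrightarrow> size \<alpha> \<noteq> k \<Longrightarrow> q \<alpha> = 0"
  unfolding symbolic_system_def sym_tensors_def by blast

lemma pdiff_comps_size:
  assumes "symbolic_system g" "q \<in> g k"
  shows "pdiff P (comps q j) \<alpha> = (\<Sum>\<beta> \<in> {\<beta> \<in> Poly_Mapping.keys P. size \<alpha> + size \<beta> = k}. Poly_Mapping.lookup P \<beta> * q (\<alpha> + \<beta>) $ j)"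
  unfolding pdiff_def comps_def by (intro sum.mono_neutral_right) (auto simp: symbolic_system_sym[OF assms])

text \<open>The coordinate functionals on \<open>g (size \<alpha>)\<close> belong to the dual
  module, and together they detect every component of \<open>P\<close> applied to a tensor.\<close>

lemma annihilator_vdiff:
  fixes g :: "nat \<Rightarrow> ('n::finite, 'm::finite) tensor set"
  assumes g: "symbolic_system g" and P: "P \<in> annihilator g" and q: "q \<in> g k" shows "vdiff P (comps q) = 0"
proof (intro ext)
  fix j \<alpha>
  note sym = symbolic_system_sym[OF g q]
  show "vdiff P (comps q) j \<alpha> = 0 j \<alpha>"
  proof (cases "size \<alpha> \<le> k")
    case False
    then have "{\<beta> \<in> Poly_Mapping.keys P. size \<alpha> + size \<beta> = k} = {}" by auto
    then show ?thesis unfolding vdiff_def pdiff_comps_size[OF g q] by (simp only: sum.empty zero_fun_def)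
  next
    case True
    define \<phi> :: "('n, 'm, real) dual" where "\<phi> = (\<lambda>i q. if i = size \<alpha> \<and> q \<in> g i then q \<alpha> $ j else 0)"
    have "\<phi> \<in> dual_module g"
    proof -
      have "{i. \<phi> i \<noteq> 0} \<subseteq> {size \<alpha>}" by (auto simp: \<phi>_def fun_eq_iff)
      then have "finite {i. \<phi> i \<noteq> 0}" by (rule finite_subset) simp
      moreover have "\<phi> i (tensor_scale a q + tensor_scale b q') = a *\<^sub>R \<phi> i q + b *\<^sub>R \<phi> i q'"
        if "q \<in> g i" "q' \<in> g i" for i q q' a b
      proof -
        have "tensor_scale a q + tensor_scale b q' \<in> g i"
          using that g unfolding symbolic_system_def by (intro tensor.subspace_add tensor.subspace_scale) blast+
        then show ?thesis using that by (simp add: \<phi>_def tensor_scale_def)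
      qed
      ultimately show ?thesis unfolding dual_module_def by (simp add: \<phi>_def)
    qed
    then have "act g P \<phi> k q = 0" using P unfolding annihilator_def by (simp add: fun_eq_iff)
    then have 0: "(\<Sum>\<beta> \<in> {\<beta> \<in> Poly_Mapping.keys P. size \<beta> \<le> k}. Poly_Mapping.lookup P \<beta> * \<phi> (k - size \<beta>) (shift \<beta> q)) = 0"
      using q by (simp add: act_def)
    have "(\<Sum>\<beta> \<in> {\<beta> \<in> Poly_Mapping.keys P. size \<alpha> + size \<beta> = k}. Poly_Mapping.lookup P \<beta> * q (\<alpha> + \<beta>) $ j) =
      (\<Sum>\<beta> \<in> {\<beta> \<in> Poly_Mapping.keys P. size \<beta> \<le> k}. Poly_Mapping.lookup P \<beta> * \<phi> (k - size \<beta>) (shift \<beta> q))"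
    proof (rule sum.mono_neutral_cong_left)
      show "Poly_Mapping.lookup P \<beta> * q (\<alpha> + \<beta>) $ j = Poly_Mapping.lookup P \<beta> * \<phi> (k - size \<beta>) (shift \<beta> q)"
        if "\<beta> \<in> {\<beta> \<in> Poly_Mapping.keys P. size \<alpha> + size \<beta> = k}" for \<beta>
      proof -
        have "size \<alpha> + size \<beta> = k" using that by blast
        moreover from this have "shift \<beta> q \<in> g (k - size \<beta>)" by (intro symbolic_system_shift[OF g q]) simp
        ultimately show ?thesis by (auto simp: \<phi>_def shift_def)
      qed
    qed (auto simp: \<phi>_def)
    then show ?thesis using 0 unfolding vdiff_def pdiff_comps_size[OF g q] by simp
  qed
qed

lemma vdiff_annihilator:
  fixes g :: "nat \<Rightarrow> ('n::finite, 'm::finite) tensor set"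
  assumes g: "symbolic_system g" and d: "\<And>\<beta>. \<beta> \<in> Poly_Mapping.keys P \<Longrightarrow> size \<beta> = d"
    and P: "\<And>k q. q \<in> g k \<Longrightarrow> vdiff P (comps q) = 0"
  shows "P \<in> annihilator g"
  unfolding annihilator_def mem_Collect_eq
proof (intro ballI ext)
  fix \<phi> :: "('n, 'm, real) dual" and k q assume \<phi>: "\<phi> \<in> dual_module g"
  show "act g P \<phi> k q = 0 k q"
  proof (cases "q \<in> g k \<and> d \<le> k")
    case False
    then show ?thesis using d by (auto simp: act_def intro!: sum.neutral)
  next
    case True
    then have q: "q \<in> g k" "d \<le> k" by auto
    have sub: "tensor.subspace (g i)" for i using g unfolding symbolic_system_def by blast
    have lin: "\<phi> i (tensor_scale a q + tensor_scale b q') = a * \<phi> i q + b * \<phi> i q'" if "q \<in> g i" "q' \<in> g i" for i q q' a b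
      using \<phi> that unfolding dual_module_def by simp
    have zero: "\<phi> i 0 = 0" for i using lin[of 0 i 0 0 0] tensor.subspace_0[OF sub] by simp
    have sum: "\<phi> i (\<Sum>\<beta>\<in>B. tensor_scale (u \<beta>) (s \<beta>)) = (\<Sum>\<beta>\<in>B. u \<beta> * \<phi> i (s \<beta>))"
      if "finite B" "\<forall>\<beta>\<in>B. s \<beta> \<in> g i" for i B u and s :: "'n multiset \<Rightarrow> ('n, 'm) tensor"
      using that
    proof (induction B rule: finite_induct)
      case (insert \<beta> B)
      have "(\<Sum>\<beta>\<in>B. tensor_scale (u \<beta>) (s \<beta>)) \<in> g i"
        by (rule tensor.subspace_sum[OF sub]) (use insert.prems in \<open>auto intro: tensor.subspace_scale[OF sub]\<close>)
      moreover have "s \<beta> \<in> g i" using insert.prems by simp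
      ultimately have "\<phi> i (tensor_scale (u \<beta>) (s \<beta>) + tensor_scale 1 (\<Sum>\<beta>\<in>B. tensor_scale (u \<beta>) (s \<beta>))) =
          u \<beta> * \<phi> i (s \<beta>) + 1 * \<phi> i (\<Sum>\<beta>\<in>B. tensor_scale (u \<beta>) (s \<beta>))" by (intro lin)
      moreover have "\<phi> i (\<Sum>\<beta>\<in>B. tensor_scale (u \<beta>) (s \<beta>)) = (\<Sum>\<beta>\<in>B. u \<beta> * \<phi> i (s \<beta>))"
        by (rule insert.IH) (use insert.prems in simp)
      ultimately show ?case unfolding sum.insert[OF insert.hyps(1,2)] tensor.scale_one mult_1_left by (simp only:)
    qed (simp add: zero)
    have "(\<Sum>\<beta>\<in>Poly_Mapping.keys P. tensor_scale (Poly_Mapping.lookup P \<beta>) (shift \<beta> q)) = 0"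
    proof
      fix \<alpha>
      have fs: "(\<Sum>i\<in>S. F i) \<alpha> = (\<Sum>i\<in>S. F i \<alpha>)" for S and F :: "'n multiset \<Rightarrow> ('n, 'm) tensor"
        by (induction S rule: infinite_finite_induct) auto
      have "(\<Sum>\<beta>\<in>Poly_Mapping.keys P. tensor_scale (Poly_Mapping.lookup P \<beta>) (shift \<beta> q) \<alpha>) $ j = 0" for j
        using fun_cong[OF fun_cong[OF P[OF q(1)]], of j \<alpha>]
        by (simp add: vdiff_def pdiff_def comps_def tensor_scale_def shift_def)
      then show "(\<Sum>\<beta>\<in>Poly_Mapping.keys P. tensor_scale (Poly_Mapping.lookup P \<beta>) (shift \<beta> q)) \<alpha> = 0 \<alpha>"
        unfolding fs by (simp add: Finite_Cartesian_Product.vec_eq_iff)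
    qed
    then have "(\<Sum>\<beta>\<in>Poly_Mapping.keys P. Poly_Mapping.lookup P \<beta> * \<phi> (k - d) (shift \<beta> q)) = 0"
      using sum[of "Poly_Mapping.keys P" "\<lambda>\<beta>. shift \<beta> q" "k - d" "Poly_Mapping.lookup P"]
        symbolic_system_shift[OF g q(1)] d q(2) zero by force
    moreover have "{\<beta> \<in> Poly_Mapping.keys P. size \<beta> \<le> k} = Poly_Mapping.keys P" using d q(2) by auto
    ultimately show ?thesis using q(1) d by (simp add: act_def)
  qed
qed

definition homogeneous_part :: "nat \<Rightarrow> ('n::finite, real) sym_alg \<Rightarrow> ('n, real) sym_alg" where
  "homogeneous_part d P = (\<Sum>\<beta> \<in> {\<beta> \<in> Poly_Mapping.keys P. size \<beta> = d}. Poly_Mapping.single \<beta> (Poly_Mapping.lookup P \<beta>))"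

lemma keys_homogeneous_part: "\<beta> \<in> Poly_Mapping.keys (homogeneous_part d P) \<Longrightarrow> size \<beta> = d"
  unfolding homogeneous_part_def using keys_sum by (fastforce split: if_splits)

text \<open>On tensors of degree k, different degrees of \<open>P\<close> produce values at
  multi-indices of different sizes, so they cannot cancel one another. This makes the annihilator
  homogeneous and the characteristic variety projectively closed.\<close>

lemma homogeneous_part_annihilator:
  assumes g: "symbolic_system g" and P: "P \<in> annihilator g" shows "homogeneous_part d P \<in> annihilator g"
proof (rule vdiff_annihilator[OF g keys_homogeneous_part])
  fix k q assume q: "q \<in> g k"
  note sym = symbolic_system_sym[OF g q]
  have e: "pdiff (homogeneous_part d P) u \<alpha> = (\<Sum>\<beta> \<in> {\<beta> \<in> Poly_Mapping.keys P. size \<beta> = d}. Poly_Mapping.lookup P \<beta> * u (\<alpha> + \<beta>))"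
    for u \<alpha> unfolding homogeneous_part_def pdiff_sum_left pdiff_single ..
  show "vdiff (homogeneous_part d P) (comps q) = 0"
  proof (intro ext)
    fix j \<alpha>
    have "pdiff (homogeneous_part d P) (comps q j) \<alpha> = (if size \<alpha> + d = k then pdiff P (comps q j) \<alpha> else 0)"
    proof (cases "size \<alpha> + d = k")
      case True
      then have "{\<beta> \<in> Poly_Mapping.keys P. size \<alpha> + size \<beta> = k} = {\<beta> \<in> Poly_Mapping.keys P. size \<beta> = d}" by auto
      then show ?thesis using True unfolding e pdiff_comps_size[OF g q, of P j \<alpha>] by (simp add: comps_def)
    next
      case False
      then show ?thesis unfolding e by (auto simp: comps_def sym intro!: sum.neutral)
    qed
    moreover have "pdiff P (comps q j) \<alpha> = 0"
      using fun_cong[OF fun_cong[OF annihilator_vdiff[OF g P q]], of j \<alpha>] by (simp add: vdiff_def)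
    ultimately show "vdiff (homogeneous_part d P) (comps q) j \<alpha> = 0 j \<alpha>" by (simp add: vdiff_def)
  qed
qed

abbreviation complexify :: "('n::finite, real) sym_alg \<Rightarrow> ('n, complex) sym_alg" where
  "complexify \<equiv> Poly_Mapping.map complex_of_real"

lemma lookup_complexify: "Poly_Mapping.lookup (complexify P) \<beta> = complex_of_real (Poly_Mapping.lookup P \<beta>)"
  by (simp add: Poly_Mapping.map.rep_eq when_def)

lemma keys_complexify: "Poly_Mapping.keys (complexify P) = Poly_Mapping.keys P"
  by (auto simp: in_keys_iff lookup_complexify)

lemma eval_sym_complexify:
  "eval_sym (complexify P) \<xi> = (\<Sum>d\<in>size ` Poly_Mapping.keys P. eval_sym (complexify (homogeneous_part d P)) \<xi>)"
proof -
  have l: "Poly_Mapping.lookup (homogeneous_part d P) \<beta> = (if size \<beta> = d then Poly_Mapping.lookup P \<beta> else 0)" for d \<beta>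
    unfolding homogeneous_part_def lookup_sum
    by (auto simp: lookup_single when_def in_keys_iff sum.delta intro!: sum.neutral)
  have "eval_sym (complexify (homogeneous_part d P)) \<xi> =
      (\<Sum>\<beta> \<in> {\<beta> \<in> Poly_Mapping.keys P. size \<beta> = d}. complex_of_real (Poly_Mapping.lookup P \<beta>) * (\<Prod>i\<in>#\<beta>. \<xi> $ i))" for d
    by (subst eval_sym_superset[of "{\<beta> \<in> Poly_Mapping.keys P. size \<beta> = d}"])
      (auto simp: keys_complexify lookup_complexify l in_keys_iff split: if_splits)
  then show ?thesis
    by (simp add: eval_sym_def keys_complexify lookup_complexify sum.image_gen[of "Poly_Mapping.keys P" _ size])
qed

lemma proj_closed_char_variety:
  fixes g :: "nat \<Rightarrow> ('n::finite, 'm::finite) tensor set"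
  assumes g: "symbolic_system g" shows "proj_closed (char_variety g)"
proof -
  let ?F = "{complexify P | P. P \<in> annihilator g \<and> homogeneous P}"
  have "(\<forall>P\<in>annihilator g. eval_sym (complexify P) \<xi> = 0) \<longleftrightarrow> (\<forall>Q\<in>?F. eval_sym Q \<xi> = 0)" for \<xi>
  proof
    assume F: "\<forall>Q\<in>?F. eval_sym Q \<xi> = 0"
    show "\<forall>P\<in>annihilator g. eval_sym (complexify P) \<xi> = 0"
    proof
      fix P assume P: "P \<in> annihilator g"
      have "homogeneous (homogeneous_part d P)" for d using keys_homogeneous_part unfolding homogeneous_def by blast
      then have "eval_sym (complexify (homogeneous_part d P)) \<xi> = 0" for d
        using F homogeneous_part_annihilator[OF g P] by blast
      then show "eval_sym (complexify P) \<xi> = 0" by (simp add: eval_sym_complexify[of P])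
    qed
  qed blast
  then have "char_variety g = {\<xi>. \<xi> \<noteq> 0 \<and> (\<forall>Q\<in>?F. eval_sym Q \<xi> = 0)}" unfolding char_variety_def by blast
  moreover have "\<forall>Q\<in>?F. homogeneous Q" unfolding homogeneous_def by (auto simp: keys_complexify)
  ultimately show ?thesis unfolding proj_closed_def by blast
qed

text \<open>For each variable the Nullstellensatz gives \<open>1 = u + v (x\<^sub>i - 1)\<close> with \<open>u\<close> annihilating all these
  tensors. Applied to \<open>p = \<Sum>\<^sub>s x\<^sub>i\<^sup>s q\<close>, which satisfies \<open>(x\<^sub>i - 1) p = - q\<close>, this yields \<open>p = - v q\<close>, so
  \<open>x\<^sub>i\<^sup>s q = 0\<close> for \<open>s > deg v\<close>.\<close>

theorem common_kernel_vanishes: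
  fixes g :: "nat \<Rightarrow> ('n::finite, 'm::finite) tensor set"
  assumes g: "symbolic_system g" and ls: "\<And>\<xi>. \<xi> \<in> char_variety g \<Longrightarrow> \<exists>l\<in>set ls. real_form l \<xi> \<noteq> 0"
  shows "\<exists>E. \<forall>k\<ge>E. \<forall>q\<in>g k. (\<forall>l\<in>set ls. \<delta> l q = 0) \<longrightarrow> q = 0"
proof -
  define K where "K k = {q \<in> g k. \<forall>l\<in>set ls. \<delta> l q = 0}" for k
  define cc where "cc q = (\<lambda>j \<alpha>. complex_of_real (comps q j \<alpha>))" for q :: "('n, 'm) tensor"
  \<comment> \<open>A single ideal for all degrees k at once, so that the resulting exponent bound
    is uniform in k.\<close>
  define J where "J = {U :: ('n, complex) sym_alg. \<forall>k. \<forall>q\<in>K k. vdiff U (cc q) = 0}"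
  have J: "poly_ideal J"
    unfolding poly_ideal_def J_def
    by (auto simp: vdiff.scale_left_distrib vdiff_mult[symmetric] vdiff.scale_zero_right vdiff.scale_zero_left simp del: vdiff.scale_scale)
  have "\<exists>D. \<forall>k. \<forall>q\<in>K k. \<forall>\<gamma>. count \<gamma> i > D \<longrightarrow> q \<gamma> = 0" for i
  proof -
    let ?x = "pvar i :: ('n, complex) sym_alg"
    \<comment> \<open>Otherwise the Nullstellensatz gives a covector with i-th coordinate 1, hence
      nonzero, that lies in the characteristic variety and is killed by all forms in
      \<open>ls\<close>.\<close>
    have "1 \<in> adjoin J (?x - const 1)"
    proof (rule ccontr)
      assume "1 \<notin> adjoin J (?x - const 1)"
      from weak_nullstellensatz[OF poly_ideal_adjoin(1)[OF J] this]
      obtain \<xi> where \<xi>: "\<forall>P\<in>adjoin J (?x - const 1). eval_sym P \<xi> = 0" by blast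
      have "eval_sym (?x - const 1) \<xi> = 0" using \<xi> poly_ideal_adjoin(3)[OF J] by blast
      then have "\<xi> $ i = 1" by (simp add: eval_sym_diff pvar_def eval_sym_single)
      then have "\<xi> \<noteq> 0" by auto
      have "complexify P \<in> J" if P: "P \<in> annihilator g" for P
      proof -
        have "vdiff (complexify P) (cc q) = 0" if "q \<in> K k" for q k
        proof (intro ext)
          fix j \<alpha>
          have "pdiff P (comps q j) \<alpha> = 0"
            using fun_cong[OF fun_cong[OF annihilator_vdiff[OF g P, of q k]], of j \<alpha>] that by (simp add: vdiff_def K_def)
          moreover have "pdiff (complexify P) (cc q j) \<alpha> = complex_of_real (pdiff P (comps q j) \<alpha>)"
            by (simp add: pdiff_def keys_complexify lookup_complexify cc_def)
          ultimately show "vdiff (complexify P) (cc q) j \<alpha> = 0 j \<alpha>" by (simp add: vdiff_def)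
        qed
        then show ?thesis by (simp add: J_def)
      qed
      then have "\<xi> \<in> char_variety g"
        using \<xi> poly_ideal_adjoin(2)[OF J] \<open>\<xi> \<noteq> 0\<close> unfolding char_variety_def by blast
      then obtain l where l: "l \<in> set ls" "real_form l \<xi> \<noteq> 0" using ls by blast
      define L where "L = (\<Sum>i\<in>UNIV. Poly_Mapping.single {#i#} (complex_of_real (l $ i)))"
      have "vdiff L (cc q) = 0" if "q \<in> K k" for q k
      proof (intro ext)
        fix j \<alpha>
        have "\<delta> l q \<alpha> $ j = 0" using that l(1) by (simp add: K_def)
        then have "(\<Sum>i\<in>UNIV. l $ i * q (add_mset i \<alpha>) $ j) = 0" by (simp add: \<delta>_def)
        then have "complex_of_real (\<Sum>i\<in>UNIV. l $ i * q (add_mset i \<alpha>) $ j) = 0" by simp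
        then show "vdiff L (cc q) j \<alpha> = 0 j \<alpha>"
          by (simp add: vdiff_def L_def pdiff_sum_left pdiff_single cc_def comps_def)
      qed
      then have "L \<in> J" by (simp add: J_def)
      then have "eval_sym L \<xi> = 0" using \<xi> poly_ideal_adjoin(2)[OF J] by blast
      then show False using l(2) by (simp add: L_def eval_sym_sum eval_sym_single real_form_def)
    qed
    then obtain u v where uv: "1 = u + v * (?x - const 1)" "u \<in> J" unfolding adjoin_def by blast
    define D where "D = Max (insert 0 (size ` Poly_Mapping.keys v))"
    have D: "size \<beta> \<le> D" if "\<beta> \<in> Poly_Mapping.keys v" for \<beta> unfolding D_def using that by (intro Max_ge) auto
    have "q \<gamma> = 0" if q: "q \<in> K k" and c: "count \<gamma> i > D" for k q \<gamma>
    proof (cases "size \<gamma> = k")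
      case False
      then show ?thesis using q by (intro symbolic_system_sym[OF g _ False]) (simp add: K_def)
    next
      case True
      have sym: "q \<alpha> = 0" if "size \<alpha> \<noteq> k" for \<alpha>
        using q by (intro symbolic_system_sym[OF g _ that]) (simp add: K_def)
      define s where "s = count \<gamma> i"
      define \<alpha> where "\<alpha> = \<gamma> - replicate_mset s i"
      have \<gamma>: "\<gamma> = \<alpha> + replicate_mset s i" unfolding \<alpha>_def s_def by (simp add: count_le_replicate_mset_subset_eq[symmetric])
      have xs: "vdiff (?x ^ t) (cc q) j \<alpha>' = complex_of_real (q (\<alpha>' + replicate_mset t i) $ j)" for t j \<alpha>'
        by (simp add: vdiff_def pvar_power pdiff_single cc_def comps_def)
      define p where "p = (\<Sum>t\<le>k. vdiff (?x ^ t) (cc q))"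
      have "vdiff (?x - const 1) p = - cc q"
      proof -
        have "vdiff (?x - const 1) p = vdiff ((?x - 1) * (\<Sum>t\<le>k. ?x ^ t)) (cc q)"
          unfolding p_def const_one by (simp only: vdiff.scale_sum_left vdiff_mult[symmetric])
        also have "(?x - 1) * (\<Sum>t\<le>k. ?x ^ t) = ?x ^ Suc k - 1"
          using power_diff_1_eq[of ?x "Suc k"] by (simp only: lessThan_Suc_atMost)
        also have "vdiff (?x ^ Suc k - 1) (cc q) = vdiff (?x ^ Suc k) (cc q) - cc q"
          by (simp only: vdiff.scale_left_diff_distrib vdiff_one)
        also have "vdiff (?x ^ Suc k) (cc q) = 0"
          by (intro ext) (simp add: xs sym del: power_Suc)
        finally show ?thesis unfolding diff_0 .
      qed
      moreover have "vdiff u p = 0"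
      proof -
        have "vdiff u (cc q) = 0" using uv(2) q unfolding J_def by blast
        then have "vdiff (?x ^ t) (vdiff u (cc q)) = 0" for t by (simp only: vdiff.scale_zero_right)
        then have "vdiff u (vdiff (?x ^ t) (cc q)) = 0" for t by (simp only: vdiff_mult mult.commute)
        then show ?thesis unfolding p_def vdiff.scale_sum_right by (intro sum.neutral) blast
      qed
      moreover have "vdiff 1 p = vdiff u p + vdiff v (vdiff (?x - const 1) p)"
        unfolding vdiff_mult vdiff_add_left[symmetric] uv(1)[symmetric] ..
      ultimately have pv: "p = vdiff v (- cc q)" by (simp only: vdiff_one) simp
      have "q \<gamma> $ j = 0" for j
      proof -
        have "p j \<alpha> = (\<Sum>t\<le>k. vdiff (?x ^ t) (cc q) j \<alpha>)"
          unfolding p_def by (induction k) auto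
        also have "\<dots> = (\<Sum>t\<le>k. if t = s then complex_of_real (q \<gamma> $ j) else 0)"
        proof (intro sum.cong refl)
          fix t
          have "size \<alpha> + s = k" using True \<gamma> by simp
          then show "vdiff (?x ^ t) (cc q) j \<alpha> = (if t = s then complex_of_real (q \<gamma> $ j) else 0)"
            unfolding xs using \<gamma> sym[of "\<alpha> + replicate_mset t i"] by auto
        qed
        also have "\<dots> = complex_of_real (q \<gamma> $ j)"
          using count_le_size[of \<gamma> i] True by (simp add: s_def)
        finally have "complex_of_real (q \<gamma> $ j) = p j \<alpha>" by simp
        \<comment> \<open>Since p = - v q, its value at \<alpha> involves \<open>q\<close> only at
          sizes up to k - s + D, which is less than k.\<close>
        also have "\<dots> = 0"
        proof -
          have "Poly_Mapping.lookup v \<beta> * (- cc q) j (\<alpha> + \<beta>) = 0" if "\<beta> \<in> Poly_Mapping.keys v" for \<beta>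
          proof -
            have "size \<alpha> + s = k" using True arg_cong[OF \<gamma>, of size] by simp
            then have "size (\<alpha> + \<beta>) \<noteq> k" using D[OF that] c by (simp add: s_def)
            then show ?thesis by (simp add: cc_def comps_def sym)
          qed
          then show ?thesis unfolding pv vdiff_def pdiff_def by (intro sum.neutral) blast
        qed
        finally show ?thesis by simp
      qed
      then show ?thesis by (simp add: Finite_Cartesian_Product.vec_eq_iff)
    qed
    then show ?thesis by blast
  qed
  from choice[OF allI[OF this]] obtain D where D: "\<forall>i. \<forall>k. \<forall>q\<in>K k. \<forall>\<gamma>. count \<gamma> i > D i \<longrightarrow> q \<gamma> = 0" ..
  \<comment> \<open>A monomial larger than the sum of the \<open>D i\<close> has some exponent above
    its \<open>D i\<close>.\<close>
  have "q = 0" if k: "k \<ge> Suc (\<Sum>i\<in>UNIV. D i)" and q: "q \<in> K k" for k q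
  proof
    fix \<gamma> show "q \<gamma> = 0 \<gamma>"
    proof (cases "\<exists>i. count \<gamma> i > D i")
      case True
      then show ?thesis using D q by auto
    next
      case False
      then have "(\<Sum>i\<in>UNIV. count \<gamma> i) \<le> (\<Sum>i\<in>UNIV. D i)" by (intro sum_mono) (simp add: not_less)
      moreover have "size \<gamma> = (\<Sum>i\<in>UNIV. count \<gamma> i)"
        unfolding size_multiset_overloaded_eq by (intro sum.mono_neutral_left) (auto simp: not_in_iff)
      ultimately have "size \<gamma> \<noteq> k" using k by simp
      then show ?thesis using q symbolic_system_sym[OF g, of q k \<gamma>] by (simp add: K_def)
    qed
  qed
  then show ?thesis unfolding K_def by (intro exI[of _ "Suc (\<Sum>i\<in>UNIV. D i)"]) blast
qed

section \<open>Relations of a symbolic system\<close>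

lemma quotient_basis_exists:
  fixes V W :: "('n::finite, 'm::finite) tensor set"
  assumes W: "tensor.subspace W" "W \<subseteq> V" shows "\<exists>B. quotient_basis tensor_scale V W B"
proof -
  obtain A where A: "A \<subseteq> W" "tensor.independent A" "W \<subseteq> tensor.span A" using tensor.basis_exists by metis
  obtain C where C: "A \<subseteq> C" "C \<subseteq> V" "tensor.independent C" "V \<subseteq> tensor.span C"
    using tensor.maximal_independent_subset_extend[of A V] A(1,2) W(2) by (metis order_trans)
  have "V \<subseteq> tensor.span (W \<union> (C - A))"
    using C(4) tensor.span_mono[of C "W \<union> (C - A)"] A(1) by blast
  moreover have "c b = 0" if S: "finite S" "S \<subseteq> C - A" "(\<Sum>b\<in>S. tensor_scale (c b) b) \<in> W" "b \<in> S" for S c b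
  proof -
    obtain T u where T: "finite T" "T \<subseteq> A" "(\<Sum>b\<in>S. tensor_scale (c b) b) = (\<Sum>a\<in>T. tensor_scale (u a) a)"
      using S(3) A(3) unfolding tensor.span_explicit by blast
    define h where "h x = (if x \<in> S then c x else - u x)" for x
    have ST: "S \<inter> T = {}" using S(2) T(2) by blast
    have "(\<Sum>x\<in>S \<union> T. tensor_scale (h x) x) = (\<Sum>x\<in>S. tensor_scale (h x) x) + (\<Sum>x\<in>T. tensor_scale (h x) x)"
      by (rule sum.union_disjoint[OF S(1) T(1) ST])
    also have "(\<Sum>x\<in>S. tensor_scale (h x) x) = (\<Sum>a\<in>T. tensor_scale (u a) a)" unfolding T(3)[symmetric] by (simp add: h_def)
    also have "(\<Sum>x\<in>T. tensor_scale (h x) x) = - (\<Sum>a\<in>T. tensor_scale (u a) a)"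
      unfolding sum_negf[symmetric] tensor.scale_minus_left[symmetric]
      by (rule sum.cong[OF refl]) (use ST in \<open>auto simp: h_def\<close>)
    finally have "(\<Sum>x\<in>S \<union> T. tensor_scale (h x) x) = 0" by (simp only: add.right_inverse)
    then have "h b = 0" using tensor.independentD[OF C(3), of "S \<union> T" h b] S T(1,2) C(1) by blast
    then show ?thesis using S(4) by (simp add: h_def)
  qed
  ultimately show ?thesis using C(2) unfolding quotient_basis_def by (intro exI[of _ "C - A"]) blast
qed

text \<open>A functional on tensors of degree k is a row of homogeneous operators of degree k, read
  off at the empty multi-index, where all k derivatives are used up.\<close>

lemma fin_gen_sym_tensors: "fin_gen tensor_scale (sym_tensors k :: ('n::finite, 'm::finite) tensor set)"
  and linear_on_sym_tensors: "Vector_Spaces.linear tensor_scale (*) \<phi> \<Longrightarrow>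
    \<exists>f. (\<forall>j. \<forall>\<beta>\<in>Poly_Mapping.keys (f j). size \<beta> = k) \<and>
      (\<forall>q\<in>sym_tensors k. \<phi> (q :: ('n, 'm) tensor) = (\<Sum>j\<in>UNIV. pdiff (f j) (comps q j) {#}))"
proof -
  define e :: "'n multiset \<Rightarrow> 'm \<Rightarrow> ('n, 'm) tensor" where "e \<alpha> j = (\<lambda>\<alpha>'. if \<alpha>' = \<alpha> then axis j 1 else 0)" for \<alpha> j
  let ?S = "{\<alpha> :: 'n multiset. size \<alpha> = k}"
  have fin: "finite ?S" by (rule finite_size_eq)
  have fs: "(\<Sum>i\<in>S. F i) \<alpha> = (\<Sum>i\<in>S. F i \<alpha>)" for S \<alpha> and F :: "'i \<Rightarrow> ('n, 'm) tensor"
    by (induction S rule: infinite_finite_induct) auto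
  have expand: "q = (\<Sum>\<alpha>\<in>?S. \<Sum>j\<in>UNIV. tensor_scale (q \<alpha> $ j) (e \<alpha> j))" if q: "q \<in> sym_tensors k" for q
  proof
    fix \<alpha>
    have "(\<Sum>\<alpha>'\<in>?S. \<Sum>j\<in>UNIV. tensor_scale (q \<alpha>' $ j) (e \<alpha>' j)) \<alpha> =
        (\<Sum>\<alpha>'\<in>?S. if \<alpha>' = \<alpha> then \<Sum>j\<in>UNIV. (q \<alpha> $ j) *\<^sub>R axis j 1 else 0)"
      unfolding fs by (intro sum.cong refl) (auto simp: tensor_scale_def e_def)
    also have "\<dots> = q \<alpha>"
      using q fin basis_expansion[of "q \<alpha>"] by (auto simp: sym_tensors_def scalar_mult_eq_scaleR)
    finally show "q \<alpha> = (\<Sum>\<alpha>\<in>?S. \<Sum>j\<in>UNIV. tensor_scale (q \<alpha> $ j) (e \<alpha> j)) \<alpha>" by simp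
  qed
  let ?B = "(\<lambda>(\<alpha>, j). e \<alpha> j) ` (?S \<times> UNIV)"
  have "q \<in> tensor.span ?B" if q: "q \<in> sym_tensors k" for q
  proof -
    have "(\<Sum>\<alpha>\<in>?S. \<Sum>j\<in>UNIV. tensor_scale (q \<alpha> $ j) (e \<alpha> j)) \<in> tensor.span ?B"
      by (intro tensor.span_sum tensor.span_scale tensor.span_base) auto
    then show ?thesis using expand[OF q] by simp
  qed
  moreover have "finite ?B" using fin by simp
  ultimately show "fin_gen tensor_scale (sym_tensors k :: ('n, 'm) tensor set)" unfolding fin_gen_def by blast
  assume lin: "Vector_Spaces.linear tensor_scale (*) \<phi>"
  interpret \<phi>: Vector_Spaces.linear tensor_scale "(*)" \<phi> by (rule lin)
  define f where "f j = (\<Sum>\<alpha>\<in>?S. Poly_Mapping.single \<alpha> (\<phi> (e \<alpha> j)))" for j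
  have "size \<beta> = k" if "\<beta> \<in> Poly_Mapping.keys (f j)" for j \<beta>
    using that keys_sum[of "\<lambda>\<alpha>. Poly_Mapping.single \<alpha> (\<phi> (e \<alpha> j))" ?S] unfolding f_def by (fastforce split: if_splits)
  moreover have "\<phi> q = (\<Sum>j\<in>UNIV. pdiff (f j) (comps q j) {#})" if q: "q \<in> sym_tensors k" for q
  proof -
    have "\<phi> q = (\<Sum>\<alpha>\<in>?S. \<Sum>j\<in>UNIV. q \<alpha> $ j * \<phi> (e \<alpha> j))"
      by (subst expand[OF q]) (simp only: \<phi>.sum \<phi>.scale)
    also have "\<dots> = (\<Sum>j\<in>UNIV. pdiff (f j) (comps q j) {#})"
      unfolding f_def pdiff_sum_left pdiff_single comps_def by (subst sum.swap) (simp add: mult.commute)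
    finally show ?thesis .
  qed
  ultimately show "\<exists>f. (\<forall>j. \<forall>\<beta>\<in>Poly_Mapping.keys (f j). size \<beta> = k) \<and>
      (\<forall>q\<in>sym_tensors k. \<phi> q = (\<Sum>j\<in>UNIV. pdiff (f j) (comps q j) {#}))" by blast
qed

interpretation tensor_real: vector_space_pair tensor_scale "(*) :: real \<Rightarrow> real \<Rightarrow> real" ..

text \<open>\<open>B\<close> together with a basis of \<open>W\<close> is independent; the
  functionals dual to \<open>B\<close> vanish on \<open>W\<close> and separate the classes of
  \<open>B\<close>.\<close>

lemma subspace_cut_out:
  fixes V W :: "('n::finite, 'm::finite) tensor set"
  assumes W: "tensor.subspace W" "W \<subseteq> V" and V: "fin_gen tensor_scale V" and B: "quotient_basis tensor_scale V W B"
  shows "finite B" and "\<exists>\<phi>. (\<forall>b\<in>B. Vector_Spaces.linear tensor_scale (*) (\<phi> b)) \<and> W = {q \<in> V. \<forall>b\<in>B. \<phi> b q = 0}"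
proof -
  have B': "B \<subseteq> V" "V \<subseteq> tensor.span (W \<union> B)"
    "\<And>S c b. finite S \<Longrightarrow> S \<subseteq> B \<Longrightarrow> (\<Sum>b\<in>S. tensor_scale (c b) b) \<in> W \<Longrightarrow> b \<in> S \<Longrightarrow> c b = 0"
    using B unfolding quotient_basis_def by blast+
  obtain A where A: "A \<subseteq> W" "tensor.independent A" "W \<subseteq> tensor.span A" using tensor.basis_exists by metis
  have disj: "b \<notin> W" if "b \<in> B" for b
    using B'(3)[of "{b}" "\<lambda>_. 1" b] that by auto
  have ind: "tensor.independent (A \<union> B)"
  proof (rule ccontr)
    assume "\<not> tensor.independent (A \<union> B)"
    then obtain T u where T: "finite T" "T \<subseteq> A \<union> B" "(\<Sum>v\<in>T. tensor_scale (u v) v) = 0" "\<exists>v\<in>T. u v \<noteq> 0"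
      unfolding tensor.dependent_explicit by blast
    have split: "(\<Sum>v\<in>T. tensor_scale (u v) v) = (\<Sum>v\<in>T \<inter> B. tensor_scale (u v) v) + (\<Sum>v\<in>T - B. tensor_scale (u v) v)"
      by (rule sum.Int_Diff[OF T(1)])
    have inW: "(\<Sum>v\<in>T - B. tensor_scale (u v) v) \<in> W"
      by (intro tensor.subspace_sum[OF W(1)] tensor.subspace_scale[OF W(1)]) (use T(2) A(1) in blast)
    have "(\<Sum>v\<in>T \<inter> B. tensor_scale (u v) v) = - (\<Sum>v\<in>T - B. tensor_scale (u v) v)"
      using split T(3) by (simp only: eq_neg_iff_add_eq_0)
    then have "(\<Sum>v\<in>T \<inter> B. tensor_scale (u v) v) \<in> W" using tensor.subspace_neg[OF W(1) inW] by (simp only:)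
    then have z: "u v = 0" if "v \<in> T \<inter> B" for v using B'(3)[of "T \<inter> B" u v] T(1) that by blast
    then have "(\<Sum>v\<in>T \<inter> B. tensor_scale (u v) v) = 0" by (intro sum.neutral) simp
    then have "(\<Sum>v\<in>T - B. tensor_scale (u v) v) = 0" using split T(3) by (simp only: add_0_left)
    then have "u v = 0" if "v \<in> T - B" for v
      using tensor.independentD[OF A(2), of "T - B" u v] T(1,2) that by blast
    then show False using z T(4) by blast
  qed
  have indB: "tensor.independent B" by (rule tensor.independent_mono[OF ind]) blast
  show fB: "finite B" by (rule tensor.fin_gen_finite_independent[OF V indB B'(1)])
  have "\<exists>\<phi>. Vector_Spaces.linear tensor_scale (*) \<phi> \<and> (\<forall>x\<in>A \<union> B. \<phi> x = (if x = b then 1 else 0))" for b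
    using tensor_real.linear_independent_extend[OF ind, of "\<lambda>x. if x = b then 1 else 0"] .
  from choice[OF allI[OF this]] obtain \<phi> :: "_ \<Rightarrow> _ \<Rightarrow> real" where
    \<phi>: "\<forall>b. Vector_Spaces.linear tensor_scale (*) (\<phi> b) \<and> (\<forall>x\<in>A \<union> B. \<phi> b x = (if x = b then 1 else 0))" ..
  have \<phi>W: "\<phi> b w = 0" if b: "b \<in> B" and w: "w \<in> W" for b w
  proof -
    interpret l: Vector_Spaces.linear tensor_scale "(*)" "\<phi> b" using \<phi> by blast
    show ?thesis
    proof (rule l.eq_0_on_span[of A])
      show "w \<in> tensor.span A" using w A(3) by blast
      show "\<phi> b x = 0" if "x \<in> A" for x using \<phi> that disj[OF b] A(1) by auto
    qed
  qed
  have qW: "q \<in> W" if q: "q \<in> V" "\<forall>b\<in>B. \<phi> b q = 0" for q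
  proof -
    have "q \<in> tensor.span (W \<union> B)" using q(1) B'(2) by blast
    then obtain w b where wb: "q = w + b" "w \<in> tensor.span W" "b \<in> tensor.span B" unfolding tensor.span_Un by blast
    have w: "w \<in> W" using wb(2) W(1) by (simp add: tensor.span_eq_iff[THEN iffD2])
    obtain c where c: "b = (\<Sum>x\<in>B. tensor_scale (c x) x)" using wb(3) unfolding tensor.span_finite[OF fB] by blast
    have "c x = 0" if x: "x \<in> B" for x
    proof -
      interpret l: Vector_Spaces.linear tensor_scale "(*)" "\<phi> x" using \<phi> by blast
      have "\<phi> x q = 0" using q(2) x by blast
      then have "0 = \<phi> x w + \<phi> x b" unfolding wb(1) l.add by (rule sym)
      also have "\<dots> = (\<Sum>y\<in>B. c y * \<phi> x y)" unfolding c \<phi>W[OF x w] by (simp only: l.sum l.scale add_0_left)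
      also have "\<dots> = (\<Sum>y\<in>B. if y = x then c x else 0)" using \<phi> by (intro sum.cong) auto
      also have "\<dots> = c x" using fB x by simp
      finally show ?thesis by simp
    qed
    then have "b = 0" unfolding c by (intro sum.neutral) simp
    then show ?thesis using wb(1) w by simp
  qed
  have "{q \<in> V. \<forall>b\<in>B. \<phi> b q = 0} \<subseteq> W" by (rule subsetI, elim CollectE conjE, rule qW)
  moreover have "W \<subseteq> {q \<in> V. \<forall>b\<in>B. \<phi> b q = 0}" using W(2) \<phi>W by auto
  ultimately have e: "W = {q \<in> V. \<forall>b\<in>B. \<phi> b q = 0}" by (rule equalityI[rotated])
  have "\<forall>b\<in>B. Vector_Spaces.linear tensor_scale (*) (\<phi> b)" using \<phi> by simp
  then show "\<exists>\<phi>. (\<forall>b\<in>B. Vector_Spaces.linear tensor_scale (*) (\<phi> b)) \<and> W = {q \<in> V. \<forall>b\<in>B. \<phi> b q = 0}"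
    using e by (intro exI[of _ \<phi>] conjI)
qed

lemma symbolic_system_step:
  fixes g :: "nat \<Rightarrow> ('n::finite, 'm::finite) tensor set"
  assumes g: "symbolic_system g"
  shows "\<exists>(B :: ('n, 'm) tensor set) f. finite B \<and> card B = multiplicity_of_order g (Suc k) \<and>
    (\<forall>b j. \<forall>\<beta>\<in>Poly_Mapping.keys (f b j). size \<beta> = Suc k) \<and>
    g (Suc k) = {q \<in> prolong k 1 (g k). \<forall>b\<in>B. (\<Sum>j\<in>UNIV. pdiff (f b j) (comps q j) {#}) = 0}"
proof (cases "Suc k \<in> orders g")
  case False
  then have "g (Suc k) = prolong k 1 (g k)" by (simp add: orders_def)
  moreover have "multiplicity_of_order g (Suc k) = 0" using False by (simp add: multiplicity_of_order_def)
  ultimately show ?thesis by (intro exI[of _ "{}"] exI[of _ "\<lambda>_ _. 0"]) simp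
next
  case True
  let ?V = "prolong k 1 (g k)"
  have sub: "tensor.subspace (g (Suc k))" "g (Suc k) \<subseteq> ?V" using g unfolding symbolic_system_def by blast+
  have sym: "?V \<subseteq> sym_tensors (Suc k)" by (auto simp: prolong_def)
  \<comment> \<open>The same choice as in \<open>quotient_dim\<close>, so that its cardinality is
    the multiplicity of the order.\<close>
  define B where "B = (SOME B. quotient_basis tensor_scale ?V (g (Suc k)) B)"
  have B: "quotient_basis tensor_scale ?V (g (Suc k)) B"
    unfolding B_def by (rule someI_ex[OF quotient_basis_exists[OF sub]])
  have V: "fin_gen tensor_scale ?V" by (rule tensor.fin_gen_mono[OF fin_gen_sym_tensors sym])
  note cut = subspace_cut_out[OF sub V B]
  from cut(2) obtain \<phi> where "(\<forall>b\<in>B. Vector_Spaces.linear tensor_scale (*) (\<phi> b)) \<and> g (Suc k) = {q \<in> ?V. \<forall>b\<in>B. \<phi> b q = 0}" ..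
  then have \<phi>: "\<forall>b\<in>B. Vector_Spaces.linear tensor_scale (*) (\<phi> b)" "g (Suc k) = {q \<in> ?V. \<forall>b\<in>B. \<phi> b q = 0}"
    by (rule conjunct1, rule conjunct2)
  have "\<forall>b. \<exists>f. (\<forall>j. \<forall>\<beta>\<in>Poly_Mapping.keys (f j). size \<beta> = Suc k) \<and>
      (b \<in> B \<longrightarrow> (\<forall>q\<in>sym_tensors (Suc k). \<phi> b q = (\<Sum>j\<in>UNIV. pdiff (f j) (comps q j) {#})))"
  proof
    fix b
    show "\<exists>f. (\<forall>j. \<forall>\<beta>\<in>Poly_Mapping.keys (f j). size \<beta> = Suc k) \<and>
      (b \<in> B \<longrightarrow> (\<forall>q\<in>sym_tensors (Suc k). \<phi> b q = (\<Sum>j\<in>UNIV. pdiff (f j) (comps q j) {#})))"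
    proof (cases "b \<in> B")
      case True
      from linear_on_sym_tensors[OF bspec[OF \<phi>(1) True], of "Suc k"] show ?thesis using True by simp
    qed (auto intro!: exI[of _ "\<lambda>_. 0"])
  qed
  from choice[OF this] obtain f where f: "\<forall>b. (\<forall>j. \<forall>\<beta>\<in>Poly_Mapping.keys (f b j). size \<beta> = Suc k) \<and>
      (b \<in> B \<longrightarrow> (\<forall>q\<in>sym_tensors (Suc k). \<phi> b q = (\<Sum>j\<in>UNIV. pdiff (f b j) (comps q j) {#})))" ..
  have gk: "g (Suc k) = {q \<in> ?V. \<forall>b\<in>B. (\<Sum>j\<in>UNIV. pdiff (f b j) (comps q j) {#}) = 0}"
    unfolding \<phi>(2) by (rule Collect_cong) (use f sym in auto)
  have cd: "card B = multiplicity_of_order g (Suc k)"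
    using True by (simp add: multiplicity_of_order_def quotient_dim_def B_def)
  have fd: "\<forall>b j. \<forall>\<beta>\<in>Poly_Mapping.keys (f b j). size \<beta> = Suc k" using f by simp
  show ?thesis
    by (rule exI[of _ B], rule exI[of _ f], intro conjI) (rule cut(1) cd fd gk)+
qed

lemma comps_add_mset: "comps q j (add_mset x \<alpha>) = comps (shift {#x#} q) j \<alpha>"
  by (simp add: comps_def shift_def)

lemma pdiff_add_mset: "pdiff P (comps q j) (add_mset x \<alpha>) = pdiff P (comps (shift {#x#} q) j) \<alpha>"
  unfolding pdiff_def by (simp add: comps_add_mset[symmetric])

text \<open>A relation read off at a nonempty multi-index is the same relation on a derivative, so
  it is inherited through the prolongation. Only the relations of order k + 1 at the empty
  multi-index are new, and these are the ones counted by the multiplicity.\<close>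

theorem symbolic_system_relations:
  fixes g :: "nat \<Rightarrow> ('n::finite, 'm::finite) tensor set"
  assumes g: "symbolic_system g" and ks: "\<forall>k. count (mset ks) k = multiplicity_of_order g k"
  shows "\<exists>f. (\<forall>i<length ks. \<forall>j. \<forall>\<beta>\<in>Poly_Mapping.keys (f i j). size \<beta> = ks ! i) \<and>
    (\<forall>k. g k = {q \<in> sym_tensors k. \<forall>i<length ks. \<forall>\<alpha>. (\<Sum>j\<in>UNIV. pdiff (f i j) (comps q j) \<alpha>) = 0})"
proof -
  have pos: "ks ! i \<ge> 1" if "i < length ks" for i
  proof -
    have "count (mset ks) (ks ! i) \<noteq> 0" using that by (simp add: count_eq_zero_iff)
    then show ?thesis using ks by (auto simp: multiplicity_of_order_def orders_def split: if_splits)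
  qed
  define R where "R k Bf \<longleftrightarrow> finite (fst Bf) \<and> card (fst Bf) = multiplicity_of_order g (Suc k) \<and>
    (\<forall>b j. \<forall>\<beta>\<in>Poly_Mapping.keys (snd Bf b j). size \<beta> = Suc k) \<and>
    g (Suc k) = {q \<in> prolong k 1 (g k). \<forall>b\<in>fst Bf. (\<Sum>j\<in>UNIV. pdiff (snd Bf b j) (comps q j) {#}) = 0}"
    for k and Bf :: "('n, 'm) tensor set \<times> (('n, 'm) tensor \<Rightarrow> 'm \<Rightarrow> ('n, real) sym_alg)"
  have "\<exists>Bf. R k Bf" for k using symbolic_system_step[OF g, of k] unfolding R_def by simp
  from choice[OF allI[OF this]] obtain Bf where Bf: "\<forall>k. R k (Bf k)" ..
  \<comment> \<open>The positions of \<open>ks\<close> that hold the order k + 1 are matched with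
    the relations of that order.\<close>
  have "\<exists>h. bij_betw h {i. i < length ks \<and> ks ! i = Suc k} (fst (Bf k))" for k
  proof (rule finite_same_card_bij)
    have "card {i. i < length ks \<and> ks ! i = Suc k} = length (filter (\<lambda>x. x = Suc k) ks)"
      by (simp add: length_filter_conv_card)
    also have "\<dots> = count (mset ks) (Suc k)" by (induction ks) auto
    finally show "card {i. i < length ks \<and> ks ! i = Suc k} = card (fst (Bf k))" using ks Bf unfolding R_def by simp
  qed (use Bf in \<open>auto simp: R_def\<close>)
  from choice[OF allI[OF this]] obtain h where h: "\<forall>k. bij_betw (h k) {i. i < length ks \<and> ks ! i = Suc k} (fst (Bf k))" ..
  define f where "f i = snd (Bf (ks ! i - 1)) (h (ks ! i - 1) i)" for i
  have fdeg: "size \<beta> = ks ! i" if "i < length ks" "\<beta> \<in> Poly_Mapping.keys (f i j)" for i j \<beta>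
    using that pos[OF that(1)] Bf unfolding R_def f_def by fastforce
  let ?rel = "\<lambda>q. \<forall>i<length ks. \<forall>\<alpha>. (\<Sum>j\<in>UNIV. pdiff (f i j) (comps q j) \<alpha>) = 0"
  have off: "pdiff (f i j) (comps q j) \<alpha> = 0" if "q \<in> sym_tensors k" "i < length ks" "size \<alpha> + ks ! i \<noteq> k" for q i j \<alpha> k
    using that fdeg[OF that(2)] unfolding pdiff_def comps_def sym_tensors_def by (intro sum.neutral) auto
  have main: "g k = {q \<in> sym_tensors k. ?rel q}" for k
  proof (induction k)
    case 0
    have "?rel q" if "q \<in> sym_tensors 0" for q
    proof (intro allI impI sum.neutral ballI)
      fix i \<alpha> j assume i: "i < length ks"
      show "pdiff (f i j) (comps q j) \<alpha> = 0" by (rule off[OF that i]) (use pos[OF i] in simp)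
    qed
    then show ?case using g unfolding symbolic_system_def by blast
  next
    case (Suc k)
    have gk: "g (Suc k) = {q \<in> prolong k 1 (g k). \<forall>b\<in>fst (Bf k). (\<Sum>j\<in>UNIV. pdiff (snd (Bf k) b j) (comps q j) {#}) = 0}"
      using Bf unfolding R_def by blast
    have sub: "tensor.subspace (g k)" using g unfolding symbolic_system_def by blast
    show ?case
    proof (intro equalityI subsetI)
      fix q assume q: "q \<in> g (Suc k)"
      have sym: "q \<in> sym_tensors (Suc k)" using q g unfolding symbolic_system_def by blast
      have "(\<Sum>j\<in>UNIV. pdiff (f i j) (comps q j) \<alpha>) = 0" if i: "i < length ks" for i \<alpha>
      proof (cases \<alpha>)
        case (add x \<alpha>')
        have "shift {#x#} q \<in> g k" by (rule symbolic_system_shift1[OF g q])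
        then have "?rel (shift {#x#} q)" using Suc by blast
        then show ?thesis using i unfolding add pdiff_add_mset by blast
      next
        case empty
        show ?thesis
        proof (cases "ks ! i = Suc k")
          case True
          then have "h k i \<in> fst (Bf k)" using h i bij_betwE by blast
          then show ?thesis using q gk True unfolding empty f_def by simp
        next
          case False
          then show ?thesis using off[OF sym i] empty by (intro sum.neutral) simp
        qed
      qed
      then show "q \<in> {q \<in> sym_tensors (Suc k). ?rel q}" using sym by blast
    next
      fix q assume "q \<in> {q \<in> sym_tensors (Suc k). ?rel q}"
      then have sym: "q \<in> sym_tensors (Suc k)" and rel: "?rel q" by auto
      have sh: "shift {#x#} q \<in> g k" for x
      proof -
        have "shift {#x#} q \<in> sym_tensors k" using sym by (simp add: sym_tensors_def shift_def)
        moreover have "?rel (shift {#x#} q)" using rel unfolding pdiff_add_mset[symmetric] by blast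
        ultimately show ?thesis using Suc by blast
      qed
      have "\<delta> v q \<in> g k" for v
      proof -
        have fs: "(\<Sum>i\<in>S. F i) \<alpha> = (\<Sum>i\<in>S. F i \<alpha>)" for S \<alpha> and F :: "'n \<Rightarrow> ('n, 'm) tensor"
          by (induction S rule: infinite_finite_induct) auto
        have "\<delta> v q = (\<Sum>i\<in>UNIV. tensor_scale (v $ i) (shift {#i#} q))"
          by (rule ext) (simp add: \<delta>_def fs tensor_scale_def shift_def)
        also have "\<dots> \<in> g k" by (intro tensor.subspace_sum[OF sub] tensor.subspace_scale[OF sub] sh)
        finally show ?thesis .
      qed
      then have "q \<in> prolong k 1 (g k)" using sym by (auto simp: prolong_def length_Suc_conv)
      moreover have "(\<Sum>j\<in>UNIV. pdiff (snd (Bf k) b j) (comps q j) {#}) = 0" if b: "b \<in> fst (Bf k)" for b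
      proof -
        obtain i where i: "i < length ks" "ks ! i = Suc k" "b = h k i"
          using h b unfolding bij_betw_def by blast
        then have "f i = snd (Bf k) b" by (simp add: f_def)
        then show ?thesis using rel i(1) by metis
      qed
      ultimately show "q \<in> g (Suc k)" unfolding gk by blast
    qed
  qed
  show ?thesis using fdeg main by (intro exI[of _ f]) blast
qed

lemma length_orders:
  assumes ks: "\<forall>k. count (mset ks) k = multiplicity_of_order g k" and pos: "codim g > 0"
  shows "length ks = codim g" "\<And>i. i < length ks \<Longrightarrow> ks ! i \<ge> 1"
proof -
  \<comment> \<open>A sum over an infinite set is 0, so positive codimension forces finitely many
    orders.\<close>
  have fin: "finite (orders g)" using pos by (intro ccontr[of "finite (orders g)"]) (simp add: codim_def)
  have sub: "set ks \<subseteq> orders g"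
  proof
    fix k assume "k \<in> set ks"
    then have "count (mset ks) k \<noteq> 0" by (simp add: count_eq_zero_iff)
    then show "k \<in> orders g" using ks by (auto simp: multiplicity_of_order_def split: if_splits)
  qed
  show "ks ! i \<ge> 1" if "i < length ks" for i
  proof -
    have "ks ! i \<in> orders g" using sub nth_mem[OF that] by blast
    then show ?thesis by (simp add: orders_def)
  qed
  have "length ks = (\<Sum>k\<in>set ks. count (mset ks) k)" by (metis size_mset size_multiset_overloaded_eq set_mset_mset)
  also have "\<dots> = (\<Sum>k\<in>orders g. count (mset ks) k)"
    by (rule sum.mono_neutral_left[OF fin sub]) (simp add: count_eq_zero_iff)
  finally show "length ks = codim g" using ks by (simp add: codim_def)
qed

section \<open>The Hilbert polynomial\<close>

text \<open>The expansion of 1 / (1 - X)^(d + 1).\<close>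

definition binomial_fps :: "nat \<Rightarrow> real fps" where
  "binomial_fps d = Abs_fps (\<lambda>n. real ((n + d) choose d))"

lemma binomial_fps_inverse: "(1 - fps_X) ^ Suc d * binomial_fps d = 1"
proof (induction d)
  case 0
  show ?case by (rule fps_ext) (simp add: binomial_fps_def left_diff_distrib fps_X_mult_nth)
next
  case (Suc d)
  have "(1 - fps_X) * binomial_fps (Suc d) = binomial_fps d"
  proof (rule fps_ext)
    fix n
    show "fps_nth ((1 - fps_X) * binomial_fps (Suc d)) n = fps_nth (binomial_fps d) n"
      by (cases n) (simp_all add: binomial_fps_def left_diff_distrib fps_X_mult_nth)
  qed
  note step = this
  show ?case unfolding power_Suc2[of "1 - fps_X" "Suc d"] mult.assoc step by (rule Suc)
qed

definition binomial_poly :: "nat \<Rightarrow> real poly" where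
  "binomial_poly d = Polynomial.smult (1 / fact d) (\<Prod>t<d. [:real (Suc t), 1:])"

lemma poly_binomial_poly: "poly (binomial_poly d) (real n) = real ((n + d) choose d)"
proof -
  have "real ((n + d) choose d) = pochhammer (real (n + d) - real d + 1) d / fact d"
    by (simp only: binomial_gbinomial gbinomial_pochhammer')
  also have "real (n + d) - real d + 1 = real n + 1" by simp
  also have "pochhammer (real n + 1) d = (\<Prod>t<d. real n + real (Suc t))"
    unfolding pochhammer_prod atLeast0LessThan by (intro prod.cong) auto
  finally show ?thesis by (simp add: binomial_poly_def poly_prod add.commute)
qed

lemma degree_binomial_poly: "degree (binomial_poly d) = d" "poly.coeff (binomial_poly d) d = 1 / fact d"
proof -
  let ?p = "\<Prod>t<d. [:real (Suc t), 1:]"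
  have d: "degree ?p = d" by (subst degree_prod_eq_sum_degree) simp_all
  have "lead_coeff ?p = (\<Prod>t<d. lead_coeff [:real (Suc t), 1:])" by (rule lead_coeff_prod)
  then have c: "poly.coeff ?p d = 1" unfolding d by simp
  show "degree (binomial_poly d) = d" "poly.coeff (binomial_poly d) d = 1 / fact d"
    using d c by (simp_all add: binomial_poly_def)
qed

text \<open>Partial sums are the coefficients of H / (1 - X), that is, of q / (1 - X)^(d + 1): a
  combination of shifted binomial polynomials of degree d whose leading coefficients add up to q(1)
  / d!.\<close>

theorem partial_sums_polynomial:
  assumes H: "H * (1 - fps_X) ^ d = fps_of_poly q" and q: "poly q 1 \<noteq> 0"
  shows "\<exists>P. degree P = d \<and> poly.coeff P d = poly q 1 / fact d \<and>
    (\<forall>\<^sub>F k in sequentially. (\<Sum>i\<le>k. fps_nth H i) = poly P (real k))"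
proof -
  define P where "P = (\<Sum>i\<le>degree q. Polynomial.smult (poly.coeff q i) (pcompose (binomial_poly d) [:- real i, 1:]))"
  have shifted: "degree (pcompose (binomial_poly d) [:- real i, 1:]) = d"
    "poly.coeff (pcompose (binomial_poly d) [:- real i, 1:]) d = 1 / fact d" for i
  proof -
    show 1: "degree (pcompose (binomial_poly d) [:- real i, 1:]) = d"
      by (simp add: degree_pcompose degree_binomial_poly)
    have "lead_coeff (pcompose (binomial_poly d) [:- real i, 1:]) = lead_coeff (binomial_poly d)"
      by (subst lead_coeff_comp) simp_all
    then show "poly.coeff (pcompose (binomial_poly d) [:- real i, 1:]) d = 1 / fact d"
      unfolding 1 degree_binomial_poly .
  qed
  have c: "poly.coeff P d = poly q 1 / fact d"
    by (simp add: P_def coeff_sum shifted poly_altdef sum_divide_distrib)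
  have "degree P \<le> d"
    unfolding P_def by (intro degree_sum_le) (auto intro: order_trans[OF degree_smult_le] simp: shifted)
  moreover have "d \<le> degree P" by (rule le_degree) (use c q in simp)
  ultimately have deg: "degree P = d" by simp
  \<comment> \<open>From the degree of \<open>q\<close> on, every shift k - i is a natural number,
    so the binomial coefficients agree with their polynomial.\<close>
  have "(\<Sum>i\<le>k. fps_nth H i) = poly P (real k)" if k: "k \<ge> degree q" for k
  proof -
    have one: "(1 - fps_X) * binomial_fps 0 = 1" using binomial_fps_inverse[of 0] by simp
    have "H * binomial_fps 0 = (H * binomial_fps 0) * ((1 - fps_X) ^ Suc d * binomial_fps d)"
      unfolding binomial_fps_inverse by simp
    also have "\<dots> = (H * (1 - fps_X) ^ d) * ((1 - fps_X) * binomial_fps 0) * binomial_fps d"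
      by (simp only: power_Suc ac_simps)
    also have "\<dots> = fps_of_poly q * binomial_fps d" unfolding H one by simp
    finally have "fps_nth (H * binomial_fps 0) k = fps_nth (fps_of_poly q * binomial_fps d) k" by simp
    then have "(\<Sum>i\<le>k. fps_nth H i) = (\<Sum>i\<le>k. poly.coeff q i * real ((k - i + d) choose d))"
      by (simp add: fps_mult_nth binomial_fps_def atLeast0AtMost)
    also have "\<dots> = (\<Sum>i\<le>degree q. poly.coeff q i * real ((k - i + d) choose d))"
      using k by (intro sum.mono_neutral_right) (auto simp: coeff_eq_0)
    also have "\<dots> = (\<Sum>i\<le>degree q. poly.coeff q i * poly (binomial_poly d) (real k - real i))"
    proof (rule sum.cong[OF refl])
      fix i assume "i \<in> {..degree q}"
      then have "real k - real i = real (k - i)" using k by simp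
      then show "poly.coeff q i * real ((k - i + d) choose d) = poly.coeff q i * poly (binomial_poly d) (real k - real i)"
        by (simp only: poly_binomial_poly)
    qed
    also have "\<dots> = poly P (real k)" by (simp add: P_def poly_sum poly_pcompose)
    finally show ?thesis .
  qed
  then have "\<forall>\<^sub>F k in sequentially. (\<Sum>i\<le>k. fps_nth H i) = poly P (real k)"
    by (rule eventually_sequentiallyI)
  then show ?thesis using deg c by (intro exI[of _ P] conjI)
qed

lemma poly_eq_of_eventually:
  fixes P Q :: "real poly"
  assumes "\<forall>\<^sub>F k in sequentially. poly P (real k) = poly Q (real k)" shows "P = Q"
proof (rule ccontr)
  assume "P \<noteq> Q"
  then have fin: "finite {x. poly (P - Q) x = 0}" by (intro poly_roots_finite) simp
  obtain K where K: "\<forall>k\<ge>K. poly P (real k) = poly Q (real k)" using assms unfolding eventually_sequentially by blast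
  have "real ` {K..} \<subseteq> {x. poly (P - Q) x = 0}" using K by auto
  then have "finite (real ` {K..})" using fin by (rule finite_subset)
  then have "finite {K..}" by (rule finite_imageD) (simp add: inj_on_def)
  then show False by (simp add: infinite_Ici)
qed

lemma coeff_higher_pderiv: "poly.coeff ((pderiv ^^ n) P) i * fact i = fact (n + i) * poly.coeff (P :: real poly) (n + i)"
proof (induction n arbitrary: i)
  case (Suc n)
  have "poly.coeff ((pderiv ^^ Suc n) P) i * fact i = poly.coeff ((pderiv ^^ n) P) (Suc i) * fact (Suc i)"
    by (simp add: coeff_pderiv mult_ac)
  then show ?case using Suc[of "Suc i"] by simp
qed simp

lemma hilbert_polynomial_data:
  fixes g :: "nat \<Rightarrow> ('n::finite, 'm::finite) tensor set"
  assumes H: "Abs_fps (\<lambda>k. real (tensor.dim (g k))) * (1 - fps_X) ^ d = fps_of_poly q" and q: "poly q 1 \<noteq> 0"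
  shows "functional_dimension g = d" "functional_rank g = poly q 1"
proof -
  obtain P where P: "degree P = d" "poly.coeff P d = poly q 1 / fact d"
    "\<forall>\<^sub>F k in sequentially. (\<Sum>i\<le>k. fps_nth (Abs_fps (\<lambda>k. real (tensor.dim (g k)))) i) = poly P (real k)"
    using partial_sums_polynomial[OF H q] by blast
  then have ev: "\<forall>\<^sub>F k in sequentially. real (\<Sum>i\<le>k. tensor.dim (g i)) = poly P (real k)" by simp
  have "hilbert_polynomial g = P"
    unfolding hilbert_polynomial_def
  proof (rule the_equality)
    show "\<forall>\<^sub>F k in sequentially. real (\<Sum>i\<le>k. tensor.dim (g i)) = poly P (real k)" by (rule ev)
  next
    fix Q assume "\<forall>\<^sub>F k in sequentially. real (\<Sum>i\<le>k. tensor.dim (g i)) = poly Q (real k)"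
    with ev have "\<forall>\<^sub>F k in sequentially. poly Q (real k) = poly P (real k)" by eventually_elim simp
    then show "Q = P" by (rule poly_eq_of_eventually)
  qed
  then show dim: "functional_dimension g = d" using P(1) by (simp add: functional_dimension_def)
  have "poly ((pderiv ^^ d) P) 0 = fact d * poly.coeff P d"
    using coeff_higher_pderiv[of d P 0] by (simp add: poly_0_coeff_0)
  then show "functional_rank g = poly q 1"
    unfolding functional_rank_def dim \<open>hilbert_polynomial g = P\<close> P(2) by simp
qed

section \<open>Symmetric tensors as families in the variables \<open>XV\<close>\<close>

definition rename :: "('n multiset \<Rightarrow>\<^sub>0 real) \<Rightarrow> 'n evar multiset \<Rightarrow>\<^sub>0 real" where
  "rename P = (\<Sum>\<beta>\<in>Poly_Mapping.keys P. Poly_Mapping.single (image_mset XV \<beta>) (Poly_Mapping.lookup P \<beta>))"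

lemma pdiff_rename: "pdiff (rename P) u \<alpha> = (\<Sum>\<beta>\<in>Poly_Mapping.keys P. Poly_Mapping.lookup P \<beta> * u (\<alpha> + image_mset XV \<beta>))"
  unfolding rename_def pdiff_sum_left pdiff_single ..

lemma keys_rename: "\<beta> \<in> Poly_Mapping.keys (rename P) \<Longrightarrow> \<exists>\<gamma>\<in>Poly_Mapping.keys P. \<beta> = image_mset XV \<gamma>"
  unfolding rename_def
  using keys_sum[of "\<lambda>\<beta>. Poly_Mapping.single (image_mset XV \<beta>) (Poly_Mapping.lookup P \<beta>)" "Poly_Mapping.keys P"]
  by (fastforce split: if_splits)

definition un_XV :: "'n evar \<Rightarrow> 'n" where "un_XV v = (THE a. v = XV a)"

lemma un_XV [simp]: "un_XV (XV a) = a" by (simp add: un_XV_def)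

locale component_listing =
  fixes J :: "nat \<Rightarrow> 'm::finite" assumes J: "bij_betw J {..<CARD('m)} UNIV"
begin

definition to_fam :: "('n::finite, 'm) tensor \<Rightarrow> 'n evar fam" where
  "to_fam q = (\<lambda>j \<alpha>. if j < CARD('m) \<and> set_mset \<alpha> \<subseteq> range XV then q (image_mset (un_XV) \<alpha>) $ J j else 0)"

lemma image_un_XV [simp]: "image_mset (un_XV) (image_mset XV \<alpha>) = \<alpha>" by (simp add: image_mset.compositionality o_def)

lemma image_XV_un_XV: "set_mset \<alpha> \<subseteq> range XV \<Longrightarrow> image_mset XV (image_mset (un_XV) \<alpha>) = \<alpha>"
  by (induction \<alpha>) auto

lemma to_fam_XV: "j < CARD('m) \<Longrightarrow> to_fam q j (image_mset XV \<alpha>) = comps q (J j) \<alpha>"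
  by (auto simp: to_fam_def comps_def)

lemma to_fam_outside: "\<not> (j < CARD('m) \<and> set_mset \<alpha> \<subseteq> range XV) \<Longrightarrow> to_fam q j \<alpha> = 0"
  by (auto simp: to_fam_def)

lemma pdiff_rename_to_fam:
  assumes j: "j < CARD('m)" and \<alpha>: "set_mset \<alpha> \<subseteq> range XV"
  shows "pdiff (rename P) (to_fam q j) \<alpha> = pdiff P (comps q (J j)) (image_mset (un_XV) \<alpha>)"
proof -
  obtain \<alpha>' where \<alpha>': "\<alpha> = image_mset XV \<alpha>'" using image_XV_un_XV[OF \<alpha>] by metis
  have "to_fam q j (\<alpha> + image_mset XV \<beta>) = comps q (J j) (\<alpha>' + \<beta>)" for \<beta>
    unfolding \<alpha>' image_mset_union[symmetric] by (rule to_fam_XV[OF j])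
  then show ?thesis unfolding pdiff_rename pdiff_def[of P] by (simp add: \<alpha>')
qed

lemma to_fam_ambient: "to_fam q \<in> ambient CARD('m) (range XV)"
  unfolding ambient_def mem_Collect_eq using to_fam_outside by blast

lemma relations_to_fam:
  fixes f :: "'m \<Rightarrow> ('n::finite, real) sym_alg" and q :: "('n, 'm) tensor"
  shows "(\<forall>\<alpha>. (\<Sum>j<CARD('m). pdiff (rename (f (J j))) (to_fam q j) \<alpha>) = 0) \<longleftrightarrow>
    (\<forall>\<alpha>. (\<Sum>j\<in>UNIV. pdiff (f j) (comps q j) \<alpha>) = 0)"
proof -
  have re: "(\<Sum>j<CARD('m). pdiff (f (J j)) (comps q (J j)) \<alpha>) = (\<Sum>j\<in>UNIV. pdiff (f j) (comps q j) \<alpha>)" for \<alpha>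
    by (rule sum.reindex_bij_betw[OF J])
  have in_range: "(\<Sum>j<CARD('m). pdiff (rename (f (J j))) (to_fam q j) \<alpha>) =
      (\<Sum>j\<in>UNIV. pdiff (f j) (comps q j) (image_mset (un_XV) \<alpha>))" if "set_mset \<alpha> \<subseteq> range XV" for \<alpha>
    unfolding re[symmetric] by (intro sum.cong refl pdiff_rename_to_fam) (use that in auto)
  have outside: "(\<Sum>j<CARD('m). pdiff (rename (f (J j))) (to_fam q j) \<alpha>) = 0" if "\<not> set_mset \<alpha> \<subseteq> range XV" for \<alpha>
    unfolding pdiff_rename using that by (intro sum.neutral ballI mult_eq_0_iff[THEN iffD2] disjI2 to_fam_outside) auto
  show ?thesis
  proof
    assume l: "\<forall>\<alpha>. (\<Sum>j<CARD('m). pdiff (rename (f (J j))) (to_fam q j) \<alpha>) = 0"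
    show "\<forall>\<alpha>. (\<Sum>j\<in>UNIV. pdiff (f j) (comps q j) \<alpha>) = 0"
    proof
      fix \<alpha> :: "'n multiset"
      have "set_mset (image_mset XV \<alpha>) \<subseteq> range XV" by auto
      from in_range[OF this] show "(\<Sum>j\<in>UNIV. pdiff (f j) (comps q j) \<alpha>) = 0" using l by simp
    qed
  next
    assume "\<forall>\<alpha>. (\<Sum>j\<in>UNIV. pdiff (f j) (comps q j) \<alpha>) = 0"
    then have "(\<Sum>j<CARD('m). pdiff (rename (f (J j))) (to_fam q j) \<alpha>) = 0" for \<alpha>
      by (cases "set_mset \<alpha> \<subseteq> range XV") (simp_all only: in_range outside not_False_eq_True)
    then show "\<forall>\<alpha>. (\<Sum>j<CARD('m). pdiff (rename (f (J j))) (to_fam q j) \<alpha>) = 0" ..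
  qed
qed

lemma to_fam_of_weight:
  assumes w: "\<And>a. w (XV a) = 1"
  shows "to_fam q \<in> of_weight w k \<longleftrightarrow> (q :: ('n::finite, 'm) tensor) \<in> sym_tensors k"
proof
  have ws: "wsize w (image_mset XV \<alpha>) = size \<alpha>" for \<alpha> by (induction \<alpha>) (auto simp: w)
  {
    assume q: "to_fam q \<in> of_weight w k"
    show "q \<in> sym_tensors k"
      unfolding sym_tensors_def mem_Collect_eq
    proof (intro allI impI)
      fix \<alpha> :: "'n multiset" assume s: "size \<alpha> \<noteq> k"
      have "q \<alpha> $ J j = 0" if "j < CARD('m)" for j
      proof (rule ccontr)
        assume "q \<alpha> $ J j \<noteq> 0"
        then have "to_fam q j (image_mset XV \<alpha>) \<noteq> 0" unfolding to_fam_XV[OF that] comps_def .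
        then have "wsize w (image_mset XV \<alpha>) = k" using q unfolding of_weight_def by blast
        then show False using s ws by simp
      qed
      moreover have "\<exists>j<CARD('m). J j = i" for i using J unfolding bij_betw_def by (metis UNIV_I imageE lessThan_iff)
      ultimately show "q \<alpha> = 0" by (metis Finite_Cartesian_Product.vec_eq_iff zero_index)
    qed
  }
  assume q: "q \<in> sym_tensors k"
  show "to_fam q \<in> of_weight w k"
    unfolding of_weight_def mem_Collect_eq
  proof (intro allI impI)
    fix j \<alpha> assume n: "to_fam q j \<alpha> \<noteq> 0"
    then have s: "set_mset \<alpha> \<subseteq> range XV" "j < CARD('m)" using to_fam_outside by blast+
    then have e: "\<alpha> = image_mset XV (image_mset (un_XV) \<alpha>)" using image_XV_un_XV by metis
    have "comps q (J j) (image_mset (un_XV) \<alpha>) \<noteq> 0" using n to_fam_XV[OF s(2), of q "image_mset (un_XV) \<alpha>"] e by metis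
    then have "q (image_mset (un_XV) \<alpha>) \<noteq> 0" by (auto simp: comps_def)
    then have "size (image_mset (un_XV) \<alpha>) = k" using q unfolding sym_tensors_def by blast
    then show "wsize w \<alpha> = k" using ws[of "image_mset (un_XV) \<alpha>"] e by metis
  qed
qed

lemma to_fam_surj:
  assumes p: "p \<in> ambient CARD('m) (range XV)" obtains q :: "('n::finite, 'm) tensor" where "p = to_fam q"
proof -
  define I where "I = inv_into {..<CARD('m)} J"
  have I: "I (J j) = j" if "j < CARD('m)" for j
    unfolding I_def using J that by (intro inv_into_f_f) (auto simp: bij_betw_def)
  define q :: "('n, 'm) tensor" where "q \<alpha> = (\<chi> i. p (I i) (image_mset XV \<alpha>))" for \<alpha>
  have "p j \<alpha> = to_fam q j \<alpha>" for j \<alpha>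
  proof (cases "j < CARD('m) \<and> set_mset \<alpha> \<subseteq> range XV")
    case True
    then show ?thesis using image_XV_un_XV[of \<alpha>] I[of j] by (simp add: to_fam_def q_def)
  next
    case False
    then have "p j \<alpha> = 0" using p unfolding ambient_def by blast
    then show ?thesis using to_fam_outside[OF False] by simp
  qed
  then show ?thesis using that[of q] by (simp add: fun_eq_iff)
qed

lemma linear_to_fam: "Vector_Spaces.linear tensor_scale fam_scale (to_fam :: ('n::finite, 'm) tensor \<Rightarrow> _)"
  by unfold_locales (auto simp: to_fam_def tensor_scale_def fam_scale_def fun_eq_iff)

lemma to_fam_eq_0: assumes "to_fam q = 0" shows "(q :: ('n::finite, 'm) tensor) = 0"
proof
  fix \<alpha>
  have "q \<alpha> $ i = 0" for i
  proof -
    obtain j where j: "j < CARD('m)" "J j = i" using J unfolding bij_betw_def by (metis UNIV_I imageE lessThan_iff)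
    have "comps q i \<alpha> = 0" using to_fam_XV[OF j(1), of q \<alpha>] assms j(2) by simp
    then show ?thesis by (simp add: comps_def)
  qed
  then show "q \<alpha> = 0 \<alpha>" by (simp add: Finite_Cartesian_Product.vec_eq_iff)
qed

lemma to_fam_image:
  fixes f :: "nat \<Rightarrow> 'm \<Rightarrow> ('n::finite, real) sym_alg"
  assumes w: "\<And>a. w (XV a) = 1"
  shows "to_fam ` {q \<in> sym_tensors k. \<forall>i<r. \<forall>\<alpha>. (\<Sum>j\<in>UNIV. pdiff (f i j) (comps q j) \<alpha>) = 0} =
    sol CARD('m) r (\<lambda>i j. rename (f i (J j))) (range XV) \<inter> of_weight w k" (is "to_fam ` ?S = _")
proof (intro equalityI subsetI)
  fix p assume "p \<in> to_fam ` ?S"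
  then obtain q where q: "p = to_fam q" "q \<in> ?S" by blast
  have p: "p \<in> of_weight w k" "p \<in> ambient CARD('m) (range XV)" using q to_fam_of_weight[of w q k] w to_fam_ambient by auto
  have "size \<alpha> \<le> k" if "p j \<alpha> \<noteq> 0" for j \<alpha>
  proof -
    have "wsize w \<alpha> = k" "set_mset \<alpha> \<subseteq> range XV" using p that unfolding of_weight_def ambient_def by blast+
    then show ?thesis using wsize_size[of \<alpha> w] w by fastforce
  qed
  moreover have "\<forall>i<r. \<forall>\<alpha>. (\<Sum>j<CARD('m). pdiff (rename (f i (J j))) (p j) \<alpha>) = 0"
    using q relations_to_fam[of "f _" q] by simp
  ultimately show "p \<in> sol CARD('m) r (\<lambda>i j. rename (f i (J j))) (range XV) \<inter> of_weight w k"
    using p unfolding sol_def by blast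
next
  fix p assume p: "p \<in> sol CARD('m) r (\<lambda>i j. rename (f i (J j))) (range XV) \<inter> of_weight w k"
  then have pa: "p \<in> ambient CARD('m) (range XV)" using sol_ambient by blast
  then obtain q :: "('n, 'm) tensor" where q: "p = to_fam q" by (rule to_fam_surj)
  have "q \<in> sym_tensors k" using p q to_fam_of_weight[of w q k] w by simp
  moreover have "\<forall>i<r. \<forall>\<alpha>. (\<Sum>j<CARD('m). pdiff (rename (f i (J j))) (to_fam q j) \<alpha>) = 0"
    using p unfolding q sol_def by blast
  then have "\<forall>i<r. \<forall>\<alpha>. (\<Sum>j\<in>UNIV. pdiff (f i j) (comps q j) \<alpha>) = 0" using relations_to_fam[of "f _" q] by simp
  ultimately show "p \<in> to_fam ` ?S" using q by blast
qed

lemma vdiff_form_to_fam: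
  fixes q :: "('n::finite, 'm) tensor"
  assumes "vdiff (rename (\<Sum>i\<in>UNIV. Poly_Mapping.single {#i#} (l $ i))) (to_fam q) = 0" shows "\<delta> l q = 0"
proof
  fix \<alpha>
  have "(\<Sum>i\<in>UNIV. l $ i * q (add_mset i \<alpha>) $ a) = 0" for a
  proof -
    obtain j where j: "j < CARD('m)" "J j = a" using J unfolding bij_betw_def by (metis UNIV_I imageE lessThan_iff)
    have "pdiff (rename (\<Sum>i\<in>UNIV. Poly_Mapping.single {#i#} (l $ i))) (to_fam q j) (image_mset XV \<alpha>) = 0"
      using fun_cong[OF fun_cong[OF assms], of j "image_mset XV \<alpha>"] by (simp add: vdiff_def)
    moreover have "set_mset (image_mset XV \<alpha>) \<subseteq> range XV" by auto
    ultimately have "pdiff (\<Sum>i\<in>UNIV. Poly_Mapping.single {#i#} (l $ i)) (comps q a) \<alpha> = 0"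
      by (simp only: pdiff_rename_to_fam[OF j(1)] image_un_XV j(2))
    then show ?thesis by (simp add: pdiff_sum_left pdiff_single comps_def)
  qed
  then show "\<delta> l q \<alpha> = 0 \<alpha>" by (simp add: \<delta>_def Finite_Cartesian_Product.vec_eq_iff)
qed

end

section \<open>Hilbert series of the symbol and conclusion\<close>

interpretation tensor_fam: vector_space_pair tensor_scale fam_scale ..

theorem hilbert_series_complete_intersection:
  fixes g :: "nat \<Rightarrow> ('n::finite, 'm::finite) tensor set"
  assumes g: "generalized_complete_intersection g" and ks: "\<forall>k. count (mset ks) k = multiplicity_of_order g k"
    and c: "codim g = CARD('m) + c" and d: "CARD('n) = Suc c + d"
  shows "Abs_fps (\<lambda>k. real (tensor.dim (g k))) * (1 - fps_X) ^ d =
      fps_of_poly (qpoly (\<lambda>i. if i < codim g then ks ! i else 1) CARD('m) c)"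
    and "\<And>i. i < codim g \<Longrightarrow> ks ! i \<ge> 1" and "length ks = codim g"
proof -
  have sym: "symbolic_system g" and pc: "proj_codim (char_variety g) = int (codim g) - int CARD('m) + 1"
    using g unfolding generalized_complete_intersection_def by blast+
  \<comment> \<open>\<open>perturbation\<close> asks for a positive degree at every index; beyond
    the last relation the value 1 is a filler.\<close>
  let ?k = "\<lambda>i. if i < codim g then ks ! i else 1" and ?m = "CARD('m)"
  have "codim g > 0" using c by simp
  note len = length_orders[OF ks this]
  show "length ks = codim g" "\<And>i. i < codim g \<Longrightarrow> ks ! i \<ge> 1" using len by auto
  obtain f where rels: "\<And>i j \<beta>. i < codim g \<Longrightarrow> \<beta> \<in> Poly_Mapping.keys (f i j) \<Longrightarrow> size \<beta> = ks ! i"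
    "\<And>k. g k = {q \<in> sym_tensors k. \<forall>i<codim g. \<forall>\<alpha>. (\<Sum>j\<in>UNIV. pdiff (f i j) (comps q j) \<alpha>) = 0}"
    using symbolic_system_relations[OF sym ks] unfolding len(1) by blast
  \<comment> \<open>The codimension is c + 1, and n - 1 - (c + 1) = d - 1; for d = 0 this is the
    dimension of the empty variety.\<close>
  have "proj_dim (char_variety g) = int d - 1" using pc c d by (simp add: proj_codim_def)
  from ex_linear_forms_of_dim[OF proj_closed_char_variety[OF sym] this]
  obtain ls where ls: "length ls = d" "\<forall>\<xi>\<in>char_variety g. \<exists>l\<in>set ls. real_form l \<xi> \<noteq> 0" by blast
  obtain E where E: "\<forall>k\<ge>E. \<forall>q\<in>g k. (\<forall>l\<in>set ls. \<delta> l q = 0) \<longrightarrow> q = 0"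
    using common_kernel_vanishes[OF sym, of ls] ls(2) by blast
  obtain J where J: "bij_betw J {..<CARD('m)} (UNIV :: 'm set)"
    using ex_bij_betw_nat_finite[OF finite[of "UNIV :: 'm set"]] by (auto simp: atLeast0LessThan)
  interpret component_listing J by unfold_locales (rule J)
  define rel :: "nat \<Rightarrow> nat \<Rightarrow> 'n evar multiset \<Rightarrow>\<^sub>0 real" where
    "rel i j = (if i < codim g then rename (f i (J j)) else 0)" for i j
  interpret perturbation rel ?k ?m c
  proof
    show "?m \<ge> 1" by (simp add: Suc_le_eq)
    show "?k i \<ge> 1" for i using len by auto
    show "set_mset \<beta> \<subseteq> range XV \<and> size \<beta> = ?k i" if b: "\<beta> \<in> Poly_Mapping.keys (rel i j)" for i j \<beta>
    proof -
      have i: "i < codim g" using b by (auto simp: rel_def split: if_splits)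
      then obtain \<gamma> where "\<gamma> \<in> Poly_Mapping.keys (f i (J j))" "\<beta> = image_mset XV \<gamma>"
        using b keys_rename unfolding rel_def by fastforce
      then show ?thesis using rels(1)[OF i] i by auto
    qed
  qed
  have solF: "sol ?m (?m + c) rel X = sol ?m (codim g) (\<lambda>i j. rename (f i (J j))) X"
    unfolding c[symmetric] by (rule sol_cong) (simp add: rel_def)
  have img: "to_fam ` g k = sol ?m (?m + c) rel X \<inter> of_weight w k" for k
  proof -
    have "to_fam ` {q \<in> sym_tensors k. \<forall>i<codim g. \<forall>\<alpha>. (\<Sum>j\<in>UNIV. pdiff (f i j) (comps q j) \<alpha>) = 0} =
        sol ?m (codim g) (\<lambda>i j. rename (f i (J j))) X \<inter> of_weight w k"
      by (rule to_fam_image) simp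
    then show ?thesis by (subst solF, subst rels(2)[of k])
  qed
  have dim: "fam.dim (sol ?m (?m + c) rel X \<inter> of_weight w k) = tensor.dim (g k)" for k
    unfolding img[symmetric]
  proof (rule tensor_fam.dim_image_inj[OF linear_to_fam])
    show "tensor.subspace (g k)" using sym unfolding symbolic_system_def by blast
    have "g k \<subseteq> sym_tensors k" using sym unfolding symbolic_system_def by blast
    then show "fin_gen tensor_scale (g k)" by (rule tensor.fin_gen_mono[OF fin_gen_sym_tensors])
  qed (rule to_fam_eq_0)
  define L where "L l = rename (\<Sum>i\<in>UNIV. Poly_Mapping.single {#i#} (l $ i))" for l :: "real ^ 'n"
  have "hilb w (sol ?m (?m + c) rel X) * (1 - fps_X) ^ length (map L ls) = fps_of_poly (qpoly ?k ?m c)"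
  proof (rule hilb_sol_of_trivial_kernel[of _ E])
    show "set_mset \<beta> \<subseteq> X \<and> size \<beta> = 1" if "\<theta> \<in> set (map L ls)" "\<beta> \<in> Poly_Mapping.keys \<theta>" for \<theta> \<beta>
    proof -
      obtain l where "\<theta> = L l" using \<open>\<theta> \<in> set (map L ls)\<close> by auto
      then obtain \<gamma> where \<gamma>: "\<gamma> \<in> Poly_Mapping.keys (\<Sum>i\<in>UNIV. Poly_Mapping.single {#i#} (l $ i))" "\<beta> = image_mset XV \<gamma>"
        using \<open>\<beta> \<in> Poly_Mapping.keys \<theta>\<close> keys_rename unfolding L_def by blast
      have "size \<gamma> = 1"
        using \<gamma>(1) keys_sum[of "\<lambda>i. Poly_Mapping.single {#i#} (l $ i)" UNIV] by (fastforce split: if_splits)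
      then show ?thesis using \<gamma>(2) by auto
    qed
    show "length (map L ls) + Suc c = CARD('n)" using ls(1) d by simp
    show "p = 0" if p: "p \<in> sol ?m (?m + c) rel X" "p \<in> of_weight w E" "\<forall>\<theta>\<in>set (map L ls). vdiff \<theta> p = 0" for p
    proof -
      obtain q where q: "q \<in> g E" "p = to_fam q" using img[of E] p(1,2) by blast
      have "\<delta> l q = 0" if l: "l \<in> set ls" for l
        by (rule vdiff_form_to_fam) (use p(3) l q(2) in \<open>simp add: L_def\<close>)
      then have "q = 0" using E q(1) by blast
      then show ?thesis using q(2) by (simp add: to_fam_def fun_eq_iff)
    qed
  qed
  then show "Abs_fps (\<lambda>k. real (tensor.dim (g k))) * (1 - fps_X) ^ d = fps_of_poly (qpoly ?k ?m c)"
    unfolding hilb_def dim using ls(1) by simp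
qed

theorem theorem5:
  fixes E :: "nat \<Rightarrow> ('n::finite, 'm::finite) jet set"
    and \<theta> :: "('n, 'm) jet"
    and g :: "nat \<Rightarrow> ('n, 'm) tensor set"
    and r :: nat
    and ks :: "nat list"
  assumes "formally_integrable E"
    and "constant_type E"
    and "\<theta> \<in> points E"
    and "g = symbol E \<theta>"
    and "generalized_complete_intersection g"
    and "r = codim g"
    and "\<forall>k. count (mset ks) k = multiplicity_of_order g k"
  shows "int (functional_dimension g) = int CARD('m) + int CARD('n) - int r - 1 \<and>
    functional_rank g = real (elementary_symmetric (r - CARD('m) + 1) ks)"
proof -
  have mr: "CARD('m) \<le> codim g" "codim g < CARD('n) + CARD('m)"
    using assms(5) unfolding generalized_complete_intersection_def by blast+
  define c where "c = codim g - CARD('m)"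
  define d where "d = CARD('n) - Suc c"
  have c: "codim g = CARD('m) + c" and d: "CARD('n) = Suc c + d" using mr by (auto simp: c_def d_def)
  note H = hilbert_series_complete_intersection[OF assms(5,7) c d]
  let ?k = "\<lambda>i. if i < codim g then ks ! i else 1"
  have "esym ?k (Suc c) (codim g) = elementary_symmetric (Suc c) ks"
    unfolding esym_def elementary_symmetric_def H(3) by (intro sum.cong prod.cong refl) auto
  then have val: "poly (qpoly ?k CARD('m) c) 1 = real (elementary_symmetric (Suc c) ks)"
    unfolding poly_qpoly_1 c by simp
  \<comment> \<open>All orders are positive and c + 1 does not exceed m + c, so the value at 1 is
    nonzero and the pole of the series at 1 has order exactly d.\<close>
  have "esym ?k (Suc c) (codim g) > 0" by (rule esym_pos) (use H(2) c in \<open>auto simp: Suc_le_eq\<close>)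
  then have "poly (qpoly ?k CARD('m) c) 1 \<noteq> 0" unfolding poly_qpoly_1 c by simp
  note data = hilbert_polynomial_data[OF H(1) this]
  have "int (functional_dimension g) = int CARD('m) + int CARD('n) - int r - 1"
    unfolding data(1) using c d assms(6) by simp
  moreover have "functional_rank g = real (elementary_symmetric (r - CARD('m) + 1) ks)"
    unfolding data(2) val using c assms(6) by simp
  ultimately show ?thesis by blast
qed

end
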